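(* Let $A$ be a Young function, let $K$ be a kernel supported in $(-\infty,0)$ with $K\in\mathcal{H}_{\overline{A}}$, and let $(T^+)^*$ be the associated maximal one-sided singular integral operator. Let $0<p<\infty$ and $\varepsilon>0$, and let $w$ be a weight with $w\in C^+_{\max\{p,1\}+\varepsilon}$. Then there is a constant $C>0$, independent of $f$, such that for every $f\in L^\infty_c$ $$\|(T^{+})^{*}f\|_{L^{p}(w)}\le C\,\|M_{A}^{+}f\|_{L^{p}(w)}.$$
   Context: A weight is a nonnegative locally integrable function $w$ on $\mathbb{R}$; $\|g\|_{L^p(w)}=\left(\int_{\mathbb{R}}|g|^p w\right)^{1/p}$ for $0<p<\infty$. $L^\infty_c$ denotes the bounded measurable functions on $\mathbb{R}$ with compact support. $M^{+}f(x)=\sup_{h>0}\frac1h\int_x^{x+h}|f(y)|\,dy$. For $1<r<\infty$, $w\in C_r^+$ means: there exist $\varepsilon_0>0$ and $C>0$ such that for all $a<b<c$ with $c-b<b-a$ and every measurable $E\subset(a,b)$, $\int_E w\le C\left(\frac{|E|}{c-b}\right)^{\varepsilon_0}\int_{\mathbb{R}}\left(M^+\chi_{(a,c)}\right)^r w$. A Young function is a convex $A:[0,\infty)\to[0,\infty)$ with $A(0)=0$, $A(1)=1$, $\lim_{t\to\infty}A(t)=\infty$. Its associated (complementary) Young function $\overline A$ satisfies $t\le\overline A^{-1}(t)A^{-1}(t)\le2t$. The Orlicz average over a measurable set $E$ is $\|f\|_{A,E}=\inf\{\lambda>0:\frac1{|E|}\int_EA(|f|/\lambda)\le1\}$, and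 $M_A^+f(x)=\sup_{h>0}\|f\|_{A,[x,x+h]}$. For a Young function $D$, $K\in\mathcal{H}_D$ means that there exist $c_D,C_D\ge1$ such that for every $x\in\mathbb{R}$ and $R>c_D|x|$, $$\sum_{m=1}^\infty2^mR\,\big\|(K(x-\cdot)-K(-\cdot))\chi_{2^mR<|\cdot|\le2^{m+1}R}\big\|_{D,B(0,2^{m+1}R)}\le C_D,$$ where $B(0,\rho)=(-\rho,\rho)$. The kernel $K\in L^1_{\mathrm{loc}}(\mathbb{R}\setminus\{0\})$ is also assumed to satisfy, with finite constants $B_1,B_2$: $\left|\int_{\varepsilon<|x|<N}K\right|\le B_1$ for all $0<\varepsilon<N$, with $\lim_{\varepsilon\to0^+}\int_{\varepsilon<|x|<N}K$ existing, and $|K(x)|\le B_2/|x|$ for $x\ne0$. The maximal operator is $(T^+)^*f(x)=\sup_{\varepsilon>0}\left|\int_{x+\varepsilon}^\infty K(x-y)f(y)\,dy\right|$. *)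

theory Defs
  imports "HOL-Analysis.Analysis"
begin

text \<open>Norms and maximal functions take values in \<^typ>\<open>ennreal\<close>, so that both sides of an
  inequality may be infinite. Measurability is Lebesgue measurability throughout.\<close>

definition ennpowr :: "ennreal \<Rightarrow> real \<Rightarrow> ennreal" where
  \<comment> \<open>only meant for positive exponents: the value at \<open>top\<close> is \<open>top\<close>\<close>
  "ennpowr x r = (if x = top then top else ennreal (enn2real x powr r))"

definition Lp_norm :: "real \<Rightarrow> (real \<Rightarrow> real) \<Rightarrow> (real \<Rightarrow> ennreal) \<Rightarrow> ennreal" where
  "Lp_norm p w g = ennpowr (\<integral>\<^sup>+x. ennpowr (g x) p * ennreal (w x) \<partial>lebesgue) (1 / p)"

definition weight :: "(real \<Rightarrow> real) \<Rightarrow> bool" where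
  "weight w \<longleftrightarrow> (\<forall>x. w x \<ge> 0) \<and> (\<forall>S. compact S \<longrightarrow> w absolutely_integrable_on S)"

definition Linf_c :: "(real \<Rightarrow> complex) set" where
  "Linf_c = {f. f \<in> borel_measurable lebesgue \<and> bounded (range f) \<and>
                (\<exists>S. compact S \<and> (\<forall>x. x \<notin> S \<longrightarrow> f x = 0))}"

definition Mplus :: "(real \<Rightarrow> 'a::real_normed_vector) \<Rightarrow> real \<Rightarrow> ennreal" where
  "Mplus f x = (SUP h\<in>{0<..}. (\<integral>\<^sup>+y\<in>{x..x+h}. ennreal (norm (f y)) \<partial>lebesgue) / ennreal h)"

definition C_plus :: "real \<Rightarrow> (real \<Rightarrow> real) \<Rightarrow> bool" where
  "C_plus r w \<longleftrightarrow>
     (\<exists>\<epsilon>0>0. \<exists>C>0. \<forall>a b c E. a < b \<longrightarrow> b < c \<longrightarrow> c - b < b - a \<longrightarrow>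
        E \<in> sets lebesgue \<longrightarrow> E \<subseteq> {a<..<b} \<longrightarrow>
        (\<integral>\<^sup>+x\<in>E. ennreal (w x) \<partial>lebesgue)
          \<le> ennreal (C * (measure lebesgue E / (c - b)) powr \<epsilon>0) *
            (\<integral>\<^sup>+x. ennpowr (Mplus (indicator {a<..<c} :: real \<Rightarrow> real) x) r * ennreal (w x) \<partial>lebesgue))"

text \<open>Only the values of a Young function on \<open>[0, \<infinity>)\<close> matter.\<close>

definition young_function :: "(real \<Rightarrow> real) \<Rightarrow> bool" where
  "young_function A \<longleftrightarrow> convex_on {0..} A \<and> (\<forall>t\<ge>0. A t \<ge> 0) \<and> A 0 = 0 \<and> A 1 = 1 \<and>
     filterlim A at_top at_top"

text \<open>The complementary function is the Legendre conjugate. It can be infinite: for \<open>A t = t\<close> it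
  is \<open>0\<close> on \<open>[0, 1]\<close> and \<open>\<infinity>\<close> on \<open>(1, \<infinity>)\<close>, and its Orlicz norm is that of \<open>L\<^sup>\<infinity>\<close>. Hence Orlicz
  averages are defined for \<^typ>\<open>ennreal\<close>-valued functions. The truncation of negative values by
  \<^const>\<open>ennreal\<close> is harmless, because the supremum is at least its value \<open>0\<close> at \<open>t = 0\<close>.\<close>

definition complementary :: "(real \<Rightarrow> real) \<Rightarrow> real \<Rightarrow> ennreal" where
  "complementary A s = (SUP t\<in>{0..}. ennreal (s * t - A t))"

definition orlicz_avg ::
  "(real \<Rightarrow> ennreal) \<Rightarrow> (real \<Rightarrow> 'a::real_normed_vector) \<Rightarrow> real set \<Rightarrow> ennreal" where
  "orlicz_avg D f E =
     Inf {ennreal l | l. l > 0 \<and>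
            (\<integral>\<^sup>+x\<in>E. D (norm (f x) / l) \<partial>lebesgue) / emeasure lebesgue E \<le> 1}"

definition M_plus_orlicz ::
  "(real \<Rightarrow> real) \<Rightarrow> (real \<Rightarrow> 'a::real_normed_vector) \<Rightarrow> real \<Rightarrow> ennreal" where
  "M_plus_orlicz A f x = (SUP h\<in>{0<..}. orlicz_avg (\<lambda>t. ennreal (A t)) f {x..x+h})"

definition hormander_class :: "(real \<Rightarrow> ennreal) \<Rightarrow> (real \<Rightarrow> complex) \<Rightarrow> bool" where
  \<comment> \<open>\<^const>\<open>suminf\<close> starts at \<open>0\<close>, so \<open>m\<close> here is the usual summation index minus \<open>1\<close>\<close>
  "hormander_class D K \<longleftrightarrow>
     (\<exists>c\<ge>1. \<exists>C\<ge>1. \<forall>x R. R > c * \<bar>x\<bar> \<longrightarrow>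
        (\<Sum>m. ennreal (2 ^ Suc m * R) *
           orlicz_avg D
             (\<lambda>y. if 2 ^ Suc m * R < \<bar>y\<bar> \<and> \<bar>y\<bar> \<le> 2 ^ (Suc m + 1) * R
                  then K (x - y) - K (- y) else 0)
             (ball 0 (2 ^ (Suc m + 1) * R)))
        \<le> ennreal C)"

text \<open>Kernels live on \<open>\<real> - {0}\<close>; the value at \<open>0\<close> is a dummy that is never constrained or used.\<close>

definition singular_kernel :: "(real \<Rightarrow> complex) \<Rightarrow> bool" where
  "singular_kernel K \<longleftrightarrow>
     (\<forall>S. compact S \<longrightarrow> 0 \<notin> S \<longrightarrow> K absolutely_integrable_on S) \<and>
     (\<exists>B1. \<forall>e N. 0 < e \<longrightarrow> e < N \<longrightarrow>
        norm (LINT x:{x. e < \<bar>x\<bar> \<and> \<bar>x\<bar> < N}|lebesgue. K x) \<le> B1) \<and>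
     (\<forall>N>0. \<exists>l. ((\<lambda>e. LINT x:{x. e < \<bar>x\<bar> \<and> \<bar>x\<bar> < N}|lebesgue. K x) \<longlongrightarrow> l) (at_right 0)) \<and>
     (\<exists>B2. \<forall>x. x \<noteq> 0 \<longrightarrow> norm (K x) \<le> B2 / \<bar>x\<bar>)"

definition one_sided_kernel :: "(real \<Rightarrow> complex) \<Rightarrow> bool" where
  "one_sided_kernel K \<longleftrightarrow> (\<forall>x>0. K x = 0)"

definition T_plus_max :: "(real \<Rightarrow> complex) \<Rightarrow> (real \<Rightarrow> complex) \<Rightarrow> real \<Rightarrow> ennreal" where
  "T_plus_max K f x =
     (SUP e\<in>{0<..}. ennreal (norm (LINT y:{x+e<..}|lebesgue. K (x - y) * f y)))"

text \<open>The Legendre conjugate has the characteristic property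
  \<open>t \<le> B\<^sup>-\<^sup>1(t) A\<^sup>-\<^sup>1(t) \<le> 2t\<close> of the complementary function, with generalized inverses.\<close>

definition gen_inverse :: "(real \<Rightarrow> ennreal) \<Rightarrow> real \<Rightarrow> real" where
  "gen_inverse D t = Sup {s. 0 \<le> s \<and> D s \<le> ennreal t}"

lemma complementary_inverse_bounds:
  assumes "young_function A" and t: "t > 0"
  shows "t \<le> gen_inverse (complementary A) t * gen_inverse (\<lambda>s. ennreal (A s)) t"
    and "gen_inverse (complementary A) t * gen_inverse (\<lambda>s. ennreal (A s)) t \<le> 2 * t"
proof -
  have cv: "convex_on {0..} A" and nn: "\<And>s. s \<ge> 0 \<Longrightarrow> A s \<ge> 0" and A0: "A 0 = 0" and A1: "A 1 = 1"
    and lim: "filterlim A at_top at_top"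
    using assms(1) unfolding young_function_def by auto
  have star: "A u \<le> u / v * A v" if "0 \<le> u" "u \<le> v" "0 < v" for u v
  proof -
    have "A ((1 - u/v) *\<^sub>R 0 + (u/v) *\<^sub>R v) \<le> (1 - u/v) * A 0 + (u/v) * A v"
      by (rule convex_onD[OF cv]) (use that in auto)
    then show ?thesis using that A0 by simp
  qed
  have "\<forall>\<^sub>F s in at_top. A s \<ge> 2 * t + 1"
    using lim by (simp add: filterlim_at_top)
  then obtain M where M: "\<And>s. s \<ge> M \<Longrightarrow> A s \<ge> 2 * t + 1"
    by (auto simp: eventually_at_top_linorder)
  define S where "S = {s. 0 \<le> s \<and> A s \<le> t}"
  have SA: "{s. 0 \<le> s \<and> ennreal (A s) \<le> ennreal t} = S"
    unfolding S_def using t by (auto simp: ennreal_le_iff)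
  have bS: "bdd_above S"
  proof (rule bdd_aboveI[of _ M])
    fix s assume "s \<in> S"
    then show "s \<le> M" using M[of s] t unfolding S_def by force
  qed
  define a where "a = Sup S"
  have ginvA: "gen_inverse (\<lambda>s. ennreal (A s)) t = a"
    unfolding gen_inverse_def SA a_def ..
  have "min 1 t \<in> S"
    using star[of "min 1 t" 1] t A1 unfolding S_def by auto
  then have apos: "a > 0"
    using cSup_upper[OF _ bS] t unfolding a_def by (metis less_le_trans min_less_iff_conj zero_less_one)
  have below: "A u \<le> t" if "0 \<le> u" "u < a" for u
  proof -
    obtain v where v: "v \<in> S" "u < v"
      using \<open>u < a\<close> less_cSup_iff[of S u] bS \<open>min 1 t \<in> S\<close> unfolding a_def by (metis empty_iff)
    have "A u \<le> u / v * A v" using star[of u v] that v by auto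
    also have "\<dots> \<le> 1 * t" by (rule mult_mono) (use v that t nn[of v] in \<open>auto simp: S_def\<close>)
    finally show ?thesis by simp
  qed
  have above: "A v > t" if "v > a" for v
    using that cSup_upper[OF _ bS, of v] apos unfolding a_def S_def
    by (smt (verit) mem_Collect_eq)
  have slope: "A u \<ge> u * t / a" if "u > a" for u
  proof (rule ccontr)
    assume n: "\<not> ?thesis"
    have up: "u > 0" using that apos by simp
    have "A u > t" using above that by simp
    have "u * t / A u > a" using n apos \<open>A u > t\<close> t by (simp add: field_simps)
    moreover have "u * t / A u \<le> u" using \<open>A u > t\<close> up t by (simp add: field_simps)
    ultimately have "A (u * t / A u) \<le> (u * t / A u) / u * A u"
      using star[of "u * t / A u" u] apos up by simp
    also have "\<dots> = t" using up \<open>A u > t\<close> t by simp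
    finally show False using above[OF \<open>u * t / A u > a\<close>] by simp
  qed
  define S' where "S' = {s. 0 \<le> s \<and> complementary A s \<le> ennreal t}"
  have S'_iff: "s \<in> S' \<longleftrightarrow> 0 \<le> s \<and> (\<forall>u\<ge>0. s * u - A u \<le> t)" for s
    unfolding S'_def complementary_def using t by (auto simp: SUP_le_iff ennreal_le_iff2)
  have ginvB: "gen_inverse (complementary A) t = Sup S'"
    unfolding gen_inverse_def S'_def ..
  have "t / a * u - A u \<le> t" if "u \<ge> 0" for u
  proof (cases "u > a")
    case True
    then show ?thesis using slope[OF True] t by (simp add: field_simps)
  next
    case False
    then have "t / a * u \<le> t" using apos t by (simp add: field_simps)
    then show ?thesis using nn[OF that] by simp
  qed
  then have mem: "t / a \<in> S'"
    using apos t by (simp add: S'_iff)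
  have ub: "s \<le> 2 * t / a" if s: "s \<in> S'" for s
  proof -
    have "s * u \<le> 2 * t" if "0 < u" "u < a" for u
    proof -
      have "s * u - A u \<le> t" using s that by (simp add: S'_iff)
      then show ?thesis using below[of u] that by linarith
    qed
    moreover have "((\<lambda>u. s * u) \<longlongrightarrow> s * a) (at_left a)"
      by (intro tendsto_intros)
    moreover have "\<forall>\<^sub>F u in at_left a. 0 < u \<and> u < a"
      using eventually_at_left_real[OF apos] by eventually_elim auto
    ultimately have "s * a \<le> 2 * t"
      by (intro tendsto_upperbound[where f = "\<lambda>u. s * u" and F = "at_left a"])
        (auto elim: eventually_mono)
    then show ?thesis using apos by (simp add: field_simps)
  qed
  have "bdd_above S'" using ub by (rule bdd_aboveI)
  then have "t / a \<le> Sup S'" by (rule cSup_upper[OF mem])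
  then show "t \<le> gen_inverse (complementary A) t * gen_inverse (\<lambda>s. ennreal (A s)) t"
    unfolding ginvA ginvB using apos by (simp add: field_simps)
  have "Sup S' \<le> 2 * t / a" by (rule cSup_least) (use mem ub in auto)
  then show "gen_inverse (complementary A) t * gen_inverse (\<lambda>s. ennreal (A s)) t \<le> 2 * t"
    unfolding ginvA ginvB using apos by (simp add: field_simps)
qed

end

theory Submission
 imports Defs "HOL-Probability.Probability"
begin

text \<open>
  The theorem is a Coifman inequality, proved by a good-lambda argument. With the reflected kernel
  \<open>k v = K (- v)\<close> the maximal singular integral \<open>T f\<close> at \<open>x\<close> sees only the values of \<open>f\<close> to the right
  of \<open>x\<close>, and so does \<open>M\<^sub>A\<^sup>+ f\<close>. The level sets \<open>\<Omega>(l) = {T f > l} \<union> {M\<^sub>A\<^sup>+ f > l / \<theta>1}\<close> are open and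
  bounded. Let \<open>J\<close> be a component of \<open>\<Omega>(l)\<close>. At its right endpoint \<open>T f\<close> is at most \<open>l\<close>. If
  \<open>M\<^sub>A\<^sup>+ f \<le> g l\<close> at some point of \<open>J\<close>, then \<open>{T f > L l}\<close> fills only a proportion of order \<open>g\<close> of the
  interval from this point to the right endpoint (\<open>Tmax_local\<close>). The condition \<open>C\<^sup>+\<^sub>r\<close> turns this into
  the bound \<open>C g\<^sup>\<epsilon> \<integral> (M\<^sup>+ \<chi>\<^sub>J)\<^sup>r w\<close> for the weight of \<open>{T f > L l, M\<^sub>A\<^sup>+ f \<le> g l}\<close> in \<open>J\<close> (\<open>good_lambda_T\<close>).

  The sum of these integrals over all components is larger than the weight of \<open>\<Omega>(l)\<close>, because of the
  tails of \<open>M\<^sup>+ \<chi>\<^sub>J\<close> to the left of \<open>J\<close>. The integral of the tails is therefore a second quantity that is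
  followed from the level \<open>l\<close> to the level \<open>L l\<close>. For this purpose \<open>M\<^sup>+ \<chi>\<^sub>J\<close> is replaced by an expression
  in the lengths of the initial pieces of \<open>J\<close> (\<open>ivl_tail\<close>). Seen from a point outside \<open>\<Omega>(l)\<close>, the set
  \<open>\<Omega>(L l)\<close> fills a proportion of order \<open>1 / L\<close> only (\<open>\<Omega>_fill\<close>). So outside the components of \<open>\<Omega>(l)\<close>
  its tails gain the factor \<open>L powr - r\<close>, which compensates \<open>L powr p\<close> because \<open>r > p\<close>. Inside the
  components, the level sets of sums of tails decay like an arbitrary power (\<open>ivl_tail_sum_decay\<close>), so
  that \<open>C\<^sup>+\<^sub>r\<close> bounds their integral (\<open>near_bound\<close>, \<open>tail_mass_rec\<close>).

  A suitable combination of both quantities contracts from level to level, up to a term with \<open>M\<^sub>A\<^sup>+ f\<close>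
  (\<open>level_step\<close>). Summing over a geometric sequence of levels gives the theorem (\<open>coifman_bound\<close>). The
  lowest level is compared with \<open>M\<^sub>A\<^sup>+ f\<close> far to the left of the support (\<open>low_level\<close>), which takes the
  place of an a priori bound.

  The unweighted estimates rest on the weak type of the truncated integrals (\<open>Tr_weak_type\<close>). Their
  \<open>L\<^sup>2\<close> bound comes from a bound for the Fourier transform of the truncated kernel, in which cancellation
  serves at small distances and Hormander's condition at large ones. The passage to maximal truncations
  is Cotlar's argument at points where \<open>M\<^sub>A\<^sup>+ f\<close> is small (\<open>cotlar_point\<close>). The condition \<open>H\<close> for the
  complementary function enters when truncations at two points are compared (\<open>Tr_compare\<close>), in a
  form obtained from Young's inequality on dyadic annuli (\<open>kernel_orlicz_bound\<close>); Hormander's condition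
  is the case \<open>f = 1\<close>. All level sets of one-sided maximal functions are treated by the rising sun lemma.
\<close>

section \<open>Components of open sets\<close>

definition ivl :: "real \<times> real \<Rightarrow> real set" where
 "ivl J = {fst J<..<snd J}"

text \<open>For a bounded open set these pairs are the endpoints of its connected components. Pairs are used
  instead of sets because the estimates start from the endpoints, which lie outside the set.\<close>
definition comp_ivls :: "real set \<Rightarrow> (real \<times> real) set" where
 "comp_ivls \<Omega> = {J. fst J < snd J \<and> ivl J \<subseteq> \<Omega> \<and> fst J \<notin> \<Omega> \<and> snd J \<notin> \<Omega>}"

lemma ivl_borel [measurable, simp]: "ivl J \<in> sets borel"
 by (simp add: ivl_def)

lemma comp_ivls_nested:
 assumes "J \<in> comp_ivls \<Omega>" "x \<in> ivl J" "x \<in> ivl J'" "ivl J \<subseteq> \<Omega>'" "J' \<in> comp_ivls \<Omega>'"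
 shows "fst J' \<le> fst J" "snd J \<le> snd J'"
proof -
 show "fst J' \<le> fst J"
 proof (rule ccontr)
  assume "\<not> fst J' \<le> fst J"
  then have "fst J' \<in> ivl J" using assms(2,3) by (auto simp: ivl_def)
  then show False using assms(4,5) by (auto simp: comp_ivls_def)
 qed
 show "snd J \<le> snd J'"
 proof (rule ccontr)
  assume "\<not> snd J \<le> snd J'"
  then have "snd J' \<in> ivl J" using assms(2,3) by (auto simp: ivl_def)
  then show False using assms(4,5) by (auto simp: comp_ivls_def)
 qed
qed

lemma comp_ivls_disjoint: "disjoint_family_on ivl (comp_ivls \<Omega>)"
 unfolding disjoint_family_on_def
proof (intro ballI impI)
 fix J J' assume J: "J \<in> comp_ivls \<Omega>" "J' \<in> comp_ivls \<Omega>" "J \<noteq> J'"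
 show "ivl J \<inter> ivl J' = {}"
 proof (rule ccontr)
  assume "ivl J \<inter> ivl J' \<noteq> {}"
  then obtain x where x: "x \<in> ivl J" "x \<in> ivl J'" by auto
  have "ivl J \<subseteq> \<Omega>" "ivl J' \<subseteq> \<Omega>" using J by (auto simp: comp_ivls_def)
  then have "fst J = fst J' \<and> snd J = snd J'"
   using comp_ivls_nested[OF J(1) x _ J(2)] comp_ivls_nested[OF J(2) x(2,1) _ J(1)] by force
  then show False using J(3) by (simp add: prod_eq_iff)
 qed
qed

lemma countable_comp_ivls: "countable (comp_ivls \<Omega>)"
proof (rule countable_image_inj_on)
 have ne: "ivl J \<noteq> {}" if "J \<in> comp_ivls \<Omega>" for J
  using that by (auto simp: comp_ivls_def ivl_def)
 show "inj_on ivl (comp_ivls \<Omega>)"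
 proof (rule inj_onI, rule ccontr)
  fix J J' assume *: "J \<in> comp_ivls \<Omega>" "J' \<in> comp_ivls \<Omega>" "ivl J = ivl J'" "J \<noteq> J'"
  then show False
   using disjoint_family_onD[OF comp_ivls_disjoint *(1,2,4)] ne[of J] by auto
 qed
 show "countable (ivl ` comp_ivls \<Omega>)"
 proof (rule countable_disjoint_open_subsets)
  show "disjoint (ivl ` comp_ivls \<Omega>)"
   using comp_ivls_disjoint by (rule disjoint_family_on_disjoint_image)
 qed (auto simp: ivl_def)
qed

lemma comp_ivls_cover:
 assumes "open \<Omega>" "bounded \<Omega>" "y \<in> \<Omega>"
 shows "\<exists>J\<in>comp_ivls \<Omega>. y \<in> ivl J"
proof -
 obtain B where B: "\<And>x. x \<in> \<Omega> \<Longrightarrow> \<bar>x\<bar> \<le> B"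
  using \<open>bounded \<Omega>\<close> by (auto simp: bounded_iff)
 have cl: "closed (- \<Omega>)" using \<open>open \<Omega>\<close> by (simp add: closed_Compl)
 define S where "S = - \<Omega> \<inter> {..y}"
 define T where "T = - \<Omega> \<inter> {y..}"
 have S: "S \<noteq> {}" "bdd_above S" "closed S"
 proof -
  have "-B-1 \<in> S" unfolding S_def using B[OF \<open>y \<in> \<Omega>\<close>] B[of "-B-1"] by (auto simp: abs_if split: if_splits)
  then show "S \<noteq> {}" by auto
 qed (use cl in \<open>auto simp: S_def intro!: bdd_aboveI[of _ y]\<close>)
 have T: "T \<noteq> {}" "bdd_below T" "closed T"
 proof -
  have "B+1 \<in> T" unfolding T_def using B[OF \<open>y \<in> \<Omega>\<close>] B[of "B+1"] by (auto simp: abs_if split: if_splits)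
  then show "T \<noteq> {}" by auto
 qed (use cl in \<open>auto simp: T_def intro!: bdd_belowI[of _ y]\<close>)
 define a where "a = Sup S" define b where "b = Inf T"
 have aS: "a \<in> S" unfolding a_def by (rule closed_contains_Sup[OF S])
 have bT: "b \<in> T" unfolding b_def by (rule closed_contains_Inf[OF T])
 have ay: "a < y" using aS \<open>y \<in> \<Omega>\<close> by (auto simp: S_def less_le)
 have yb: "y < b" using bT \<open>y \<in> \<Omega>\<close> by (auto simp: T_def less_le)
 have "x \<in> \<Omega>" if "a < x" "x < b" for x
 proof (rule ccontr)
  assume x: "x \<notin> \<Omega>"
  show False
  proof (cases "x \<le> y")
   case True
   then have "x \<le> a" unfolding a_def using x S by (intro cSup_upper) (auto simp: S_def)
   then show False using that by simp
  next
   case False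
   then have "b \<le> x" unfolding b_def using x T by (intro cInf_lower) (auto simp: T_def)
   then show False using that by simp
  qed
 qed
 then have "(a, b) \<in> comp_ivls \<Omega>"
  using aS bT ay yb by (auto simp: comp_ivls_def ivl_def S_def T_def)
 moreover have "y \<in> ivl (a, b)" using ay yb by (simp add: ivl_def)
 ultimately show ?thesis by blast
qed

lemma Union_comp_ivls:
 assumes "open \<Omega>" "bounded \<Omega>"
 shows "\<Omega> = (\<Union>J\<in>comp_ivls \<Omega>. ivl J)"
 using comp_ivls_cover[OF assms] by (auto simp: comp_ivls_def)

text \<open>Sums over components are integrals with respect to a counting measure, so that sums and integrals
  are exchanged by Tonelli's theorem.\<close>
lemma emeasure_comp_ivls:
 assumes "open \<Omega>" "bounded \<Omega>" "sets M = sets borel"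
 shows "emeasure M \<Omega> = (\<integral>\<^sup>+J. emeasure M (ivl J) \<partial>count_space (comp_ivls \<Omega>))"
 by (subst Union_comp_ivls[OF assms(1,2)], rule emeasure_UN_countable)
   (auto simp: assms(3) countable_comp_ivls comp_ivls_disjoint)

section \<open>The rising sun lemma\<close>

lemma integrable_set_integrable:
 fixes \<phi> :: "real \<Rightarrow> 'a::{banach, second_countable_topology}"
 assumes "integrable lborel \<phi>" "S \<in> sets borel"
 shows "set_integrable lborel S \<phi>"
 unfolding set_integrable_def by (rule integrable_mult_indicator) (use assms in auto)

lemma continuous_Iic_integral:
 fixes \<phi> :: "real \<Rightarrow> real"
 assumes "integrable lborel \<phi>"
 shows "continuous_on UNIV (\<lambda>x. LBINT y:{..x}. \<phi> y)"
proof -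
 have "isCont (\<lambda>x. LBINT y:{..x}. \<phi> y) x" for x
  unfolding continuous_at_sequentially comp_def set_lebesgue_integral_def
 proof (intro allI impI)
  fix X :: "nat \<Rightarrow> real" assume X: "X \<longlonglongrightarrow> x"
  show "(\<lambda>n. LBINT y. indicat_real {..X n} y *\<^sub>R \<phi> y) \<longlonglongrightarrow> (LBINT y. indicat_real {..x} y *\<^sub>R \<phi> y)"
  proof (rule integral_dominated_convergence[where w = "\<lambda>y. norm (\<phi> y)"])
   have "AE y in lborel. y \<noteq> x" by (simp add: AE_lborel_singleton)
   then show "AE y in lborel. (\<lambda>n. indicat_real {..X n} y *\<^sub>R \<phi> y) \<longlonglongrightarrow> indicat_real {..x} y *\<^sub>R \<phi> y"
   proof eventually_elim
    case (elim y)
    have "\<forall>\<^sub>F n in sequentially. indicat_real {..X n} y = indicat_real {..x} y"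
    proof (cases "y < x")
     case True
     from order_tendstoD(1)[OF X this] show ?thesis by eventually_elim (use True in \<open>auto simp: indicator_def\<close>)
    next
     case False
     then have "x < y" using elim by simp
     from order_tendstoD(2)[OF X this] show ?thesis
      by eventually_elim (use \<open>x < y\<close> in \<open>auto simp: indicator_def\<close>)
    qed
    then have "\<forall>\<^sub>F n in sequentially. indicat_real {..X n} y *\<^sub>R \<phi> y = indicat_real {..x} y *\<^sub>R \<phi> y"
     by eventually_elim simp
    then show ?case by (rule tendsto_eventually)
   qed
  qed (use assms in \<open>auto simp: indicator_def\<close>)
 qed
 then show ?thesis by (simp add: continuous_on_eq_continuous_at)
qed

lemma Iic_integral_diff:
 fixes \<phi> :: "real \<Rightarrow> real"
 assumes "integrable lborel \<phi>" "x \<le> y"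
 shows "(LBINT t:{x..y}. \<phi> t) = (LBINT t:{..y}. \<phi> t) - (LBINT t:{..x}. \<phi> t)"
proof -
 have "(LBINT t:{..y}. \<phi> t) = (LBINT t:{..x} \<union> {x<..y}. \<phi> t)"
  using \<open>x \<le> y\<close> by (intro arg_cong[where f = "\<lambda>S. set_lebesgue_integral lborel S \<phi>"]) auto
 also have "\<dots> = (LBINT t:{..x}. \<phi> t) + (LBINT t:{x<..y}. \<phi> t)"
  by (intro set_integral_Un) (auto intro: integrable_set_integrable assms)
 also have "(LBINT t:{x<..y}. \<phi> t) = (LBINT t:{x..y}. \<phi> t)"
  unfolding set_lebesgue_integral_def
 proof (rule integral_cong_AE)
  show "AE t in lborel. indicat_real {x<..y} t *\<^sub>R \<phi> t = indicat_real {x..y} t *\<^sub>R \<phi> t"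
   using AE_lborel_singleton[of x] by eventually_elim (auto simp: indicator_def)
 qed (use assms(1) in measurable)
 finally show ?thesis by simp
qed

text \<open>This is the level set \<open>{M\<^sup>+ \<phi> > \<tau>}\<close> of the one-sided maximal function. One-sidedness
  makes it accessible to F. Riesz's rising sun lemma, so that no covering lemma is used anywhere.\<close>
definition rising_set :: "(real \<Rightarrow> real) \<Rightarrow> real \<Rightarrow> real set" where
 "rising_set \<phi> \<tau> = {x. \<exists>h>0. (LBINT y:{x..x+h}. \<phi> y) > \<tau> * h}"

context
 fixes \<phi> :: "real \<Rightarrow> real" and R \<tau> :: real
 assumes int: "integrable lborel \<phi>" and nonneg: "\<And>x. \<phi> x \<ge> 0"
  and supp: "\<And>x. \<bar>x\<bar> > R \<Longrightarrow> \<phi> x = 0" and tau: "\<tau> > 0"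
begin

abbreviation (input) "rise x \<equiv> (LBINT y:{..x}. \<phi> y) - \<tau> * x"

lemma rising_set_iff: "x \<in> rising_set \<phi> \<tau> \<longleftrightarrow> (\<exists>y>x. rise y > rise x)"
proof -
 have "((LBINT y:{x..x+h}. \<phi> y) > \<tau> * h) \<longleftrightarrow> rise (x+h) > rise x" if "h > 0" for h
  using Iic_integral_diff[OF int, of x "x+h"] that by (auto simp: distrib_left)
 moreover have "(\<exists>y>x. rise y > rise x) \<longleftrightarrow> (\<exists>h>0. rise (x+h) > rise x)"
  by (metis add.commute diff_add_cancel diff_gt_0_iff_gt less_add_same_cancel1)
 ultimately show ?thesis unfolding rising_set_def by auto
qed

lemma continuous_rise: "continuous_on UNIV (\<lambda>x. rise x)"
 by (intro continuous_intros continuous_Iic_integral int)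

lemma open_rising_set: "open (rising_set \<phi> \<tau>)"
proof -
 have "rising_set \<phi> \<tau> = (\<Union>y. {..<y} \<inter> {x. rise x < rise y})"
  using rising_set_iff by auto
 moreover have "open {x. rise x < rise y}" for y
  using continuous_rise by (intro open_Collect_less) auto
 ultimately show ?thesis by (auto intro!: open_UN open_Int)
qed

lemma bounded_rising_set: "bounded (rising_set \<phi> \<tau>)"
proof -
 define I where "I = (LBINT y. \<phi> y)"
 have le: "(LBINT y:{x..x+h}. \<phi> y) \<le> I" for x h
  unfolding I_def set_lebesgue_integral_def
  using integrable_set_integrable[OF int, of "{x..x+h}"] int nonneg
  by (intro integral_mono) (auto simp: indicator_def set_integrable_def)
 have "\<bar>x\<bar> \<le> \<bar>R\<bar> + I / \<tau>" if "x \<in> rising_set \<phi> \<tau>" for x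
 proof -
  from that obtain h where h: "h > 0" "(LBINT y:{x..x+h}. \<phi> y) > \<tau> * h"
   unfolding rising_set_def by blast
  have pos: "(LBINT y:{x..x+h}. \<phi> y) > 0" using h tau by (meson less_trans mult_pos_pos)
  have "\<exists>y. x \<le> y \<and> y \<le> x + h \<and> \<phi> y \<noteq> 0"
  proof (rule ccontr)
   assume "\<not> ?thesis"
   then have "(\<lambda>y. indicat_real {x..x+h} y *\<^sub>R \<phi> y) = (\<lambda>y. 0)" by (auto simp: indicator_def)
   then show False using pos by (simp add: set_lebesgue_integral_def)
  qed
  then obtain y where "x \<le> y" "y \<le> x + h" "\<phi> y \<noteq> 0" by blast
  then have y: "\<bar>y\<bar> \<le> R" using supp[of y] by force
  have "\<tau> * h < I" using h le[of x h] by linarith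
  then have "h < I / \<tau>" using tau by (simp add: field_simps)
  then show ?thesis using y \<open>x \<le> y\<close> \<open>y \<le> x + h\<close> by linarith
 qed
 then show ?thesis by (auto simp: bounded_iff)
qed

text \<open>The rising sun lemma. The set consists of the points from which a higher point of the graph of
  \<open>rise\<close> is visible to the right. From inside a component nothing to the right can be higher than
  the right endpoint, and from the left endpoint nothing at all is higher, so both ends of the
  component have the same height.\<close>
lemma rising_set_component:
 assumes "J \<in> comp_ivls (rising_set \<phi> \<tau>)"
 shows "(LBINT y:{fst J..snd J}. \<phi> y) = \<tau> * (snd J - fst J)"
proof -
 define a b where "a = fst J" and "b = snd J"
 have J: "a < b" "{a<..<b} \<subseteq> rising_set \<phi> \<tau>" "a \<notin> rising_set \<phi> \<tau>" "b \<notin> rising_set \<phi> \<tau>"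
  using assms by (auto simp: comp_ivls_def ivl_def a_def b_def)
 have up: "rise x \<le> rise b" if x: "a < x" "x < b" for x
 proof (rule ccontr)
  assume n: "\<not> rise x \<le> rise b"
  define S where "S = {y \<in> {x..b}. rise x \<le> rise y}"
  have "closed ({x..b} \<inter> {y. rise x \<le> rise y})"
   using continuous_rise by (intro closed_Int closed_Collect_le continuous_on_const) auto
  then have cS: "closed S" by (simp add: S_def Int_def)
  have S: "x \<in> S" "bdd_above S" using x by (auto simp: S_def intro: bdd_aboveI[of _ b])
  have "S \<noteq> {}" using S(1) by blast
  define y where "y = Sup S"
  have yS: "y \<in> S" unfolding y_def by (rule closed_contains_Sup) (use \<open>S \<noteq> {}\<close> S(2) cS in blast)+
  then have "y < b" "a < y" using n x by (auto simp: S_def less_le)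
  then have "y \<in> rising_set \<phi> \<tau>" using J by auto
  then obtain u where u: "u > y" "rise u > rise y" using rising_set_iff by auto
  have "u > b"
  proof (rule ccontr)
   assume "\<not> u > b"
   then have "u \<in> S" using u yS x by (auto simp: S_def)
   then have "u \<le> y" unfolding y_def using S by (intro cSup_upper) auto
   then show False using u by simp
  qed
  moreover have "rise u > rise b" using u yS n by (auto simp: S_def)
  ultimately show False using J(4) rising_set_iff by auto
 qed
 have "rise a \<le> rise b"
 proof (rule tendsto_upperbound)
  show "((\<lambda>x. rise x) \<longlongrightarrow> rise a) (at_right a)"
   using continuous_rise by (simp add: continuous_on_def filterlim_at_split)
  show "\<forall>\<^sub>F x in at_right a. rise x \<le> rise b"
   using eventually_at_right_real[OF J(1)] by eventually_elim (auto intro: up)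
 qed simp
 moreover have "rise b \<le> rise a" using J(1,3) rising_set_iff[of a] by (metis not_le)
 ultimately show ?thesis
  using Iic_integral_diff[OF int, of a b] J(1) by (simp add: a_def b_def algebra_simps)
qed

text \<open>The weak type (1,1) of \<open>M\<^sup>+\<close>, with constant 1: the previous equality, summed over the components.\<close>
lemma rising_set_measure:
 "ennreal \<tau> * emeasure lborel (rising_set \<phi> \<tau>) \<le> (\<integral>\<^sup>+x. ennreal (\<phi> x) \<partial>lborel)"
proof -
 let ?O = "rising_set \<phi> \<tau>"
 have [measurable]: "\<phi> \<in> borel_measurable borel" using int by auto
 have "ennreal \<tau> * emeasure lborel ?O
   = (\<integral>\<^sup>+J. ennreal \<tau> * emeasure lborel (ivl J) \<partial>count_space (comp_ivls ?O))"
  by (subst emeasure_comp_ivls[OF open_rising_set bounded_rising_set])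
    (auto simp: nn_integral_cmult)
 also have "\<dots> = (\<integral>\<^sup>+J. emeasure (density lborel \<phi>) (ivl J) \<partial>count_space (comp_ivls ?O))"
 proof (rule nn_integral_cong)
  fix J assume "J \<in> space (count_space (comp_ivls ?O))"
  then have J: "J \<in> comp_ivls ?O" by simp
  then have lt: "fst J < snd J" by (auto simp: comp_ivls_def)
  have "emeasure (density lborel \<phi>) (ivl J) = (\<integral>\<^sup>+x. ennreal (indicator {fst J..snd J} x *\<^sub>R \<phi> x) \<partial>lborel)"
  proof (subst emeasure_density, simp, simp, rule nn_integral_cong_AE)
   show "AE x in lborel. ennreal (\<phi> x) * indicator (ivl J) x = ennreal (indicator {fst J..snd J} x *\<^sub>R \<phi> x)"
    using AE_lborel_singleton[of "fst J"] AE_lborel_singleton[of "snd J"]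
    by eventually_elim (auto simp: ivl_def indicator_def)
  qed
  also have "\<dots> = ennreal (LBINT y:{fst J..snd J}. \<phi> y)"
   unfolding set_lebesgue_integral_def
   using integrable_set_integrable[OF int, of "{fst J..snd J}"] nonneg
   by (intro nn_integral_eq_integral) (auto simp: set_integrable_def)
  also have "\<dots> = ennreal \<tau> * emeasure lborel (ivl J)"
   using lt tau by (simp add: rising_set_component[OF J] ivl_def ennreal_mult)
  finally show "ennreal \<tau> * emeasure lborel (ivl J) = emeasure (density lborel \<phi>) (ivl J)" ..
 qed
 also have "\<dots> = emeasure (density lborel \<phi>) ?O"
  by (rule emeasure_comp_ivls[symmetric]) (auto simp: open_rising_set bounded_rising_set)
 also have "\<dots> \<le> emeasure (density lborel \<phi>) UNIV"
  by (rule emeasure_mono) auto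
 also have "\<dots> = (\<integral>\<^sup>+x. ennreal (\<phi> x) \<partial>lborel)"
  by (subst emeasure_density) auto
 finally show ?thesis .
qed

end

section \<open>Differentiation and correlations\<close>

lemma integrable_indicator_Icc: "integrable lborel (\<lambda>x. c * indicator {a..b::real} x :: real)"
 by (intro integrable_mult_right integrable_real_indicator) (auto simp: emeasure_lborel_Icc_eq)

lemma not_rising_setD: "x \<notin> rising_set \<phi> \<tau> \<Longrightarrow> h > 0 \<Longrightarrow> (LBINT y:{x..x+h}. \<phi> y) \<le> \<tau> * h"
 unfolding rising_set_def mem_Collect_eq not_ex de_Morgan_conj not_less by (metis leD)

text \<open>Averages are only controlled on intervals that start at a point of the set. Letting that point
  decrease to the infimum recovers the whole set.\<close>
lemma emeasure_le_by_right_parts: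
 fixes S :: "real set"
 assumes M: "sets M = sets borel" and S: "S \<in> sets borel" "bdd_below S"
  and le: "\<And>x. x \<in> S \<Longrightarrow> emeasure M (S \<inter> {x..}) \<le> c"
 shows "emeasure M S \<le> c"
proof (cases "S = {} \<or> Inf S \<in> S")
 case True
 then show ?thesis
 proof
  assume "Inf S \<in> S"
  moreover have "S \<inter> {Inf S..} = S" using S(2) by (auto intro: cInf_lower)
  ultimately show ?thesis using le[of "Inf S"] by simp
 qed simp
next
 case False
 define T where "T n = S \<inter> {Inf S + inverse (real (Suc n))..}" for n
 have T: "T n \<in> sets M" for n unfolding T_def M using S(1) by simp
 have "S = (\<Union>n. T n)"
 proof
  show "S \<subseteq> (\<Union>n. T n)"
  proof
   fix x assume x: "x \<in> S"
   then have "x - Inf S > 0" using False S(2) cInf_lower[OF x S(2)] by (metis diff_gt_0_iff_gt less_le)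
   then obtain n where "inverse (real (Suc n)) < x - Inf S" using reals_Archimedean by blast
   then have "x \<in> T n" using x by (simp add: T_def del: of_nat_Suc)
   then show "x \<in> (\<Union>n. T n)" by blast
  qed
 qed (auto simp: T_def)
 moreover have "(SUP n. emeasure M (T n)) = emeasure M (\<Union>n. T n)"
 proof (rule SUP_emeasure_incseq)
  show "incseq T"
  proof (rule incseq_SucI)
   fix n
   have "inverse (real (Suc (Suc n))) \<le> inverse (real (Suc n))" by (rule le_imp_inverse_le) auto
   then have "{Inf S + inverse (real (Suc n))..} \<subseteq> {Inf S + inverse (real (Suc (Suc n)))..}" by simp
   then show "T n \<subseteq> T (Suc n)" unfolding T_def by (rule Int_mono[OF subset_refl])
  qed
 qed (use T in auto)
 moreover have "emeasure M (T n) \<le> c" for n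
 proof -
  obtain x where x: "x \<in> S" "x < Inf S + inverse (real (Suc n))"
   using False cInf_lessD[of S "Inf S + inverse (real (Suc n))"] by (auto simp del: of_nat_Suc)
  have "emeasure M (T n) \<le> emeasure M (S \<inter> {x..})"
   by (rule emeasure_mono) (use x S M in \<open>auto simp: T_def simp del: of_nat_Suc\<close>)
  then show ?thesis using le[OF x(1)] by (rule order_trans)
 qed
 ultimately show ?thesis by (metis SUP_least)
qed

text \<open>The consequence of Lebesgue's differentiation theorem that the Calderon--Zygmund decomposition
  needs, proved by comparing measures. If \<open>\<phi> > \<tau> + \<delta>\<close> on a set \<open>E\<close> of positive measure outside the
  rising set, cover \<open>E\<close> by an open set \<open>U\<close> of almost the same measure. In each component of \<open>U\<close> the
  mean of \<open>\<phi>\<close> from a point of \<open>E\<close> to the right end is at most \<open>\<tau>\<close>, so the integral of \<open>\<phi>\<close> over \<open>E\<close>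
  is at most \<open>\<tau> |U|\<close>, which is too small.\<close>
lemma rising_set_AE_le:
 fixes \<phi> :: "real \<Rightarrow> real"
 assumes int: "integrable lborel \<phi>" and nonneg: "\<And>x. \<phi> x \<ge> 0"
  and supp: "\<And>x. \<bar>x\<bar> > R \<Longrightarrow> \<phi> x = 0" and tau: "\<tau> > 0"
 shows "AE x in lborel. x \<notin> rising_set \<phi> \<tau> \<longrightarrow> \<phi> x \<le> \<tau>"
proof -
 let ?O = "rising_set \<phi> \<tau>"
 have [measurable]: "\<phi> \<in> borel_measurable borel" using int by auto
 have Ob [measurable]: "?O \<in> sets borel" using open_rising_set[OF int nonneg supp tau] by auto
 define \<nu> where "\<nu> = density lborel (\<lambda>x. ennreal (\<phi> x))"
 have \<nu>: "sets \<nu> = sets borel" by (simp add: \<nu>_def)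
 have null: "emeasure lborel {x. x \<notin> ?O \<and> \<phi> x > \<tau> + \<delta>} = 0" if \<delta>: "\<delta> > 0" for \<delta>
 proof (rule ccontr)
  define E where "E = {x. x \<notin> ?O \<and> \<phi> x > \<tau> + \<delta>}"
  assume "emeasure lborel {x. x \<notin> ?O \<and> \<phi> x > \<tau> + \<delta>} \<noteq> 0"
  then have ne: "emeasure lborel E \<noteq> 0" by (simp add: E_def)
  have E [measurable]: "E \<in> sets borel" unfolding E_def by measurable
  have ER: "E \<subseteq> {-R..R}"
  proof
   fix x assume "x \<in> E"
   then have "\<phi> x \<noteq> 0" using tau \<delta> by (auto simp: E_def)
   then show "x \<in> {-R..R}" using supp[of x] by (cases "R < \<bar>x\<bar>") (auto simp: abs_le_iff)
  qed
  have finE: "emeasure lborel E < \<infinity>"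
   using emeasure_mono[OF ER, of lborel] emeasure_lborel_Icc_eq[of "-R" R]
   by (auto simp: less_top[symmetric] top_unique split: if_splits)
  define m where "m = measure lborel E"
  have m: "emeasure lborel E = ennreal m" unfolding m_def using finE by (intro emeasure_eq_ennreal_measure) auto
  have m0: "m > 0" using ne m by (cases "m > 0") (auto simp: ennreal_neg)
  have e0: "\<delta> * m / (2 * \<tau>) > 0" using \<delta> m0 tau by simp
  \<comment> \<open>The excess of \<open>U\<close> over \<open>E\<close> must cost less than the gain \<open>\<delta> |E|\<close>.\<close>
  obtain V where V: "open V" "E \<subseteq> V" "emeasure lborel (V - E) < ennreal (\<delta> * m / (2 * \<tau>))"
   using outer_regular_lborel[OF E e0] by blast
  define U where "U = V \<inter> ball 0 (\<bar>R\<bar> + 1)"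
  have U: "open U" "bounded U" using V by (auto simp: U_def)
  have [measurable]: "U \<in> sets borel" "V \<in> sets borel" using U V by auto
  have EU: "E \<subseteq> U" using ER V by (force simp: U_def)
  have step: "emeasure \<nu> (E \<inter> ivl J) \<le> ennreal \<tau> * emeasure lborel (ivl J)" if J: "J \<in> comp_ivls U" for J
  proof (rule emeasure_le_by_right_parts[OF \<nu>])
   fix x assume x: "x \<in> E \<inter> ivl J"
   have "emeasure \<nu> (E \<inter> ivl J \<inter> {x..}) \<le> emeasure \<nu> {x..snd J}"
    by (rule emeasure_mono) (auto simp: \<nu> ivl_def)
   also have "\<dots> = (\<integral>\<^sup>+y. ennreal (indicator {x..snd J} y *\<^sub>R \<phi> y) \<partial>lborel)"
    unfolding \<nu>_def by (subst emeasure_density) (auto intro!: nn_integral_cong simp: indicator_def)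
   also have "\<dots> = ennreal (LBINT y:{x..x+(snd J - x)}. \<phi> y)"
    using integrable_set_integrable[OF int, of "{x..snd J}"] nonneg
    unfolding set_lebesgue_integral_def
    by (subst nn_integral_eq_integral) (auto simp: set_integrable_def)
   also have "\<dots> \<le> ennreal (\<tau> * (snd J - x))"
   proof (rule ennreal_leI)
    have "x \<notin> ?O" "snd J - x > 0" using x by (auto simp: E_def ivl_def)
    then show "(LBINT y:{x..x+(snd J - x)}. \<phi> y) \<le> \<tau> * (snd J - x)"
     by (rule not_rising_setD)
   qed
   also have "\<dots> \<le> ennreal (\<tau> * (snd J - fst J))"
    using x tau by (intro ennreal_leI mult_left_mono) (auto simp: ivl_def)
   also have "\<dots> = ennreal \<tau> * emeasure lborel (ivl J)"
    using J tau by (auto simp: ivl_def comp_ivls_def ennreal_mult)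
   finally show "emeasure \<nu> (E \<inter> ivl J \<inter> {x..}) \<le> ennreal \<tau> * emeasure lborel (ivl J)" .
  qed (auto simp: ivl_def intro!: bdd_belowI[of _ "fst J"])
  have "ennreal (\<tau> + \<delta>) * emeasure lborel E = (\<integral>\<^sup>+x. ennreal (\<tau> + \<delta>) * indicator E x \<partial>lborel)"
   by (simp add: nn_integral_cmult)
  also have "\<dots> \<le> (\<integral>\<^sup>+x. ennreal (\<phi> x) * indicator E x \<partial>lborel)"
   by (intro nn_integral_mono) (auto simp: indicator_def E_def intro!: ennreal_leI)
  also have "\<dots> = emeasure \<nu> E" unfolding \<nu>_def by (subst emeasure_density) auto
  also have "emeasure \<nu> E = emeasure \<nu> (\<Union>J\<in>comp_ivls U. E \<inter> ivl J)"
   using Union_comp_ivls[OF U] EU by (intro arg_cong[where f = "emeasure \<nu>"]) blast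
  also have "\<dots> = (\<integral>\<^sup>+J. emeasure \<nu> (E \<inter> ivl J) \<partial>count_space (comp_ivls U))"
  proof (rule emeasure_UN_countable)
   show "disjoint_family_on (\<lambda>J. E \<inter> ivl J) (comp_ivls U)"
    using comp_ivls_disjoint[of U] unfolding disjoint_family_on_def by blast
  qed (auto simp: \<nu> countable_comp_ivls)
  also have "\<dots> \<le> (\<integral>\<^sup>+J. ennreal \<tau> * emeasure lborel (ivl J) \<partial>count_space (comp_ivls U))"
   by (intro nn_integral_mono) (use step in auto)
  also have "\<dots> = ennreal \<tau> * emeasure lborel U"
   by (subst emeasure_comp_ivls[OF U]) (auto simp: nn_integral_cmult)
  also have "emeasure lborel U \<le> emeasure lborel (E \<union> (V - E))"
   by (rule emeasure_mono) (auto simp: U_def)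
  also have "\<dots> \<le> emeasure lborel E + emeasure lborel (V - E)"
   by (rule emeasure_subadditive) auto
  also have "\<dots> \<le> ennreal m + ennreal (\<delta> * m / (2 * \<tau>))"
   using V(3) m by (intro add_mono) auto
  finally have "ennreal (\<tau> + \<delta>) * ennreal m \<le> ennreal \<tau> * (ennreal m + ennreal (\<delta> * m / (2 * \<tau>)))"
   using m by (simp add: mult_left_mono)
  then have "ennreal ((\<tau> + \<delta>) * m) \<le> ennreal (\<tau> * (m + \<delta> * m / (2 * \<tau>)))"
   using tau \<delta> m0 by (simp add: ennreal_mult' ennreal_plus)
  then have "(\<tau> + \<delta>) * m \<le> \<tau> * (m + \<delta> * m / (2 * \<tau>))"
   using tau \<delta> m0 by (subst (asm) ennreal_le_iff) auto
  also have "\<dots> = \<tau> * m + \<delta> * m / 2" using tau by (simp add: field_simps)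
  finally show False using \<delta> m0 by (simp add: field_simps)
 qed
 have "AE x in lborel. \<not> (x \<notin> ?O \<and> \<phi> x > \<tau> + inverse (real (Suc n)))" for n
  using null[of "inverse (real (Suc n))"] by (intro AE_I[OF subset_refl]) (auto simp del: of_nat_Suc)
 then have "AE x in lborel. \<forall>n. \<not> (x \<notin> ?O \<and> \<phi> x > \<tau> + inverse (real (Suc n)))"
  by (intro AE_all_countable[THEN iffD2] allI)
 then show ?thesis
 proof eventually_elim
  case (elim x)
  show ?case
  proof (intro impI, rule ccontr)
   assume x: "x \<notin> ?O" "\<not> \<phi> x \<le> \<tau>"
   then obtain n where "inverse (real (Suc n)) < \<phi> x - \<tau>" using reals_Archimedean[of "\<phi> x - \<tau>"] by auto
   then show False using elim x by (auto simp del: of_nat_Suc simp: algebra_simps)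
  qed
 qed
qed

text \<open>The approximants share a bound and a bounded support, as dominated convergence requires.\<close>
lemma continuous_approx_L1:
 fixes f :: "real \<Rightarrow> complex"
 assumes f [measurable]: "f \<in> borel_measurable borel" and bd: "\<And>x. norm (f x) \<le> C"
  and supp: "\<And>x. \<bar>x\<bar> > R \<Longrightarrow> f x = 0" and e: "e > 0"
 shows "\<exists>g. continuous_on UNIV g \<and> (\<forall>x. norm (g x) \<le> \<bar>C\<bar> + 1) \<and> (\<forall>x. \<bar>x\<bar> > \<bar>R\<bar> + 1 \<longrightarrow> g x = 0) \<and>
       (LBINT x. norm (f x - g x)) < e"
proof -
 have "f measurable_on UNIV"
  using f by (intro lebesgue_measurable_imp_measurable_on) (auto simp: measurable_completion)
 then obtain N g where N: "negligible N" and g: "\<And>n. continuous_on UNIV (g n)"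
  and lim: "\<And>x. x \<notin> N \<Longrightarrow> (\<lambda>n. g n x) \<longlonglongrightarrow> f x"
  by (auto simp: measurable_on_def)
 define D where "D = \<bar>C\<bar> + 1"
 define cut where "cut x = max 0 (min 1 (\<bar>R\<bar> + 1 - \<bar>x\<bar>))" for x :: real
 define G where "G n x = (cut x / max 1 (norm (g n x) / D)) *\<^sub>R g n x" for n x
 have D: "D > 0" by (simp add: D_def add_nonneg_pos)
 have contG: "continuous_on UNIV (G n)" for n
  unfolding G_def cut_def using g D by (intro continuous_intros) (auto simp: max_def)
 have cut01: "0 \<le> cut x" "cut x \<le> 1" for x by (auto simp: cut_def)
 have bdG: "norm (G n x) \<le> D" for n x
 proof -
  have "norm (g n x) \<le> D * max 1 (norm (g n x) / D)"
   using D by (auto simp: max_def field_simps)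
  then have "norm (g n x) / max 1 (norm (g n x) / D) \<le> D"
   by (subst pos_divide_le_eq) auto
  moreover have "cut x * (norm (g n x) / max 1 (norm (g n x) / D)) \<le> 1 * (norm (g n x) / max 1 (norm (g n x) / D))"
   using cut01 by (intro mult_right_mono) auto
  ultimately show ?thesis using cut01[of x] by (simp add: G_def)
 qed
 have suppG: "G n x = 0" if "\<bar>x\<bar> > \<bar>R\<bar> + 1" for n x using that by (simp add: G_def cut_def)
 have limG: "(\<lambda>n. G n x) \<longlonglongrightarrow> f x" if "x \<notin> N" for x
 proof -
  have "(\<lambda>n. G n x) \<longlonglongrightarrow> (cut x / max 1 (norm (f x) / D)) *\<^sub>R f x"
   unfolding G_def using lim[OF that] D by (intro tendsto_intros) auto
  also have "(cut x / max 1 (norm (f x) / D)) *\<^sub>R f x = f x"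
  proof (cases "\<bar>x\<bar> > R")
   case False
   then have "cut x = 1" by (auto simp: cut_def)
   moreover have "norm (f x) / D \<le> 1" using bd[of x] D by (simp add: D_def field_simps)
   ultimately show ?thesis by (simp add: max_def)
  qed (simp add: supp)
  finally show ?thesis .
 qed
 have [measurable]: "G n \<in> borel_measurable borel" for n
  using contG by (rule borel_measurable_continuous_onI)
 have "(\<lambda>n. LBINT x. norm (f x - G n x)) \<longlonglongrightarrow> integral\<^sup>L lborel (\<lambda>x::real. 0::real)"
 proof (rule integral_dominated_convergence[where w = "\<lambda>x. 2 * D * indicator {-\<bar>R\<bar>-1..\<bar>R\<bar>+1} x"])
  show "integrable lborel (\<lambda>x. 2 * D * indicator {-\<bar>R\<bar>-1..\<bar>R\<bar>+1} x :: real)"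
   by (rule integrable_indicator_Icc)
  have "N \<in> null_sets lebesgue" using N by (simp add: negligible_iff_null_sets)
  then have "AE x in lebesgue. x \<notin> N" by (rule AE_not_in)
  then have "AE x in lebesgue. (\<lambda>n. norm (f x - G n x)) \<longlonglongrightarrow> 0"
  proof eventually_elim
   case (elim x)
   have "(\<lambda>n. f x - G n x) \<longlonglongrightarrow> f x - f x" by (intro tendsto_diff tendsto_const limG elim)
   then show ?case by (intro tendsto_norm_zero) simp
  qed
  then show "AE x in lborel. (\<lambda>n. norm (f x - G n x)) \<longlonglongrightarrow> 0"
   by (simp add: AE_completion_iff)
  fix n
  have "norm (f x - G n x) \<le> 2 * D" for x
   using norm_triangle_ineq4[of "f x" "G n x"] bdG[of n x] bd[of x] by (simp add: D_def)
  then show "AE x in lborel. norm (norm (f x - G n x)) \<le> 2 * D * indicator {-\<bar>R\<bar>-1..\<bar>R\<bar>+1} x"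
   using suppG[of _ n] supp by (intro AE_I2) (auto simp: indicator_def not_le not_less abs_le_iff)
 qed simp_all
 then have "(\<lambda>n. LBINT x. norm (f x - G n x)) \<longlonglongrightarrow> 0" by simp
 from order_tendstoD(2)[OF this e] obtain n where "(LBINT x. norm (f x - G n x)) < e"
  by (auto simp: eventually_sequentially)
 then show ?thesis using contG bdG suppG by (intro exI[of _ "G n"]) (auto simp: D_def)
qed

text \<open>With a truncated kernel as \<open>m\<close> this makes the level sets of the truncated singular integrals
  open; with the conjugate of \<open>f\<close> as \<open>m\<close> it is the continuity of autocorrelations behind the
  Plancherel estimate. The correlation is a uniform limit of those of continuous approximants.\<close>
lemma continuous_correlation:
 fixes f m :: "real \<Rightarrow> complex"
 assumes f [measurable]: "f \<in> borel_measurable borel" and bd: "\<And>x. norm (f x) \<le> C"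
  and supp: "\<And>x. \<bar>x\<bar> > R \<Longrightarrow> f x = 0"
  and m [measurable]: "m \<in> borel_measurable borel" and mB: "\<And>x. norm (m x) \<le> B"
 shows "continuous_on UNIV (\<lambda>x. LBINT v. m v * f (x + v))"
proof -
 define D where "D = \<bar>C\<bar> + 1" define S where "S = \<bar>R\<bar> + 1"
 have B0: "B \<ge> 0" using order_trans[OF norm_ge_zero mB] .
 have int: "integrable lborel (\<lambda>v. m v * g (x + v))"
  if [measurable]: "g \<in> borel_measurable borel" and g: "\<And>x. norm (g x) \<le> D" "\<And>x. \<bar>x\<bar> > S \<Longrightarrow> g x = 0"
  for g :: "real \<Rightarrow> complex" and x
 proof (rule Bochner_Integration.integrable_bound)
  show "integrable lborel (\<lambda>v. B * D * indicator {-S-x..S-x} v :: real)"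
   by (rule integrable_indicator_Icc)
  show "AE v in lborel. norm (m v * g (x + v)) \<le> norm (B * D * indicator {-S-x..S-x} v :: real)"
  proof (intro AE_I2)
   fix v
   show "norm (m v * g (x + v)) \<le> norm (B * D * indicator {-S-x..S-x} v :: real)"
   proof (cases "v \<in> {-S-x..S-x}")
    case True
    then show ?thesis using mult_mono[OF mB[of v] g(1)[of "x+v"] B0] B0 by (simp add: norm_mult D_def)
   next
    case False
    then have "g (x + v) = 0" by (intro g(2)) auto
    then show ?thesis by simp
   qed
  qed
 qed simp
 have "isCont (\<lambda>x. LBINT v. m v * f (x + v)) x" for x
  unfolding continuous_at_sequentially comp_def
 proof (intro allI impI)
  fix X :: "nat \<Rightarrow> real" assume X: "X \<longlonglongrightarrow> x"
  show "(\<lambda>n. LBINT v. m v * f (X n + v)) \<longlonglongrightarrow> (LBINT v. m v * f (x + v))"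
  proof (rule metric_LIMSEQ_I)
   fix e :: real assume e: "e > 0"
   have e': "e / (3 * (B + 1)) > 0" using e B0 by simp
   obtain g where g: "continuous_on UNIV g" "\<And>x. norm (g x) \<le> D" "\<And>x. \<bar>x\<bar> > S \<Longrightarrow> g x = 0"
    and fg: "(LBINT x. norm (f x - g x)) < e / (3 * (B + 1))"
    using continuous_approx_L1[OF f bd supp e'] unfolding D_def S_def by blast
   have gm [measurable]: "g \<in> borel_measurable borel" using g(1) by (rule borel_measurable_continuous_onI)
   have fD: "norm (f x) \<le> D" for x using bd[of x] by (simp add: D_def)
   have fS: "f x = 0" if "\<bar>x\<bar> > S" for x using that by (intro supp) (simp add: S_def)
   have close: "norm ((LBINT v. m v * f (z + v)) - (LBINT v. m v * g (z + v))) \<le> e / 3" for z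
   proof -
    have ifg: "integrable lborel (\<lambda>v. norm (f (z + v) - g (z + v)))"
    proof (rule Bochner_Integration.integrable_bound)
     show "integrable lborel (\<lambda>v. 2 * D * indicator {-S-z..S-z} v :: real)"
      by (rule integrable_indicator_Icc)
     show "AE v in lborel. norm (norm (f (z + v) - g (z + v))) \<le> norm (2 * D * indicator {-S-z..S-z} v :: real)"
     proof (intro AE_I2)
      fix v
      show "norm (norm (f (z + v) - g (z + v))) \<le> norm (2 * D * indicator {-S-z..S-z} v :: real)"
      proof (cases "v \<in> {-S-z..S-z}")
       case True
       then show ?thesis using norm_triangle_ineq4[of "f (z+v)" "g (z+v)"] fD[of "z+v"] g(2)[of "z+v"] by simp
      next
       case False
       then have "\<bar>z + v\<bar> > S" by auto
       then show ?thesis using g(3) fS by simp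
      qed
     qed
    qed simp
    have "(LBINT v. m v * f (z + v)) - (LBINT v. m v * g (z + v)) = (LBINT v. m v * (f (z + v) - g (z + v)))"
     using int[OF f fD fS] int[OF gm g(2,3)] by (simp add: right_diff_distrib)
    also have "norm \<dots> \<le> (LBINT v. B * norm (f (z + v) - g (z + v)))"
     by (intro Bochner_Integration.integral_norm_bound_integral integrable_mult_right ifg)
       (use Bochner_Integration.integrable_diff[OF int[OF f fD fS] int[OF gm g(2,3)]] mB in \<open>auto simp: right_diff_distrib[symmetric] norm_mult intro: mult_right_mono\<close>)
    also have "\<dots> = B * (LBINT v. norm (f (z + 1 * v) - g (z + 1 * v)))" by simp
    also have "(LBINT v. norm (f (z + 1 * v) - g (z + 1 * v))) = (LBINT x. norm (f x - g x))"
     using lborel_integral_real_affine[of 1 "\<lambda>x. norm (f x - g x)" z] by simp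
    also have "B * \<dots> \<le> (B + 1) * (e / (3 * (B + 1)))"
     using fg B0 by (intro mult_mono) auto
    also have "\<dots> = e / 3" using B0 by (simp add: field_simps)
    finally show ?thesis .
   qed
   obtain Y where Y: "\<And>n. \<bar>X n\<bar> \<le> Y"
    using convergent_imp_Bseq[OF convergentI[OF X]] by (auto simp: Bseq_def)
   have "(\<lambda>n. LBINT v. m v * g (X n + v)) \<longlonglongrightarrow> (LBINT v. m v * g (x + v))"
   proof (rule integral_dominated_convergence[where w = "\<lambda>v. B * D * indicator {-S-Y..S+Y} v"])
    show "integrable lborel (\<lambda>v. B * D * indicator {-S-Y..S+Y} v :: real)"
     by (rule integrable_indicator_Icc)
    have "isCont g y" for y using g(1) by (simp add: continuous_on_eq_continuous_at)
    then have "(\<lambda>n. g (X n + v)) \<longlonglongrightarrow> g (x + v)" for v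
     using X by (intro isCont_tendsto_compose[of _ g] tendsto_intros)
    then show "AE v in lborel. (\<lambda>n. m v * g (X n + v)) \<longlonglongrightarrow> m v * g (x + v)"
     by (intro AE_I2 tendsto_intros)
    fix n
    show "AE v in lborel. norm (m v * g (X n + v)) \<le> B * D * indicator {-S-Y..S+Y} v"
    proof (intro AE_I2)
     fix v
     show "norm (m v * g (X n + v)) \<le> B * D * indicator {-S-Y..S+Y} v"
     proof (cases "v \<in> {-S-Y..S+Y}")
      case True
      then show ?thesis using mult_mono[OF mB[of v] g(2)[of "X n+v"] B0] by (simp add: norm_mult)
     next
      case False
      then have "\<bar>X n + v\<bar> > S" using Y[of n] by auto
      then show ?thesis using g(3) False by simp
     qed
    qed
   qed simp_all
   from metric_LIMSEQ_D[OF this, of "e/3"] e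
   obtain N where N: "\<And>n. n \<ge> N \<Longrightarrow> dist (LBINT v. m v * g (X n + v)) (LBINT v. m v * g (x + v)) < e / 3"
    by auto
   have "dist (LBINT v. m v * f (X n + v)) (LBINT v. m v * f (x + v)) < e" if "n \<ge> N" for n
    using N[OF that] close[of "X n"] close[of x] unfolding dist_norm by norm
   then show "\<exists>N. \<forall>n\<ge>N. dist (LBINT v. m v * f (X n + v)) (LBINT v. m v * f (x + v)) < e" by blast
  qed
 qed
 then show ?thesis by (simp add: continuous_on_eq_continuous_at)
qed

section \<open>Multipliers on the line\<close>

text \<open>Every function of \<open>L\<^sup>\<infinity>\<^sub>c\<close> agrees almost everywhere with one of these. Borel measurability is
  preserved by translations and makes functions of several variables jointly measurable.\<close>
definition bcs :: "(real \<Rightarrow> complex) \<Rightarrow> bool" where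
 "bcs f \<longleftrightarrow> f \<in> borel_measurable borel \<and> bounded (range f) \<and> (\<exists>R. \<forall>x. \<bar>x\<bar> > R \<longrightarrow> f x = 0)"

lemma bcsE:
 assumes "bcs f"
 obtains C R where "C > 0" "R > 0" "f \<in> borel_measurable borel" "\<And>x. norm (f x) \<le> C"
  "\<And>x. \<bar>x\<bar> > R \<Longrightarrow> f x = 0" "\<And>x. norm (f x) \<le> C * indicator {-R..R} x"
proof -
 obtain C where C: "\<And>x. norm (f x) \<le> C" using assms by (auto simp: bcs_def bounded_iff)
 obtain R where R: "\<And>x. \<bar>x\<bar> > R \<Longrightarrow> f x = 0" using assms by (auto simp: bcs_def)
 have C': "norm (f x) \<le> \<bar>C\<bar> + 1" for x using C[of x] by simp
 have R': "f x = 0" if "\<bar>x\<bar> > \<bar>R\<bar> + 1" for x using R[of x] that by simp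
 show thesis
 proof
  show "norm (f x) \<le> (\<bar>C\<bar> + 1) * indicator {-(\<bar>R\<bar> + 1)..\<bar>R\<bar> + 1} x" for x
   using C'[of x] R'[of x] by (cases "\<bar>x\<bar> > \<bar>R\<bar> + 1") (auto simp: indicator_def abs_le_iff)
 qed (use C' R' assms in \<open>auto simp: bcs_def\<close>)
qed

lemma bcsI:
 assumes "f \<in> borel_measurable borel" "\<And>x. norm (f x) \<le> C" "\<And>x. \<bar>x\<bar> > R \<Longrightarrow> f x = 0"
 shows "bcs f"
 using assms by (auto simp: bcs_def bounded_iff)

lemma bcs_measurable: "bcs f \<Longrightarrow> f \<in> borel_measurable borel" by (simp add: bcs_def)

lemma integrable_bcs:
 assumes "bcs f" shows "integrable lborel f"
proof -
 obtain C R where f: "f \<in> borel_measurable borel" "\<And>x. norm (f x) \<le> C * indicator {-R..R} x"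
  using assms by (rule bcsE) blast
 show ?thesis
 proof (rule Bochner_Integration.integrable_bound[OF integrable_indicator_Icc[of C "-R" R]])
  show "AE x in lborel. norm (f x) \<le> norm (C * indicator {-R..R} x :: real)"
   using f(2) by (intro AE_I2) (metis abs_ge_self order_trans real_norm_def)
 qed (use f in simp)
qed

lemma bcs_mult_bounded:
 assumes "bcs f" "g \<in> borel_measurable borel" "\<And>x. norm (g x) \<le> B"
 shows "bcs (\<lambda>x. g x * f x)"
proof -
 obtain C R where f: "f \<in> borel_measurable borel" "\<And>x. norm (f x) \<le> C" "\<And>x. \<bar>x\<bar> > R \<Longrightarrow> f x = 0"
  using assms(1) by (rule bcsE) blast
 show ?thesis
 proof (rule bcsI)
  have "B \<ge> 0" using order_trans[OF norm_ge_zero assms(3)] .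
  then show "norm (g x * f x) \<le> B * C" for x
   unfolding norm_mult by (intro mult_mono assms f) auto
 qed (use f assms in auto)
qed

lemma bcs_bounded: "bcs f \<Longrightarrow> \<exists>B. \<forall>x. norm (f x) \<le> B"
 by (auto simp: bcs_def bounded_iff)

lemma bcs_cnj: "bcs f \<Longrightarrow> bcs (\<lambda>x. cnj (f x))"
 by (auto simp: bcs_def bounded_iff intro: borel_measurable_continuous_on[of cnj] continuous_intros)

lemma bcs_shift: assumes "bcs f" shows "bcs (\<lambda>x. f (a + x))"
proof -
 obtain C R where f: "f \<in> borel_measurable borel" "\<And>x. norm (f x) \<le> C" "\<And>x. \<bar>x\<bar> > R \<Longrightarrow> f x = 0"
  using assms(1) by (rule bcsE) blast
 show ?thesis by (rule bcsI[of _ C "R + \<bar>a\<bar>"]) (use f in \<open>auto intro!: f(3)\<close>)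
qed

lemma bcs_correlation:
 assumes "bcs m" "bcs f"
 shows "bcs (\<lambda>x. LBINT v. m v * f (x + v))"
proof -
 obtain C R where f: "C > 0" "R > 0" "f \<in> borel_measurable borel" "\<And>x. norm (f x) \<le> C" "\<And>x. \<bar>x\<bar> > R \<Longrightarrow> f x = 0"
  using assms(2) by (rule bcsE) blast
 obtain D S where m: "D > 0" "S > 0" "m \<in> borel_measurable borel" "\<And>x. norm (m x) \<le> D" "\<And>x. \<bar>x\<bar> > S \<Longrightarrow> m x = 0"
   "\<And>x. norm (m x) \<le> D * indicator {-S..S} x"
  using assms(1) by (rule bcsE) blast
 show ?thesis
 proof (rule bcsI)
  show "(\<lambda>x. LBINT v. m v * f (x + v)) \<in> borel_measurable borel"
   by (rule borel_measurable_continuous_onI, rule continuous_correlation[OF f(3,4,5) m(3,4)])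
  show "norm (LBINT v. m v * f (x + v)) \<le> (LBINT v. C * D * indicator {-S..S} v)" for x
  proof (rule Bochner_Integration.integral_norm_bound_integral)
   show "integrable lborel (\<lambda>v. m v * f (x + v))"
    by (rule integrable_bcs, rule bcs_mult_bounded[OF bcs_shift[OF assms(2)] m(3,4)])
   fix v
   have "norm (m v * f (x + v)) \<le> (D * indicator {-S..S} v) * C"
    unfolding norm_mult by (intro mult_mono m f) (use m(1) in auto)
   then show "norm (m v * f (x + v)) \<le> C * D * indicator {-S..S} v" by (simp add: mult_ac)
  qed (rule integrable_indicator_Icc)
  show "(LBINT v. m v * f (x + v)) = 0" if "\<bar>x\<bar> > R + S" for x
  proof -
   have "m v * f (x + v) = 0" for v
    using that m(5)[of v] f(5)[of "x+v"] by (cases "\<bar>v\<bar> > S") auto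
   then have "(\<lambda>v. m v * f (x + v)) = (\<lambda>v. 0)" by blast
   then show ?thesis by simp
  qed
 qed
qed

text \<open>The form of Fubini's theorem that fits bounded functions with bounded support in one variable.\<close>
lemma Fubini_strip:
 fixes F :: "'a \<Rightarrow> real \<Rightarrow> complex"
 assumes "sigma_finite_measure M" and [measurable]: "(\<lambda>(a, x). F a x) \<in> borel_measurable (M \<Otimes>\<^sub>M borel)"
  and g: "integrable M g" and bd: "\<And>a x. norm (F a x) \<le> g a * indicator {-R..R} x"
 shows "(LBINT x. LINT a|M. F a x) = (LINT a|M. (LBINT x. F a x))"
proof -
 interpret M: sigma_finite_measure M by fact
 interpret P: pair_sigma_finite M lborel ..
 have [measurable]: "(\<lambda>(a, x). F a x) \<in> borel_measurable (M \<Otimes>\<^sub>M lborel)" by measurable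
 have iF: "integrable lborel (\<lambda>x. F a x)" if "a \<in> space M" for a
 proof (rule Bochner_Integration.integrable_bound[OF integrable_indicator_Icc[of "g a" "-R" R]])
  have "(\<lambda>x. case (a, x) of (a, x) \<Rightarrow> F a x) \<in> borel_measurable lborel"
   using that by measurable
  then show "F a \<in> borel_measurable lborel" by simp
  show "AE x in lborel. norm (F a x) \<le> norm (g a * indicator {-R..R} x :: real)"
   using bd by (intro AE_I2) (metis abs_ge_self order_trans real_norm_def)
 qed
 have "integrable (M \<Otimes>\<^sub>M lborel) (\<lambda>(a, x). F a x)"
 proof (rule P.Fubini_integrable)
  show "integrable M (\<lambda>a. LBINT x. norm (case (a, x) of (a, x) \<Rightarrow> F a x))"
  proof (rule Bochner_Integration.integrable_bound)
   show "integrable M (\<lambda>a. g a * (LBINT x. indicator {-R..R} x))" using g by simp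
   show "AE a in M. norm (LBINT x. norm (case (a, x) of (a, x) \<Rightarrow> F a x)) \<le> norm (g a * (LBINT x. indicator {-R..R} x))"
   proof (intro AE_I2)
    fix a assume a: "a \<in> space M"
    have "(LBINT x. norm (F a x)) \<le> (LBINT x. g a * indicator {-R..R} x)"
     using iF[OF a] bd integrable_indicator_Icc[of "g a" "-R" R] by (intro integral_mono) auto
    then have "(LBINT x. norm (F a x)) \<le> g a * (LBINT x. indicator {-R..R} x)" by simp
    moreover have "(LBINT x. norm (F a x)) \<ge> 0" by simp
    ultimately show "norm (LBINT x. norm (case (a, x) of (a, x) \<Rightarrow> F a x)) \<le> norm (g a * (LBINT x. indicator {-R..R} x))"
     by simp
   qed
  qed measurable
  show "AE a in M. integrable lborel (\<lambda>x. case (a, x) of (a, x) \<Rightarrow> F a x)"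
   using iF by auto
 qed measurable
 then show ?thesis by (rule P.Fubini_integral)
qed

definition ft :: "(real \<Rightarrow> complex) \<Rightarrow> real \<Rightarrow> complex" where
 "ft f \<xi> = (LBINT x. f x * cis (- (\<xi> * x)))"

lemma cis_borel [measurable]: "cis \<in> borel_measurable borel"
 by (intro borel_measurable_continuous_onI) (auto intro: continuous_intros)

lemma cnj_borel [measurable]: "cnj \<in> borel_measurable borel"
 by (intro borel_measurable_continuous_onI) (auto intro: continuous_intros)

lemma ft_measurable [measurable]:
 assumes "bcs f" shows "ft f \<in> borel_measurable borel"
proof -
 have [measurable]: "f \<in> borel_measurable borel" using assms by (rule bcs_measurable)
 have "(\<lambda>\<xi>. LBINT x. f x * cis (- (\<xi> * x))) \<in> borel_measurable borel" by measurable
 then show ?thesis by (simp add: ft_def[abs_def])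
qed

lemma ft_bounded: assumes "bcs f" shows "norm (ft f \<xi>) \<le> (LBINT x. norm (f x))"
proof -
 have "norm (ft f \<xi>) \<le> (LBINT x. norm (f x * cis (- (\<xi> * x))))"
  unfolding ft_def by (rule integral_norm_bound)
 then show ?thesis by (simp add: norm_mult)
qed

abbreviation autocorr :: "(real \<Rightarrow> complex) \<Rightarrow> real \<Rightarrow> complex" where
 "autocorr f a \<equiv> (LBINT x. f x * cnj (f (a + x)))"

lemma continuous_autocorr:
 assumes "bcs f" shows "continuous_on UNIV (autocorr f)"
proof -
 obtain C R where C: "f \<in> borel_measurable borel" "\<And>x. norm (f x) \<le> C" "\<And>x. \<bar>x\<bar> > R \<Longrightarrow> f x = 0"
  using assms by (rule bcsE) blast
 show ?thesis
  by (rule continuous_correlation[where C = C and R = R and B = C])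
    (use C bcs_measurable[OF bcs_cnj[OF assms]] in auto)
qed

text \<open>A substitute for Plancherel's theorem that uses only the Fourier transform of the Gaussian. As
  \<open>S\<close> grows, the right-hand side concentrates at the value of the autocorrelation at 0, which is the
  square of the \<open>L\<^sup>2\<close> norm, while a pointwise bound of the Fourier transform passes through the
  left-hand side for each \<open>S\<close>.\<close>
lemma gaussian_parseval:
 assumes f: "bcs f" and S: "S > 0"
 shows "(LINT \<xi>|std_normal_distribution. ft f (S * \<xi>) * cnj (ft f (S * \<xi>)))
    = of_real (sqrt (2 * pi) / S) * (LINT u|std_normal_distribution. autocorr f (u / S))"
proof -
 let ?N = std_normal_distribution
 interpret N: real_distribution ?N by (rule real_dist_normal_dist)
 obtain C R where C: "C > 0" "R > 0" "\<And>x. norm (f x) \<le> C" and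
  fm [measurable]: "f \<in> borel_measurable borel" and bd: "\<And>x. norm (f x) \<le> C * indicator {-R..R} x"
  using f by (rule bcsE) blast
 define A where "A = (LBINT x. norm (f x))"
 have A: "norm (ft f \<xi>) \<le> A" for \<xi> unfolding A_def by (rule ft_bounded[OF f])
 have [measurable]: "ft f \<in> borel_measurable borel" by (rule ft_measurable[OF f])
 have sf: "sigma_finite_measure ?N" by unfold_locales
 have "(LINT \<xi>|?N. ft f (S * \<xi>) * cnj (ft f (S * \<xi>)))
   = (LINT \<xi>|?N. (LBINT x. f x * cis (- (S * \<xi> * x)) * cnj (ft f (S * \<xi>))))"
  unfolding ft_def[of f "S * _"] by (intro Bochner_Integration.integral_cong) simp_all
 also have "\<dots> = (LBINT x. LINT \<xi>|?N. f x * cis (- (S * \<xi> * x)) * cnj (ft f (S * \<xi>)))"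
 proof (rule Fubini_strip[symmetric, OF sf])
  show "integrable ?N (\<lambda>\<xi>. A * C)" by simp
  show "norm (f x * cis (- (S * \<xi> * x)) * cnj (ft f (S * \<xi>))) \<le> A * C * indicator {-R..R} x" for \<xi> x
   using mult_mono[OF A[of "S * \<xi>"] bd[of x]] order_trans[OF norm_ge_zero A]
   by (simp add: norm_mult mult_ac)
 qed measurable
 also have "\<dots> = (LBINT x. f x * (LINT \<xi>|?N. (LBINT y. cnj (f y) * cis (S * \<xi> * (y - x)))))"
 proof (intro Bochner_Integration.integral_cong refl)
  fix x
  have eq: "f x * cis (- (S * \<xi> * x)) * cnj (ft f (S * \<xi>)) = f x * (LBINT y. cnj (f y) * cis (S * \<xi> * (y - x)))" for \<xi>
  proof -
   have "cnj (ft f (S * \<xi>)) = (LBINT y. cnj (f y) * cis (S * \<xi> * y))"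
    unfolding ft_def Bochner_Integration.integral_cnj[symmetric] by (simp add: cis_cnj)
   then have "cis (- (S * \<xi> * x)) * cnj (ft f (S * \<xi>)) = (LBINT y. cis (- (S * \<xi> * x)) * (cnj (f y) * cis (S * \<xi> * y)))"
    by simp
   also have "\<dots> = (LBINT y. cnj (f y) * cis (S * \<xi> * (y - x)))"
   proof (intro Bochner_Integration.integral_cong refl)
    fix y
    have "cis (S * \<xi> * (y - x)) = cis (S * \<xi> * y) * cis (- (S * \<xi> * x))"
     by (simp add: cis_mult algebra_simps)
    then show "cis (- (S * \<xi> * x)) * (cnj (f y) * cis (S * \<xi> * y)) = cnj (f y) * cis (S * \<xi> * (y - x))"
     by (simp add: mult_ac)
   qed
   finally show ?thesis by (simp add: mult.assoc)
  qed
  show "(LINT \<xi>|?N. f x * cis (- (S * \<xi> * x)) * cnj (ft f (S * \<xi>)))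
    = f x * (LINT \<xi>|?N. (LBINT y. cnj (f y) * cis (S * \<xi> * (y - x))))"
   unfolding eq by (rule integral_mult_right_zero)
 qed
 also have "\<dots> = (LBINT x. f x * (of_real (sqrt (2 * pi) / S) * (LINT u|?N. cnj (f (u / S + x)))))"
 proof (intro Bochner_Integration.integral_cong refl arg_cong2[where f = "(*)"])
  fix x
  have "(LINT \<xi>|?N. (LBINT y. cnj (f y) * cis (S * \<xi> * (y - x))))
    = (LBINT y. LINT \<xi>|?N. cnj (f y) * cis (S * \<xi> * (y - x)))"
  proof (rule Fubini_strip[symmetric, OF sf])
   show "integrable ?N (\<lambda>\<xi>. C)" by simp
   show "norm (cnj (f y) * cis (S * \<xi> * (y - x))) \<le> C * indicator {-R..R} y" for \<xi> y
    using bd[of y] by (simp add: norm_mult)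
  qed measurable
  also have "\<dots> = (LBINT y. cnj (f y) * char ?N (S * (y - x)))"
   by (intro Bochner_Integration.integral_cong refl) (simp add: char_def cis_conv_exp mult_ac)
  also have "\<dots> = (LBINT y. cnj (f y) * of_real (exp (- (S * (y - x))\<^sup>2 / 2)))"
   by (simp add: char_std_normal_distribution)
  also have "\<dots> = \<bar>1 / S\<bar> *\<^sub>R (LBINT u. cnj (f (x + (1 / S) * u)) * of_real (exp (- (S * ((x + (1 / S) * u) - x))\<^sup>2 / 2)))"
   using S by (intro lborel_integral_real_affine) auto
  also have "\<dots> = (1 / S) *\<^sub>R (LBINT u. of_real (sqrt (2 * pi)) * (std_normal_density u *\<^sub>R cnj (f (u / S + x))))"
   using S by (intro arg_cong2[where f = scaleR] Bochner_Integration.integral_cong refl)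
    (auto simp: std_normal_density_def add.commute scaleR_conv_of_real)
  also have "\<dots> = of_real (sqrt (2 * pi) / S) * (LINT u|?N. cnj (f (u / S + x)))"
   by (subst integral_density) (auto simp: scaleR_conv_of_real)
  finally show "(LINT \<xi>|?N. (LBINT y. cnj (f y) * cis (S * \<xi> * (y - x))))
    = of_real (sqrt (2 * pi) / S) * (LINT u|?N. cnj (f (u / S + x)))" .
 qed
 also have "\<dots> = of_real (sqrt (2 * pi) / S) * (LBINT x. f x * (LINT u|?N. cnj (f (u / S + x))))"
  by (simp only: mult.left_commute[of "f _" "of_real _"] integral_mult_right_zero)
 also have "\<dots> = of_real (sqrt (2 * pi) / S) * (LBINT x. LINT u|?N. f x * cnj (f (u / S + x)))"
  by (simp only: integral_mult_right_zero)
 also have "(LBINT x. LINT u|?N. f x * cnj (f (u / S + x))) = (LINT u|?N. (LBINT x. f x * cnj (f (u / S + x))))"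
 proof (rule Fubini_strip[OF sf])
  show "integrable ?N (\<lambda>\<xi>. C * C)" by simp
  show "norm (f x * cnj (f (u / S + x))) \<le> C * C * indicator {-R..R} x" for u x
   using mult_mono[OF bd[of x] C(3)[of "u/S+x"]] C(1) by (simp add: norm_mult mult_ac)
 qed measurable
 finally show ?thesis .
qed

lemma integrable_bcs_sq: assumes "bcs f" shows "integrable lborel (\<lambda>x. (norm (f x))\<^sup>2)"
proof -
 obtain B where "\<And>x. norm (f x) \<le> B" using bcs_bounded[OF assms] by blast
 then have "integrable lborel (\<lambda>x. cnj (f x) * f x)"
  using bcs_measurable[OF bcs_cnj[OF assms]] by (intro integrable_bcs bcs_mult_bounded[OF assms, where B=B]) auto
 then have "integrable lborel (\<lambda>x. norm (cnj (f x) * f x))" by (rule integrable_norm)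
 then show ?thesis by (simp add: norm_mult power2_eq_square)
qed

lemma autocorr_le:
 assumes f: "bcs f"
 shows "norm (autocorr f a) \<le> (LBINT x. (norm (f x))\<^sup>2)"
proof -
 obtain B where B: "\<And>x. norm (f x) \<le> B" using bcs_bounded[OF f] by blast
 have i1: "integrable lborel (\<lambda>x. (norm (f (a + x)))\<^sup>2)" by (rule integrable_bcs_sq[OF bcs_shift[OF f]])
 have i2: "integrable lborel (\<lambda>x. (norm (f x))\<^sup>2)" by (rule integrable_bcs_sq[OF f])
 have "norm (autocorr f a) \<le> (LBINT x. ((norm (f x))\<^sup>2 + (norm (f (a + x)))\<^sup>2) / 2)"
 proof (rule Bochner_Integration.integral_norm_bound_integral)
  show "integrable lborel (\<lambda>x. f x * cnj (f (a + x)))"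
   by (intro integrable_bcs bcs_mult_bounded[OF bcs_cnj[OF bcs_shift[OF f]] bcs_measurable[OF f] B])
  show "norm (f x * cnj (f (a + x))) \<le> ((norm (f x))\<^sup>2 + (norm (f (a + x)))\<^sup>2) / 2" for x
   using sum_squares_bound[of "norm (f x)" "norm (f (a + x))"] by (simp add: norm_mult)
 qed (use i1 i2 in auto)
 also have "\<dots> = ((LBINT x. (norm (f x))\<^sup>2) + (LBINT x. (norm (f (a + 1 * x)))\<^sup>2)) / 2"
  using i1 i2 by simp
 also have "(LBINT x. (norm (f (a + 1 * x)))\<^sup>2) = (LBINT x. (norm (f x))\<^sup>2)"
  using lborel_integral_real_affine[of 1 "\<lambda>x. (norm (f x))\<^sup>2" a] by simp
 finally show ?thesis by simp
qed

lemma ft_correlation: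
 assumes m: "bcs m" and f: "bcs f"
 shows "ft (\<lambda>x. LBINT v. m v * f (x + v)) \<xi> = ft m (- \<xi>) * ft f \<xi>"
proof -
 obtain C R where C: "C > 0" "R > 0" and
  fm [measurable]: "f \<in> borel_measurable borel" and bd: "\<And>x. norm (f x) \<le> C" "\<And>x. \<bar>x\<bar> > R \<Longrightarrow> f x = 0"
  using f by (rule bcsE) blast
 obtain D S where D: "D > 0" "S > 0" and
  mm [measurable]: "m \<in> borel_measurable borel" and mbd: "\<And>x. norm (m x) \<le> D * indicator {-S..S} x"
  using m by (rule bcsE) blast
 have "ft (\<lambda>x. LBINT v. m v * f (x + v)) \<xi> = (LBINT x. LBINT v. m v * f (x + v) * cis (- (\<xi> * x)))"
  by (simp add: ft_def)
 also have "\<dots> = (LBINT v. LBINT x. m v * f (x + v) * cis (- (\<xi> * x)))"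
 proof (rule Fubini_strip[where g = "\<lambda>v. D * C * indicator {-S..S} v" and R = "R + S"])
  show "norm (m v * f (x + v) * cis (- (\<xi> * x))) \<le> (D * C * indicator {-S..S} v) * indicator {-(R+S)..R+S} x" for v x
  proof (cases "v \<in> {-S..S} \<and> x \<notin> {-(R+S)..R+S}")
   case True
   then have "f (x + v) = 0" by (intro bd(2)) auto
   then show ?thesis using True by simp
  next
   case False
   then show ?thesis using mult_mono[OF mbd[of v] bd(1)[of "x+v"]] C D
    by (auto simp: norm_mult indicator_def split: if_splits)
  qed
  show "integrable lborel (\<lambda>v. D * C * indicator {-S..S} v :: real)" by (rule integrable_indicator_Icc)
  show "sigma_finite_measure (lborel :: real measure)" by (rule lborel.sigma_finite_measure_axioms)
 qed measurable
 also have "\<dots> = (LBINT v. m v * cis (- (- \<xi> * v)) * ft f \<xi>)"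
 proof (intro Bochner_Integration.integral_cong refl)
  fix v
  have "ft f \<xi> = (LBINT x. f (v + 1 * x) * cis (- (\<xi> * (v + 1 * x))))"
   unfolding ft_def using lborel_integral_real_affine[of 1 "\<lambda>x. f x * cis (- (\<xi> * x))" v] by simp
  also have "\<dots> = (LBINT x. cis (- (\<xi> * v)) * (f (x + v) * cis (- (\<xi> * x))))"
  proof (intro Bochner_Integration.integral_cong refl)
   fix x
   have "cis (- (\<xi> * (v + 1 * x))) = cis (- (\<xi> * v)) * cis (- (\<xi> * x))"
    by (simp add: cis_mult algebra_simps)
   then show "f (v + 1 * x) * cis (- (\<xi> * (v + 1 * x))) = cis (- (\<xi> * v)) * (f (x + v) * cis (- (\<xi> * x)))"
    by (simp add: mult_ac add.commute)
  qed
  finally have ft: "ft f \<xi> = cis (- (\<xi> * v)) * (LBINT x. f (x + v) * cis (- (\<xi> * x)))" by simp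
  have "(LBINT x. m v * f (x + v) * cis (- (\<xi> * x))) = m v * (LBINT x. f (x + v) * cis (- (\<xi> * x)))"
   by (simp add: mult.assoc)
  also have "\<dots> = m v * (cis (\<xi> * v) * cis (- (\<xi> * v))) * (LBINT x. f (x + v) * cis (- (\<xi> * x)))"
   by (simp add: cis_mult)
  also have "\<dots> = m v * cis (- (- \<xi> * v)) * ft f \<xi>" unfolding ft by (simp add: mult_ac)
  finally show "(LBINT x. m v * f (x + v) * cis (- (\<xi> * x))) = m v * cis (- (- \<xi> * v)) * ft f \<xi>" .
 qed
 also have "\<dots> = ft m (- \<xi>) * ft f \<xi>" by (simp add: ft_def)
 finally show ?thesis .
qed

text \<open>A bounded multiplier is bounded on \<open>L\<^sup>2\<close>: for each \<open>S\<close> compare the Gaussian means of the Fourier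
  transforms of \<open>f\<close> and of the correlation, then let \<open>S\<close> tend to infinity.\<close>
theorem correlation_L2_bound:
 assumes m: "bcs m" and f: "bcs f" and B: "\<And>\<xi>. norm (ft m \<xi>) \<le> B"
 shows "(LBINT x. (norm (LBINT v. m v * f (x + v)))\<^sup>2) \<le> B\<^sup>2 * (LBINT x. (norm (f x))\<^sup>2)"
proof -
 let ?N = std_normal_distribution
 interpret N: real_distribution ?N by (rule real_dist_normal_dist)
 define h where "h = (\<lambda>x. LBINT v. m v * f (x + v))"
 have h: "bcs h" unfolding h_def by (rule bcs_correlation[OF m f])
 have [measurable]: "ft f \<in> borel_measurable borel" "ft h \<in> borel_measurable borel"
  by (auto intro: ft_measurable f h)
 obtain Bh where Bh: "\<And>x. norm (h x) \<le> Bh" using bcs_bounded[OF h] by blast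
 have cont: "continuous_on UNIV (autocorr h)" by (rule continuous_autocorr[OF h])
 have int_ft: "integrable ?N (\<lambda>\<xi>. (norm (ft g (S * \<xi>)))\<^sup>2)" if g: "bcs g" for g S
 proof (rule N.integrable_const_bound)
  have [measurable]: "ft g \<in> borel_measurable borel" by (rule ft_measurable[OF g])
  show "(\<lambda>\<xi>. (norm (ft g (S * \<xi>)))\<^sup>2) \<in> borel_measurable ?N" by measurable
  show "AE \<xi> in ?N. norm ((norm (ft g (S * \<xi>)))\<^sup>2) \<le> (LBINT x. norm (g x))\<^sup>2"
   using ft_bounded[OF g] by (intro AE_I2) (simp add: power_mono)
 qed
 have pars: "Re (LINT u|?N. autocorr g (u / S)) = S / sqrt (2 * pi) * (LINT \<xi>|?N. (norm (ft g (S * \<xi>)))\<^sup>2)"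
  if "S > 0" "bcs g" for S g
 proof -
  have eq: "ft g (S * \<xi>) * cnj (ft g (S * \<xi>)) = of_real ((norm (ft g (S * \<xi>)))\<^sup>2)" for \<xi>
   by (rule complex_norm_square[symmetric])
  have "of_real (LINT \<xi>|?N. (norm (ft g (S * \<xi>)))\<^sup>2) = of_real (sqrt (2 * pi) / S) * (LINT u|?N. autocorr g (u / S))"
   using gaussian_parseval[OF that(2,1)] unfolding eq integral_complex_of_real .
  then have "Re (of_real (LINT \<xi>|?N. (norm (ft g (S * \<xi>)))\<^sup>2)) = Re (of_real (sqrt (2 * pi) / S) * (LINT u|?N. autocorr g (u / S)))"
   by (rule arg_cong)
  then have "(LINT \<xi>|?N. (norm (ft g (S * \<xi>)))\<^sup>2) = sqrt (2 * pi) / S * Re (LINT u|?N. autocorr g (u / S))"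
   by simp
  then show ?thesis using that by simp
 qed
 have le: "Re (LINT u|?N. autocorr h (u / S)) \<le> B\<^sup>2 * (LBINT x. (norm (f x))\<^sup>2)" if S: "S > 0" for S
 proof -
  have "(LINT \<xi>|?N. (norm (ft h (S * \<xi>)))\<^sup>2) \<le> (LINT \<xi>|?N. B\<^sup>2 * (norm (ft f (S * \<xi>)))\<^sup>2)"
  proof (rule integral_mono[OF int_ft[OF h]])
   fix \<xi>
   have "norm (ft h (S * \<xi>)) \<le> B * norm (ft f (S * \<xi>))"
    unfolding h_def ft_correlation[OF m f] norm_mult by (intro mult_right_mono B) auto
   then show "(norm (ft h (S * \<xi>)))\<^sup>2 \<le> B\<^sup>2 * (norm (ft f (S * \<xi>)))\<^sup>2"
    by (metis norm_ge_zero power_mono power_mult_distrib)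
  qed (use int_ft[OF f] in auto)
  then have "Re (LINT u|?N. autocorr h (u / S)) \<le> S / sqrt (2 * pi) * (B\<^sup>2 * (LINT \<xi>|?N. (norm (ft f (S * \<xi>)))\<^sup>2))"
   unfolding pars[OF S h] using S by (intro mult_left_mono) auto
  also have "\<dots> = B\<^sup>2 * Re (LINT u|?N. autocorr f (u / S))" unfolding pars[OF S f] by simp
  also have "Re (LINT u|?N. autocorr f (u / S)) \<le> norm (LINT u|?N. autocorr f (u / S))" by (rule complex_Re_le_cmod)
  also have "\<dots> \<le> (LINT u|?N. norm (autocorr f (u / S)))" by (rule integral_norm_bound)
  also have "\<dots> \<le> (LBINT x. (norm (f x))\<^sup>2)"
  proof (rule N.integral_le_const)
   have [measurable]: "autocorr f \<in> borel_measurable borel"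
    by (rule borel_measurable_continuous_onI[OF continuous_autocorr[OF f]])
   show "integrable ?N (\<lambda>u. norm (autocorr f (u / S)))"
    by (rule N.integrable_const_bound[where B = "(LBINT x. (norm (f x))\<^sup>2)"]) (auto simp: autocorr_le[OF f])
  qed (auto simp: autocorr_le[OF f])
  finally show ?thesis by (simp add: mult_left_mono)
 qed
 have "(\<lambda>n. LINT u|?N. autocorr h (u / real (Suc n))) \<longlonglongrightarrow> (LINT u|?N. autocorr h 0)"
 proof (rule integral_dominated_convergence[where w = "\<lambda>u. LBINT x. (norm (h x))\<^sup>2"])
  have [measurable]: "autocorr h \<in> borel_measurable borel" by (rule borel_measurable_continuous_onI[OF cont])
  show "(\<lambda>u. autocorr h (u / real (Suc n))) \<in> borel_measurable ?N" for n by measurable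
  have "(\<lambda>n. u / real (Suc n)) \<longlonglongrightarrow> 0" for u
   by (rule LIMSEQ_Suc[OF lim_const_over_n])
  then show "AE u in ?N. (\<lambda>n. autocorr h (u / real (Suc n))) \<longlonglongrightarrow> autocorr h 0"
   using cont by (intro AE_I2 isCont_tendsto_compose[of 0 "autocorr h"]) (auto simp: continuous_on_eq_continuous_at)
  show "AE u in ?N. norm (autocorr h (u / real (Suc n))) \<le> (LBINT x. (norm (h x))\<^sup>2)" for n
   by (intro AE_I2 autocorr_le[OF h])
 qed simp_all
 then have "(\<lambda>n. Re (LINT u|?N. autocorr h (u / real (Suc n)))) \<longlonglongrightarrow> Re (LINT u|?N. autocorr h 0)"
  by (rule tendsto_Re)
 then have "Re (LINT u|?N. autocorr h 0) \<le> B\<^sup>2 * (LBINT x. (norm (f x))\<^sup>2)"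
  by (rule LIMSEQ_le_const2) (auto intro!: le)
 also have "Re (LINT u|?N. autocorr h 0) = Re (autocorr h 0)" using N.prob_space by simp
 also have "autocorr h 0 = of_real (LBINT x. (norm (h x))\<^sup>2)"
  by (simp add: complex_norm_square[symmetric] flip: integral_complex_of_real)
 finally show ?thesis by (simp add: h_def)
qed

section \<open>Weak type of truncated singular integrals\<close>

lemma emeasure_UN_le_count_space:
 assumes "countable I" "\<And>i. i \<in> I \<Longrightarrow> X i \<in> sets M"
 shows "emeasure M (\<Union>i\<in>I. X i) \<le> (\<integral>\<^sup>+i. emeasure M (X i) \<partial>count_space I)"
proof -
 have "emeasure M (\<Union>i\<in>I. X i) = (\<integral>\<^sup>+x. indicator (\<Union>i\<in>I. X i) x \<partial>M)"
  using assms by (intro nn_integral_indicator[symmetric] sets.countable_UN'') auto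
 also have "\<dots> \<le> (\<integral>\<^sup>+x. \<integral>\<^sup>+i. indicator (X i) x \<partial>count_space I \<partial>M)"
 proof (rule nn_integral_mono)
  fix x
  show "indicator (\<Union>i\<in>I. X i) x \<le> (\<integral>\<^sup>+i. indicator (X i) x \<partial>count_space I :: ennreal)"
  proof (cases "x \<in> (\<Union>i\<in>I. X i)")
   case True
   then obtain j where j: "j \<in> I" "x \<in> X j" by auto
   have "(1::ennreal) = (\<integral>\<^sup>+i. indicator {j} i \<partial>count_space I)"
    using j by (simp add: one_ennreal_def[symmetric])
   also have "\<dots> \<le> (\<integral>\<^sup>+i. indicator (X i) x \<partial>count_space I)"
    using j by (intro nn_integral_mono) (auto simp: indicator_def)
   finally show ?thesis using True by simp
  qed simp
 qed
 also have "\<dots> = (\<integral>\<^sup>+i. \<integral>\<^sup>+x. indicator (X i) x \<partial>M \<partial>count_space I)"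
  using assms by (intro nn_integral_count_space_nn_integral) auto
 also have "\<dots> = (\<integral>\<^sup>+i. emeasure M (X i) \<partial>count_space I)"
  using assms by (intro nn_integral_cong nn_integral_indicator) auto
 finally show ?thesis .
qed

lemma norm_integral_UN_le:
 fixes F :: "real \<Rightarrow> complex"
 assumes I: "countable I" and X: "\<And>i. i \<in> I \<Longrightarrow> X i \<in> sets borel" and disj: "disjoint_family_on X I"
  and F: "integrable lborel F"
 shows "ennreal (norm (LBINT y:(\<Union>i\<in>I. X i). F y)) \<le> (\<integral>\<^sup>+i. ennreal (norm (LBINT y:X i. F y)) \<partial>count_space I)"
proof -
 define X' where "X' n = (if n \<in> to_nat_on I ` I then X (from_nat_into I n) else {})" for n
 have inv: "from_nat_into I (to_nat_on I i) = i" if "i \<in> I" for i using I that by simp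
 have X'm: "X' n \<in> sets borel" for n using X inv by (auto simp: X'_def)
 have un: "(\<Union>n. X' n) = (\<Union>i\<in>I. X i)" using inv by (auto simp: X'_def split: if_splits)
 have dis: "disjoint_family X'"
 proof (unfold disjoint_family_on_def, intro ballI impI)
  fix m n :: nat assume mn: "m \<noteq> n"
  show "X' m \<inter> X' n = {}"
  proof (cases "m \<in> to_nat_on I ` I \<and> n \<in> to_nat_on I ` I")
   case True
   then obtain i j where ij: "i \<in> I" "j \<in> I" "m = to_nat_on I i" "n = to_nat_on I j" by auto
   then have "i \<noteq> j" using mn by auto
   then show ?thesis using disjoint_family_onD[OF disj ij(1,2)] ij inv by (simp add: X'_def)
  qed (auto simp: X'_def)
 qed
 have sI: "set_integrable lborel S F" if "S \<in> sets borel" for S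
  using integrable_set_integrable[OF F that] .
 have s: "(\<lambda>n. LBINT y:X' n. F y) sums (LBINT y:(\<Union>n. X' n). F y)"
  unfolding set_lebesgue_integral_def
 proof -
  have "(\<lambda>n. LBINT y. indicat_real (\<Union>i<n. X' i) y *\<^sub>R F y) \<longlonglongrightarrow> (LBINT y. indicat_real (\<Union>n. X' n) y *\<^sub>R F y)"
  proof (rule integral_dominated_convergence[where w = "\<lambda>y. norm (F y)"])
   show "AE y in lborel. (\<lambda>n. indicat_real (\<Union>i<n. X' i) y *\<^sub>R F y) \<longlonglongrightarrow> indicat_real (\<Union>n. X' n) y *\<^sub>R F y"
    by (intro AE_I2 tendsto_scaleR LIMSEQ_indicator_UN tendsto_const)
  qed (use F X'm in \<open>auto simp: indicator_def\<close>)
  also have "(\<lambda>n. LBINT y. indicat_real (\<Union>i<n. X' i) y *\<^sub>R F y) = (\<lambda>n. \<Sum>i<n. LBINT y. indicat_real (X' i) y *\<^sub>R F y)"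
  proof
   fix n
   have "(LBINT y. indicat_real (\<Union>i<n. X' i) y *\<^sub>R F y) = (LBINT y. \<Sum>i<n. indicat_real (X' i) y *\<^sub>R F y)"
   proof (rule Bochner_Integration.integral_cong[OF refl])
    fix y
    have "indicat_real (\<Union>i<n. X' i) y = (\<Sum>i<n. indicat_real (X' i) y)"
     using dis by (intro indicator_UN_disjoint) (auto simp: disjoint_family_on_def)
    then show "indicat_real (\<Union>i<n. X' i) y *\<^sub>R F y = (\<Sum>i<n. indicat_real (X' i) y *\<^sub>R F y)"
     by (simp add: scaleR_sum_left)
   qed
   also have "\<dots> = (\<Sum>i<n. LBINT y. indicat_real (X' i) y *\<^sub>R F y)"
    using sI[OF X'm] by (intro Bochner_Integration.integral_sum) (auto simp: set_integrable_def)
   finally show "(LBINT y. indicat_real (\<Union>i<n. X' i) y *\<^sub>R F y) = (\<Sum>i<n. LBINT y. indicat_real (X' i) y *\<^sub>R F y)" .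
  qed
  finally show "(\<lambda>n. LBINT y. indicat_real (X' n) y *\<^sub>R F y) sums (LBINT y. indicat_real (\<Union>n. X' n) y *\<^sub>R F y)"
   by (simp add: sums_def)
 qed
 have "ennreal (norm (LBINT y:(\<Union>n. X' n). F y)) \<le> (\<Sum>n. ennreal (norm (LBINT y:X' n. F y)))"
 proof (rule LIMSEQ_le_const2)
  show "(\<lambda>n. ennreal (norm (\<Sum>i<n. LBINT y:X' i. F y))) \<longlonglongrightarrow> ennreal (norm (LBINT y:(\<Union>n. X' n). F y))"
   using s unfolding sums_def by (intro tendsto_ennrealI tendsto_norm)
  have "ennreal (norm (\<Sum>i<n. LBINT y:X' i. F y)) \<le> (\<Sum>n. ennreal (norm (LBINT y:X' n. F y)))" for n
  proof -
   have "ennreal (norm (\<Sum>i<n. LBINT y:X' i. F y)) \<le> ennreal (\<Sum>i<n. norm (LBINT y:X' i. F y))"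
    by (intro ennreal_leI norm_sum)
   also have "\<dots> = (\<Sum>i<n. ennreal (norm (LBINT y:X' i. F y)))" by simp
   also have "\<dots> \<le> (\<Sum>n. ennreal (norm (LBINT y:X' n. F y)))" by (intro sum_le_suminf) auto
   finally show ?thesis .
  qed
  then show "\<exists>N. \<forall>n\<ge>N. ennreal (norm (\<Sum>i<n. LBINT y:X' i. F y)) \<le> (\<Sum>n. ennreal (norm (LBINT y:X' n. F y)))" by blast
 qed
 also have "\<dots> = (\<integral>\<^sup>+n. ennreal (norm (LBINT y:X' n. F y)) \<partial>count_space UNIV)"
  by (rule nn_integral_count_space_nat[symmetric])
 also have "\<dots> = (\<integral>\<^sup>+n. ennreal (norm (LBINT y:X' n. F y)) \<partial>count_space (to_nat_on I ` I))"
  by (rule nn_integral_count_space_eq[symmetric]) (auto simp: X'_def set_lebesgue_integral_def)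
 also have "\<dots> = (\<integral>\<^sup>+i. ennreal (norm (LBINT y:X' (to_nat_on I i). F y)) \<partial>count_space I)"
  by (rule nn_integral_bij_count_space[symmetric]) (use I in \<open>simp add: bij_betw_def inj_on_to_nat_on\<close>)
 also have "\<dots> = (\<integral>\<^sup>+i. ennreal (norm (LBINT y:X i. F y)) \<partial>count_space I)"
  by (rule nn_integral_cong) (simp add: X'_def inv)
 finally show ?thesis by (simp add: un)
qed

definition trunc :: "(real \<Rightarrow> complex) \<Rightarrow> real \<Rightarrow> real \<Rightarrow> complex" where
 "trunc k \<eta> v = indicator {\<eta><..} v *\<^sub>R k v"

text \<open>For \<open>k v = K (- v)\<close> this is the truncated integral of \<open>K (z - y) g y\<close> over \<open>y > z + \<eta>\<close>, written
  with \<open>y = z + v\<close>. The reflected kernel lives on the positive half-line, so the operator sees only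
  the values of \<open>g\<close> to the right of \<open>z\<close>.\<close>
definition Tr :: "(real \<Rightarrow> complex) \<Rightarrow> real \<Rightarrow> (real \<Rightarrow> complex) \<Rightarrow> real \<Rightarrow> complex" where
 "Tr k \<eta> g z = (LBINT v. trunc k \<eta> v * g (z + v))"

text \<open>Size, cancellation, and Hormander's condition in the \<open>L\<^sup>1\<close> form that suffices without weights: the
  difference of the kernels based at two points of an interval is integrable beyond a multiple of
  its length.\<close>
locale cz_kernel =
 fixes k :: "real \<Rightarrow> complex" and B1 B2 \<kappa> C0 :: real
 assumes k_meas [measurable]: "k \<in> borel_measurable borel"
  and k_neg: "\<And>v. v \<le> 0 \<Longrightarrow> k v = 0"
  and k_size: "\<And>v. v > 0 \<Longrightarrow> norm (k v) \<le> B2 / v"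
  and k_cancel: "\<And>e N. 0 < e \<Longrightarrow> e < N \<Longrightarrow> norm (LBINT v:{e<..<N}. k v) \<le> B1"
  and kappa: "\<kappa> \<ge> 2" and C0: "C0 \<ge> 0"
  and hormander: "\<And>h \<xi> x z. h > 0 \<Longrightarrow> x \<in> {\<xi>..\<xi>+h} \<Longrightarrow> z \<in> {\<xi>..\<xi>+h} \<Longrightarrow>
   (\<integral>\<^sup>+y. ennreal (norm (k (y - x) - k (y - z))) * indicator {\<xi>+\<kappa>*h<..} y \<partial>lborel) \<le> ennreal C0"
begin

lemma B2_nonneg: "B2 \<ge> 0"
 using order_trans[OF norm_ge_zero k_size[of 1]] by simp

lemma B1_nonneg: "B1 \<ge> 0"
 using order_trans[OF norm_ge_zero k_cancel[of 1 2]] by simp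

lemma k_size_le: "v \<ge> a \<Longrightarrow> a > 0 \<Longrightarrow> norm (k v) \<le> B2 / a"
 using k_size[of v] B2_nonneg by (meson divide_left_mono less_le_trans mult_pos_pos order_trans)

lemma bcs_window:
 assumes "0 < a" shows "bcs (\<lambda>v. indicator {a<..<b} v *\<^sub>R k v)"
proof (rule bcsI)
 show "norm (indicator {a<..<b} v *\<^sub>R k v) \<le> B2 / a" for v
  using k_size_le[of a v] assms B2_nonneg by (auto simp: indicator_def)
 show "indicator {a<..<b} v *\<^sub>R k v = 0" if "\<bar>v\<bar> > \<bar>a\<bar> + \<bar>b\<bar>" for v
  using that by (auto simp: indicator_def)
qed simp

lemma bcs_window_cis:
 assumes "0 < a" shows "bcs (\<lambda>v. indicator {a<..<b} v *\<^sub>R k v * cis (t * v))"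
proof -
 have "bcs (\<lambda>v. cis (t * v) * (indicator {a<..<b} v *\<^sub>R k v))"
  by (rule bcs_mult_bounded[OF bcs_window[OF assms], where B = 1]) auto
 then show ?thesis by (simp add: mult.commute)
qed

lemma norm_cis_minus_1: "norm (cis x - 1) \<le> \<bar>x\<bar>"
 using iexp_approx1[of x 0] by (simp add: cis_conv_exp)

text \<open>Up to distance comparable to \<open>1 / |t|\<close> the exponential may be replaced by 1, which leaves the
  cancellation of the kernel; the factor \<open>|t v|\<close> in the error is absorbed by the size \<open>B2 / v\<close>.\<close>
lemma ft_small_window:
 assumes "0 < a" "a < b"
 shows "norm (LBINT v. indicator {a<..<b} v *\<^sub>R k v * cis (t * v)) \<le> B1 + B2 * \<bar>t\<bar> * b"
proof -
 have i1: "integrable lborel (\<lambda>v. indicator {a<..<b} v *\<^sub>R k v)" by (rule integrable_bcs[OF bcs_window[OF assms(1)]])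
 have i2: "integrable lborel (\<lambda>v. indicator {a<..<b} v *\<^sub>R k v * cis (t * v))" by (rule integrable_bcs[OF bcs_window_cis[OF assms(1)]])
 have i3: "integrable lborel (\<lambda>v. indicator {a<..<b} v *\<^sub>R k v * (cis (t * v) - 1))"
  using Bochner_Integration.integrable_diff[OF i2 i1] by (simp add: right_diff_distrib)
 have "(LBINT v. indicator {a<..<b} v *\<^sub>R k v * cis (t * v))
   = (LBINT v. indicator {a<..<b} v *\<^sub>R k v) + (LBINT v. indicator {a<..<b} v *\<^sub>R k v * (cis (t * v) - 1))"
  by (subst Bochner_Integration.integral_add[OF i1 i3, symmetric]) (simp add: right_diff_distrib)
 also have "norm \<dots> \<le> norm (LBINT v. indicator {a<..<b} v *\<^sub>R k v) + norm (LBINT v. indicator {a<..<b} v *\<^sub>R k v * (cis (t * v) - 1))"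
  by (rule norm_triangle_ineq)
 also have "norm (LBINT v. indicator {a<..<b} v *\<^sub>R k v) \<le> B1"
  using k_cancel[OF assms] by (simp add: set_lebesgue_integral_def)
 also have "norm (LBINT v. indicator {a<..<b} v *\<^sub>R k v * (cis (t * v) - 1)) \<le> (LBINT v. (B2 * \<bar>t\<bar>) * indicator {0..b} v)"
 proof (rule Bochner_Integration.integral_norm_bound_integral[OF i3 integrable_indicator_Icc])
  fix v
  show "norm (indicator {a<..<b} v *\<^sub>R k v * (cis (t * v) - 1)) \<le> (B2 * \<bar>t\<bar>) * indicator {0..b} v"
  proof (cases "v \<in> {a<..<b}")
   case True
   then have v: "v > 0" using assms by simp
   have "norm (k v * (cis (t * v) - 1)) \<le> (B2 / v) * \<bar>t * v\<bar>"
    unfolding norm_mult using v B2_nonneg by (intro mult_mono k_size norm_cis_minus_1) auto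
   also have "\<dots> = B2 * \<bar>t\<bar>" using v by (simp add: abs_mult)
   finally show ?thesis using True v by (simp add: indicator_def)
  next
   case False
   then have "norm (indicator {a<..<b} v *\<^sub>R k v * (cis (t * v) - 1)) = 0" by simp
   also have "0 \<le> (B2 * \<bar>t\<bar>) * indicator {0..b} v" using B2_nonneg by simp
   finally show ?thesis .
  qed
 qed
 also have "(LBINT v. (B2 * \<bar>t\<bar>) * indicator {0..b} v) = B2 * \<bar>t\<bar> * b" using assms by simp
 finally show ?thesis by simp
qed

text \<open>A translation by half a period \<open>\<pi> / |t|\<close> changes the sign of the exponential. Averaging the
  integral with its translate produces a difference of two translates of the kernel, to which
  Hormander's condition applies; the two ends of the window are estimated by the size of the kernel.\<close>
lemma ft_large_window:
 assumes "t \<noteq> 0" "\<kappa> * (pi / \<bar>t\<bar>) \<le> a" "a < b"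
 shows "norm (LBINT v. indicator {a<..<b} v *\<^sub>R k v * cis (t * v)) \<le> C0 + 2 * B2"
proof -
 define \<delta> where "\<delta> = pi / \<bar>t\<bar>"
 have \<delta>: "\<delta> > 0" using assms by (simp add: \<delta>_def)
 have "2 * \<delta> \<le> \<kappa> * \<delta>" using kappa \<delta> by (intro mult_right_mono) auto
 moreover have "\<kappa> * \<delta> \<le> a" using assms(2) by (simp add: \<delta>_def)
 ultimately have a\<delta>: "a \<ge> \<delta>" "a > 0" using \<delta> by linarith+
 have a: "a > 0" using a\<delta> by simp
 define q where "q v = indicator {a<..<b} v *\<^sub>R k v" for v
 have [measurable]: "q \<in> borel_measurable borel" unfolding q_def[abs_def] by measurable
 define J where "J = (LBINT v. q v * cis (t * v))"
 have i1: "integrable lborel (\<lambda>v. q v * cis (t * v))"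
  unfolding q_def by (rule integrable_bcs[OF bcs_window_cis[OF a]])
 have cs: "cis (t * (v - \<delta>)) = - cis (t * v)" for v
 proof -
  have "cis (t * (v - \<delta>)) = cis (t * v) * cis (- (t * \<delta>))" by (simp add: cis_mult algebra_simps)
  moreover have "t * \<delta> = pi \<or> t * \<delta> = - pi" using assms(1) by (auto simp: \<delta>_def abs_if)
  then have "cis (- (t * \<delta>)) = -1" by (auto simp: cis_pi cis_cnj[symmetric])
  ultimately show ?thesis by simp
 qed
 have eq: "q (- \<delta> + 1 * v) * cis (t * (- \<delta> + 1 * v)) = - (q (v - \<delta>) * cis (t * v))" for v
  using cs[of v] by (simp add: add.commute)
 have i2: "integrable lborel (\<lambda>v. q (v - \<delta>) * cis (t * v))"
  using lborel_integrable_real_affine[OF i1, of 1 "-\<delta>"] unfolding eq by simp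
 have "J = - (LBINT v. q (v - \<delta>) * cis (t * v))"
  unfolding J_def using lborel_integral_real_affine[of 1 "\<lambda>v. q v * cis (t * v)" "-\<delta>"] unfolding eq by simp
 then have "2 * J = (LBINT v. q v * cis (t * v)) - (LBINT v. q (v - \<delta>) * cis (t * v))" by (simp add: J_def)
 also have "\<dots> = (LBINT v. (q v - q (v - \<delta>)) * cis (t * v))"
  by (subst Bochner_Integration.integral_diff[OF i1 i2, symmetric]) (simp add: left_diff_distrib)
 finally have J2: "2 * J = (LBINT v. (q v - q (v - \<delta>)) * cis (t * v))" .
 have "ennreal (norm (2 * J)) \<le> (\<integral>\<^sup>+v. ennreal (norm ((q v - q (v - \<delta>)) * cis (t * v))) \<partial>lborel)"
  unfolding J2 using Bochner_Integration.integrable_diff[OF i1 i2]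
  by (intro integral_norm_bound_ennreal) (simp add: left_diff_distrib)
 also have "\<dots> \<le> (\<integral>\<^sup>+v. ennreal (norm (k (v - 0) - k (v - \<delta>))) * indicator {0+\<kappa>*\<delta><..} v
   + (ennreal (B2 / \<delta>) * indicator {a..a+\<delta>} v + ennreal (B2 / \<delta>) * indicator {b..b+\<delta>} v) \<partial>lborel)"
 proof (rule nn_integral_mono)
  fix v
  let ?R = "ennreal (norm (k (v - 0) - k (v - \<delta>))) * indicator {0+\<kappa>*\<delta><..} v
   + (ennreal (B2 / \<delta>) * indicator {a..a+\<delta>} v + ennreal (B2 / \<delta>) * indicator {b..b+\<delta>} v)"
  consider "v \<in> {a<..<b}" "v - \<delta> \<in> {a<..<b}" | "v \<in> {a<..<b}" "v - \<delta> \<notin> {a<..<b}"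
   | "v \<notin> {a<..<b}" "v - \<delta> \<in> {a<..<b}" | "v \<notin> {a<..<b}" "v - \<delta> \<notin> {a<..<b}" by blast
  then show "ennreal (norm ((q v - q (v - \<delta>)) * cis (t * v))) \<le> ?R"
  proof cases
   case 1
   then have "v > \<kappa> * \<delta>" using assms(2) by (simp add: \<delta>_def)
   then show ?thesis using 1 by (auto simp: q_def norm_mult indicator_def intro: add_increasing2)
  next
   case 2
   then have v: "v \<in> {a..a+\<delta>}" using \<delta> by auto
   have "norm (k v) \<le> B2 / \<delta>" using v a\<delta> \<delta> by (intro k_size_le) auto
   then have "ennreal (norm ((q v - q (v - \<delta>)) * cis (t * v))) \<le> ennreal (B2 / \<delta>) * indicator {a..a+\<delta>} v"
    using 2 v by (auto simp: q_def norm_mult intro: ennreal_leI)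
   also have "\<dots> \<le> ?R" by (simp add: add_increasing add_increasing2)
   finally show ?thesis .
  next
   case 3
   then have v: "v \<in> {b..b+\<delta>}" using \<delta> by auto
   have "norm (k (v - \<delta>)) \<le> B2 / \<delta>" using 3 a\<delta> \<delta> by (intro k_size_le) auto
   then have "ennreal (norm ((q v - q (v - \<delta>)) * cis (t * v))) \<le> ennreal (B2 / \<delta>) * indicator {b..b+\<delta>} v"
    using 3 v by (auto simp: q_def norm_mult intro: ennreal_leI)
   also have "\<dots> \<le> ?R" by (simp add: add_increasing add_increasing2)
   finally show ?thesis .
  qed (simp add: q_def)
 qed
 also have "\<dots> = (\<integral>\<^sup>+v. ennreal (norm (k (v - 0) - k (v - \<delta>))) * indicator {0+\<kappa>*\<delta><..} v \<partial>lborel)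
   + (ennreal (B2 / \<delta>) * emeasure lborel {a..a+\<delta>} + ennreal (B2 / \<delta>) * emeasure lborel {b..b+\<delta>})"
  by (subst nn_integral_add, measurable)+ (simp add: nn_integral_cmult)
 also have "\<dots> \<le> ennreal C0 + (ennreal (B2 / \<delta>) * ennreal \<delta> + ennreal (B2 / \<delta>) * ennreal \<delta>)"
  using \<delta> hormander[of \<delta> 0 0 \<delta>] by (intro add_mono mult_left_mono) auto
 also have "\<dots> = ennreal (C0 + 2 * B2)"
  using \<delta> B2_nonneg C0 by (simp add: ennreal_mult[symmetric] ennreal_plus[symmetric] del: ennreal_plus)
 finally have "norm (2 * J) \<le> C0 + 2 * B2"
  using C0 B2_nonneg by (subst (asm) ennreal_le_iff) auto
 then have "2 * norm J \<le> C0 + 2 * B2" by (simp add: norm_mult)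
 then have "norm J \<le> C0 + 2 * B2" using norm_ge_zero[of J] by linarith
 then show ?thesis by (simp only: J_def q_def)
qed

definition fourier_const :: real where "fourier_const = B1 + B2 * (\<kappa> * pi) + (C0 + 2 * B2)"

lemma ft_window_bound:
 assumes "0 < \<eta>" "\<eta> < N"
 shows "norm (ft (\<lambda>v. indicator {\<eta><..<N} v *\<^sub>R k v) \<xi>) \<le> fourier_const"
proof -
 \<comment> \<open>\<open>ft\<close> has the exponential with the opposite sign.\<close>
 define t where "t = - \<xi>"
 define I where "I a b = (LBINT v. indicator {a<..<b} v *\<^sub>R k v * cis (t * v))" for a b
 have ft: "ft (\<lambda>v. indicator {\<eta><..<N} v *\<^sub>R k v) \<xi> = I \<eta> N" by (simp add: ft_def I_def t_def)
 have "norm (I \<eta> N) \<le> fourier_const"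
 proof (cases "t = 0")
  case True
  then have "norm (I \<eta> N) \<le> B1" using k_cancel[OF assms] by (simp add: I_def set_lebesgue_integral_def)
  moreover have "0 \<le> B2 * (\<kappa> * pi)" using B2_nonneg kappa by simp
  ultimately show ?thesis using B2_nonneg C0 unfolding fourier_const_def by linarith
 next
  case t: False
  define \<rho> where "\<rho> = \<kappa> * (pi / \<bar>t\<bar>)"
  have \<rho>: "\<rho> > 0" using t kappa by (simp add: \<rho>_def)
  have small: "norm (I a b) \<le> B1 + B2 * (\<kappa> * pi)" if "0 < a" "a < b" "b \<le> \<rho>" for a b
  proof -
   have "norm (I a b) \<le> B1 + B2 * \<bar>t\<bar> * b" unfolding I_def by (rule ft_small_window[OF that(1,2)])
   also have "\<dots> \<le> B1 + B2 * \<bar>t\<bar> * \<rho>" using that B2_nonneg by (intro add_left_mono mult_left_mono) auto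
   also have "\<dots> = B1 + B2 * (\<kappa> * pi)" using t by (simp add: \<rho>_def)
   finally show ?thesis .
  qed
  have large: "norm (I a b) \<le> C0 + 2 * B2" if "\<rho> \<le> a" "a < b" for a b
   unfolding I_def using ft_large_window[OF t, of a b] that by (simp add: \<rho>_def)
  consider "N \<le> \<rho>" | "\<rho> \<le> \<eta>" | "\<eta> < \<rho>" "\<rho> < N" by linarith
  then show ?thesis
  proof cases
   case 1
   then show ?thesis using small[OF assms] C0 B2_nonneg by (simp add: fourier_const_def)
  next
   case 2
   then have "norm (I \<eta> N) \<le> C0 + 2 * B2" using large[OF _ assms(2)] by simp
   moreover have "0 \<le> B2 * (\<kappa> * pi)" using B2_nonneg kappa by simp
   ultimately show ?thesis using B1_nonneg unfolding fourier_const_def by linarith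
  next
   case 3
   have i: "integrable lborel (\<lambda>v. indicator {a<..<b} v *\<^sub>R k v * cis (t * v))" if "0 < a" for a b
    by (rule integrable_bcs[OF bcs_window_cis[OF that]])
   have "I \<eta> N = (LBINT v. indicator {\<eta><..<\<rho>} v *\<^sub>R k v * cis (t * v) + indicator {\<rho><..<N} v *\<^sub>R k v * cis (t * v))"
    unfolding I_def
   proof (rule integral_cong_AE)
    show "AE v in lborel. indicator {\<eta><..<N} v *\<^sub>R k v * cis (t * v) =
      indicator {\<eta><..<\<rho>} v *\<^sub>R k v * cis (t * v) + indicator {\<rho><..<N} v *\<^sub>R k v * cis (t * v)"
     using AE_lborel_singleton[of \<rho>] by eventually_elim (use 3 in \<open>auto simp: indicator_def\<close>)
   qed measurable
   also have "\<dots> = I \<eta> \<rho> + I \<rho> N"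
    unfolding I_def by (rule Bochner_Integration.integral_add[OF i[OF assms(1)] i[OF \<rho>]])
   finally have "norm (I \<eta> N) \<le> norm (I \<eta> \<rho>) + norm (I \<rho> N)" by (simp add: norm_triangle_ineq)
   also have "\<dots> \<le> fourier_const" unfolding fourier_const_def using small[of \<eta> \<rho>] large[of \<rho> N] 3 assms by (intro add_mono) auto
   finally show ?thesis .
  qed
 qed
 then show ?thesis by (simp add: ft)
qed

lemma trunc_measurable [measurable]: "trunc k \<eta> \<in> borel_measurable borel"
 unfolding trunc_def[abs_def] by measurable

lemma trunc_bounded: "\<eta> > 0 \<Longrightarrow> norm (trunc k \<eta> v) \<le> B2 / \<eta>"
 using k_size_le[of \<eta> v] B2_nonneg by (auto simp: trunc_def indicator_def)

lemma bcs_trunc_mult: "\<eta> > 0 \<Longrightarrow> bcs g \<Longrightarrow> bcs (\<lambda>v. trunc k \<eta> v * g (z + v))"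
 by (rule bcs_mult_bounded[OF bcs_shift]) (auto intro: trunc_bounded)

lemma continuous_Tr:
 assumes "\<eta> > 0" "bcs g" shows "continuous_on UNIV (Tr k \<eta> g)"
proof -
 obtain C R where C: "g \<in> borel_measurable borel" "\<And>x. norm (g x) \<le> C" "\<And>x. \<bar>x\<bar> > R \<Longrightarrow> g x = 0"
  using assms(2) by (rule bcsE) blast
 show ?thesis unfolding Tr_def[abs_def]
  by (rule continuous_correlation[OF C trunc_measurable trunc_bounded[OF assms(1)]])
qed

lemma Tr_measurable: "\<eta> > 0 \<Longrightarrow> bcs g \<Longrightarrow> Tr k \<eta> g \<in> borel_measurable borel"
 by (rule borel_measurable_continuous_onI, rule continuous_Tr)

text \<open>Since \<open>g\<close> has compact support, at each point the truncations of the kernel to bounded windows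
  eventually give the exact value. The uniform multiplier bound of the windows therefore passes to the
  limit by Fatou's lemma.\<close>
lemma Tr_L2:
 assumes \<eta>: "\<eta> > 0" and g: "bcs g"
 shows "(\<integral>\<^sup>+z. ennreal ((norm (Tr k \<eta> g z))\<^sup>2) \<partial>lborel) \<le> ennreal (fourier_const\<^sup>2 * (LBINT x. (norm (g x))\<^sup>2))"
proof -
 obtain C R where C: "C > 0" "R > 0" "g \<in> borel_measurable borel" "\<And>x. norm (g x) \<le> C" "\<And>x. \<bar>x\<bar> > R \<Longrightarrow> g x = 0"
  using g by (rule bcsE) blast
 define m where "m n v = indicator {\<eta><..<\<eta> + 1 + real n} v *\<^sub>R k v" for n v
 define U where "U n z = (LBINT v. m n v * g (z + v))" for n z
 have m: "bcs (m n)" for n unfolding m_def[abs_def] by (rule bcs_window[OF \<eta>])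
 have bU: "bcs (U n)" for n unfolding U_def[abs_def] by (rule bcs_correlation[OF m g])
 have [measurable]: "U n \<in> borel_measurable borel" for n by (rule bcs_measurable[OF bU])
 have le: "(\<integral>\<^sup>+z. ennreal ((norm (U n z))\<^sup>2) \<partial>lborel) \<le> ennreal (fourier_const\<^sup>2 * (LBINT x. (norm (g x))\<^sup>2))" for n
 proof -
  have "(\<integral>\<^sup>+z. ennreal ((norm (U n z))\<^sup>2) \<partial>lborel) = ennreal (LBINT z. (norm (U n z))\<^sup>2)"
   by (rule nn_integral_eq_integral[OF integrable_bcs_sq[OF bU]]) simp
  also have "\<dots> \<le> ennreal (fourier_const\<^sup>2 * (LBINT x. (norm (g x))\<^sup>2))"
   unfolding U_def m_def
   by (intro ennreal_leI correlation_L2_bound bcs_window \<eta> g ft_window_bound) (use \<eta> in auto)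
  finally show ?thesis .
 qed
 have lim: "(\<lambda>n. ennreal ((norm (U n z))\<^sup>2)) \<longlonglongrightarrow> ennreal ((norm (Tr k \<eta> g z))\<^sup>2)" for z
 proof (rule tendsto_eventually, unfold eventually_sequentially, intro exI allI impI)
  fix n assume n: "nat \<lceil>R + \<bar>z\<bar>\<rceil> \<le> n"
  have "m n v * g (z + v) = trunc k \<eta> v * g (z + v)" for v
  proof (cases "v < \<eta> + 1 + real n")
   case False
   then have "\<bar>z + v\<bar> > R" using n \<eta> by linarith
   then show ?thesis using C by simp
  qed (auto simp: m_def trunc_def indicator_def)
  then have "(\<lambda>v. m n v * g (z + v)) = (\<lambda>v. trunc k \<eta> v * g (z + v))" by blast
  then show "ennreal ((norm (U n z))\<^sup>2) = ennreal ((norm (Tr k \<eta> g z))\<^sup>2)" by (simp only: U_def Tr_def)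
 qed
 have "(\<integral>\<^sup>+z. ennreal ((norm (Tr k \<eta> g z))\<^sup>2) \<partial>lborel) = (\<integral>\<^sup>+z. liminf (\<lambda>n. ennreal ((norm (U n z))\<^sup>2)) \<partial>lborel)"
  by (intro nn_integral_cong lim_imp_Liminf[symmetric] lim) simp
 also have "\<dots> \<le> liminf (\<lambda>n. \<integral>\<^sup>+z. ennreal ((norm (U n z))\<^sup>2) \<partial>lborel)"
  by (rule nn_integral_liminf) measurable
 also have "\<dots> \<le> liminf (\<lambda>n::nat. ennreal (fourier_const\<^sup>2 * (LBINT x. (norm (g x))\<^sup>2)))"
  by (intro Liminf_mono always_eventually allI le)
 also have "\<dots> = ennreal (fourier_const\<^sup>2 * (LBINT x. (norm (g x))\<^sup>2))" by (simp add: Liminf_const)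
 finally show ?thesis .
qed

text \<open>The truncation cuts off exactly one of the two values only on an interval of length at most \<open>h\<close>,
  where the kernel is at most \<open>B2 / h\<close>.\<close>
lemma hormander_trunc:
 assumes "h > 0" "x \<in> {\<xi>..\<xi>+h}" "z \<in> {\<xi>..\<xi>+h}"
 shows "(\<integral>\<^sup>+y. ennreal (norm (trunc k \<eta> (y - x) - trunc k \<eta> (y - z))) * indicator {\<xi>+\<kappa>*h<..} y \<partial>lborel) \<le> ennreal (C0 + B2)"
proof -
 have hk: "h + \<xi> \<le> \<xi> + \<kappa> * h - h" "2 * h \<le> \<kappa> * h"
  using mult_right_mono[OF kappa, of h] assms(1) by simp_all
 have "(\<integral>\<^sup>+y. ennreal (norm (trunc k \<eta> (y - x) - trunc k \<eta> (y - z))) * indicator {\<xi>+\<kappa>*h<..} y \<partial>lborel)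
   \<le> (\<integral>\<^sup>+y. ennreal (norm (k (y - x) - k (y - z))) * indicator {\<xi>+\<kappa>*h<..} y
     + ennreal (B2 / h) * indicator {\<eta> + min x z..\<eta> + max x z} y \<partial>lborel)"
 proof (rule nn_integral_mono)
  fix y
  show "ennreal (norm (trunc k \<eta> (y - x) - trunc k \<eta> (y - z))) * indicator {\<xi>+\<kappa>*h<..} y \<le>
    ennreal (norm (k (y - x) - k (y - z))) * indicator {\<xi>+\<kappa>*h<..} y
     + ennreal (B2 / h) * indicator {\<eta> + min x z..\<eta> + max x z} y"
  proof (cases "y > \<xi> + \<kappa> * h")
   case y: True
   have "h \<le> y - x" "h \<le> y - z" using y hk assms(2,3) unfolding atLeastAtMost_iff by linarith+
   then have kx: "norm (k (y - x)) \<le> B2 / h" and kz: "norm (k (y - z)) \<le> B2 / h"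
    using assms(1) by (auto intro: k_size_le)
   consider "y - x > \<eta> \<longleftrightarrow> y - z > \<eta>" | "y - x > \<eta>" "\<not> y - z > \<eta>" | "\<not> y - x > \<eta>" "y - z > \<eta>" by blast
   then show ?thesis
   proof cases
    case 1
    then show ?thesis by (auto simp: trunc_def indicator_def intro: add_increasing2)
   next
    case 2
    then show ?thesis using kx y
     by (auto simp: trunc_def indicator_def min_def max_def intro!: add_increasing ennreal_leI)
   next
    case 3
    then show ?thesis using kz y
     by (auto simp: trunc_def indicator_def min_def max_def intro!: add_increasing ennreal_leI)
   qed
  qed simp
 qed
 also have "\<dots> = (\<integral>\<^sup>+y. ennreal (norm (k (y - x) - k (y - z))) * indicator {\<xi>+\<kappa>*h<..} y \<partial>lborel)
   + ennreal (B2 / h) * emeasure lborel {\<eta> + min x z..\<eta> + max x z}"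
  by (subst nn_integral_add, measurable) (simp add: nn_integral_cmult)
 also have "\<dots> \<le> ennreal C0 + ennreal (B2 / h) * ennreal h"
  using assms by (intro add_mono mult_left_mono hormander) (auto simp: min_def max_def intro!: ennreal_leI)
 also have "\<dots> = ennreal (C0 + B2)"
  using assms(1) C0 B2_nonneg by (simp add: ennreal_mult[symmetric])
 finally show ?thesis .
qed

text \<open>The mean value zero allows the kernel at \<open>a\<close> to be subtracted. After a reflection, the variable
  of integration and the two base points of Hormander's condition are in the required position. To
  the right of its support the function is not seen, so only an enlargement to the left is removed.\<close>
lemma Tr_bad_part:
 assumes \<eta>: "\<eta> > 0" and b: "bcs b" and ab: "a < c" and supp: "\<And>y. y \<notin> {a<..<c} \<Longrightarrow> b y = 0"
  and mean: "(LBINT y. b y) = 0"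
 shows "(\<integral>\<^sup>+z. ennreal (norm (Tr k \<eta> b z)) * indicator (- {a - \<kappa> * (c - a)<..<c}) z \<partial>lborel)
   \<le> ennreal (C0 + B2) * (\<integral>\<^sup>+y. ennreal (norm (b y)) \<partial>lborel)"
proof -
 have [measurable]: "b \<in> borel_measurable borel" by (rule bcs_measurable[OF b])
 define h where "h = c - a"
 have h: "h > 0" using ab by (simp add: h_def)
 have Tr: "Tr k \<eta> b z = (LBINT y. trunc k \<eta> (y - z) * b y)" for z
  unfolding Tr_def using lborel_integral_real_affine[of 1 "\<lambda>v. trunc k \<eta> v * b (z + v)" "-z"] by simp
 have int: "integrable lborel (\<lambda>y. trunc k \<eta> (y - z) * b y)" for z
  by (rule integrable_bcs[OF bcs_mult_bounded[OF b, where B = "B2 / \<eta>"]]) (auto intro: trunc_bounded[OF \<eta>])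
 define G where "G z y = norm (trunc k \<eta> (y - z) - trunc k \<eta> (a - z)) * norm (b y) * indicator {..a - \<kappa> * h} z" for z y
 have [measurable]: "(\<lambda>(z, y). G z y) \<in> borel_measurable (borel \<Otimes>\<^sub>M borel)" unfolding G_def by measurable
 have le: "ennreal (norm (Tr k \<eta> b z)) * indicator (- {a - \<kappa> * h<..<c}) z \<le> (\<integral>\<^sup>+y. ennreal (G z y) \<partial>lborel)" for z
 proof -
  consider "z \<ge> c" | "z \<le> a - \<kappa> * h" | "z \<in> {a - \<kappa> * h<..<c}" by fastforce
  then show ?thesis
  proof cases
   case 1
   have "trunc k \<eta> (y - z) * b y = 0" for y
    using 1 supp[of y] \<eta> by (cases "y \<in> {a<..<c}") (auto simp: trunc_def indicator_def)
   then have "Tr k \<eta> b z = 0" unfolding Tr by (simp only: integral_zero)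
   then show ?thesis by simp
  next
   case 2
   have "integrable lborel (\<lambda>y. trunc k \<eta> (a - z) * b y)" using integrable_bcs[OF b] by simp
   then have "(LBINT y. trunc k \<eta> (y - z) * b y) - (LBINT y. trunc k \<eta> (a - z) * b y)
     = (LBINT y. trunc k \<eta> (y - z) * b y - trunc k \<eta> (a - z) * b y)"
    and i: "integrable lborel (\<lambda>y. trunc k \<eta> (y - z) * b y - trunc k \<eta> (a - z) * b y)"
    using int[of z] by simp_all
   then have "Tr k \<eta> b z = (LBINT y. (trunc k \<eta> (y - z) - trunc k \<eta> (a - z)) * b y)"
    unfolding Tr using mean by (simp add: left_diff_distrib)
   also have "ennreal (norm \<dots>) \<le> (\<integral>\<^sup>+y. ennreal (norm ((trunc k \<eta> (y - z) - trunc k \<eta> (a - z)) * b y)) \<partial>lborel)"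
    using i by (intro integral_norm_bound_ennreal) (simp add: left_diff_distrib)
   also have "\<dots> = (\<integral>\<^sup>+y. ennreal (G z y) \<partial>lborel)" using 2 by (simp add: G_def norm_mult)
   finally show ?thesis by (simp add: indicator_def)
  qed simp
 qed
 have "(\<integral>\<^sup>+z. ennreal (norm (Tr k \<eta> b z)) * indicator (- {a - \<kappa> * h<..<c}) z \<partial>lborel)
   \<le> (\<integral>\<^sup>+z. \<integral>\<^sup>+y. ennreal (G z y) \<partial>lborel \<partial>lborel)"
  by (intro nn_integral_mono le)
 also have "\<dots> = (\<integral>\<^sup>+y. \<integral>\<^sup>+z. ennreal (G z y) \<partial>lborel \<partial>lborel)"
  by (rule lborel_pair.Fubini') measurable
 also have "\<dots> \<le> (\<integral>\<^sup>+y. ennreal (C0 + B2) * ennreal (norm (b y)) \<partial>lborel)"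
 proof (rule nn_integral_mono)
  fix y
  show "(\<integral>\<^sup>+z. ennreal (G z y) \<partial>lborel) \<le> ennreal (C0 + B2) * ennreal (norm (b y))"
  proof (cases "y \<in> {a<..<c}")
   case False
   then show ?thesis using supp[of y] by (simp add: G_def)
  next
   case y: True
   have "(\<integral>\<^sup>+z. ennreal (norm (trunc k \<eta> (y - z) - trunc k \<eta> (a - z))) * indicator {..a - \<kappa> * h} z \<partial>lborel)
     = (\<integral>\<^sup>+u. ennreal (norm (trunc k \<eta> (u - (-y)) - trunc k \<eta> (u - (-a)))) * indicator {..a - \<kappa> * h} (- u) \<partial>lborel)"
    by (subst nn_integral_real_affine[where c = "-1" and t = 0]) (auto simp: add.commute)
   also have "\<dots> \<le> (\<integral>\<^sup>+u. ennreal (norm (trunc k \<eta> (u - (-y)) - trunc k \<eta> (u - (-a)))) * indicator {- c + \<kappa> * h<..} u \<partial>lborel)"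
    using ab by (intro nn_integral_mono mult_left_mono) (auto simp: indicator_def)
   also have "\<dots> \<le> ennreal (C0 + B2)"
    by (rule hormander_trunc[OF h]) (use y in \<open>auto simp: h_def\<close>)
   finally have inner: "(\<integral>\<^sup>+z. ennreal (norm (trunc k \<eta> (y - z) - trunc k \<eta> (a - z))) * indicator {..a - \<kappa> * h} z \<partial>lborel) \<le> ennreal (C0 + B2)" .
   have outer: "(\<integral>\<^sup>+z. ennreal (G z y) \<partial>lborel)
     = ennreal (norm (b y)) * (\<integral>\<^sup>+z. ennreal (norm (trunc k \<eta> (y - z) - trunc k \<eta> (a - z))) * indicator {..a - \<kappa> * h} z \<partial>lborel)"
    unfolding G_def by (subst nn_integral_cmult[symmetric], measurable)
     (auto intro!: nn_integral_cong simp: indicator_def ennreal_mult mult_ac)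
   have "(\<integral>\<^sup>+z. ennreal (G z y) \<partial>lborel) \<le> ennreal (norm (b y)) * ennreal (C0 + B2)"
    unfolding outer by (rule mult_left_mono[OF inner]) simp
   then show ?thesis by (simp only: mult.commute)
  qed
 qed
 also have "\<dots> = ennreal (C0 + B2) * (\<integral>\<^sup>+y. ennreal (norm (b y)) \<partial>lborel)"
  by (rule nn_integral_cmult) measurable
 finally show ?thesis by (simp add: h_def)
qed

definition weak_const :: real where "weak_const = 8 * fourier_const\<^sup>2 + (\<kappa> + 1) + 4 * (C0 + B2)"

lemma weak_const_pos: "weak_const > 0"
 using kappa C0 B2_nonneg by (simp add: weak_const_def add_nonneg_pos add_pos_nonneg)

text \<open>The Calderon--Zygmund decomposition at height \<open>t\<close>, on the components of the rising set of the
  modulus of \<open>g\<close>. The mean of the modulus over each component is exactly \<open>t\<close>, so the good part \<open>g0\<close>,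
  which replaces \<open>g\<close> by its means, is bounded by \<open>t\<close> and is treated in \<open>L\<^sup>2\<close>. The bad part \<open>b\<close> has mean
  zero on each component. The constant does not depend on the truncation.\<close>
theorem Tr_weak_type:
 assumes \<eta>: "\<eta> > 0" and g: "bcs g" and t: "t > 0"
 shows "ennreal t * emeasure lborel {z. norm (Tr k \<eta> g z) > t} \<le> ennreal (weak_const * (LBINT x. norm (g x)))"
proof -
 obtain C R where C: "C > 0" "R > 0" and [measurable]: "g \<in> borel_measurable borel"
  and gC: "\<And>x. norm (g x) \<le> C" and gR: "\<And>x. \<bar>x\<bar> > R \<Longrightarrow> g x = 0"
  using g by (rule bcsE) blast
 define \<phi> where "\<phi> x = norm (g x)" for x
 define G where "G = (LBINT x. norm (g x))"
 have G0: "G \<ge> 0" by (simp add: G_def)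
 have \<phi>: "integrable lborel \<phi>" "\<And>x. \<phi> x \<ge> 0" "\<And>x. \<bar>x\<bar> > R \<Longrightarrow> \<phi> x = 0"
  unfolding \<phi>_def using integrable_bcs[OF g] gR by auto
 have [measurable]: "\<phi> \<in> borel_measurable borel" unfolding \<phi>_def[abs_def] by measurable
 have nn\<phi>: "(\<integral>\<^sup>+x. ennreal (\<phi> x) \<partial>lborel) = ennreal G"
  unfolding G_def using nn_integral_eq_integral[OF \<phi>(1)] by (simp add: \<phi>_def[abs_def])
 define \<Omega> where "\<Omega> = rising_set \<phi> t"
 have \<Omega>: "open \<Omega>" "bounded \<Omega>"
  unfolding \<Omega>_def using open_rising_set[OF \<phi> t] bounded_rising_set[OF \<phi> t] by auto
 have [measurable]: "\<Omega> \<in> sets borel" using \<Omega> by auto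
 define I where "I = comp_ivls \<Omega>"
 have cI: "countable I" unfolding I_def by (rule countable_comp_ivls)
 have J: "fst J < snd J" "ivl J \<subseteq> \<Omega>" if "J \<in> I" for J using that by (auto simp: I_def comp_ivls_def)
 have meas\<Omega>: "ennreal t * emeasure lborel \<Omega> \<le> ennreal G"
  unfolding \<Omega>_def nn\<phi>[symmetric] by (rule rising_set_measure[OF \<phi> t])
 have gi: "set_integrable lborel S g" if "S \<in> sets borel" for S
  by (rule integrable_set_integrable[OF integrable_bcs[OF g] that])
 have avg\<phi>: "(LBINT y:ivl J. norm (g y)) = t * (snd J - fst J)" if J': "J \<in> I" for J
 proof -
  have "(LBINT y:ivl J. norm (g y)) = (LBINT y:{fst J..snd J}. \<phi> y)"
   unfolding set_lebesgue_integral_def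
  proof (rule integral_cong_AE)
   show "AE y in lborel. indicat_real (ivl J) y *\<^sub>R norm (g y) = indicat_real {fst J..snd J} y *\<^sub>R \<phi> y"
    using AE_lborel_singleton[of "fst J"] AE_lborel_singleton[of "snd J"]
    by eventually_elim (auto simp: ivl_def indicator_def \<phi>_def)
  qed measurable
  then show ?thesis using rising_set_component[OF \<phi> t] J' by (simp add: I_def \<Omega>_def)
 qed
 define c where "c J = (1 / (snd J - fst J)) *\<^sub>R (LBINT y:ivl J. g y)" for J
 have c: "norm (c J) \<le> t" if J': "J \<in> I" for J
 proof -
  have "norm (LBINT y:ivl J. g y) \<le> (LBINT y:ivl J. norm (g y))"
   by (rule set_integral_norm_bound[OF gi]) simp
  then have "norm (LBINT y:ivl J. g y) \<le> t * (snd J - fst J)" using avg\<phi>[OF J'] by simp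
  then show ?thesis using J(1)[OF J'] by (simp add: c_def field_simps)
 qed
 \<comment> \<open>\<open>\<iota> y\<close> is the component that contains \<open>y\<close>, for \<open>y\<close> in \<open>\<Omega>\<close>.\<close>
 define \<iota> where "\<iota> y = (THE J. J \<in> I \<and> y \<in> ivl J)" for y
 have \<iota>: "\<iota> y = J" if "J \<in> I" "y \<in> ivl J" for y J
  unfolding \<iota>_def
 proof (rule the_equality)
  fix J' assume "J' \<in> I \<and> y \<in> ivl J'"
  then show "J' = J" using disjoint_family_onD[OF comp_ivls_disjoint[of \<Omega>], of J' J] that by (auto simp: I_def)
 qed (use that in simp)
 have cov: "\<exists>J\<in>I. y \<in> ivl J" if "y \<in> \<Omega>" for y
  unfolding I_def by (rule comp_ivls_cover[OF \<Omega> that])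
 have \<Omega>U: "\<Omega> = (\<Union>J\<in>I. ivl J)" using cov J by blast
 define g0 where "g0 y = (if y \<in> \<Omega> then c (\<iota> y) else g y)" for y
 have [measurable]: "g0 \<in> borel_measurable borel"
 proof (rule measurableI)
  fix S :: "complex set" assume S: "S \<in> sets borel"
  have "g0 -` S \<inter> space borel = (\<Union>J\<in>{J\<in>I. c J \<in> S}. ivl J) \<union> ((g -` S \<inter> space borel) - \<Omega>)"
  proof (rule set_eqI)
   fix y
   show "y \<in> g0 -` S \<inter> space borel \<longleftrightarrow> y \<in> (\<Union>J\<in>{J\<in>I. c J \<in> S}. ivl J) \<union> ((g -` S \<inter> space borel) - \<Omega>)"
   proof (cases "y \<in> \<Omega>")
    case True
    then obtain J0 where J0: "J0 \<in> I" "y \<in> ivl J0" using cov by blast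
    have uniq: "J' = J0" if "J' \<in> I" "y \<in> ivl J'" for J' using \<iota>[OF J0] \<iota>[OF that] by simp
    have "g0 y = c J0" using True \<iota>[OF J0] by (simp add: g0_def)
    moreover have "y \<in> (\<Union>J\<in>{J\<in>I. c J \<in> S}. ivl J) \<longleftrightarrow> c J0 \<in> S" using uniq J0 by blast
    ultimately show ?thesis using True by simp
   qed (use J(2) in \<open>auto simp: g0_def\<close>)
  qed
  moreover have "(\<Union>J\<in>{J\<in>I. c J \<in> S}. ivl J) \<in> sets borel"
   using cI by (intro sets.countable_UN'') auto
  ultimately show "g0 -` S \<inter> space borel \<in> sets borel"
   using measurable_sets[OF _ S, of g borel] by auto
 qed simp
 have g0_on: "norm (g0 y) \<le> t" if y: "y \<in> \<Omega>" for y
 proof -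
  obtain J0 where "J0 \<in> I" "y \<in> ivl J0" using cov[OF y] by blast
  then show ?thesis using y \<iota> c by (simp add: g0_def)
 qed
 obtain R' where R': "\<And>y. y \<in> \<Omega> \<Longrightarrow> \<bar>y\<bar> \<le> R'" using \<Omega>(2) by (auto simp: bounded_iff)
 have g0: "bcs g0"
 proof (rule bcsI)
  show "norm (g0 x) \<le> C + t" for x
   using g0_on[of x] gC[of x] C(1) t by (cases "x \<in> \<Omega>") (auto simp: g0_def)
  show "g0 x = 0" if "\<bar>x\<bar> > max R R'" for x
   using that gR[of x] R'[of x] by (auto simp: g0_def)
 qed simp
 define b where "b y = g y - g0 y" for y
 have [measurable]: "b \<in> borel_measurable borel" unfolding b_def[abs_def] by measurable
 have boff: "b y = 0" if "y \<notin> \<Omega>" for y using that by (simp add: b_def g0_def)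
 have bon: "norm (b y) \<le> \<phi> y + t * indicator \<Omega> y" for y
  using norm_triangle_ineq4[of "g y" "g0 y"] g0_on[of y] boff[of y]
  by (cases "y \<in> \<Omega>") (auto simp: b_def \<phi>_def)
 have b: "bcs b"
 proof (rule bcsI)
  show "norm (b x) \<le> C + t" for x
  proof -
   have "t * indicator \<Omega> x \<le> t" using t by (simp add: indicator_def)
   then show ?thesis using bon[of x] gC[of x] unfolding \<phi>_def by linarith
  qed
  show "b x = 0" if "\<bar>x\<bar> > R'" for x using that boff[of x] R'[of x] by auto
 qed simp
 have L1b: "(\<integral>\<^sup>+y. ennreal (norm (b y)) \<partial>lborel) \<le> ennreal (2 * G)"
 proof -
  have "(\<integral>\<^sup>+y. ennreal (norm (b y)) \<partial>lborel) \<le> (\<integral>\<^sup>+y. ennreal (\<phi> y) + ennreal t * indicator \<Omega> y \<partial>lborel)"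
  proof (rule nn_integral_mono)
   fix y
   have "ennreal (norm (b y)) \<le> ennreal (\<phi> y + t * indicator \<Omega> y)" by (rule ennreal_leI[OF bon])
   also have "\<dots> = ennreal (\<phi> y) + ennreal t * indicator \<Omega> y"
    using t \<phi>(2)[of y] by (auto simp: indicator_def)
   finally show "ennreal (norm (b y)) \<le> ennreal (\<phi> y) + ennreal t * indicator \<Omega> y" .
  qed
  also have "\<dots> = ennreal G + ennreal t * emeasure lborel \<Omega>"
   by (subst nn_integral_add, measurable) (simp add: nn_integral_cmult nn\<phi>)
  also have "\<dots> \<le> ennreal G + ennreal G" using meas\<Omega> by (intro add_mono) auto
  also have "\<dots> = ennreal (2 * G)" using G0 by (simp flip: ennreal_plus)
  finally show ?thesis .
 qed
 have L2g0: "(LBINT x. (norm (g0 x))\<^sup>2) \<le> 2 * t * G"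
 proof -
  have "AE x in lborel. x \<notin> \<Omega> \<longrightarrow> \<phi> x \<le> t" unfolding \<Omega>_def by (rule rising_set_AE_le[OF \<phi> t])
  then have "AE x in lborel. (norm (g0 x))\<^sup>2 \<le> t * \<phi> x + t * (t * indicator \<Omega> x)"
  proof eventually_elim
   case (elim x)
   show ?case
   proof (cases "x \<in> \<Omega>")
    case True
    then have "(norm (g0 x))\<^sup>2 \<le> t\<^sup>2" using g0_on[of x] by (intro power_mono) auto
    moreover have "0 \<le> t * \<phi> x" using t \<phi>(2)[of x] by simp
    ultimately show ?thesis using True by (simp add: power2_eq_square)
   next
    case False
    then have "(norm (g0 x))\<^sup>2 = \<phi> x * \<phi> x" by (simp add: g0_def \<phi>_def power2_eq_square)
    also have "\<dots> \<le> t * \<phi> x" using elim False \<phi>(2)[of x] by (intro mult_right_mono) auto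
    finally show ?thesis using False by simp
   qed
  qed
  then have "(\<integral>\<^sup>+x. ennreal ((norm (g0 x))\<^sup>2) \<partial>lborel) \<le> (\<integral>\<^sup>+x. ennreal t * ennreal (\<phi> x) + ennreal t * (ennreal t * indicator \<Omega> x) \<partial>lborel)"
  proof (intro nn_integral_mono_AE, eventually_elim)
   fix x assume "(norm (g0 x))\<^sup>2 \<le> t * \<phi> x + t * (t * indicator \<Omega> x)"
   then have "ennreal ((norm (g0 x))\<^sup>2) \<le> ennreal (t * \<phi> x + t * (t * indicator \<Omega> x))" by (rule ennreal_leI)
   also have "\<dots> = ennreal t * ennreal (\<phi> x) + ennreal t * (ennreal t * indicator \<Omega> x)"
    using t \<phi>(2)[of x] by (auto simp: indicator_def ennreal_mult)
   finally show "ennreal ((norm (g0 x))\<^sup>2) \<le> ennreal t * ennreal (\<phi> x) + ennreal t * (ennreal t * indicator \<Omega> x)" .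
  qed
  also have "\<dots> = ennreal t * ennreal G + ennreal t * (ennreal t * emeasure lborel \<Omega>)"
   by (subst nn_integral_add, measurable) (simp add: nn_integral_cmult nn\<phi>)
  also have "\<dots> \<le> ennreal t * ennreal G + ennreal t * ennreal G"
   using meas\<Omega> by (intro add_mono mult_left_mono) auto
  also have "\<dots> = ennreal (2 * t * G)" using t G0 by (simp add: ennreal_mult[symmetric] flip: ennreal_plus)
  finally have "ennreal (LBINT x. (norm (g0 x))\<^sup>2) \<le> ennreal (2 * t * G)"
   by (subst (asm) nn_integral_eq_integral[OF integrable_bcs_sq[OF g0]]) auto
  then show ?thesis using t G0 by (subst (asm) ennreal_le_iff) auto
 qed
 \<comment> \<open>Off the enlarged components the bad part is estimated in \<open>L\<^sup>1\<close>.\<close>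
 define X where "X J = {fst J - \<kappa> * (snd J - fst J)<..<snd J}" for J :: "real \<times> real"
 define Ob where "Ob = (\<Union>J\<in>I. X J)"
 have [measurable]: "X J \<in> sets borel" "- X J \<in> sets borel" for J by (auto simp: X_def intro: borel_comp)
 have [measurable]: "Ob \<in> sets borel" unfolding Ob_def using cI by (intro sets.countable_UN'') auto
 have mOb: "ennreal t * emeasure lborel Ob \<le> ennreal ((\<kappa> + 1) * G)"
 proof -
  have "emeasure lborel Ob \<le> (\<integral>\<^sup>+J. emeasure lborel (X J) \<partial>count_space I)"
   unfolding Ob_def by (rule emeasure_UN_le_count_space[OF cI]) simp
  also have "\<dots> = (\<integral>\<^sup>+J. ennreal (\<kappa> + 1) * emeasure lborel (ivl J) \<partial>count_space I)"
  proof (rule nn_integral_cong)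
   fix J' assume "J' \<in> space (count_space I)"
   then have lt: "fst J' < snd J'" using J by simp
   then have "fst J' - \<kappa> * (snd J' - fst J') \<le> snd J'" using kappa mult_nonneg_nonneg[of \<kappa> "snd J' - fst J'"] by linarith
   then show "emeasure lborel (X J') = ennreal (\<kappa> + 1) * emeasure lborel (ivl J')"
   proof -
    assume le: "fst J' - \<kappa> * (snd J' - fst J') \<le> snd J'"
    have "emeasure lborel (X J') = ennreal (snd J' - (fst J' - \<kappa> * (snd J' - fst J')))"
     using le by (simp add: X_def)
    also have "snd J' - (fst J' - \<kappa> * (snd J' - fst J')) = (\<kappa> + 1) * (snd J' - fst J')"
     by (simp add: algebra_simps)
    also have "ennreal \<dots> = ennreal (\<kappa> + 1) * emeasure lborel (ivl J')"
     using lt kappa by (subst ennreal_mult) (auto simp: ivl_def)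
    finally show ?thesis .
   qed
  qed
  also have "\<dots> = ennreal (\<kappa> + 1) * emeasure lborel \<Omega>"
   by (subst emeasure_comp_ivls[OF \<Omega>]) (auto simp: nn_integral_cmult I_def)
  finally have "ennreal t * emeasure lborel Ob \<le> ennreal (\<kappa> + 1) * (ennreal t * emeasure lborel \<Omega>)"
   by (metis mult.left_commute mult_left_mono zero_le)
  also have "\<dots> \<le> ennreal (\<kappa> + 1) * ennreal G" using meas\<Omega> by (rule mult_left_mono) simp
  finally show ?thesis using kappa G0 by (simp add: ennreal_mult)
 qed
 have Tb: "(\<integral>\<^sup>+z. ennreal (norm (Tr k \<eta> b z)) * indicator (- Ob) z \<partial>lborel) \<le> ennreal (C0 + B2) * ennreal (2 * G)"
 proof -
  define bJ where "bJ J y = indicator (ivl J) y *\<^sub>R b y" for J y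
  have bJ: "bcs (bJ J)" for J
  proof -
   have "bcs (\<lambda>y. of_real (indicator (ivl J) y) * b y)"
    by (rule bcs_mult_bounded[OF b, where B = 1]) (auto simp: indicator_def)
   then show ?thesis by (simp add: bJ_def[abs_def] scaleR_conv_of_real)
  qed
  have mJ: "(LBINT y. bJ J' y) = 0" if J': "J' \<in> I" for J'
  proof -
   have eq: "bJ J' y = indicator (ivl J') y *\<^sub>R g y - indicator (ivl J') y *\<^sub>R c J'" for y
    using J' \<iota>[OF J', of y] J(2)[OF J'] by (auto simp: bJ_def b_def g0_def indicator_def)
   have "(LBINT y. bJ J' y) = (LBINT y:ivl J'. g y) - (LBINT y:ivl J'. c J')"
    unfolding eq set_lebesgue_integral_def
    by (rule Bochner_Integration.integral_diff)
      (use gi[of "ivl J'"] J(1)[OF J'] in \<open>auto simp: set_integrable_def ivl_def\<close>)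
   also have "(LBINT y:ivl J'. c J') = (snd J' - fst J') *\<^sub>R c J'"
    using J(1)[OF J'] unfolding set_lebesgue_integral_def
    by (subst integral_scaleR_left) (auto simp: ivl_def)
   also have "\<dots> = (LBINT y:ivl J'. g y)" using J(1)[OF J'] by (simp add: c_def)
   finally show ?thesis by simp
  qed
  have pt: "ennreal (norm (Tr k \<eta> b z)) * indicator (- Ob) z
    \<le> (\<integral>\<^sup>+J. ennreal (norm (Tr k \<eta> (bJ J) z)) * indicator (- X J) z \<partial>count_space I)" for z
  proof (cases "z \<in> Ob")
   case False
   have sub: "(LBINT y. trunc k \<eta> (y - z) * f y) = Tr k \<eta> f z" for f
    unfolding Tr_def using lborel_integral_real_affine[of 1 "\<lambda>v. trunc k \<eta> v * f (z + v)" "-z"] by simp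
   have int: "integrable lborel (\<lambda>y. trunc k \<eta> (y - z) * b y)"
    by (rule integrable_bcs[OF bcs_mult_bounded[OF b, where B = "B2 / \<eta>"]]) (auto intro: trunc_bounded[OF \<eta>])
   have "Tr k \<eta> b z = (LBINT y:(\<Union>J\<in>I. ivl J). trunc k \<eta> (y - z) * b y)"
    unfolding sub[symmetric] set_lebesgue_integral_def \<Omega>U[symmetric]
    by (intro Bochner_Integration.integral_cong refl) (use boff in \<open>auto simp: indicator_def\<close>)
   also have "ennreal (norm \<dots>) \<le> (\<integral>\<^sup>+J. ennreal (norm (LBINT y:ivl J. trunc k \<eta> (y - z) * b y)) \<partial>count_space I)"
    by (rule norm_integral_UN_le[OF cI _ _ int]) (auto simp: I_def comp_ivls_disjoint)
   also have "\<dots> = (\<integral>\<^sup>+J. ennreal (norm (Tr k \<eta> (bJ J) z)) * indicator (- X J) z \<partial>count_space I)"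
   proof (rule nn_integral_cong)
    fix J' assume "J' \<in> space (count_space I)"
    then have z: "z \<notin> X J'" using False by (auto simp: Ob_def)
    have "(LBINT y:ivl J'. trunc k \<eta> (y - z) * b y) = Tr k \<eta> (bJ J') z"
     unfolding sub[symmetric] set_lebesgue_integral_def bJ_def by simp
    then show "ennreal (norm (LBINT y:ivl J'. trunc k \<eta> (y - z) * b y)) = ennreal (norm (Tr k \<eta> (bJ J') z)) * indicator (- X J') z"
     using z by simp
   qed
   finally show ?thesis using False by simp
  qed simp
  have "(\<integral>\<^sup>+z. ennreal (norm (Tr k \<eta> b z)) * indicator (- Ob) z \<partial>lborel)
    \<le> (\<integral>\<^sup>+z. \<integral>\<^sup>+J. ennreal (norm (Tr k \<eta> (bJ J) z)) * indicator (- X J) z \<partial>count_space I \<partial>lborel)"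
   by (intro nn_integral_mono pt)
  also have "\<dots> = (\<integral>\<^sup>+J. \<integral>\<^sup>+z. ennreal (norm (Tr k \<eta> (bJ J) z)) * indicator (- X J) z \<partial>lborel \<partial>count_space I)"
   using Tr_measurable[OF \<eta> bJ] by (intro nn_integral_count_space_nn_integral[OF cI]) simp
  also have "\<dots> \<le> (\<integral>\<^sup>+J. ennreal (C0 + B2) * emeasure (density lborel (\<lambda>y. ennreal (norm (b y)))) (ivl J) \<partial>count_space I)"
  proof (rule nn_integral_mono)
   fix J' assume "J' \<in> space (count_space I)"
   then have J': "J' \<in> I" by simp
   have "(\<integral>\<^sup>+z. ennreal (norm (Tr k \<eta> (bJ J') z)) * indicator (- X J') z \<partial>lborel)
     \<le> ennreal (C0 + B2) * (\<integral>\<^sup>+y. ennreal (norm (bJ J' y)) \<partial>lborel)"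
    unfolding X_def by (rule Tr_bad_part[OF \<eta> bJ J(1)[OF J'] _ mJ[OF J']]) (auto simp: bJ_def ivl_def)
   also have "(\<integral>\<^sup>+y. ennreal (norm (bJ J' y)) \<partial>lborel) = emeasure (density lborel (\<lambda>y. ennreal (norm (b y)))) (ivl J')"
    by (subst emeasure_density) (auto intro!: nn_integral_cong simp: bJ_def indicator_def)
   finally show "(\<integral>\<^sup>+z. ennreal (norm (Tr k \<eta> (bJ J') z)) * indicator (- X J') z \<partial>lborel)
     \<le> ennreal (C0 + B2) * emeasure (density lborel (\<lambda>y. ennreal (norm (b y)))) (ivl J')" .
  qed
  also have "\<dots> = ennreal (C0 + B2) * emeasure (density lborel (\<lambda>y. ennreal (norm (b y)))) \<Omega>"
   by (subst emeasure_comp_ivls[OF \<Omega>]) (auto simp: nn_integral_cmult I_def)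
  also have "\<dots> \<le> ennreal (C0 + B2) * (\<integral>\<^sup>+y. ennreal (norm (b y)) \<partial>lborel)"
   by (subst emeasure_density) (auto intro!: mult_left_mono nn_integral_mono simp: indicator_def)
  also have "\<dots> \<le> ennreal (C0 + B2) * ennreal (2 * G)" using L1b by (rule mult_left_mono) simp
  finally show ?thesis .
 qed
 have [measurable]: "Tr k \<eta> g0 \<in> borel_measurable borel" "Tr k \<eta> b \<in> borel_measurable borel"
  using Tr_measurable[OF \<eta>] g0 b by auto
 have split: "Tr k \<eta> g z = Tr k \<eta> g0 z + Tr k \<eta> b z" for z
 proof -
  have "Tr k \<eta> g z = (LBINT v. trunc k \<eta> v * g0 (z + v) + trunc k \<eta> v * b (z + v))"
   unfolding Tr_def by (intro Bochner_Integration.integral_cong refl) (simp add: b_def algebra_simps)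
  also have "\<dots> = Tr k \<eta> g0 z + Tr k \<eta> b z"
   unfolding Tr_def by (intro Bochner_Integration.integral_add integrable_bcs bcs_trunc_mult \<eta> g0 b)
  finally show ?thesis .
 qed
 define E1 where "E1 = {z. norm (Tr k \<eta> g0 z) > t / 2}"
 define E2 where "E2 = {z. norm (Tr k \<eta> b z) > t / 2} - Ob"
 have [measurable]: "E1 \<in> sets borel" "E2 \<in> sets borel" unfolding E1_def E2_def by measurable
 have mE1: "ennreal t * emeasure lborel E1 \<le> ennreal (8 * fourier_const\<^sup>2 * G)"
 proof -
  have "ennreal (t\<^sup>2 / 4) * emeasure lborel E1 = (\<integral>\<^sup>+z. ennreal (t\<^sup>2 / 4) * indicator E1 z \<partial>lborel)"
   by (simp add: nn_integral_cmult)
  also have "\<dots> \<le> (\<integral>\<^sup>+z. ennreal ((norm (Tr k \<eta> g0 z))\<^sup>2) \<partial>lborel)"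
  proof (rule nn_integral_mono)
   fix z
   show "ennreal (t\<^sup>2 / 4) * indicator E1 z \<le> ennreal ((norm (Tr k \<eta> g0 z))\<^sup>2)"
   proof (cases "z \<in> E1")
    case True
    then have "(t / 2)\<^sup>2 \<le> (norm (Tr k \<eta> g0 z))\<^sup>2" using t by (intro power_mono) (auto simp: E1_def)
    then show ?thesis using True by (auto simp: power_divide intro: ennreal_leI)
   qed simp
  qed
  also have "\<dots> \<le> ennreal (fourier_const\<^sup>2 * (LBINT x. (norm (g0 x))\<^sup>2))" by (rule Tr_L2[OF \<eta> g0])
  also have "\<dots> \<le> ennreal (fourier_const\<^sup>2 * (2 * t * G))" using L2g0 by (intro ennreal_leI mult_left_mono) auto
  finally have "ennreal (4 / t) * (ennreal (t\<^sup>2 / 4) * emeasure lborel E1) \<le> ennreal (4 / t) * ennreal (fourier_const\<^sup>2 * (2 * t * G))"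
   by (rule mult_left_mono) simp
  also have "ennreal (4 / t) * ennreal (fourier_const\<^sup>2 * (2 * t * G)) = ennreal (8 * fourier_const\<^sup>2 * G)"
   using t G0 by (subst ennreal_mult[symmetric]) auto
  also have "ennreal (4 / t) * (ennreal (t\<^sup>2 / 4) * emeasure lborel E1) = ennreal t * emeasure lborel E1"
   using t by (simp add: mult.assoc[symmetric] ennreal_mult[symmetric] power2_eq_square)
  finally show ?thesis .
 qed
 have mE2: "ennreal t * emeasure lborel E2 \<le> ennreal (4 * (C0 + B2) * G)"
 proof -
  have "ennreal (t / 2) * emeasure lborel E2 = (\<integral>\<^sup>+z. ennreal (t / 2) * indicator E2 z \<partial>lborel)"
   by (simp add: nn_integral_cmult)
  also have "\<dots> \<le> (\<integral>\<^sup>+z. ennreal (norm (Tr k \<eta> b z)) * indicator (- Ob) z \<partial>lborel)"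
   by (rule nn_integral_mono) (auto simp: E2_def indicator_def intro: ennreal_leI)
  also have "\<dots> \<le> ennreal (C0 + B2) * ennreal (2 * G)" by (rule Tb)
  finally have "ennreal 2 * (ennreal (t / 2) * emeasure lborel E2) \<le> ennreal 2 * (ennreal (C0 + B2) * ennreal (2 * G))"
   by (rule mult_left_mono) simp
  also have "ennreal 2 * (ennreal (C0 + B2) * ennreal (2 * G)) = ennreal (4 * (C0 + B2) * G)"
  proof -
   have "ennreal (C0 + B2) * ennreal (2 * G) = ennreal ((C0 + B2) * (2 * G))"
    using C0 B2_nonneg G0 by (subst ennreal_mult) auto
   also have "ennreal 2 * \<dots> = ennreal (2 * ((C0 + B2) * (2 * G)))"
    using C0 B2_nonneg G0 by (subst ennreal_mult) auto
   finally show ?thesis by (simp add: mult_ac)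
  qed
  also have "ennreal 2 * (ennreal (t / 2) * emeasure lborel E2) = ennreal t * emeasure lborel E2"
   using t by (simp add: mult.assoc[symmetric] ennreal_mult[symmetric] del: ennreal_numeral)
  finally show ?thesis .
 qed
 have "{z. norm (Tr k \<eta> g z) > t} \<subseteq> E1 \<union> (Ob \<union> E2)"
 proof
  fix z assume "z \<in> {z. norm (Tr k \<eta> g z) > t}"
  then have "norm (Tr k \<eta> g0 z) + norm (Tr k \<eta> b z) > t"
   using norm_triangle_ineq[of "Tr k \<eta> g0 z" "Tr k \<eta> b z"] by (simp add: split)
  then show "z \<in> E1 \<union> (Ob \<union> E2)" by (auto simp: E1_def E2_def)
 qed
 then have "emeasure lborel {z. norm (Tr k \<eta> g z) > t} \<le> emeasure lborel (E1 \<union> (Ob \<union> E2))"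
  by (rule emeasure_mono) simp
 also have "\<dots> \<le> emeasure lborel E1 + emeasure lborel (Ob \<union> E2)"
  by (rule emeasure_subadditive) auto
 also have "\<dots> \<le> emeasure lborel E1 + (emeasure lborel Ob + emeasure lborel E2)"
  by (intro add_left_mono emeasure_subadditive) auto
 finally have "ennreal t * emeasure lborel {z. norm (Tr k \<eta> g z) > t}
   \<le> ennreal t * (emeasure lborel E1 + (emeasure lborel Ob + emeasure lborel E2))"
  by (rule mult_left_mono) simp
 also have "\<dots> = ennreal t * emeasure lborel E1 + (ennreal t * emeasure lborel Ob + ennreal t * emeasure lborel E2)"
  by (simp add: distrib_left)
 also have "\<dots> \<le> ennreal (8 * fourier_const\<^sup>2 * G) + (ennreal ((\<kappa> + 1) * G) + ennreal (4 * (C0 + B2) * G))"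
  by (intro add_mono mE1 mOb mE2)
 also have "\<dots> = ennreal (weak_const * G)"
  using G0 kappa C0 B2_nonneg by (simp add: weak_const_def algebra_simps flip: ennreal_plus)
 finally show ?thesis by (simp add: G_def)
qed

end

section \<open>Tails of intervals\<close>

lemma borel_measurable_nn_integral_count:
 assumes "countable I" "\<And>i. i \<in> I \<Longrightarrow> f i \<in> borel_measurable M"
 shows "(\<lambda>x. \<integral>\<^sup>+i. f i x \<partial>count_space I) \<in> borel_measurable M"
proof -
 interpret sigma_finite_measure "count_space I" by (rule sigma_finite_measure_count_space_countable[OF assms(1)])
 have "(\<lambda>p. f (fst p) (snd p)) \<in> borel_measurable (count_space I \<Otimes>\<^sub>M M)"
  by (rule measurable_pair_measure_countable1[OF assms(1)]) (use assms in auto)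
 from measurable_compose[OF measurable_pair_swap' this]
 have "(\<lambda>(x, i). f i x) \<in> borel_measurable (M \<Otimes>\<^sub>M count_space I)"
  by (simp add: case_prod_beta')
 then show ?thesis by (rule borel_measurable_nn_integral)
qed

lemma nn_integral_powr_tail:
 assumes "c > 0" "q > 1"
 shows "(\<integral>\<^sup>+h. ennreal (h powr (-q)) * indicator {c..} h \<partial>lborel) = ennreal (c powr (1 - q) / (q - 1))"
proof -
 have "(\<integral>\<^sup>+h. ennreal (h powr (-q)) * indicator {c..} h \<partial>lborel) = ennreal (0 - c powr (1 - q) / (1 - q))"
 proof (rule nn_integral_FTC_atLeast)
  show "DERIV (\<lambda>h. h powr (1 - q) / (1 - q)) h :> h powr (-q)" if "c \<le> h" for h
   using that assms by (auto intro!: derivative_eq_intros)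
  have "((\<lambda>h. h powr (1 - q)) \<longlongrightarrow> 0) at_top"
   using assms by (intro tendsto_neg_powr filterlim_ident) auto
  then have "((\<lambda>h. h powr (1 - q) / (1 - q)) \<longlongrightarrow> 0 / (1 - q)) at_top"
   using assms by (intro tendsto_intros) auto
  then show "((\<lambda>h. h powr (1 - q) / (1 - q)) \<longlongrightarrow> 0) at_top" by simp
 qed auto
 also have "0 - c powr (1 - q) / (1 - q) = c powr (1 - q) / (q - 1)"
  by (metis diff_0 minus_diff_eq minus_divide_right)
 finally show ?thesis .
qed

text \<open>Among nonnegative families with given sum, the sum of the \<open>r\<close>-th powers is largest when a single
  term carries everything.\<close>
lemma sum_powr_le:
 assumes r: "r \<ge> 1" and S: "S \<ge> 0" and u: "\<And>i. i \<in> I \<Longrightarrow> u i \<ge> 0"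
  and le: "(\<integral>\<^sup>+i. ennreal (u i) \<partial>count_space I) \<le> ennreal S"
 shows "(\<integral>\<^sup>+i. ennreal (u i powr r) \<partial>count_space I) \<le> ennreal (S powr r)"
proof -
 have each: "u i \<le> S" if "i \<in> I" for i
 proof -
  have "ennreal (u i) = (\<integral>\<^sup>+j. ennreal (u i) * indicator {i} j \<partial>count_space I)"
   using that by (subst nn_integral_cmult_indicator) (auto simp: one_ennreal_def[symmetric])
  also have "\<dots> \<le> (\<integral>\<^sup>+j. ennreal (u j) \<partial>count_space I)" by (intro nn_integral_mono) (auto simp: indicator_def)
  also note le
  finally show ?thesis using S by (simp add: ennreal_le_iff)
 qed
 have "(\<integral>\<^sup>+i. ennreal (u i powr r) \<partial>count_space I) \<le> (\<integral>\<^sup>+i. ennreal (S powr (r - 1)) * ennreal (u i) \<partial>count_space I)"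
 proof (rule nn_integral_mono)
  fix i assume "i \<in> space (count_space I)"
  then have i: "i \<in> I" by simp
  have "u i powr r \<le> S powr (r - 1) * u i"
  proof (cases "u i = 0")
   case False
   then have "u i powr r = u i powr (r - 1) * u i" using u[OF i] by (simp add: powr_diff)
   also have "\<dots> \<le> S powr (r - 1) * u i" using r u[OF i] each[OF i] by (intro mult_right_mono powr_mono2) auto
   finally show ?thesis .
  qed simp
  then show "ennreal (u i powr r) \<le> ennreal (S powr (r - 1)) * ennreal (u i)"
   using u[OF i] by (simp add: ennreal_mult[symmetric] ennreal_leI)
 qed
 also have "\<dots> = ennreal (S powr (r - 1)) * (\<integral>\<^sup>+i. ennreal (u i) \<partial>count_space I)"
  by (rule nn_integral_cmult) simp
 also have "\<dots> \<le> ennreal (S powr (r - 1)) * ennreal S" by (rule mult_left_mono[OF le]) simp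
 also have "\<dots> = ennreal (S powr r)"
  using S by (cases "S = 0") (auto simp: ennreal_mult[symmetric] powr_diff)
 finally show ?thesis .
qed

lemma ennreal_le_suminf: "f n \<le> (\<Sum>n. f n :: ennreal)"
 using sum_le_suminf[of f "{n}"] by simp

lemma sum_halves_cut: "c > 0 \<Longrightarrow> (\<Sum>i<N. if c / 2 ^ i < 4 then c / 2 ^ i else 0) \<le> (if c < 4 then 2 * c else (8::real))"
proof (induction N arbitrary: c)
 case (Suc N)
 have "(\<Sum>i<Suc N. if c / 2 ^ i < 4 then c / 2 ^ i else 0)
   = (if c < 4 then c else 0) + (\<Sum>i<N. if (c / 2) / 2 ^ i < 4 then (c / 2) / 2 ^ i else 0)"
  by (subst sum.lessThan_Suc_shift) (simp cong: if_cong)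
 also have "\<dots> \<le> (if c < 4 then c else 0) + (if c / 2 < 4 then 2 * (c / 2) else 8)"
  using Suc by (intro add_left_mono Suc.IH) auto
 also have "\<dots> \<le> (if c < 4 then 2 * c else 8)" using Suc.prems by auto
 finally show ?case .
qed auto

text \<open>The function \<open>M\<^sup>+ \<chi>\<close> for the indicator \<open>\<chi>\<close> of the interval from \<open>a\<close> to \<open>b\<close>.\<close>
definition ivl_max :: "real \<Rightarrow> real \<Rightarrow> real \<Rightarrow> real" where
 "ivl_max a b x = (if x \<le> a then (b - a) / (b - x) else if x < b then 1 else 0)"

lemma ivl_max_measurable [measurable]: "ivl_max a b \<in> borel_measurable borel"
 unfolding ivl_max_def[abs_def] by measurable

text \<open>These points cut the interval into pieces of which each is twice as long as the next, so that three
  consecutive ones satisfy the hypothesis on the lengths in the condition \<open>C\<^sup>+\<^sub>r\<close>.\<close>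
definition halving :: "real \<Rightarrow> real \<Rightarrow> nat \<Rightarrow> real" where "halving a b i = b - (b - a) / 2 ^ i"

lemma halving_0 [simp]: "halving a b 0 = a" by (simp add: halving_def)
lemma halving_diff: "halving a b (Suc i) - halving a b i = (b - a) / 2 ^ i / 2" by (simp add: halving_def)
lemma halving_bounds: "a < b \<Longrightarrow> halving a b i < halving a b (Suc i)" "a < b \<Longrightarrow> halving a b i < b" "a < b \<Longrightarrow> a \<le> halving a b i"
proof -
 assume ab: "a < b"
 have "(b - a) / 2 ^ i \<le> (b - a) / 1" using ab by (intro divide_left_mono) auto
 then show "a \<le> halving a b i" by (simp add: halving_def)
qed (auto simp: halving_def field_simps)

lemma halving_cover:
 assumes "a < b" "a \<le> x" "x < b" shows "\<exists>i. halving a b i \<le> x \<and> x < halving a b (Suc i)"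
proof -
 obtain n where n: "inverse (2::real) ^ n < (b - x) / (b - a)"
  using real_arch_pow_inv[of "(b - x) / (b - a)" "inverse 2"] assms by auto
 then have "(b - a) / 2 ^ n < b - x" using assms by (simp add: field_simps)
 then have ex: "\<exists>i. x < halving a b i" by (intro exI[of _ n]) (simp add: halving_def)
 define m where "m = (LEAST i. x < halving a b i)"
 have m: "x < halving a b m" unfolding m_def using ex by (rule LeastI_ex)
 then obtain j where j: "m = Suc j" using assms by (cases m) auto
 then have "\<not> x < halving a b j" using not_less_Least[of j "\<lambda>i. x < halving a b i"] by (simp add: m_def)
 then show ?thesis using m j by (auto simp: not_less)
qed

text \<open>At a point at distance \<open>d\<close> from \<open>b\<close> the terms with pieces longer than a multiple of \<open>d\<close> vanish, and
  the others decay geometrically.\<close>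
lemma ivl_max_halving_le:
 assumes ab: "a < b" and r: "r \<ge> 1"
 shows "(\<Sum>i<N. ivl_max (halving a b i) (halving a b (Suc (Suc i))) x powr r) \<le> 8 * ivl_max a b x powr r"
proof (cases "x < b")
 case False
 have "ivl_max (halving a b i) (halving a b (Suc (Suc i))) x = 0" for i
  using False halving_bounds(2)[OF ab, of i] halving_bounds(2)[OF ab, of "Suc (Suc i)"] by (auto simp: ivl_max_def)
 then show ?thesis by simp
next
 case True
 define d where "d = b - x" define l where "l = b - a"
 have d: "d > 0" and l: "l > 0" using True ab by (auto simp: d_def l_def)
 define u where "u i = (l / d) / 2 ^ i" for i
 have u0: "u i > 0" for i using d l by (simp add: u_def)
 have val: "ivl_max (halving a b i) (halving a b (Suc (Suc i))) x \<le> (if u i < 4 then u i else 0)"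
    "ivl_max (halving a b i) (halving a b (Suc (Suc i))) x \<le> 1" "ivl_max (halving a b i) (halving a b (Suc (Suc i))) x \<ge> 0" for i
 proof -
  have lu: "l / 2 ^ i = u i * d" using d by (simp add: u_def)
  have zi: "halving a b i = b - u i * d" "halving a b (Suc (Suc i)) = b - u i * d / 4"
   using lu by (auto simp: halving_def l_def[symmetric] field_simps)
  have xi: "x = b - d" by (simp add: d_def)
  consider "u i \<le> 1" | "1 < u i" "u i < 4" | "u i \<ge> 4" by linarith
  then have "ivl_max (halving a b i) (halving a b (Suc (Suc i))) x \<le> (if u i < 4 then u i else 0) \<and>
    ivl_max (halving a b i) (halving a b (Suc (Suc i))) x \<le> 1 \<and> ivl_max (halving a b i) (halving a b (Suc (Suc i))) x \<ge> 0"
  proof cases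
   case 1
   then have xl: "x \<le> halving a b i" using d unfolding zi xi by (simp add: mult_left_le)
   then have "ivl_max (halving a b i) (halving a b (Suc (Suc i))) x = (3 / 4 * (u i * d)) / (d - u i * d / 4)"
    unfolding ivl_max_def by (simp add: zi xi)
   also have "\<dots> = (3 / 4 * u i) / (1 - u i / 4)" using d 1 by (simp add: field_simps)
   finally have eq: "ivl_max (halving a b i) (halving a b (Suc (Suc i))) x = (3 / 4 * u i) / (1 - u i / 4)" .
   have "(3 / 4 * u i) / (1 - u i / 4) \<le> (3 / 4 * u i) / (3 / 4)"
    using 1 u0[of i] by (intro divide_left_mono) auto
   then show ?thesis unfolding eq using 1 u0[of i] by (auto simp: divide_le_eq)
  next
   case 2
   then have "\<not> x \<le> halving a b i" "x < halving a b (Suc (Suc i))" using d unfolding zi xi by auto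
   then show ?thesis using 2 by (simp add: ivl_max_def)
  next
   case 3
   then have "\<not> x < halving a b (Suc (Suc i))" "\<not> x \<le> halving a b i" using d u0[of i] unfolding zi xi by (auto simp: not_less)
   then show ?thesis using 3 by (simp add: ivl_max_def)
  qed
  then show "ivl_max (halving a b i) (halving a b (Suc (Suc i))) x \<le> (if u i < 4 then u i else 0)"
    "ivl_max (halving a b i) (halving a b (Suc (Suc i))) x \<le> 1" "ivl_max (halving a b i) (halving a b (Suc (Suc i))) x \<ge> 0" by auto
 qed
 show ?thesis
 proof (cases "x \<le> a")
  case xa: True
  define m where "m = l / d"
  have m: "0 < m" "m \<le> 1" using d l xa by (auto simp: m_def d_def l_def)
  have ivl_max: "ivl_max a b x = m" using xa by (simp add: ivl_max_def m_def l_def d_def)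
  have "(\<Sum>i<N. ivl_max (halving a b i) (halving a b (Suc (Suc i))) x powr r) \<le> (\<Sum>i<N. m powr r * (if 1 / 2 ^ i < (4::real) then 1 / 2 ^ i else 0))"
  proof (rule sum_mono)
   fix i
   have "ivl_max (halving a b i) (halving a b (Suc (Suc i))) x \<le> u i" using val(1)[of i] u0[of i] by (auto split: if_splits)
   then have "ivl_max (halving a b i) (halving a b (Suc (Suc i))) x powr r \<le> u i powr r"
    using val(3) r by (intro powr_mono2) auto
   also have "u i powr r = m powr r * (1 / 2 ^ i) powr r" using m by (simp add: u_def m_def powr_mult[symmetric])
   also have "(1 / 2 ^ i :: real) powr r \<le> (1 / 2 ^ i) powr 1" using r by (intro powr_mono') auto
   also have "\<dots> = (if 1 / 2 ^ i < (4::real) then 1 / 2 ^ i else 0)"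
   proof -
    have "1 / 2 ^ i \<le> (1::real)" by simp
    then have "1 / 2 ^ i < (4::real)" by linarith
    then show ?thesis by simp
   qed
   finally show "ivl_max (halving a b i) (halving a b (Suc (Suc i))) x powr r \<le> m powr r * (if 1 / 2 ^ i < (4::real) then 1 / 2 ^ i else 0)"
    by (simp add: mult_left_mono)
  qed
  also have "\<dots> = m powr r * (\<Sum>i<N. if 1 / 2 ^ i < (4::real) then 1 / 2 ^ i else 0)" by (simp add: sum_distrib_left)
  also have "\<dots> \<le> m powr r * 8" using sum_halves_cut[of 1 N] by (intro mult_left_mono) auto
  finally show ?thesis by (simp add: ivl_max mult.commute)
 next
  case False
  then have ivl_max: "ivl_max a b x = 1" using True by (simp add: ivl_max_def)
  have "(\<Sum>i<N. ivl_max (halving a b i) (halving a b (Suc (Suc i))) x powr r) \<le> (\<Sum>i<N. if (l / d) / 2 ^ i < 4 then (l / d) / 2 ^ i else 0)"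
  proof (rule sum_mono)
   fix i
   have "ivl_max (halving a b i) (halving a b (Suc (Suc i))) x powr r \<le> ivl_max (halving a b i) (halving a b (Suc (Suc i))) x powr 1"
    using val(2,3)[of i] r by (intro powr_mono') auto
   also have "\<dots> \<le> (if u i < 4 then u i else 0)" using val(1,3)[of i] by simp
   finally show "ivl_max (halving a b i) (halving a b (Suc (Suc i))) x powr r \<le> (if (l / d) / 2 ^ i < 4 then (l / d) / 2 ^ i else 0)"
    by (simp only: u_def)
  qed
  also have "\<dots> \<le> (if l / d < 4 then 2 * (l / d) else 8)" using d l by (intro sum_halves_cut) auto
  also have "\<dots> \<le> 8" by auto
  finally show ?thesis by (simp add: ivl_max)
 qed
qed

text \<open>The integral on the right-hand side of the condition \<open>C\<^sup>+\<^sub>r\<close>.\<close>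
definition ivl_mass :: "real measure \<Rightarrow> real \<Rightarrow> real \<Rightarrow> real \<Rightarrow> ennreal" where
 "ivl_mass \<mu> r a b = (\<integral>\<^sup>+x. ennreal (ivl_max a b x powr r) \<partial>\<mu>)"

text \<open>The length of the part of the interval to the left of \<open>v\<close>.\<close>
definition len :: "real \<Rightarrow> real \<Rightarrow> real \<Rightarrow> real" where "len a b v = max 0 (min v b - a)"

text \<open>A substitute, to the left of the interval \<open>J\<close>, for the \<open>r\<close>-th power of \<open>M\<^sup>+\<close> of its indicator. It
  depends on \<open>J\<close> only through the lengths of its initial pieces. Hence tails of several intervals
  inside \<open>J\<close> can be compared with the tail of \<open>J\<close> by comparing these lengths for each \<open>h\<close>.\<close>
definition ivl_tail :: "real \<Rightarrow> real \<times> real \<Rightarrow> real \<Rightarrow> ennreal" where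
 "ivl_tail r J x = (if x \<le> fst J then
   \<integral>\<^sup>+h. ennreal (len (fst J) (snd J) (x + h) powr r * h powr (- r - 1)) \<partial>lborel else 0)"

lemma ivl_tail_measurable [measurable]: "ivl_tail r J \<in> borel_measurable borel"
 unfolding ivl_tail_def[abs_def] len_def by measurable

lemma ivl_max_le_tail:
 assumes "fst J < snd J" "x \<le> fst J" "r > 1"
 shows "ennreal (ivl_max (fst J) (snd J) x powr r) \<le> ennreal r * ivl_tail r J x"
proof -
 define a b where "a = fst J" and "b = snd J"
 have ab: "a < b" "x \<le> a" using assms by (auto simp: a_def b_def)
 have "ennreal ((b - a) powr r) * ennreal ((b - x) powr (1 - (r + 1)) / ((r + 1) - 1))
   = ennreal ((b - a) powr r) * (\<integral>\<^sup>+h. ennreal (h powr (- (r + 1))) * indicator {b - x..} h \<partial>lborel)"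
  using ab assms(3) by (subst nn_integral_powr_tail) auto
 also have "\<dots> = (\<integral>\<^sup>+h. ennreal ((b - a) powr r) * (ennreal (h powr (- (r + 1))) * indicator {b - x..} h) \<partial>lborel)"
  by (rule nn_integral_cmult[symmetric]) measurable
 also have "\<dots> \<le> (\<integral>\<^sup>+h. ennreal (len a b (x + h) powr r * h powr (- r - 1)) \<partial>lborel)"
  using ab by (intro nn_integral_mono) (auto simp: indicator_def len_def ennreal_mult minus_diff_commute[of 1 r])
 also have "\<dots> = ivl_tail r J x" using assms by (simp add: ivl_tail_def a_def b_def)
 finally have le: "ennreal ((b - a) powr r) * ennreal ((b - x) powr (1 - (r + 1)) / ((r + 1) - 1)) \<le> ivl_tail r J x" .
 have "ennreal (ivl_max a b x powr r) = ennreal r * (ennreal ((b - a) powr r) * ennreal ((b - x) powr (1 - (r + 1)) / ((r + 1) - 1)))"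
  using ab assms(3) by (simp add: ennreal_mult[symmetric] ivl_max_def powr_divide powr_minus field_simps)
 also have "\<dots> \<le> ennreal r * ivl_tail r J x" by (rule mult_left_mono[OF le]) simp
 finally show ?thesis by (simp add: a_def b_def)
qed

text \<open>The key comparison. If the intervals fill at most the proportion \<open>\<eta>\<close> of every initial piece of
  \<open>J'\<close>, then for each \<open>h\<close> the sum of the \<open>r\<close>-th powers of their lengths is at most the \<open>r\<close>-th power of
  the sum. Thus the tails gain \<open>\<eta> powr r\<close>, and not only \<open>\<eta>\<close>.\<close>
lemma ivl_tail_sum_le:
 assumes I: "countable I" and r: "r \<ge> 1" and \<eta>: "\<eta> \<ge> 0" and x: "x \<le> fst J'"
  and fill: "\<And>v. v > fst J' \<Longrightarrow> (\<integral>\<^sup>+J. ennreal (len (fst J) (snd J) v) \<partial>count_space I) \<le> ennreal (\<eta> * len (fst J') (snd J') v)"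
  and right: "\<And>J. J \<in> I \<Longrightarrow> fst J' \<le> fst J"
 shows "(\<integral>\<^sup>+J. ivl_tail r J x \<partial>count_space I) \<le> ennreal (\<eta> powr r) * ivl_tail r J' x"
proof -
 have "(\<integral>\<^sup>+J. ivl_tail r J x \<partial>count_space I)
   = (\<integral>\<^sup>+J. \<integral>\<^sup>+h. ennreal (len (fst J) (snd J) (x + h) powr r * h powr (- r - 1)) \<partial>lborel \<partial>count_space I)"
  using x right by (intro nn_integral_cong) (force simp: ivl_tail_def)
 also have "\<dots> = (\<integral>\<^sup>+h. \<integral>\<^sup>+J. ennreal (len (fst J) (snd J) (x + h) powr r * h powr (- r - 1)) \<partial>count_space I \<partial>lborel)"
  by (rule nn_integral_count_space_nn_integral[OF I, symmetric]) (simp add: len_def)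
 also have "\<dots> \<le> (\<integral>\<^sup>+h. ennreal (\<eta> powr r) * ennreal (len (fst J') (snd J') (x + h) powr r * h powr (- r - 1)) \<partial>lborel)"
 proof (rule nn_integral_mono)
  fix h
  let ?u = "\<lambda>J. len (fst J) (snd J) (x + h)"
  show "(\<integral>\<^sup>+J. ennreal (?u J powr r * h powr (- r - 1)) \<partial>count_space I)
    \<le> ennreal (\<eta> powr r) * ennreal (len (fst J') (snd J') (x + h) powr r * h powr (- r - 1))"
  proof (cases "x + h > fst J'")
   case True
   have "(\<integral>\<^sup>+J. ennreal (?u J powr r) \<partial>count_space I) \<le> ennreal ((\<eta> * len (fst J') (snd J') (x + h)) powr r)"
    by (rule sum_powr_le[OF r _ _ fill[OF True]]) (auto simp: len_def \<eta>)
   then have "ennreal (h powr (- r - 1)) * (\<integral>\<^sup>+J. ennreal (?u J powr r) \<partial>count_space I)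
     \<le> ennreal (h powr (- r - 1)) * ennreal ((\<eta> * len (fst J') (snd J') (x + h)) powr r)"
    by (rule mult_left_mono) simp
   also have "\<dots> = ennreal (\<eta> powr r) * ennreal (len (fst J') (snd J') (x + h) powr r * h powr (- r - 1))"
    using \<eta> by (simp add: ennreal_mult[symmetric] powr_mult len_def mult_ac)
   also have "ennreal (h powr (- r - 1)) * (\<integral>\<^sup>+J. ennreal (?u J powr r) \<partial>count_space I)
     = (\<integral>\<^sup>+J. ennreal (?u J powr r * h powr (- r - 1)) \<partial>count_space I)"
    by (subst nn_integral_cmult[symmetric]) (auto simp: ennreal_mult mult.commute)
   finally show ?thesis .
  next
   case False
   have "(\<integral>\<^sup>+J. ennreal (?u J powr r * h powr (- r - 1)) \<partial>count_space I) = (\<integral>\<^sup>+J. 0 \<partial>count_space I)"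
   proof (rule nn_integral_cong)
    fix J assume "J \<in> space (count_space I)"
    then have "fst J' \<le> fst J" using right by simp
    then have "?u J = 0" using False by (simp add: len_def)
    then show "ennreal (?u J powr r * h powr (- r - 1)) = 0" by simp
   qed
   then show ?thesis by simp
  qed
 qed
 also have "\<dots> = ennreal (\<eta> powr r) * ivl_tail r J' x"
  unfolding ivl_tail_def using x by (subst nn_integral_cmult) (auto simp: len_def)
 finally show ?thesis .
qed

text \<open>Away from the interval the tail is comparable to the maximal function of an enlarged interval;
  the enlargement is needed because the tail is unbounded near the left endpoint.\<close>
lemma ivl_tail_le_max:
 assumes r: "r > 1" and ab: "a < b" and x: "x \<le> a - (b - a)"
 shows "ivl_tail r (a, b) x \<le> ennreal (ivl_max (a - (b - a)) b x powr r)"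
proof -
 have ax: "a - x > 0" using ab x by simp
 have "ivl_tail r (a, b) x = (\<integral>\<^sup>+h. ennreal (len a b (x + h) powr r * h powr (- r - 1)) \<partial>lborel)"
  using ax by (simp add: ivl_tail_def)
 also have "\<dots> \<le> (\<integral>\<^sup>+h. ennreal ((b - a) powr r) * (ennreal (h powr (- (r + 1))) * indicator {a - x..} h) \<partial>lborel)"
 proof (rule nn_integral_mono)
  fix h
  show "ennreal (len a b (x + h) powr r * h powr (- r - 1)) \<le> ennreal ((b - a) powr r) * (ennreal (h powr (- (r + 1))) * indicator {a - x..} h)"
  proof (cases "h \<ge> a - x")
   case True
   have "len a b (x + h) powr r \<le> (b - a) powr r" using ab r by (intro powr_mono2) (auto simp: len_def)
   then have "len a b (x + h) powr r * h powr (- r - 1) \<le> (b - a) powr r * h powr (- r - 1)" by (rule mult_right_mono) simp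
   then have "ennreal (len a b (x + h) powr r * h powr (- r - 1)) \<le> ennreal ((b - a) powr r * h powr (- r - 1))" by (rule ennreal_leI)
   also have "\<dots> = ennreal ((b - a) powr r) * (ennreal (h powr (- (r + 1))) * indicator {a - x..} h)"
    using True by (simp add: ennreal_mult)
   finally show ?thesis .
  next
   case False
   then have "len a b (x + h) = 0" by (simp add: len_def)
   then show ?thesis by simp
  qed
 qed
 also have "\<dots> = ennreal ((b - a) powr r) * ennreal ((a - x) powr (1 - (r + 1)) / ((r + 1) - 1))"
  using ax r by (subst nn_integral_cmult) (auto simp: nn_integral_powr_tail[of _ "r + 1", simplified])
 also have "\<dots> = ennreal (((b - a) / (a - x)) powr r / r)"
  using ax ab r by (simp add: ennreal_mult[symmetric] powr_divide powr_minus field_simps)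
 also have "\<dots> \<le> ennreal (ivl_max (a - (b - a)) b x powr r)"
 proof (rule ennreal_leI)
  have "((b - a) / (a - x)) powr r / r \<le> ((b - a) / (a - x)) powr r / 1"
   using r by (intro divide_left_mono) auto
  also have "(b - a) / (a - x) \<le> ivl_max (a - (b - a)) b x"
  proof -
   have "(b - a) / (a - x) = (2 * (b - a)) / (2 * (a - x))"
    by (rule mult_divide_mult_cancel_left[symmetric]) simp
   also have "\<dots> \<le> (2 * (b - a)) / (b - x)" using x ax ab by (intro divide_left_mono) auto
   also have "\<dots> = ivl_max (a - (b - a)) b x" using x by (simp add: ivl_max_def)
   finally show ?thesis .
  qed
  then have "((b - a) / (a - x)) powr r / 1 \<le> ivl_max (a - (b - a)) b x powr r"
   using ax ab r by (auto intro!: powr_mono2)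
  finally show "((b - a) / (a - x)) powr r / r \<le> ivl_max (a - (b - a)) b x powr r" .
 qed
 finally show ?thesis .
qed

section \<open>The left maximal function of a set\<close>

text \<open>The maximal function of the indicator of \<open>E\<close> that looks to the left. It is dual to the tails,
  which look to the right.\<close>
definition left_max :: "real set \<Rightarrow> real \<Rightarrow> ennreal" where
 "left_max E y = (SUP \<tau>\<in>{0<..}. emeasure lborel (E \<inter> {y-\<tau>..y}) / ennreal \<tau>)"

lemma ennreal_div_mult: "\<tau> > 0 \<Longrightarrow> x / ennreal \<tau> * ennreal \<tau> = x"
 by (metis ennreal_times_divide mult.commute mult_divide_eq_ennreal ennreal_eq_0_iff ennreal_neq_top infinity_ennreal_def not_le)

lemma left_max_upper: assumes "\<tau> > 0" shows "emeasure lborel (E \<inter> {y-\<tau>..y}) \<le> left_max E y * ennreal \<tau>"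
proof -
 have "emeasure lborel (E \<inter> {y-\<tau>..y}) = emeasure lborel (E \<inter> {y-\<tau>..y}) / ennreal \<tau> * ennreal \<tau>"
  using assms by (simp add: ennreal_div_mult)
 also have "\<dots> \<le> left_max E y * ennreal \<tau>"
  unfolding left_max_def using assms by (intro mult_right_mono SUP_upper) auto
 finally show ?thesis .
qed

lemma left_max_le_1: assumes "E \<in> sets borel" shows "left_max E y \<le> 1"
 unfolding left_max_def
proof (rule SUP_least)
 fix \<tau> :: real assume "\<tau> \<in> {0<..}"
 then have t: "\<tau> > 0" by simp
 have "emeasure lborel (E \<inter> {y-\<tau>..y}) \<le> emeasure lborel {y-\<tau>..y}" by (rule emeasure_mono) auto
 also have "\<dots> = ennreal \<tau>" using t by simp
 finally have "emeasure lborel (E \<inter> {y-\<tau>..y}) / ennreal \<tau> \<le> ennreal \<tau> / ennreal \<tau>" by (rule divide_right_mono_ennreal)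
 also have "\<dots> = 1" using t by (simp add: divide_ennreal)
 finally show "emeasure lborel (E \<inter> {y-\<tau>..y}) / ennreal \<tau> \<le> 1" .
qed

lemma emeasure_uminus_vimage:
 assumes "S \<in> sets borel" shows "emeasure lborel (uminus -` S) = emeasure lborel (S :: real set)"
proof -
 have "emeasure lborel S = emeasure (distr lborel borel uminus) S" by (simp add: lborel_distr_uminus)
 also have "\<dots> = emeasure lborel (uminus -` S)" using assms by (subst emeasure_distr) auto
 finally show ?thesis ..
qed

text \<open>A reflection turns these level sets into rising sets.\<close>
lemma left_max_level:
 assumes E [measurable]: "E \<in> sets borel" and R: "E \<subseteq> {-R..R}" and c: "c > 0"
 shows "open {y. left_max E y > ennreal c}" (is ?op)
  and "ennreal c * emeasure lborel {y. left_max E y > ennreal c} \<le> emeasure lborel E" (is ?me)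
proof -
 define F where "F = uminus -` E"
 have F [measurable]: "F \<in> sets borel" unfolding F_def using measurable_sets[OF borel_measurable_uminus[OF measurable_ident] E] by simp
 have FR: "F \<subseteq> {-R..R}" using R by (force simp: F_def)
 have iF: "integrable lborel (\<lambda>x. indicator F x :: real)"
 proof (rule integrable_real_indicator)
  have "emeasure lborel F \<le> emeasure lborel {-R..R}" by (rule emeasure_mono[OF FR]) simp
  then show "emeasure lborel F < \<infinity>" by (rule order_le_less_trans) (simp add: emeasure_lborel_Icc_eq)
 qed simp
 have z: "indicator F x = (0::real)" if "\<bar>x\<bar> > R" for x using FR that by (force simp: indicator_def)
 define O' where "O' = rising_set (indicator F) c"
 have O': "open O'" "ennreal c * emeasure lborel O' \<le> (\<integral>\<^sup>+x. ennreal (indicator F x) \<partial>lborel)"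
  unfolding O'_def using open_rising_set[OF iF _ z c] rising_set_measure[OF iF _ z c] by auto
 have eq: "emeasure lborel (E \<inter> {y-\<tau>..y}) = ennreal (LBINT u:{-y..-y+\<tau>}. indicator F u)" for y \<tau>
 proof -
  have "E \<inter> {y-\<tau>..y} = uminus -` (F \<inter> {-y..-y+\<tau>})" by (auto simp: F_def)
  then have "emeasure lborel (E \<inter> {y-\<tau>..y}) = emeasure lborel (F \<inter> {-y..-y+\<tau>})"
   by (simp only: emeasure_uminus_vimage[OF sets.Int[OF F]] atLeastAtMost_borel)
  also have "\<dots> = (\<integral>\<^sup>+u. indicator (F \<inter> {-y..-y+\<tau>}) u \<partial>lborel)" by (rule nn_integral_indicator[symmetric]) simp
  also have "\<dots> = (\<integral>\<^sup>+u. ennreal (indicator {-y..-y+\<tau>} u *\<^sub>R indicator F u) \<partial>lborel)"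
   by (intro nn_integral_cong) (auto simp: indicator_def)
  also have "\<dots> = ennreal (LBINT u:{-y..-y+\<tau>}. indicator F u)"
   using integrable_set_integrable[OF iF, of "{-y..-y+\<tau>}"] unfolding set_lebesgue_integral_def set_integrable_def
   by (intro nn_integral_eq_integral) auto
  finally show ?thesis .
 qed
 have nn: "0 \<le> (LBINT u:{-y..-y+\<tau>}. indicator F u :: real)" for y \<tau>
  unfolding set_lebesgue_integral_def by (intro Bochner_Integration.integral_nonneg) auto
 have lev: "left_max E y > ennreal c \<longleftrightarrow> - y \<in> O'" for y
 proof -
  have "ennreal c < emeasure lborel (E \<inter> {y-\<tau>..y}) / ennreal \<tau> \<longleftrightarrow> c * \<tau> < (LBINT u:{-y..-y+\<tau>}. indicator F u)" if "\<tau> > 0" for \<tau>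
   unfolding eq using that nn[of y \<tau>] c by (simp add: divide_ennreal ennreal_less_iff pos_less_divide_eq)
  then show ?thesis unfolding left_max_def less_SUP_iff O'_def rising_set_def by auto
 qed
 have s: "{y. left_max E y > ennreal c} = uminus -` O'" using lev by auto
 show ?op unfolding s using O'(1) by (intro open_vimage continuous_intros) auto
 have "ennreal c * emeasure lborel {y. left_max E y > ennreal c} = ennreal c * emeasure lborel O'"
  unfolding s using O'(1) by (simp add: emeasure_uminus_vimage)
 also have "\<dots> \<le> emeasure lborel F" using O'(2) by (simp add: ennreal_indicator)
 also have "\<dots> = emeasure lborel E" unfolding F_def by (rule emeasure_uminus_vimage) simp
 finally show ?me .
qed

lemma left_max_measurable:
 assumes E: "E \<in> sets borel" and R: "E \<subseteq> {-R..R}" shows "left_max E \<in> borel_measurable borel"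
proof (rule borel_measurableI_greater)
 fix c
 show "{y \<in> space borel. c < left_max E y} \<in> sets borel"
 proof (cases "c = 0")
  case True
  have "{y \<in> space borel. c < left_max E y} = (\<Union>n. {y. left_max E y > ennreal (inverse (real (Suc n)))})"
  proof (rule set_eqI, rule iffI)
   fix y assume "y \<in> {y \<in> space borel. c < left_max E y}"
   then have "left_max E y > 0" using True by simp
   then obtain e where e: "0 < e" "e < left_max E y" using dense by blast
   then have "e \<noteq> top" by (metis not_top_less)
   then obtain e' where e': "e = ennreal e'" "e' > 0" using e by (cases e) auto
   obtain n where "inverse (real (Suc n)) < e'" using reals_Archimedean[OF e'(2)] by auto
   then have "ennreal (inverse (real (Suc n))) < ennreal e'" by (intro ennreal_lessI e'(2))
   also have "\<dots> < left_max E y" using e e' by simp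
   finally show "y \<in> (\<Union>n. {y. left_max E y > ennreal (inverse (real (Suc n)))})" by blast
  qed (use True in \<open>auto intro: le_less_trans[OF zero_le]\<close>)
  also have "\<dots> \<in> sets borel"
   using left_max_level(1)[OF E R, of "inverse (real (Suc _))"] by (intro sets.countable_UN) auto
  finally show ?thesis .
 next
  case False
  show ?thesis
  proof (cases c)
   case (real c')
   then have "c' > 0" using False by (auto simp: less_le)
   then show ?thesis using left_max_level(1)[OF E R, of c'] real by simp
  next
   case top
   then show ?thesis by simp
  qed
 qed
qed

text \<open>Kolmogorov's inequality. Besides the weak type, the level sets have at most the measure of the
  interval; the minimum of the two bounds is at most their geometric mean with weights \<open>\<theta>\<close> and
  \<open>1 - \<theta>\<close>, which is summable over dyadic levels.\<close>
lemma integral_left_max: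
 assumes E [measurable]: "E \<in> sets borel" and R: "E \<subseteq> {-R..R}" and \<theta>: "0 < \<theta>" "\<theta> < 1" and zb: "z < b"
  and e: "emeasure lborel E = ennreal e" "e \<ge> 0"
 shows "(\<integral>\<^sup>+y. left_max E y * indicator {z<..<b} y \<partial>lborel)
  \<le> ennreal ((2 powr \<theta> / (1 - 2 powr (\<theta> - 1))) * ((b - z) powr (1 - \<theta>) * e powr \<theta>))"
proof -
 define L where "L n = {y. left_max E y > ennreal (1 / 2 ^ Suc n)} \<inter> {z<..<b}" for n :: nat
 have Lm [measurable]: "L n \<in> sets borel" for n
  using left_max_level(1)[OF E R, of "1 / 2 ^ Suc n"] by (auto simp: L_def)
 define q where "q = (2::real) powr (\<theta> - 1)"
 have "2 powr (\<theta> - 1) < (2::real) powr 0" using \<theta> by (intro powr_less_mono) auto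
 then have q: "0 < q" "q < 1" by (auto simp: q_def)
 define D where "D = (b - z) powr (1 - \<theta>) * e powr \<theta>"
 have D: "D \<ge> 0" using e by (simp add: D_def)
 have pt: "left_max E y * indicator {z<..<b} y \<le> (\<Sum>n. ennreal (1 / 2 ^ n) * indicator (L n) y)" for y
 proof (cases "left_max E y = 0 \<or> y \<notin> {z<..<b}")
  case False
  then obtain m where m: "left_max E y = ennreal m" "0 < m" "m \<le> 1"
   using left_max_le_1[OF E, of y] by (cases "left_max E y") (auto simp: less_le top_unique)
  obtain n0 where "(1/2::real) ^ n0 < m" using real_arch_pow_inv[of m "1/2"] m by auto
  then have ex: "\<exists>n. 1 / 2 ^ Suc n < m"
  proof (intro exI[of _ n0])
   have "1 / 2 ^ Suc n0 \<le> (1 / 2 :: real) ^ n0" by (simp add: power_divide field_simps)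
   then show "1 / 2 ^ Suc n0 < m" using \<open>(1/2::real) ^ n0 < m\<close> by linarith
  qed
  define n where "n = (LEAST n. 1 / 2 ^ Suc n < m)"
  have n1: "1 / 2 ^ Suc n < m" unfolding n_def using ex by (rule LeastI_ex)
  have n2: "m \<le> 1 / 2 ^ n"
  proof (cases n)
   case (Suc k)
   then show ?thesis using not_less_Least[of k "\<lambda>n. 1 / 2 ^ Suc n < m"] by (simp add: n_def)
  qed (use m in simp)
  have "y \<in> L n" using n1 m False by (auto simp: L_def ennreal_less_iff simp del: power_Suc)
  then have "left_max E y * indicator {z<..<b} y \<le> ennreal (1 / 2 ^ n) * indicator (L n) y"
   using n2 m False by (auto intro: ennreal_leI)
  also have "\<dots> \<le> (\<Sum>n. ennreal (1 / 2 ^ n) * indicator (L n) y)" by (rule ennreal_le_suminf)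
  finally show ?thesis .
 qed auto
 have Ln: "ennreal (1 / 2 ^ n) * emeasure lborel (L n) \<le> ennreal (2 powr \<theta> * D * q ^ n)" for n
 proof -
  have "emeasure lborel (L n) \<le> emeasure lborel {z<..<b}" by (rule emeasure_mono) (auto simp: L_def)
  then have l1: "emeasure lborel (L n) \<le> ennreal (b - z)" using zb by simp
  then have "emeasure lborel (L n) < top" by (rule order_le_less_trans) simp
  then obtain l where l: "emeasure lborel (L n) = ennreal l" "l \<ge> 0" by (cases "emeasure lborel (L n)") auto
  have lb: "l \<le> b - z" using l1 l zb by (simp add: ennreal_le_iff)
  have "ennreal (1 / 2 ^ Suc n) * emeasure lborel (L n) \<le> ennreal (1 / 2 ^ Suc n) * emeasure lborel {y. left_max E y > ennreal (1 / 2 ^ Suc n)}"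
   using left_max_level(1)[OF E R, of "1 / 2 ^ Suc n"] by (intro mult_left_mono emeasure_mono) (auto simp: L_def)
  also have "\<dots> \<le> ennreal e" unfolding e(1)[symmetric] by (rule left_max_level(2)[OF E R]) simp
  finally have "ennreal (1 / 2 ^ Suc n * l) \<le> ennreal e"
   unfolding l(1) using l(2) by (subst ennreal_mult) auto
  then have "1 / 2 ^ Suc n * l \<le> e" using e by (simp add: ennreal_le_iff del: power_Suc)
  then have le: "l \<le> 2 ^ Suc n * e" by (simp add: field_simps)
  have "l \<le> (b - z) powr (1 - \<theta>) * (2 ^ Suc n * e) powr \<theta>"
  proof (cases "l = 0")
   case False
   then have "l = l powr (1 - \<theta>) * l powr \<theta>" using l by (simp flip: powr_add)
   also have "\<dots> \<le> (b - z) powr (1 - \<theta>) * (2 ^ Suc n * e) powr \<theta>"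
    using l lb le \<theta> by (intro mult_mono powr_mono2) auto
   finally show ?thesis .
  qed simp
  also have "(2 ^ Suc n * e) powr \<theta> = 2 powr \<theta> * (2 powr \<theta>) ^ n * e powr \<theta>"
   using e by (simp add: powr_mult powr_power powr_realpow[symmetric] powr_powr mult_ac powr_add[symmetric])
  finally have "1 / 2 ^ n * l \<le> 1 / 2 ^ n * ((b - z) powr (1 - \<theta>) * (2 powr \<theta> * (2 powr \<theta>) ^ n * e powr \<theta>))"
   by (rule mult_left_mono) simp
  also have "\<dots> = 2 powr \<theta> * D * ((2 powr \<theta>) ^ n / 2 ^ n)" by (simp add: D_def)
  also have "(2 powr \<theta>) ^ n / 2 ^ n = q ^ n" by (simp add: q_def powr_diff power_divide)
  finally have "1 / 2 ^ n * l \<le> 2 powr \<theta> * D * q ^ n" .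
  then show ?thesis unfolding l(1) using l(2) by (simp add: ennreal_mult[symmetric] ennreal_leI)
 qed
 have "(\<integral>\<^sup>+y. left_max E y * indicator {z<..<b} y \<partial>lborel) \<le> (\<integral>\<^sup>+y. (\<Sum>n. ennreal (1 / 2 ^ n) * indicator (L n) y) \<partial>lborel)"
  by (intro nn_integral_mono pt)
 also have "\<dots> = (\<Sum>n. ennreal (1 / 2 ^ n) * emeasure lborel (L n))"
  by (subst nn_integral_suminf) (auto simp: nn_integral_cmult)
 also have "\<dots> \<le> (\<Sum>n. ennreal (2 powr \<theta> * D * q ^ n))" by (intro suminf_le Ln) auto
 also have "\<dots> = ennreal (\<Sum>n. 2 powr \<theta> * D * q ^ n)"
  using D q by (intro suminf_ennreal2) (auto intro!: summable_mult summable_geometric)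
 also have "(\<Sum>n. 2 powr \<theta> * D * q ^ n) = 2 powr \<theta> * D * (1 / (1 - q))"
  using q by (subst suminf_mult) (auto intro!: summable_geometric simp: suminf_geometric)
 finally show ?thesis by (simp add: D_def q_def mult_ac)
qed

text \<open>After an exchange of the integrals, the inner one is the measure of \<open>E\<close> in an interval of length
  \<open>h\<close> to the left of \<open>a\<close>. For \<open>h < b - a\<close> this is controlled by the maximal function at the point
  \<open>a + h\<close>, and for larger \<open>h\<close> by its value at any point of the interval.\<close>
lemma integral_tail_le_left_max:
 assumes E [measurable]: "E \<in> sets borel" and R: "E \<subseteq> {-R..R}" and ab: "a < b" and r: "r > 1"
 shows "(\<integral>\<^sup>+x. ivl_tail r (a, b) x * indicator E x \<partial>lborel)
   \<le> ennreal (2 + 2 / (r - 1)) * (\<integral>\<^sup>+y. left_max E y * indicator {a<..<b} y \<partial>lborel)"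
proof -
 have [measurable]: "left_max E \<in> borel_measurable borel" by (rule left_max_measurable[OF E R])
 define l where "l = b - a"
 have l: "l > 0" using ab by (simp add: l_def)
 define M where "M = (\<integral>\<^sup>+y. left_max E y * indicator {a<..<b} y \<partial>lborel)"
 define G where "G x h = ennreal (len a b (x + h) powr r * h powr (- r - 1)) * indicator (E \<inter> {..a}) x" for x h
 have [measurable]: "(\<lambda>(x, h). G x h) \<in> borel_measurable (borel \<Otimes>\<^sub>M borel)" unfolding G_def len_def by measurable
 have "(\<integral>\<^sup>+x. ivl_tail r (a, b) x * indicator E x \<partial>lborel) = (\<integral>\<^sup>+x. \<integral>\<^sup>+h. G x h \<partial>lborel \<partial>lborel)"
  by (intro nn_integral_cong) (auto simp: ivl_tail_def G_def indicator_def)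
 also have "\<dots> = (\<integral>\<^sup>+h. \<integral>\<^sup>+x. G x h \<partial>lborel \<partial>lborel)" by (rule lborel_pair.Fubini'[symmetric]) measurable
 also have "\<dots> \<le> (\<integral>\<^sup>+h. 2 * (left_max E (a + h) * indicator {a<..<b} (a + h))
    + ennreal (2 * l powr (r - 1)) * M * (ennreal (h powr (- r)) * indicator {l..} h) \<partial>lborel)"
 proof (rule nn_integral_mono)
  fix h
  show "(\<integral>\<^sup>+x. G x h \<partial>lborel) \<le> 2 * (left_max E (a + h) * indicator {a<..<b} (a + h))
    + ennreal (2 * l powr (r - 1)) * M * (ennreal (h powr (- r)) * indicator {l..} h)"
  proof (cases "h > 0")
   case False
   then have "G x h = 0" for x by (auto simp: G_def len_def indicator_def)
   then show ?thesis by simp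
  next
   case h: True
   have "(\<integral>\<^sup>+x. G x h \<partial>lborel) \<le> (\<integral>\<^sup>+x. ennreal (min l h powr r * h powr (- r - 1)) * indicator (E \<inter> {a-h..a}) x \<partial>lborel)"
   proof (rule nn_integral_mono)
    fix x
    show "G x h \<le> ennreal (min l h powr r * h powr (- r - 1)) * indicator (E \<inter> {a-h..a}) x"
    proof (cases "x \<in> E \<and> x \<le> a \<and> x \<ge> a - h")
     case True
     then have "len a b (x + h) powr r \<le> min l h powr r"
      using r l h by (intro powr_mono2) (auto simp: len_def l_def)
     then show ?thesis using True by (auto simp: G_def intro!: ennreal_leI mult_right_mono)
    next
     case False
     then have "G x h = 0" by (auto simp: G_def len_def indicator_def)
     then show ?thesis by simp
    qed
   qed
   also have "\<dots> = ennreal (min l h powr r * h powr (- r - 1)) * emeasure lborel (E \<inter> {a-h..a})"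
    by (subst nn_integral_cmult_indicator) auto
   finally have le: "(\<integral>\<^sup>+x. G x h \<partial>lborel) \<le> ennreal (min l h powr r * h powr (- r - 1)) * emeasure lborel (E \<inter> {a-h..a})" .
   have mm: "emeasure lborel (E \<inter> {a-h..a}) \<le> left_max E y * ennreal (2 * h)" if "a \<le> y" "y \<le> a + h" for y
   proof -
    have "emeasure lborel (E \<inter> {a-h..a}) \<le> emeasure lborel (E \<inter> {y-2*h..y})"
     using that by (intro emeasure_mono) auto
    also have "\<dots> \<le> left_max E y * ennreal (2 * h)" using h by (intro left_max_upper) auto
    finally show ?thesis .
   qed
   show ?thesis
   proof (cases "h < l")
    case True
    have "ennreal (min l h powr r * h powr (- r - 1)) * emeasure lborel (E \<inter> {a-h..a})
      \<le> ennreal (h powr r * h powr (- r - 1)) * (left_max E (a + h) * ennreal (2 * h))"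
     using True h mm[of "a + h"] by (intro mult_mono) auto
    also have "h powr r * h powr (- r - 1) = 1 / h" using h by (simp add: powr_add[symmetric] powr_minus_divide)
    also have "ennreal (1 / h) * (left_max E (a + h) * ennreal (2 * h)) = (ennreal (1 / h) * ennreal (2 * h)) * left_max E (a + h)"
     by (simp add: mult_ac)
    also have "ennreal (1 / h) * ennreal (2 * h) = 2" using h by (subst ennreal_mult[symmetric]) auto
    finally have "(\<integral>\<^sup>+x. G x h \<partial>lborel) \<le> 2 * left_max E (a + h)" using le by (rule order_trans[rotated])
    then show ?thesis using True h by (simp add: l_def)
   next
    case False
    have "ennreal l * emeasure lborel (E \<inter> {a-h..a}) = (\<integral>\<^sup>+y. emeasure lborel (E \<inter> {a-h..a}) * indicator {a<..<b} y \<partial>lborel)"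
     using ab by (subst nn_integral_cmult_indicator) (auto simp: l_def mult.commute)
    also have "\<dots> \<le> (\<integral>\<^sup>+y. ennreal (2 * h) * (left_max E y * indicator {a<..<b} y) \<partial>lborel)"
     using False mm by (intro nn_integral_mono) (auto simp: indicator_def l_def mult.commute)
    also have "\<dots> = ennreal (2 * h) * M" unfolding M_def by (rule nn_integral_cmult) measurable
    finally have "ennreal (1 / l) * (ennreal l * emeasure lborel (E \<inter> {a-h..a})) \<le> ennreal (1 / l) * (ennreal (2 * h) * M)"
     by (rule mult_left_mono) simp
    then have e2: "emeasure lborel (E \<inter> {a-h..a}) \<le> ennreal (2 * h / l) * M"
     using l h by (simp add: mult.assoc[symmetric] ennreal_mult[symmetric])
    have "(\<integral>\<^sup>+x. G x h \<partial>lborel) \<le> ennreal (l powr r * h powr (- r - 1)) * (ennreal (2 * h / l) * M)"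
     using False e2 by (intro order_trans[OF le] mult_mono) (auto simp: min_def)
    also have "\<dots> = ennreal (l powr r * h powr (- r - 1) * (2 * h / l)) * M"
     using l h by (simp add: mult.assoc[symmetric] ennreal_mult[symmetric])
    also have "l powr r * h powr (- r - 1) * (2 * h / l) = 2 * l powr (r - 1) * h powr (- r)"
     using l h by (simp add: powr_diff field_simps)
    also have "ennreal (2 * l powr (r - 1) * h powr (- r)) * M = ennreal (2 * l powr (r - 1)) * M * (ennreal (h powr (- r)) * indicator {l..} h)"
     using False by (simp add: ennreal_mult mult_ac)
    finally show ?thesis by (simp add: add_increasing)
   qed
  qed
 qed
 also have "\<dots> = (\<integral>\<^sup>+h. 2 * (left_max E (a + h) * indicator {a<..<b} (a + h)) \<partial>lborel)
    + (\<integral>\<^sup>+h. ennreal (2 * l powr (r - 1)) * M * (ennreal (h powr (- r)) * indicator {l..} h) \<partial>lborel)"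
  by (rule nn_integral_add) measurable
 also have "(\<integral>\<^sup>+h. 2 * (left_max E (a + h) * indicator {a<..<b} (a + h)) \<partial>lborel) = 2 * M"
 proof -
  have "M = (\<integral>\<^sup>+h. left_max E (a + h) * indicator {a<..<b} (a + h) \<partial>lborel)"
   unfolding M_def by (subst nn_integral_real_affine[where c = 1 and t = a]) auto
  then show ?thesis by (subst nn_integral_cmult) auto
 qed
 also have "(\<integral>\<^sup>+h. ennreal (2 * l powr (r - 1)) * M * (ennreal (h powr (- r)) * indicator {l..} h) \<partial>lborel)
   = ennreal (2 * l powr (r - 1)) * M * ennreal (l powr (1 - r) / (r - 1))"
  using l r by (subst nn_integral_cmult) (auto simp: nn_integral_powr_tail)
 also have "\<dots> = ennreal (2 / (r - 1)) * M"
 proof -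
  have "ennreal (2 * l powr (r - 1)) * ennreal (l powr (1 - r) / (r - 1)) = ennreal (2 * l powr (r - 1) * (l powr (1 - r) / (r - 1)))"
   using r by (intro ennreal_mult[symmetric]) auto
  also have "2 * l powr (r - 1) * (l powr (1 - r) / (r - 1)) = 2 / (r - 1) * (l powr (r - 1) * l powr (1 - r))" by simp
  also have "l powr (r - 1) * l powr (1 - r) = 1" using l by (simp flip: powr_add)
  finally show ?thesis by (simp add: mult_ac)
 qed
 also have "2 * M + ennreal (2 / (r - 1)) * M = ennreal (2 + 2 / (r - 1)) * M"
  using r by (simp add: distrib_right)
 finally show ?thesis by (simp add: M_def)
qed

text \<open>Integrating the sum of the tails over \<open>E\<close> and passing to the maximal function of \<open>E\<close> on the
  disjoint intervals gives, with \<open>e = |E|\<close>, an inequality \<open>s e \<le> K (b - z) powr (1 - \<theta>) * e powr \<theta>\<close>,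
  which is solved for \<open>e\<close>. The exponent \<open>1 / (1 - \<theta>)\<close> of the decay in \<open>s\<close> is as large as desired.\<close>
lemma ivl_tail_sum_decay:
 assumes r: "r > 1" and \<theta>: "0 < \<theta>" "\<theta> < 1"
 defines "K \<equiv> (2 + 2 / (r - 1)) * (2 powr \<theta> / (1 - 2 powr (\<theta> - 1)))"
 assumes I: "countable I" "disjoint_family_on ivl I" "\<And>J. J \<in> I \<Longrightarrow> fst J < snd J \<and> snd J \<le> b"
  and E [measurable]: "E \<in> sets borel" "E \<subseteq> {z<..<b}" and zb: "z < b" and s: "s > 0"
  and big: "\<And>x. x \<in> E \<Longrightarrow> (\<integral>\<^sup>+J. ivl_tail r J x \<partial>count_space I) \<ge> ennreal s"
 shows "emeasure lborel E \<le> ennreal ((K / s) powr (1 / (1 - \<theta>)) * (b - z))"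
proof -
 define R where "R = \<bar>z\<bar> + \<bar>b\<bar>"
 have R: "E \<subseteq> {-R..R}" using E(2) by (force simp: R_def)
 have [measurable]: "left_max E \<in> borel_measurable borel" by (rule left_max_measurable[OF E(1) R])
 have "emeasure lborel E \<le> emeasure lborel {z<..<b}" by (rule emeasure_mono[OF E(2)]) simp
 then have "emeasure lborel E < top" using zb by (auto intro: order_le_less_trans)
 then obtain e where e: "emeasure lborel E = ennreal e" "e \<ge> 0" by (cases "emeasure lborel E") auto
 have "2 powr (\<theta> - 1) < (2::real) powr 0" using \<theta> by (intro powr_less_mono) auto
 then have q: "1 - 2 powr (\<theta> - 1) > (0::real)" by simp
 have K: "K > 0" unfolding K_def using r q by (intro mult_pos_pos divide_pos_pos add_pos_pos) auto
 have "ennreal s * emeasure lborel E = (\<integral>\<^sup>+x. ennreal s * indicator E x \<partial>lborel)"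
  by (simp add: nn_integral_cmult)
 also have "\<dots> \<le> (\<integral>\<^sup>+x. \<integral>\<^sup>+J. ivl_tail r J x * indicator E x \<partial>count_space I \<partial>lborel)"
  by (rule nn_integral_mono) (use big in \<open>auto simp: indicator_def\<close>)
 also have "\<dots> = (\<integral>\<^sup>+J. \<integral>\<^sup>+x. ivl_tail r J x * indicator E x \<partial>lborel \<partial>count_space I)"
  by (rule nn_integral_count_space_nn_integral[OF I(1)]) simp
 also have "\<dots> \<le> (\<integral>\<^sup>+J. ennreal (2 + 2 / (r - 1)) * (\<integral>\<^sup>+y. left_max E y * indicator (ivl J \<inter> {z<..<b}) y \<partial>lborel) \<partial>count_space I)"
 proof (rule nn_integral_mono)
  fix J assume "J \<in> space (count_space I)"
  then have J: "fst J < snd J" "snd J \<le> b" using I(3) by auto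
  show "(\<integral>\<^sup>+x. ivl_tail r J x * indicator E x \<partial>lborel)
    \<le> ennreal (2 + 2 / (r - 1)) * (\<integral>\<^sup>+y. left_max E y * indicator (ivl J \<inter> {z<..<b}) y \<partial>lborel)"
  proof (cases "fst J \<le> z")
   case True
   then have "ivl_tail r J x * indicator E x = 0" for x using E(2) by (auto simp: ivl_tail_def indicator_def)
   then have "(\<lambda>x. ivl_tail r J x * indicator E x) = (\<lambda>x. 0)" by blast
   then show ?thesis by simp
  next
   case False
   then have "ivl J \<inter> {z<..<b} = {fst J<..<snd J}" using J by (auto simp: ivl_def)
   then show ?thesis using integral_tail_le_left_max[OF E(1) R J(1) r] by simp
  qed
 qed
 also have "\<dots> = ennreal (2 + 2 / (r - 1)) * (\<integral>\<^sup>+J. \<integral>\<^sup>+y. left_max E y * indicator (ivl J \<inter> {z<..<b}) y \<partial>lborel \<partial>count_space I)"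
  by (rule nn_integral_cmult) simp
 also have "(\<integral>\<^sup>+J. \<integral>\<^sup>+y. left_max E y * indicator (ivl J \<inter> {z<..<b}) y \<partial>lborel \<partial>count_space I)
   = (\<integral>\<^sup>+J. emeasure (density lborel (left_max E)) (ivl J \<inter> {z<..<b}) \<partial>count_space I)"
  by (intro nn_integral_cong) (subst emeasure_density, auto)
 also have "\<dots> = emeasure (density lborel (left_max E)) (\<Union>J\<in>I. ivl J \<inter> {z<..<b})"
 proof (rule emeasure_UN_countable[symmetric])
  show "disjoint_family_on (\<lambda>J. ivl J \<inter> {z<..<b}) I"
   using I(2) unfolding disjoint_family_on_def by blast
 qed (use I(1) in auto)
 also have "\<dots> \<le> emeasure (density lborel (left_max E)) {z<..<b}" by (rule emeasure_mono) auto
 also have "\<dots> = (\<integral>\<^sup>+y. left_max E y * indicator {z<..<b} y \<partial>lborel)" by (rule emeasure_density) auto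
 also have "\<dots> \<le> ennreal ((2 powr \<theta> / (1 - 2 powr (\<theta> - 1))) * ((b - z) powr (1 - \<theta>) * e powr \<theta>))"
  by (rule integral_left_max[OF E(1) R \<theta> zb e])
 finally have "ennreal s * ennreal e \<le> ennreal (2 + 2 / (r - 1)) * ennreal ((2 powr \<theta> / (1 - 2 powr (\<theta> - 1))) * ((b - z) powr (1 - \<theta>) * e powr \<theta>))"
  using e by (simp add: mult_left_mono)
 also have "\<dots> = ennreal (K * ((b - z) powr (1 - \<theta>) * e powr \<theta>))"
  using r q by (subst ennreal_mult[symmetric]) (auto simp: K_def mult.assoc)
 finally have "ennreal (s * e) \<le> ennreal (K * ((b - z) powr (1 - \<theta>) * e powr \<theta>))"
  using s e by (simp add: ennreal_mult)
 then have se: "s * e \<le> K * ((b - z) powr (1 - \<theta>) * e powr \<theta>)" using K by (subst (asm) ennreal_le_iff) auto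
 have "e \<le> (K / s) powr (1 / (1 - \<theta>)) * (b - z)"
 proof (cases "e = 0")
  case True
  then show ?thesis using zb by simp
 next
  case False
  then have e0: "e > 0" using e by simp
  have "s * (e powr (1 - \<theta>) * e powr \<theta>) \<le> K * ((b - z) powr (1 - \<theta>) * e powr \<theta>)"
   using se e0 by (simp flip: powr_add)
  then have "s * e powr (1 - \<theta>) \<le> K * (b - z) powr (1 - \<theta>)" using e0 by simp
  then have "e powr (1 - \<theta>) \<le> (K / s) * (b - z) powr (1 - \<theta>)" using s by (simp add: field_simps)
  then have "(e powr (1 - \<theta>)) powr (1 / (1 - \<theta>)) \<le> ((K / s) * (b - z) powr (1 - \<theta>)) powr (1 / (1 - \<theta>))"
   using \<theta> by (intro powr_mono2) auto
  moreover have "(e powr (1 - \<theta>)) powr (1 / (1 - \<theta>)) = e" using \<theta> e0 by (simp add: powr_powr)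
  moreover have "((K / s) * (b - z) powr (1 - \<theta>)) powr (1 / (1 - \<theta>)) = (K / s) powr (1 / (1 - \<theta>)) * (b - z)"
  proof -
   have "((b - z) powr (1 - \<theta>)) powr (1 / (1 - \<theta>)) = b - z" using \<theta> zb by (simp add: powr_powr)
   then show ?thesis using K s by (subst powr_mult) auto
  qed
  ultimately show ?thesis by simp
 qed
 then show ?thesis using e by (simp add: ennreal_leI)
qed

section \<open>The one-sided condition on the weight\<close>

lemma nn_integral_count_subset:
 assumes "S \<subseteq> C"
 shows "(\<integral>\<^sup>+J. f J * indicator S J \<partial>count_space C) = (\<integral>\<^sup>+J. f J \<partial>count_space S)"
proof -
 have "(\<integral>\<^sup>+J. f J * indicator S J \<partial>count_space C) = (\<integral>\<^sup>+J. f J * indicator S J * indicator C J \<partial>count_space UNIV)"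
  by (subst nn_integral_count_space_indicator) simp_all
 also have "\<dots> = (\<integral>\<^sup>+J. f J * indicator S J \<partial>count_space UNIV)"
  by (rule nn_integral_cong) (use assms in \<open>auto simp: indicator_def\<close>)
 also have "\<dots> = (\<integral>\<^sup>+J. f J \<partial>count_space S)"
  by (subst (2) nn_integral_count_space_indicator) simp_all
 finally show ?thesis .
qed

lemma halving_double: "b - halving a b i = 2 * (halving a b (Suc i) - halving a b i)"
 by (simp add: halving_def field_simps)

definition tail_sum :: "real \<Rightarrow> real set \<Rightarrow> real \<Rightarrow> ennreal" where
 "tail_sum r \<Omega> x = (\<integral>\<^sup>+J. ivl_tail r J x \<partial>count_space (comp_ivls \<Omega>))"

lemma tail_sum_measurable [measurable]: "tail_sum r \<Omega> \<in> borel_measurable borel"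
 unfolding tail_sum_def[abs_def] by (rule borel_measurable_nn_integral_count[OF countable_comp_ivls]) simp

text \<open>The condition \<open>C\<^sup>+\<^sub>r\<close> for the measure with density \<open>w\<close>. Measures instead of weights allow the use
  of integrals with respect to \<open>\<mu>\<close> throughout.\<close>
locale cplus =
 fixes \<mu> :: "real measure" and r \<epsilon>0 Cw :: real
 assumes sets_mu [measurable_cong, simp]: "sets \<mu> = sets borel"
  and r: "r > 1" and e0: "\<epsilon>0 > 0" and Cw: "Cw > 0"
  and cplus: "\<And>a b c E. a < b \<Longrightarrow> b < c \<Longrightarrow> c - b < b - a \<Longrightarrow> E \<in> sets borel \<Longrightarrow> E \<subseteq> {a<..<b} \<Longrightarrow>
    emeasure \<mu> E \<le> ennreal (Cw * (measure lborel E / (c - b)) powr \<epsilon>0) * ivl_mass \<mu> r a c"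
begin

lemma space_mu [simp]: "space \<mu> = UNIV"
 using sets_eq_imp_space_eq[OF sets_mu] by simp

lemma mu_singleton: "emeasure \<mu> {z} = 0"
 using cplus[of "z - 2" "z + 1" "z + 2" "{z}"] by simp

text \<open>The condition \<open>C\<^sup>+\<^sub>r\<close> leaves room between \<open>b\<close> and \<open>c\<close>, whereas here \<open>E\<close> may reach the right end of
  the interval. Applying it to each of the halving pieces, with the next piece as room, costs only a
  constant, since the powers of the maximal functions of the pieces add up to at most a multiple of
  that of the interval.\<close>
lemma mu_le_of_fill:
 assumes ab: "a < b" and E: "E \<in> sets borel" "E \<subseteq> {a<..<b}" and \<eta>: "\<eta> \<ge> 0"
  and fill: "\<And>i. emeasure lborel (E \<inter> {halving a b i<..<halving a b (Suc i)}) \<le> ennreal (\<eta> * (halving a b (Suc i) - halving a b i))"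
 shows "emeasure \<mu> E \<le> ennreal (8 * Cw * (2 * \<eta>) powr \<epsilon>0) * ivl_mass \<mu> r a b"
proof -
 define Ei where "Ei i = E \<inter> {halving a b i<..<halving a b (Suc i)}" for i
 define Z where "Z i = {halving a b i}" for i
 have [measurable]: "Ei i \<in> sets borel" "Z i \<in> sets borel" for i using E by (auto simp: Ei_def Z_def)
 define k where "k = Cw * (2 * \<eta>) powr \<epsilon>0"
 have k: "k \<ge> 0" using Cw by (simp add: k_def)
 have sub: "E \<subseteq> (\<Union>i. Ei i) \<union> (\<Union>i. Z i)"
 proof
  fix x assume x: "x \<in> E"
  then have "a \<le> x" "x < b" using E(2) by force+
  then obtain i where "halving a b i \<le> x" "x < halving a b (Suc i)" using halving_cover[OF ab] by blast
  then show "x \<in> (\<Union>i. Ei i) \<union> (\<Union>i. Z i)" using x by (cases "halving a b i = x") (auto simp: Ei_def Z_def)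
 qed
 have each: "emeasure \<mu> (Ei i) \<le> ennreal k * ivl_mass \<mu> r (halving a b i) (halving a b (Suc (Suc i)))" for i
 proof -
  have d: "halving a b (Suc (Suc i)) - halving a b (Suc i) = (halving a b (Suc i) - halving a b i) / 2"
   using halving_diff[of a b i] halving_diff[of a b "Suc i"] by simp
  have p: "halving a b (Suc i) - halving a b i > 0" using halving_bounds(1)[OF ab, of i] by simp
  have "emeasure lborel (Ei i) \<le> ennreal (\<eta> * (halving a b (Suc i) - halving a b i))" using fill by (simp add: Ei_def)
  then have m: "measure lborel (Ei i) \<le> \<eta> * (halving a b (Suc i) - halving a b i)"
   unfolding measure_def using \<eta> p by (intro enn2real_leI) auto
  have "emeasure \<mu> (Ei i) \<le> ennreal (Cw * (measure lborel (Ei i) / (halving a b (Suc (Suc i)) - halving a b (Suc i))) powr \<epsilon>0)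
    * ivl_mass \<mu> r (halving a b i) (halving a b (Suc (Suc i)))"
   using p d E(1) by (intro cplus) (auto simp: Ei_def)
  also have "\<dots> \<le> ennreal k * ivl_mass \<mu> r (halving a b i) (halving a b (Suc (Suc i)))"
  proof (intro mult_right_mono ennreal_leI)
   have ratio: "measure lborel (Ei i) / (halving a b (Suc (Suc i)) - halving a b (Suc i)) \<le> 2 * \<eta>"
    using m p unfolding d by (simp add: pos_divide_le_eq)
   have nonneg: "0 \<le> measure lborel (Ei i) / (halving a b (Suc (Suc i)) - halving a b (Suc i))"
    using p unfolding d by simp
   show "Cw * (measure lborel (Ei i) / (halving a b (Suc (Suc i)) - halving a b (Suc i))) powr \<epsilon>0 \<le> k"
    unfolding k_def using Cw e0 by (intro mult_left_mono powr_mono2 ratio nonneg) auto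
  qed simp
  finally show ?thesis .
 qed
 have "emeasure \<mu> E \<le> emeasure \<mu> ((\<Union>i. Ei i) \<union> (\<Union>i. Z i))" by (rule emeasure_mono[OF sub]) simp
 also have "\<dots> \<le> emeasure \<mu> (\<Union>i. Ei i) + emeasure \<mu> (\<Union>i. Z i)" by (rule emeasure_subadditive) auto
 also have "emeasure \<mu> (\<Union>i. Z i) \<le> (\<Sum>i. emeasure \<mu> (Z i))" by (rule emeasure_subadditive_countably) auto
 also have "\<dots> = 0" by (simp add: Z_def mu_singleton)
 also have "emeasure \<mu> (\<Union>i. Ei i) \<le> (\<Sum>i. emeasure \<mu> (Ei i))" by (rule emeasure_subadditive_countably) auto
 also have "\<dots> \<le> (\<Sum>i. ennreal k * ivl_mass \<mu> r (halving a b i) (halving a b (Suc (Suc i))))" by (intro suminf_le each) auto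
 also have "\<dots> = (\<integral>\<^sup>+x. (\<Sum>i. ennreal k * ennreal (ivl_max (halving a b i) (halving a b (Suc (Suc i))) x powr r)) \<partial>\<mu>)"
  unfolding ivl_mass_def by (subst nn_integral_suminf) (auto simp: nn_integral_cmult)
 also have "\<dots> \<le> (\<integral>\<^sup>+x. ennreal (8 * k) * ennreal (ivl_max a b x powr r) \<partial>\<mu>)"
 proof (rule nn_integral_mono, rule suminf_le_const)
  fix x N
  have "(\<Sum>i<N. ennreal k * ennreal (ivl_max (halving a b i) (halving a b (Suc (Suc i))) x powr r))
    = ennreal (k * (\<Sum>i<N. ivl_max (halving a b i) (halving a b (Suc (Suc i))) x powr r))"
   using k by (simp add: ennreal_mult[symmetric] sum_distrib_left)
  also have "\<dots> \<le> ennreal (k * (8 * ivl_max a b x powr r))"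
   using ivl_max_halving_le[OF ab, of r x N] r k by (intro ennreal_leI mult_left_mono) auto
  also have "\<dots> = ennreal (8 * k) * ennreal (ivl_max a b x powr r)" using k by (simp add: ennreal_mult[symmetric] mult_ac)
  finally show "(\<Sum>i<N. ennreal k * ennreal (ivl_max (halving a b i) (halving a b (Suc (Suc i))) x powr r)) \<le> ennreal (8 * k) * ennreal (ivl_max a b x powr r)" .
 qed simp
 also have "\<dots> = ennreal (8 * k) * ivl_mass \<mu> r a b" unfolding ivl_mass_def by (rule nn_integral_cmult) measurable
 finally show ?thesis by (simp add: k_def mult.assoc)
qed

lemma ivl_mass_le:
 assumes J: "fst J < snd J"
 shows "ivl_mass \<mu> r (fst J) (snd J) \<le> emeasure \<mu> (ivl J) + ennreal r * (\<integral>\<^sup>+x. ivl_tail r J x \<partial>\<mu>)"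
proof -
 have "ivl_mass \<mu> r (fst J) (snd J) \<le> (\<integral>\<^sup>+x. indicator (ivl J) x + ennreal r * ivl_tail r J x \<partial>\<mu>)"
  unfolding ivl_mass_def
 proof (rule nn_integral_mono)
  fix x
  consider "x \<le> fst J" | "x \<in> ivl J" | "x \<ge> snd J" by (force simp: ivl_def)
  then show "ennreal (ivl_max (fst J) (snd J) x powr r) \<le> indicator (ivl J) x + ennreal r * ivl_tail r J x"
  proof cases
   case 1
   then show ?thesis using ivl_max_le_tail[OF J 1 r] by (simp add: add_increasing)
  next
   case 2
   then show ?thesis by (simp add: ivl_max_def ivl_def add_increasing2)
  next
   case 3
   then show ?thesis using J by (simp add: ivl_max_def)
  qed
 qed
 also have "\<dots> = emeasure \<mu> (ivl J) + ennreal r * (\<integral>\<^sup>+x. ivl_tail r J x \<partial>\<mu>)"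
  by (subst nn_integral_add) (auto simp: nn_integral_cmult)
 finally show ?thesis .
qed

text \<open>The loss in replacing the intervals of \<open>\<Omega>\<close> by their maximal functions is the integral of the tails,
  which the measure of \<open>\<Omega>\<close> does not control. It is therefore carried along as a second
  quantity.\<close>
lemma sum_ivl_mass_le:
 assumes "open \<Omega>" "bounded \<Omega>"
 shows "(\<integral>\<^sup>+J. ivl_mass \<mu> r (fst J) (snd J) \<partial>count_space (comp_ivls \<Omega>)) \<le> emeasure \<mu> \<Omega> + ennreal r * (\<integral>\<^sup>+x. tail_sum r \<Omega> x \<partial>\<mu>)"
proof -
 have "(\<integral>\<^sup>+J. ivl_mass \<mu> r (fst J) (snd J) \<partial>count_space (comp_ivls \<Omega>))
   \<le> (\<integral>\<^sup>+J. emeasure \<mu> (ivl J) + ennreal r * (\<integral>\<^sup>+x. ivl_tail r J x \<partial>\<mu>) \<partial>count_space (comp_ivls \<Omega>))"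
  by (intro nn_integral_mono ivl_mass_le) (auto simp: comp_ivls_def)
 also have "\<dots> = emeasure \<mu> \<Omega> + ennreal r * (\<integral>\<^sup>+J. \<integral>\<^sup>+x. ivl_tail r J x \<partial>\<mu> \<partial>count_space (comp_ivls \<Omega>))"
  by (subst nn_integral_add) (auto simp: nn_integral_cmult emeasure_comp_ivls[OF assms])
 also have "(\<integral>\<^sup>+J. \<integral>\<^sup>+x. ivl_tail r J x \<partial>\<mu> \<partial>count_space (comp_ivls \<Omega>)) = (\<integral>\<^sup>+x. tail_sum r \<Omega> x \<partial>\<mu>)"
  unfolding tail_sum_def by (rule nn_integral_count_space_nn_integral[OF countable_comp_ivls, symmetric]) simp
 finally show ?thesis .
qed

text \<open>The power of decay for which, after it is raised to \<open>\<epsilon>0\<close> by the condition \<open>C\<^sup>+\<^sub>r\<close>, the sum of the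
  level times the measure of the level set converges, with room to spare; \<open>\<theta>\<close> is the exponent of
  Kolmogorov's inequality that produces it.\<close>
definition decay_exp :: real where "decay_exp = (2 + \<epsilon>0) / \<epsilon>0"
definition \<theta> :: real where "\<theta> = 1 - 1 / decay_exp"
definition decay_const :: real where "decay_const = max 1 ((2 + 2 / (r - 1)) * (2 powr \<theta> / (1 - 2 powr (\<theta> - 1))))"
definition near_const :: real where "near_const = 32 * Cw * 4 powr \<epsilon>0 * decay_const\<^sup>2"

lemma decay_exp: "decay_exp > 1" "decay_exp * \<epsilon>0 = 2 + \<epsilon>0" "0 < \<theta>" "\<theta> < 1" "1 / (1 - \<theta>) = decay_exp"
proof -
 show N: "decay_exp > 1" "decay_exp * \<epsilon>0 = 2 + \<epsilon>0" using e0 by (auto simp: decay_exp_def)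
 then show "0 < \<theta>" "\<theta> < 1" "1 / (1 - \<theta>) = decay_exp" by (auto simp: \<theta>_def)
qed

lemma near_const_nonneg: "near_const \<ge> 0" using Cw by (simp add: near_const_def)

text \<open>Inside an interval, the tails of subintervals are split by their dyadic levels above \<open>t\<close>. A level
  set at height \<open>s\<close> fills at most a multiple of \<open>s powr - decay_exp\<close> of each halving piece, so
  the condition \<open>C\<^sup>+\<^sub>r\<close> makes it small in measure. A large \<open>t\<close> gives a small coefficient of the
  maximal function, at the price of a multiple of the measure itself.\<close>
lemma near_bound:
 assumes I: "countable I" "disjoint_family_on ivl I" "\<And>J. J \<in> I \<Longrightarrow> fst J < snd J \<and> snd J \<le> b"
  and ab: "a < b" and t: "t \<ge> decay_const"
 shows "(\<integral>\<^sup>+x. (\<integral>\<^sup>+J. ivl_tail r J x \<partial>count_space I) * indicator {a<..<b} x \<partial>\<mu>)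
   \<le> ennreal t * emeasure \<mu> {a<..<b} + ennreal (near_const / t) * ivl_mass \<mu> r a b"
proof -
 define \<Phi> where "\<Phi> x = (\<integral>\<^sup>+J. ivl_tail r J x \<partial>count_space I)" for x
 have [measurable]: "\<Phi> \<in> borel_measurable borel"
  unfolding \<Phi>_def[abs_def] by (rule borel_measurable_nn_integral_count[OF I(1)]) simp
 \<comment> \<open>Heights of the levels; everything below \<open>t\<close> is left to the measure of the interval.\<close>
 define s where "s n = 2 ^ n * t" for n :: nat
 have t0: "t \<ge> 1" "t > 0" using t by (auto simp: decay_const_def)
 have s: "s n \<ge> decay_const" "s n > 0" for n
 proof -
  have "1 * t \<le> 2 ^ n * t" using t0 by (intro mult_right_mono) auto
  then have "t \<le> s n" by (simp only: s_def mult_1)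
  then show "s n \<ge> decay_const" "s n > 0" using t t0 by linarith+
 qed
 define E where "E n = {x. \<Phi> x > ennreal (s n)} \<inter> {a<..<b}" for n
 have [measurable]: "E n \<in> sets borel" for n unfolding E_def by measurable
 have pt: "\<Phi> x * indicator {a<..<b} x \<le> ennreal t * indicator {a<..<b} x + (\<Sum>n. ennreal (2 * s n) * indicator (E n) x)" for x
 proof (cases "x \<in> {a<..<b} \<and> \<Phi> x > ennreal t")
  case x: True
  show ?thesis
  proof (cases "\<Phi> x")
   case (real p)
   then have pt: "p > t" using x t0 by (simp add: ennreal_less_iff)
   obtain n0 where "p / t < 2 ^ n0" using real_arch_pow[of 2 "p / t"] by auto
   then have ex: "\<exists>n. p \<le> s n" using t0 by (intro exI[of _ n0]) (simp add: s_def field_simps)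
   define m where "m = (LEAST n. p \<le> s n)"
   have m: "p \<le> s m" unfolding m_def using ex by (rule LeastI_ex)
   then obtain j where j: "m = Suc j" using pt by (cases m) (auto simp: s_def)
   then have "\<not> p \<le> s j" using not_less_Least[of j "\<lambda>n. p \<le> s n"] by (simp add: m_def)
   then have "x \<in> E j" using x real s(2)[of j] by (simp add: E_def ennreal_less_iff)
   moreover have "p \<le> 2 * s j" using m j by (simp add: s_def)
   ultimately have "\<Phi> x * indicator {a<..<b} x \<le> ennreal (2 * s j) * indicator (E j) x"
    using x real by (simp add: ennreal_leI)
   also have "\<dots> \<le> (\<Sum>n. ennreal (2 * s n) * indicator (E n) x)" by (rule ennreal_le_suminf)
   finally show ?thesis by (simp add: add_increasing)
  next
   case top
   have "(\<Sum>n. ennreal (2 * s n) * indicator (E n) x) = top"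
   proof (rule ccontr)
    assume "(\<Sum>n. ennreal (2 * s n) * indicator (E n) x) \<noteq> top"
    then obtain S where S: "(\<Sum>n. ennreal (2 * s n) * indicator (E n) x) = ennreal S" "S \<ge> 0"
     by (cases "(\<Sum>n. ennreal (2 * s n) * indicator (E n) x)") auto
    obtain n where n: "S < 2 ^ n" using real_arch_pow[of 2 S] by auto
    have "2 * s n \<le> S"
    proof -
     have "x \<in> E n" using x top by (simp add: E_def)
     then have "ennreal (2 * s n) \<le> ennreal S"
      using ennreal_le_suminf[of "\<lambda>n. ennreal (2 * s n) * indicator (E n) x" n] S by simp
     then show ?thesis using S by (simp add: ennreal_le_iff)
    qed
    moreover have "2 ^ n * 1 \<le> 2 ^ n * t" using t0 by (intro mult_left_mono) auto
    ultimately show False using s(2)[of n] n unfolding s_def by linarith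
   qed
   then show ?thesis by simp
  qed
 next
  case False
  then have "\<Phi> x * indicator {a<..<b} x \<le> ennreal t * indicator {a<..<b} x" by (auto simp: indicator_def not_less)
  then show ?thesis by (simp add: add_increasing2)
 qed
 have left_max: "emeasure \<mu> (E n) \<le> ennreal (8 * Cw * 4 powr \<epsilon>0 * (decay_const / s n)\<^sup>2) * ivl_mass \<mu> r a b" for n
 proof -
  have Ks: "decay_const / s n \<le> 1" "decay_const / s n \<ge> 0" using s[of n] by (auto simp: decay_const_def)
  define \<eta> where "\<eta> = 2 * (decay_const / s n) powr decay_exp"
  have "emeasure \<mu> (E n) \<le> ennreal (8 * Cw * (2 * \<eta>) powr \<epsilon>0) * ivl_mass \<mu> r a b"
  proof (rule mu_le_of_fill[OF ab])
   fix i
   have zb: "halving a b i < b" by (rule halving_bounds(2)[OF ab])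
   let ?K = "(2 + 2 / (r - 1)) * (2 powr \<theta> / (1 - 2 powr (\<theta> - 1)))"
   have "emeasure lborel (E n \<inter> {halving a b i<..<halving a b (Suc i)}) \<le> ennreal ((?K / s n) powr (1 / (1 - \<theta>)) * (b - halving a b i))"
   proof (rule ivl_tail_sum_decay[OF r decay_exp(3,4) I _ _ zb s(2)])
    show "E n \<inter> {halving a b i<..<halving a b (Suc i)} \<subseteq> {halving a b i<..<b}"
     using halving_bounds(2)[OF ab, of "Suc i"] by auto
    show "E n \<inter> {halving a b i<..<halving a b (Suc i)} \<in> sets borel" by simp
   qed (auto simp: E_def \<Phi>_def)
   also have "\<dots> \<le> ennreal (\<eta> * (halving a b (Suc i) - halving a b i))"
   proof (rule ennreal_leI)
    have "2 powr (\<theta> - 1) < (2::real) powr 0" using decay_exp by (intro powr_less_mono) auto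
    then have "?K \<ge> 0" using r by (intro mult_nonneg_nonneg divide_nonneg_nonneg add_nonneg_nonneg) auto
    then have k1: "0 \<le> ?K / s n" using s(2)[of n] by (rule divide_nonneg_pos)
    have "?K \<le> decay_const" by (simp add: decay_const_def)
    then have "?K / s n \<le> decay_const / s n" using s(2)[of n] by (intro divide_right_mono) auto
    then have "(?K / s n) powr decay_exp \<le> (decay_const / s n) powr decay_exp" using k1 decay_exp(1) by (intro powr_mono2) auto
    then have "(?K / s n) powr (1 / (1 - \<theta>)) * (b - halving a b i) \<le> (decay_const / s n) powr decay_exp * (b - halving a b i)"
     unfolding decay_exp(5) using zb by (intro mult_right_mono) auto
    also have "b - halving a b i = 2 * (halving a b (Suc i) - halving a b i)" by (rule halving_double)
    also have "(decay_const / s n) powr decay_exp * (2 * (halving a b (Suc i) - halving a b i)) = \<eta> * (halving a b (Suc i) - halving a b i)"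
     by (simp add: \<eta>_def)
    finally show "(?K / s n) powr (1 / (1 - \<theta>)) * (b - halving a b i) \<le> \<eta> * (halving a b (Suc i) - halving a b i)"
     by (simp only: halving_double)
   qed
   finally show "emeasure lborel (E n \<inter> {halving a b i<..<halving a b (Suc i)}) \<le> ennreal (\<eta> * (halving a b (Suc i) - halving a b i))" .
  qed (auto simp: E_def \<eta>_def)
  also have "(2 * \<eta>) powr \<epsilon>0 = 4 powr \<epsilon>0 * (decay_const / s n) powr (2 + \<epsilon>0)"
   using decay_exp(2) Ks by (simp add: \<eta>_def powr_mult powr_powr)
  also have "ennreal (8 * Cw * (4 powr \<epsilon>0 * (decay_const / s n) powr (2 + \<epsilon>0))) * ivl_mass \<mu> r a b
    \<le> ennreal (8 * Cw * 4 powr \<epsilon>0 * (decay_const / s n)\<^sup>2) * ivl_mass \<mu> r a b"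
  proof (intro mult_right_mono ennreal_leI)
   have "decay_const > 0" by (simp add: decay_const_def)
   then have "(decay_const / s n) powr (2 + \<epsilon>0) \<le> (decay_const / s n) powr 2"
    using Ks s(2)[of n] e0 by (intro powr_mono') auto
   also have "\<dots> = (decay_const / s n)\<^sup>2" using \<open>decay_const > 0\<close> s(2)[of n] by (simp add: powr_numeral)
   finally show "8 * Cw * (4 powr \<epsilon>0 * (decay_const / s n) powr (2 + \<epsilon>0)) \<le> 8 * Cw * 4 powr \<epsilon>0 * (decay_const / s n)\<^sup>2"
    using Cw by (simp add: mult.assoc mult_left_mono)
  qed simp
  finally show ?thesis .
 qed
 have "(\<integral>\<^sup>+x. \<Phi> x * indicator {a<..<b} x \<partial>\<mu>)
   \<le> (\<integral>\<^sup>+x. ennreal t * indicator {a<..<b} x + (\<Sum>n. ennreal (2 * s n) * indicator (E n) x) \<partial>\<mu>)"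
  by (intro nn_integral_mono pt)
 also have "\<dots> = ennreal t * emeasure \<mu> {a<..<b} + (\<Sum>n. ennreal (2 * s n) * emeasure \<mu> (E n))"
  by (subst nn_integral_add, measurable) (subst nn_integral_suminf, auto simp: nn_integral_cmult)
 also have "(\<Sum>n. ennreal (2 * s n) * emeasure \<mu> (E n)) \<le> (\<Sum>n. ennreal ((near_const / t / 2) * (1/2) ^ n) * ivl_mass \<mu> r a b)"
 proof (intro suminf_le allI)
  fix n
  have "ennreal (2 * s n) * emeasure \<mu> (E n) \<le> ennreal (2 * s n) * (ennreal (8 * Cw * 4 powr \<epsilon>0 * (decay_const / s n)\<^sup>2) * ivl_mass \<mu> r a b)"
   by (intro mult_left_mono left_max) simp
  also have "\<dots> = ennreal (2 * s n * (8 * Cw * 4 powr \<epsilon>0 * (decay_const / s n)\<^sup>2)) * ivl_mass \<mu> r a b"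
  proof -
   have "ennreal (2 * s n * (8 * Cw * 4 powr \<epsilon>0 * (decay_const / s n)\<^sup>2)) = ennreal (2 * s n) * ennreal (8 * Cw * 4 powr \<epsilon>0 * (decay_const / s n)\<^sup>2)"
    using s(2)[of n] Cw by (intro ennreal_mult) auto
   then show ?thesis by (simp only: mult.assoc)
  qed
  also have "2 * s n * (8 * Cw * 4 powr \<epsilon>0 * (decay_const / s n)\<^sup>2) = (near_const / t / 2) * (1/2) ^ n"
   using t0 by (simp add: s_def near_const_def power2_eq_square field_simps)
  finally show "ennreal (2 * s n) * emeasure \<mu> (E n) \<le> ennreal ((near_const / t / 2) * (1/2) ^ n) * ivl_mass \<mu> r a b" .
 qed auto
 also have "\<dots> = (\<Sum>n. ennreal ((near_const / t / 2) * (1/2) ^ n)) * ivl_mass \<mu> r a b" by (simp add: ennreal_suminf_multc)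
 also have "(\<Sum>n. ennreal ((near_const / t / 2) * (1/2) ^ n)) = ennreal (near_const / t)"
 proof -
  have "(\<Sum>n. ennreal ((near_const / t / 2) * (1/2) ^ n)) = ennreal (\<Sum>n. (near_const / t / 2) * (1/2) ^ n)"
   using near_const_nonneg t0 by (intro suminf_ennreal2) (auto intro!: summable_mult summable_geometric)
  also have "(\<Sum>n. (near_const / t / 2) * (1/2) ^ n) = (near_const / t / 2) * (\<Sum>n. (1/2) ^ n)"
   by (intro suminf_mult summable_geometric) auto
  also have "(\<Sum>n. (1/2::real) ^ n) = 2" by (subst suminf_geometric) auto
  finally show ?thesis by simp
 qed
 finally show ?thesis by (simp add: \<Phi>_def add_left_mono)
qed

text \<open>The second quantity, besides the measure of \<open>\<Omega>\<close>, that is followed from one level to the next.\<close>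
definition tail_mass :: "real set \<Rightarrow> ennreal" where "tail_mass \<Omega> = (\<integral>\<^sup>+x. tail_sum r \<Omega> x \<partial>\<mu>)"

lemma len_eq_measure:
 assumes "fst J < snd J" shows "ennreal (len (fst J) (snd J) v) = emeasure lborel (ivl J \<inter> {..<v})"
proof -
 have "ivl J \<inter> {..<v} = (if v > fst J then {fst J<..<min v (snd J)} else {})" by (auto simp: ivl_def)
 then show ?thesis using assms by (auto simp: len_def min_def max_def)
qed

text \<open>A component of \<open>\<Omega>\<close> lies in a component \<open>J'\<close> of \<open>\<Omega>'\<close>. To the left of \<open>J'\<close> the filling hypothesis,
  applied at the left endpoint of \<open>J'\<close>, yields the factor \<open>\<eta> powr r\<close>. Inside \<open>J'\<close> the tails are
  bounded by \<open>near_bound\<close>, and to the right of \<open>J'\<close> they vanish.\<close>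
lemma tail_mass_rec:
 assumes \<Omega>: "open \<Omega>" "bounded \<Omega>" and \<Omega>': "open \<Omega>'" "bounded \<Omega>'" and sub: "\<Omega> \<subseteq> \<Omega>'" and \<eta>: "\<eta> \<ge> 0" and t: "t \<ge> decay_const"
  and fill: "\<And>c h. c \<notin> \<Omega>' \<Longrightarrow> h > 0 \<Longrightarrow> emeasure lborel (\<Omega> \<inter> {c<..<c+h}) \<le> ennreal (\<eta> * h)"
 shows "tail_mass \<Omega> \<le> ennreal (\<eta> powr r) * tail_mass \<Omega>' + (ennreal t * emeasure \<mu> \<Omega>' + ennreal (near_const / t) * (emeasure \<mu> \<Omega>' + ennreal r * tail_mass \<Omega>'))"
proof -
 let ?C = "comp_ivls \<Omega>" and ?C' = "comp_ivls \<Omega>'"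
 define sb where "sb J' = {J \<in> ?C. ivl J \<subseteq> ivl J'}" for J'
 have sbC: "sb J' \<subseteq> ?C" for J' by (auto simp: sb_def)
 have csb: "countable (sb J')" for J' using countable_comp_ivls sbC by (rule countable_subset[rotated])
 have C: "fst J < snd J" if "J \<in> ?C" for J using that by (simp add: comp_ivls_def)
 have C': "fst J < snd J" "fst J \<notin> \<Omega>'" if "J \<in> ?C'" for J using that by (auto simp: comp_ivls_def)
 have sb: "fst J' \<le> fst J \<and> snd J \<le> snd J'" if "J \<in> sb J'" for J J'
 proof -
  have J: "fst J < snd J" "ivl J \<subseteq> ivl J'" using that C by (auto simp: sb_def)
  then show ?thesis unfolding ivl_def by (subst (asm) greaterThanLessThan_subseteq_greaterThanLessThan) auto
 qed
 have parent: "\<exists>J'\<in>?C'. J \<in> sb J'" if J: "J \<in> ?C" for J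
 proof -
  define x where "x = (fst J + snd J) / 2"
  have x: "x \<in> ivl J" using C[OF J] by (simp add: x_def ivl_def field_simps)
  have J\<Omega>: "ivl J \<subseteq> \<Omega>'" using J sub by (auto simp: comp_ivls_def)
  then obtain J' where J': "J' \<in> ?C'" "x \<in> ivl J'" using comp_ivls_cover[OF \<Omega>', of x] x by blast
  have "fst J' \<le> fst J" "snd J \<le> snd J'" using comp_ivls_nested[OF J x J'(2) J\<Omega> J'(1)] by auto
  then have "ivl J \<subseteq> ivl J'" by (auto simp: ivl_def)
  then show ?thesis using J J' by (auto simp: sb_def)
 qed
 define \<Phi> where "\<Phi> J' x = (\<integral>\<^sup>+J. ivl_tail r J x \<partial>count_space (sb J'))" for J' x
 have [measurable]: "\<Phi> J' \<in> borel_measurable borel" for J'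
  unfolding \<Phi>_def[abs_def] by (rule borel_measurable_nn_integral_count[OF csb]) simp
 have group: "tail_sum r \<Omega> x \<le> (\<integral>\<^sup>+J'. \<Phi> J' x \<partial>count_space ?C')" for x
 proof -
  have "tail_sum r \<Omega> x \<le> (\<integral>\<^sup>+J. \<integral>\<^sup>+J'. ivl_tail r J x * indicator (sb J') J \<partial>count_space ?C' \<partial>count_space ?C)"
   unfolding tail_sum_def
  proof (rule nn_integral_mono)
   fix J assume "J \<in> space (count_space ?C)"
   then have "J \<in> ?C" by simp
   from parent[OF this] obtain J0 where J0: "J0 \<in> ?C'" "J \<in> sb J0" by blast
   have "ivl_tail r J x = (\<integral>\<^sup>+J'. ivl_tail r J x * indicator {J0} J' \<partial>count_space ?C')"
    using J0 by (subst nn_integral_cmult_indicator) (auto simp: one_ennreal_def[symmetric])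
   also have "\<dots> \<le> (\<integral>\<^sup>+J'. ivl_tail r J x * indicator (sb J') J \<partial>count_space ?C')"
    using J0 by (intro nn_integral_mono) (auto simp: indicator_def)
   finally show "ivl_tail r J x \<le> (\<integral>\<^sup>+J'. ivl_tail r J x * indicator (sb J') J \<partial>count_space ?C')" .
  qed
  also have "\<dots> = (\<integral>\<^sup>+J'. \<integral>\<^sup>+J. ivl_tail r J x * indicator (sb J') J \<partial>count_space ?C \<partial>count_space ?C')"
   by (rule nn_integral_count_space_nn_integral[OF countable_comp_ivls]) simp
  also have "\<dots> = (\<integral>\<^sup>+J'. \<Phi> J' x \<partial>count_space ?C')"
   unfolding \<Phi>_def by (intro nn_integral_cong nn_integral_count_subset sbC)
  finally show ?thesis .
 qed
 have each: "\<Phi> J' x \<le> ennreal (\<eta> powr r) * ivl_tail r J' x + \<Phi> J' x * indicator (ivl J') x" if J': "J' \<in> ?C'" for J' x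
 proof -
  consider "x \<le> fst J'" | "x \<in> ivl J'" | "x \<ge> snd J'" by (force simp: ivl_def)
  then show ?thesis
  proof cases
   case 1
   have "\<Phi> J' x \<le> ennreal (\<eta> powr r) * ivl_tail r J' x"
    unfolding \<Phi>_def
   proof (rule ivl_tail_sum_le[OF csb _ \<eta> 1])
    fix v assume v: "v > fst J'"
    have "(\<integral>\<^sup>+J. ennreal (len (fst J) (snd J) v) \<partial>count_space (sb J')) = (\<integral>\<^sup>+J. emeasure lborel (ivl J \<inter> {..<v}) \<partial>count_space (sb J'))"
     using C[OF subsetD[OF sbC]] by (intro nn_integral_cong len_eq_measure) simp
    also have "\<dots> = emeasure lborel (\<Union>J\<in>sb J'. ivl J \<inter> {..<v})"
    proof (rule emeasure_UN_countable[symmetric])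
     show "disjoint_family_on (\<lambda>J. ivl J \<inter> {..<v}) (sb J')"
      using comp_ivls_disjoint[of \<Omega>] sbC unfolding disjoint_family_on_def by blast
    qed (use csb in auto)
    also have "\<dots> \<le> emeasure lborel (\<Omega> \<inter> {fst J'<..<fst J' + (min v (snd J') - fst J')})"
    proof (rule emeasure_mono)
     show "(\<Union>J\<in>sb J'. ivl J \<inter> {..<v}) \<subseteq> \<Omega> \<inter> {fst J'<..<fst J' + (min v (snd J') - fst J')}"
     proof
      fix y assume "y \<in> (\<Union>J\<in>sb J'. ivl J \<inter> {..<v})"
      then obtain J where "J \<in> sb J'" "y \<in> ivl J" "y < v" by auto
      then have "y \<in> \<Omega>" "y \<in> ivl J'" "y < v" by (auto simp: sb_def comp_ivls_def)
      then show "y \<in> \<Omega> \<inter> {fst J'<..<fst J' + (min v (snd J') - fst J')}" by (auto simp: ivl_def)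
     qed
     show "\<Omega> \<inter> {fst J'<..<fst J' + (min v (snd J') - fst J')} \<in> sets lborel" using \<Omega>(1) by auto
    qed
    also have "\<dots> \<le> ennreal (\<eta> * (min v (snd J') - fst J'))"
     using C'[OF J'] v by (intro fill) auto
    also have "min v (snd J') - fst J' = len (fst J') (snd J') v" using C'[OF J'] v by (auto simp: len_def)
    finally show "(\<integral>\<^sup>+J. ennreal (len (fst J) (snd J) v) \<partial>count_space (sb J')) \<le> ennreal (\<eta> * len (fst J') (snd J') v)" .
   qed (use sb r in auto)
   then show ?thesis by (simp add: add_increasing2)
  next
   case 2
   then show ?thesis by (simp add: add_increasing)
  next
   case 3
   have "\<Phi> J' x = (\<integral>\<^sup>+J. 0 \<partial>count_space (sb J'))"
    unfolding \<Phi>_def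
   proof (rule nn_integral_cong)
    fix J assume "J \<in> space (count_space (sb J'))"
    then have "J \<in> sb J'" by simp
    then have "fst J < snd J" "snd J \<le> snd J'" using sb[of J J'] C[of J] sbC[of J'] by blast+
    then show "ivl_tail r J x = 0" using 3 by (simp add: ivl_tail_def)
   qed
   then show ?thesis by simp
  qed
 qed
 have "tail_mass \<Omega> \<le> (\<integral>\<^sup>+x. \<integral>\<^sup>+J'. ennreal (\<eta> powr r) * ivl_tail r J' x + \<Phi> J' x * indicator (ivl J') x \<partial>count_space ?C' \<partial>\<mu>)"
  unfolding tail_mass_def
  by (rule nn_integral_mono, rule order_trans[OF group], rule nn_integral_mono) (use each in simp)
 also have "\<dots> = (\<integral>\<^sup>+J'. \<integral>\<^sup>+x. ennreal (\<eta> powr r) * ivl_tail r J' x + \<Phi> J' x * indicator (ivl J') x \<partial>\<mu> \<partial>count_space ?C')"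
  by (rule nn_integral_count_space_nn_integral[OF countable_comp_ivls]) simp
 also have "\<dots> = (\<integral>\<^sup>+J'. ennreal (\<eta> powr r) * (\<integral>\<^sup>+x. ivl_tail r J' x \<partial>\<mu>) + (\<integral>\<^sup>+x. \<Phi> J' x * indicator (ivl J') x \<partial>\<mu>) \<partial>count_space ?C')"
  by (intro nn_integral_cong) (subst nn_integral_add, auto simp: nn_integral_cmult)
 also have "\<dots> \<le> (\<integral>\<^sup>+J'. ennreal (\<eta> powr r) * (\<integral>\<^sup>+x. ivl_tail r J' x \<partial>\<mu>)
    + (ennreal t * emeasure \<mu> (ivl J') + ennreal (near_const / t) * ivl_mass \<mu> r (fst J') (snd J')) \<partial>count_space ?C')"
 proof (intro nn_integral_mono add_left_mono)
  fix J' assume "J' \<in> space (count_space ?C')"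
  then have J': "J' \<in> ?C'" by simp
  show "(\<integral>\<^sup>+x. \<Phi> J' x * indicator (ivl J') x \<partial>\<mu>) \<le> ennreal t * emeasure \<mu> (ivl J') + ennreal (near_const / t) * ivl_mass \<mu> r (fst J') (snd J')"
   unfolding \<Phi>_def ivl_def
  proof (rule near_bound[OF csb _ _ C'(1)[OF J'] t])
   show "disjoint_family_on ivl (sb J')"
    using comp_ivls_disjoint[of \<Omega>] sbC unfolding disjoint_family_on_def by blast
  qed (use sb C sbC in blast)
 qed
 also have "\<dots> = ennreal (\<eta> powr r) * (\<integral>\<^sup>+J'. \<integral>\<^sup>+x. ivl_tail r J' x \<partial>\<mu> \<partial>count_space ?C')
    + (ennreal t * (\<integral>\<^sup>+J'. emeasure \<mu> (ivl J') \<partial>count_space ?C') + ennreal (near_const / t) * (\<integral>\<^sup>+J'. ivl_mass \<mu> r (fst J') (snd J') \<partial>count_space ?C'))"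
  by (subst nn_integral_add, simp, simp, subst nn_integral_add, simp, simp) (simp add: nn_integral_cmult)
 also have "\<dots> \<le> ennreal (\<eta> powr r) * tail_mass \<Omega>' + (ennreal t * emeasure \<mu> \<Omega>' + ennreal (near_const / t) * (emeasure \<mu> \<Omega>' + ennreal r * tail_mass \<Omega>'))"
 proof (intro add_mono mult_left_mono)
  show "(\<integral>\<^sup>+J'. \<integral>\<^sup>+x. ivl_tail r J' x \<partial>\<mu> \<partial>count_space ?C') \<le> tail_mass \<Omega>'"
   unfolding tail_mass_def tail_sum_def
   by (rule eq_refl, rule nn_integral_count_space_nn_integral[OF countable_comp_ivls, symmetric]) simp
  show "(\<integral>\<^sup>+J'. emeasure \<mu> (ivl J') \<partial>count_space ?C') \<le> emeasure \<mu> \<Omega>'"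
   by (simp add: emeasure_comp_ivls[OF \<Omega>'])
  show "(\<integral>\<^sup>+J'. ivl_mass \<mu> r (fst J') (snd J') \<partial>count_space ?C') \<le> emeasure \<mu> \<Omega>' + ennreal r * tail_mass \<Omega>'"
   unfolding tail_mass_def by (rule sum_ivl_mass_le[OF \<Omega>'])
 qed auto
 finally show ?thesis .
qed

text \<open>The filling hypothesis holds from every point of \<open>E\<close> to the right end of its component, which gives
  the filling of the halving pieces that \<open>mu_le_of_fill\<close> requires.\<close>
lemma good_lambda:
 assumes \<Omega>: "open \<Omega>" "bounded \<Omega>" and E: "E \<in> sets borel" "E \<subseteq> \<Omega>" and \<eta>: "\<eta> \<ge> 0"
  and fill: "\<And>J \<xi>. J \<in> comp_ivls \<Omega> \<Longrightarrow> \<xi> \<in> E \<Longrightarrow> \<xi> \<in> ivl J \<Longrightarrow> emeasure lborel (E \<inter> {\<xi>..<snd J}) \<le> ennreal (\<eta> * (snd J - \<xi>))"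
 shows "emeasure \<mu> E \<le> ennreal (8 * Cw * (4 * \<eta>) powr \<epsilon>0) * (emeasure \<mu> \<Omega> + ennreal r * tail_mass \<Omega>)"
proof -
 let ?C = "comp_ivls \<Omega>"
 have each: "emeasure \<mu> (E \<inter> ivl J) \<le> ennreal (8 * Cw * (2 * (2 * \<eta>)) powr \<epsilon>0) * ivl_mass \<mu> r (fst J) (snd J)" if J: "J \<in> ?C" for J
 proof (rule mu_le_of_fill)
  define a b where "a = fst J" and "b = snd J"
  show ab: "fst J < snd J" using J by (simp add: comp_ivls_def)
  show "E \<inter> ivl J \<in> sets borel" using E by simp
  show "E \<inter> ivl J \<subseteq> {fst J<..<snd J}" by (auto simp: ivl_def)
  show "0 \<le> 2 * \<eta>" using \<eta> by simp
  fix i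
  show "emeasure lborel (E \<inter> ivl J \<inter> {halving (fst J) (snd J) i<..<halving (fst J) (snd J) (Suc i)})
    \<le> ennreal (2 * \<eta> * (halving (fst J) (snd J) (Suc i) - halving (fst J) (snd J) i))"
   unfolding a_def[symmetric] b_def[symmetric]
  proof (rule emeasure_le_by_right_parts)
   fix \<xi> assume \<xi>: "\<xi> \<in> E \<inter> ivl J \<inter> {halving a b i<..<halving a b (Suc i)}"
   have "emeasure lborel (E \<inter> ivl J \<inter> {halving a b i<..<halving a b (Suc i)} \<inter> {\<xi>..}) \<le> emeasure lborel (E \<inter> {\<xi>..<snd J})"
    using E by (intro emeasure_mono) (auto simp: ivl_def)
   also have "\<dots> \<le> ennreal (\<eta> * (snd J - \<xi>))" using \<xi> by (intro fill[OF J]) auto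
   also have "\<dots> \<le> ennreal (\<eta> * (b - halving a b i))"
    using \<xi> \<eta> by (intro ennreal_leI mult_left_mono) (auto simp: b_def)
   also have "b - halving a b i = 2 * (halving a b (Suc i) - halving a b i)" by (rule halving_double)
   finally show "emeasure lborel (E \<inter> ivl J \<inter> {halving a b i<..<halving a b (Suc i)} \<inter> {\<xi>..}) \<le> ennreal (2 * \<eta> * (halving a b (Suc i) - halving a b i))"
    by (simp add: mult_ac)
  qed (use E in \<open>auto intro: bdd_belowI[of _ "halving a b i"]\<close>)
 qed
 have "E = (\<Union>J\<in>?C. E \<inter> ivl J)" using Union_comp_ivls[OF \<Omega>] E(2) by blast
 then have "emeasure \<mu> E = emeasure \<mu> (\<Union>J\<in>?C. E \<inter> ivl J)" by simp
 also have "\<dots> \<le> (\<integral>\<^sup>+J. emeasure \<mu> (E \<inter> ivl J) \<partial>count_space ?C)"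
  using E by (intro emeasure_UN_le_count_space countable_comp_ivls) auto
 also have "\<dots> \<le> (\<integral>\<^sup>+J. ennreal (8 * Cw * (2 * (2 * \<eta>)) powr \<epsilon>0) * ivl_mass \<mu> r (fst J) (snd J) \<partial>count_space ?C)"
  by (intro nn_integral_mono each) simp
 also have "\<dots> = ennreal (8 * Cw * (4 * \<eta>) powr \<epsilon>0) * (\<integral>\<^sup>+J. ivl_mass \<mu> r (fst J) (snd J) \<partial>count_space ?C)"
  by (subst nn_integral_cmult) auto
 also have "\<dots> \<le> ennreal (8 * Cw * (4 * \<eta>) powr \<epsilon>0) * (emeasure \<mu> \<Omega> + ennreal r * tail_mass \<Omega>)"
  unfolding tail_mass_def by (intro mult_left_mono sum_ivl_mass_le \<Omega>) simp
 finally show ?thesis .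
qed

definition base_const :: real where "base_const = decay_const + near_const / decay_const + 1"

text \<open>The bound from which the iteration starts: without any information on how \<open>\<Omega>\<close> fills the interval,
  the trivial proportion 1 is used.\<close>
lemma base_bound:
 assumes \<Omega>: "open \<Omega>" "\<Omega> \<subseteq> {\<alpha><..<\<beta>}" and ab: "\<alpha> < \<beta>"
 shows "emeasure \<mu> \<Omega> \<le> ivl_mass \<mu> r (\<alpha> - (\<beta> - \<alpha>)) \<beta>" "tail_mass \<Omega> \<le> ennreal base_const * ivl_mass \<mu> r (\<alpha> - (\<beta> - \<alpha>)) \<beta>"
proof -
 define q where "q = \<alpha> - (\<beta> - \<alpha>)"
 have q: "q < \<alpha>" "q < \<beta>" using ab by (auto simp: q_def)
 let ?V = "ivl_mass \<mu> r q \<beta>" and ?C = "comp_ivls \<Omega>"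
 have QV: "emeasure \<mu> {q<..<\<beta>} \<le> ?V"
 proof -
  have "emeasure \<mu> {q<..<\<beta>} = (\<integral>\<^sup>+x. indicator {q<..<\<beta>} x \<partial>\<mu>)" by simp
  also have "\<dots> \<le> ?V" unfolding ivl_mass_def by (intro nn_integral_mono) (auto simp: indicator_def ivl_max_def)
  finally show ?thesis .
 qed
 show "emeasure \<mu> \<Omega> \<le> ivl_mass \<mu> r (\<alpha> - (\<beta> - \<alpha>)) \<beta>"
  using \<Omega>(2) q unfolding q_def[symmetric] by (intro order_trans[OF emeasure_mono QV]) auto
 have C: "fst J < snd J \<and> \<alpha> \<le> fst J \<and> snd J \<le> \<beta>" if "J \<in> ?C" for J
 proof -
  have "fst J < snd J" "ivl J \<subseteq> {\<alpha><..<\<beta>}" using that \<Omega>(2) by (auto simp: comp_ivls_def)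
  then show ?thesis unfolding ivl_def by (subst (asm) greaterThanLessThan_subseteq_greaterThanLessThan) auto
 qed
 have pt: "tail_sum r \<Omega> x \<le> ennreal (ivl_max q \<beta> x powr r) + tail_sum r \<Omega> x * indicator {q<..<\<beta>} x" for x
 proof -
  consider "x \<le> q" | "x \<in> {q<..<\<beta>}" | "x \<ge> \<beta>" by force
  then show ?thesis
  proof cases
   case 1
   have "tail_sum r \<Omega> x \<le> ennreal (1 powr r) * ivl_tail r (\<alpha>, \<beta>) x"
    unfolding tail_sum_def
   proof (rule ivl_tail_sum_le[OF countable_comp_ivls])
    fix v assume v: "fst (\<alpha>, \<beta>) < v"
    have "(\<integral>\<^sup>+J. ennreal (len (fst J) (snd J) v) \<partial>count_space ?C) = (\<integral>\<^sup>+J. emeasure lborel (ivl J \<inter> {..<v}) \<partial>count_space ?C)"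
     using C by (intro nn_integral_cong len_eq_measure) auto
    also have "\<dots> = emeasure lborel (\<Union>J\<in>?C. ivl J \<inter> {..<v})"
    proof (rule emeasure_UN_countable[symmetric])
     show "disjoint_family_on (\<lambda>J. ivl J \<inter> {..<v}) ?C"
      using comp_ivls_disjoint[of \<Omega>] unfolding disjoint_family_on_def by blast
    qed (use countable_comp_ivls in auto)
    also have "\<dots> \<le> emeasure lborel {\<alpha><..<min v \<beta>}"
     using C by (intro emeasure_mono) (force simp: ivl_def)+
    also have "\<dots> = ennreal (1 * len (fst (\<alpha>, \<beta>)) (snd (\<alpha>, \<beta>)) v)" using v ab by (auto simp: len_def)
    finally show "(\<integral>\<^sup>+J. ennreal (len (fst J) (snd J) v) \<partial>count_space ?C) \<le> ennreal (1 * len (fst (\<alpha>, \<beta>)) (snd (\<alpha>, \<beta>)) v)" .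
   qed (use r 1 q C in auto)
   also have "\<dots> \<le> ennreal (ivl_max q \<beta> x powr r)"
    using ivl_tail_le_max[OF r ab, of x] 1 by (simp add: q_def)
   finally show ?thesis by (simp add: add_increasing2)
  next
   case 2
   then show ?thesis by (simp add: add_increasing)
  next
   case 3
   have "tail_sum r \<Omega> x = (\<integral>\<^sup>+J. 0 \<partial>count_space ?C)"
    unfolding tail_sum_def using 3 C by (intro nn_integral_cong) (force simp: ivl_tail_def)
   then show ?thesis by simp
  qed
 qed
 have "tail_mass \<Omega> \<le> (\<integral>\<^sup>+x. ennreal (ivl_max q \<beta> x powr r) + tail_sum r \<Omega> x * indicator {q<..<\<beta>} x \<partial>\<mu>)"
  unfolding tail_mass_def by (intro nn_integral_mono pt)
 also have "\<dots> = ?V + (\<integral>\<^sup>+x. tail_sum r \<Omega> x * indicator {q<..<\<beta>} x \<partial>\<mu>)"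
  unfolding ivl_mass_def by (rule nn_integral_add) measurable
 also have "\<dots> \<le> ?V + (ennreal decay_const * emeasure \<mu> {q<..<\<beta>} + ennreal (near_const / decay_const) * ?V)"
  unfolding tail_sum_def
 proof (intro add_left_mono near_bound[OF countable_comp_ivls comp_ivls_disjoint _ q(2) order_refl])
  fix J assume "J \<in> ?C"
  then show "fst J < snd J \<and> snd J \<le> \<beta>" using C by blast
 qed
 also have "\<dots> \<le> ?V + (ennreal decay_const * ?V + ennreal (near_const / decay_const) * ?V)"
  by (intro add_left_mono add_right_mono mult_left_mono QV) simp
 also have "\<dots> = ennreal base_const * ?V"
  using near_const_nonneg by (simp add: base_const_def decay_const_def distrib_right add_ac)
 finally show "tail_mass \<Omega> \<le> ennreal base_const * ivl_mass \<mu> r (\<alpha> - (\<beta> - \<alpha>)) \<beta>" by (simp add: q_def)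
qed

end

section \<open>The Orlicz maximal operator\<close>

text \<open>This says that \<open>M\<^sub>A\<^sup>+ f (\<xi>) \<le> s\<close>, but with the integral condition at \<open>s\<close> itself in place of the
  infimum over admissible \<open>s\<close> in the Orlicz averages.\<close>
definition orlicz_le :: "(real \<Rightarrow> real) \<Rightarrow> (real \<Rightarrow> complex) \<Rightarrow> real \<Rightarrow> real \<Rightarrow> bool" where
 "orlicz_le A f \<xi> s \<longleftrightarrow> (\<forall>H>0. (\<integral>\<^sup>+y. ennreal (A (norm (f y) / s)) * indicator {\<xi>..\<xi>+H} y \<partial>lborel) \<le> ennreal H)"

definition Tmax :: "(real \<Rightarrow> complex) \<Rightarrow> (real \<Rightarrow> complex) \<Rightarrow> real \<Rightarrow> ennreal" where
 "Tmax k f x = (SUP e\<in>{0<..}. ennreal (norm (Tr k e f x)))"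

lemma Tmax_gt: "Tmax k f x > ennreal t \<longleftrightarrow> (\<exists>e>0. ennreal (norm (Tr k e f x)) > ennreal t)"
 by (auto simp: Tmax_def less_SUP_iff)

lemma Tr_le_Tmax: "e > 0 \<Longrightarrow> ennreal (norm (Tr k e f x)) \<le> Tmax k f x"
 by (auto simp: Tmax_def intro: SUP_upper)

lemma ennreal_div_le_1: "H > 0 \<Longrightarrow> x / ennreal H \<le> 1 \<longleftrightarrow> x \<le> ennreal H"
 by (cases x) (auto simp: divide_ennreal ennreal_le_1 ennreal_top_divide top_unique ennreal_le_iff2)

locale young =
 fixes A :: "real \<Rightarrow> real"
 assumes young: "young_function A"
begin

lemma A_nn: "t \<ge> 0 \<Longrightarrow> A t \<ge> 0" using young by (simp add: young_function_def)
lemma A0: "A 0 = 0" using young by (simp add: young_function_def)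

lemma A_scale: assumes "0 \<le> c" "c \<le> 1" "t \<ge> 0" shows "A (c * t) \<le> c * A t"
proof -
 have "convex_on {0..} A" using young by (simp add: young_function_def)
 from convex_onD[OF this assms(1,2), of 0 t] show ?thesis using assms A0 by simp
qed

lemma A_mono: assumes "0 \<le> s" "s \<le> t" shows "A s \<le> A t"
proof (cases "t = 0")
 case False
 then have "A s = A ((s / t) * t)" by simp
 also have "\<dots> \<le> (s / t) * A t" by (rule A_scale) (use assms False in auto)
 also have "\<dots> \<le> 1 * A t" using assms False A_nn[of t] by (intro mult_right_mono) auto
 finally show ?thesis by simp
qed (use assms in auto)

text \<open>Convexity with \<open>A 0 = 0\<close> and \<open>A 1 = 1\<close> gives \<open>t \<le> A t\<close> for \<open>t \<ge> 1\<close>; hence Orlicz averages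
  control ordinary averages.\<close>
lemma A_ge: assumes "0 \<le> t" shows "t \<le> 1 + A t"
proof (cases "t \<le> 1")
 case True
 then show ?thesis using A_nn[OF assms] by simp
next
 case False
 have "A 1 = A ((1 / t) * t)" using False by simp
 also have "\<dots> \<le> (1 / t) * A t" by (rule A_scale) (use assms False in auto)
 finally have "1 \<le> A t / t" using young by (simp add: young_function_def)
 then show ?thesis using False by (simp add: field_simps)
qed

lemma A_measurable:
 assumes f: "f \<in> borel_measurable M" and s: "s > 0"
 shows "(\<lambda>x. A (norm (f x) / s)) \<in> borel_measurable M"
proof -
 have "mono (\<lambda>t. A (max 0 t))" by (intro monoI A_mono) auto
 then have 1: "(\<lambda>t. A (max 0 t)) \<in> borel_measurable borel" by (rule borel_measurable_mono)
 have "(\<lambda>x. (\<lambda>t. A (max 0 t)) (norm (f x) / s)) \<in> borel_measurable M"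
  by (rule measurable_compose[OF _ 1]) (use f in measurable)
 then show ?thesis using s by (simp add: max_def)
qed

lemma A_div_mono: "0 < s \<Longrightarrow> s \<le> s' \<Longrightarrow> A (norm u / s') \<le> A (norm u / s)"
 by (intro A_mono) (auto intro: divide_left_mono)

lemma A_div_scale: "0 < s \<Longrightarrow> l \<ge> 1 \<Longrightarrow> A (norm u / (l * s)) \<le> (1 / l) * A (norm u / s)"
 using A_scale[of "1 / l" "norm u / s"] by (simp add: field_simps)

lemma orlicz_le_mono:
 assumes "orlicz_le A f \<xi> s" "0 < s" "s \<le> s'" shows "orlicz_le A f \<xi> s'"
 unfolding orlicz_le_def
proof (intro allI impI)
 fix H :: real assume H: "H > 0"
 have "(\<integral>\<^sup>+y. ennreal (A (norm (f y) / s')) * indicator {\<xi>..\<xi>+H} y \<partial>lborel)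
   \<le> (\<integral>\<^sup>+y. ennreal (A (norm (f y) / s)) * indicator {\<xi>..\<xi>+H} y \<partial>lborel)"
  using assms by (intro nn_integral_mono mult_right_mono ennreal_leI A_div_mono) auto
 also have "\<dots> \<le> ennreal H" using assms(1) H by (simp add: orlicz_le_def)
 finally show "(\<integral>\<^sup>+y. ennreal (A (norm (f y) / s')) * indicator {\<xi>..\<xi>+H} y \<partial>lborel) \<le> ennreal H" .
qed

lemma orlicz_le_of_less:
 assumes f: "f \<in> borel_measurable borel" and less: "M_plus_orlicz A f \<xi> < ennreal s"
 shows "orlicz_le A f \<xi> s"
 unfolding orlicz_le_def
proof (intro allI impI)
 fix H :: real assume H: "H > 0"
 let ?L = "{ennreal l | l. l > 0 \<and> (\<integral>\<^sup>+x\<in>{\<xi>..\<xi>+H}. ennreal (A (norm (f x) / l)) \<partial>lebesgue) / emeasure lebesgue {\<xi>..\<xi>+H} \<le> 1}"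
 have "orlicz_avg (\<lambda>t. ennreal (A t)) f {\<xi>..\<xi>+H} < ennreal s"
  using H less unfolding M_plus_orlicz_def by (meson SUP_lessD greaterThan_iff)
 then have "Inf ?L < ennreal s" by (simp only: orlicz_avg_def)
 then obtain l where l: "l > 0" "ennreal l < ennreal s"
  "(\<integral>\<^sup>+x\<in>{\<xi>..\<xi>+H}. ennreal (A (norm (f x) / l)) \<partial>lebesgue) / emeasure lebesgue {\<xi>..\<xi>+H} \<le> 1"
  unfolding Inf_less_iff by blast
 have ls: "l < s" using l by (simp add: ennreal_less_iff)
 have [measurable]: "(\<lambda>x. A (norm (f x) / l)) \<in> borel_measurable borel" using A_measurable[OF f l(1)] by simp
 have "(\<integral>\<^sup>+x\<in>{\<xi>..\<xi>+H}. ennreal (A (norm (f x) / l)) \<partial>lebesgue) / ennreal H \<le> 1"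
  using l(3) H by (simp add: emeasure_completion)
 then have "(\<integral>\<^sup>+x\<in>{\<xi>..\<xi>+H}. ennreal (A (norm (f x) / l)) \<partial>lebesgue) \<le> ennreal H"
  using H by (simp only: ennreal_div_le_1)
 then have "(\<integral>\<^sup>+y. ennreal (A (norm (f y) / l)) * indicator {\<xi>..\<xi>+H} y \<partial>lborel) \<le> ennreal H"
  by (subst (asm) nn_integral_completion) auto
 moreover have "(\<integral>\<^sup>+y. ennreal (A (norm (f y) / s)) * indicator {\<xi>..\<xi>+H} y \<partial>lborel)
   \<le> (\<integral>\<^sup>+y. ennreal (A (norm (f y) / l)) * indicator {\<xi>..\<xi>+H} y \<partial>lborel)"
  using l ls by (intro nn_integral_mono mult_right_mono ennreal_leI A_div_mono) auto
 ultimately show "(\<integral>\<^sup>+y. ennreal (A (norm (f y) / s)) * indicator {\<xi>..\<xi>+H} y \<partial>lborel) \<le> ennreal H" by (rule order_trans[rotated])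
qed

lemma le_of_orlicz_le:
 assumes f: "f \<in> borel_measurable borel" and s: "s > 0" and o: "orlicz_le A f \<xi> s"
 shows "M_plus_orlicz A f \<xi> \<le> ennreal s"
 unfolding M_plus_orlicz_def
proof (rule SUP_least)
 fix H :: real assume "H \<in> {0<..}"
 then have H: "H > 0" by simp
 have [measurable]: "(\<lambda>x. A (norm (f x) / s)) \<in> borel_measurable borel" using A_measurable[OF f s] by simp
 have "(\<integral>\<^sup>+x\<in>{\<xi>..\<xi>+H}. ennreal (A (norm (f x) / s)) \<partial>lebesgue) \<le> ennreal H"
  using o H unfolding orlicz_le_def by (subst nn_integral_completion) auto
 then have "(\<integral>\<^sup>+x\<in>{\<xi>..\<xi>+H}. ennreal (A (norm (f x) / s)) \<partial>lebesgue) / ennreal H \<le> 1"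
  using H by (simp only: ennreal_div_le_1)
 then show "orlicz_avg (\<lambda>t. ennreal (A t)) f {\<xi>..\<xi>+H} \<le> ennreal s"
  unfolding orlicz_avg_def using H s by (intro Inf_lower) (auto simp: emeasure_completion)
qed

lemma integral_le_of_orlicz_le:
 assumes f [measurable]: "f \<in> borel_measurable borel" and s: "s > 0" and o: "orlicz_le A f \<xi> s" and H: "H > 0"
 shows "(\<integral>\<^sup>+y. ennreal (norm (f y)) * indicator {\<xi>..\<xi>+H} y \<partial>lborel) \<le> ennreal (2 * H * s)"
proof -
 have [measurable]: "(\<lambda>x. A (norm (f x) / s)) \<in> borel_measurable borel" using A_measurable[OF f s] by simp
 have "(\<integral>\<^sup>+y. ennreal (norm (f y)) * indicator {\<xi>..\<xi>+H} y \<partial>lborel)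
   \<le> (\<integral>\<^sup>+y. ennreal s * (indicator {\<xi>..\<xi>+H} y + ennreal (A (norm (f y) / s)) * indicator {\<xi>..\<xi>+H} y) \<partial>lborel)"
 proof (rule nn_integral_mono)
  fix y
  have "norm (f y) \<le> s * (1 + A (norm (f y) / s))"
   using A_ge[of "norm (f y) / s"] s by (simp add: field_simps)
  then have "ennreal (norm (f y)) \<le> ennreal (s * (1 + A (norm (f y) / s)))" by (rule ennreal_leI)
  also have "\<dots> = ennreal s * (1 + ennreal (A (norm (f y) / s)))"
   using s A_nn[of "norm (f y) / s"] by (simp add: ennreal_mult)
  finally show "ennreal (norm (f y)) * indicator {\<xi>..\<xi>+H} y
    \<le> ennreal s * (indicator {\<xi>..\<xi>+H} y + ennreal (A (norm (f y) / s)) * indicator {\<xi>..\<xi>+H} y)"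
   by (auto simp: indicator_def)
 qed
 also have "\<dots> = ennreal s * (ennreal H + (\<integral>\<^sup>+y. ennreal (A (norm (f y) / s)) * indicator {\<xi>..\<xi>+H} y \<partial>lborel))"
  using H by (subst nn_integral_cmult, measurable) (subst nn_integral_add, auto)
 also have "\<dots> \<le> ennreal s * (ennreal H + ennreal H)"
  using o H unfolding orlicz_le_def by (intro mult_left_mono add_left_mono) auto
 also have "\<dots> = ennreal (2 * H * s)" using s H by (simp add: ennreal_mult[symmetric] mult_ac flip: ennreal_plus)
 finally show ?thesis .
qed

text \<open>The level sets of \<open>M\<^sub>A\<^sup>+ f\<close> are rising sets of the function \<open>A (|f| / s)\<close> at height 1. Openness,
  boundedness and a weak type estimate follow from the rising sun lemma.\<close>
lemma orlicz_le_level: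
 assumes g: "bcs g" and s: "s > 0"
 obtains R where "integrable lborel (\<lambda>y. A (norm (g y) / s))" "\<And>y. A (norm (g y) / s) \<ge> 0"
  "\<And>y. \<bar>y\<bar> > R \<Longrightarrow> A (norm (g y) / s) = 0"
  "\<And>x. \<not> orlicz_le A g x s \<longleftrightarrow> x \<in> rising_set (\<lambda>y. A (norm (g y) / s)) 1"
proof -
 obtain C R where C: "C > 0" "R > 0" and gm: "g \<in> borel_measurable borel"
  and gC: "\<And>x. norm (g x) \<le> C" and gR: "\<And>x. \<bar>x\<bar> > R \<Longrightarrow> g x = 0"
  using g by (rule bcsE) blast
 have m [measurable]: "(\<lambda>x. A (norm (g x) / s)) \<in> borel_measurable borel" using A_measurable[OF gm s] by simp
 have nn: "\<And>y. A (norm (g y) / s) \<ge> 0" using s by (intro A_nn) auto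
 have zero: "\<And>y. \<bar>y\<bar> > R \<Longrightarrow> A (norm (g y) / s) = 0" using gR A0 by simp
 have int: "integrable lborel (\<lambda>y. A (norm (g y) / s))"
 proof (rule Bochner_Integration.integrable_bound[OF integrable_indicator_Icc[of "A (C / s)" "-R" R]])
  show "AE y in lborel. norm (A (norm (g y) / s)) \<le> norm (A (C / s) * indicator {-R..R} y :: real)"
  proof (intro AE_I2)
   fix y
   have "A (norm (g y) / s) \<le> A (C / s)" using s gC[of y] by (intro A_mono divide_right_mono) auto
   then show "norm (A (norm (g y) / s)) \<le> norm (A (C / s) * indicator {-R..R} y :: real)"
    using nn[of y] zero[of y] by (cases "\<bar>y\<bar> > R") (auto simp: indicator_def abs_le_iff)
  qed
 qed simp
 have eq: "(\<integral>\<^sup>+y. ennreal (A (norm (g y) / s)) * indicator {x..x+H} y \<partial>lborel) = ennreal (LBINT y:{x..x+H}. A (norm (g y) / s))" for x H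
 proof -
  have "(\<integral>\<^sup>+y. ennreal (A (norm (g y) / s)) * indicator {x..x+H} y \<partial>lborel)
    = (\<integral>\<^sup>+y. ennreal (indicator {x..x+H} y *\<^sub>R A (norm (g y) / s)) \<partial>lborel)"
   by (intro nn_integral_cong) (auto simp: indicator_def)
  also have "\<dots> = ennreal (LBINT y:{x..x+H}. A (norm (g y) / s))"
   using integrable_set_integrable[OF int, of "{x..x+H}"] nn unfolding set_lebesgue_integral_def set_integrable_def
   by (intro nn_integral_eq_integral) auto
  finally show ?thesis .
 qed
 have "\<not> orlicz_le A g x s \<longleftrightarrow> x \<in> rising_set (\<lambda>y. A (norm (g y) / s)) 1" for x
 proof -
  have "(ennreal (LBINT y:{x..x+H}. A (norm (g y) / s)) \<le> ennreal H) \<longleftrightarrow> \<not> 1 * H < (LBINT y:{x..x+H}. A (norm (g y) / s))" if "H > 0" for H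
   using that by (simp add: ennreal_le_iff2 not_less)
  then show ?thesis unfolding orlicz_le_def eq rising_set_def by auto
 qed
 with int nn zero show thesis by (rule that)
qed

lemma open_not_orlicz_le: assumes "bcs g" "s > 0" shows "open {x. \<not> orlicz_le A g x s}"
proof -
 obtain R where R: "integrable lborel (\<lambda>y. A (norm (g y) / s))" "\<And>y. A (norm (g y) / s) \<ge> 0"
  "\<And>y. \<bar>y\<bar> > R \<Longrightarrow> A (norm (g y) / s) = 0"
  "\<And>x. \<not> orlicz_le A g x s \<longleftrightarrow> x \<in> rising_set (\<lambda>y. A (norm (g y) / s)) 1"
  using orlicz_le_level[OF assms] by blast
 show ?thesis using open_rising_set[OF R(1-3) zero_less_one] by (simp add: R(4))
qed

lemma not_orlicz_le_measure:
 assumes "bcs g" "s > 0"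
 shows "emeasure lborel {x. \<not> orlicz_le A g x s} \<le> (\<integral>\<^sup>+y. ennreal (A (norm (g y) / s)) \<partial>lborel)"
proof -
 obtain R where R: "integrable lborel (\<lambda>y. A (norm (g y) / s))" "\<And>y. A (norm (g y) / s) \<ge> 0"
  "\<And>y. \<bar>y\<bar> > R \<Longrightarrow> A (norm (g y) / s) = 0"
  "\<And>x. \<not> orlicz_le A g x s \<longleftrightarrow> x \<in> rising_set (\<lambda>y. A (norm (g y) / s)) 1"
  using orlicz_le_level[OF assms] by blast
 show ?thesis using rising_set_measure[OF R(1-3) zero_less_one] by (simp add: R(4))
qed

lemma M_gt_iff:
 assumes f: "f \<in> borel_measurable borel" and l: "l \<ge> 0"
 shows "M_plus_orlicz A f x > ennreal l \<longleftrightarrow> (\<exists>s>l. \<not> orlicz_le A f x s)"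
proof
 assume "M_plus_orlicz A f x > ennreal l"
 then obtain e where e: "ennreal l < e" "e < M_plus_orlicz A f x" using dense by blast
 then have "e \<noteq> top" by (metis not_top_less)
 then obtain s where s: "ennreal l < ennreal s" "ennreal s < M_plus_orlicz A f x" using e by (cases e) auto
 then have "s > l" using l by (simp add: ennreal_less_iff)
 moreover have "\<not> orlicz_le A f x s" using le_of_orlicz_le[OF f, of s x] s(2) \<open>s > l\<close> l by auto
 ultimately show "\<exists>s>l. \<not> orlicz_le A f x s" by blast
next
 assume "\<exists>s>l. \<not> orlicz_le A f x s"
 then obtain s where s: "s > l" "\<not> orlicz_le A f x s" by blast
 then have "ennreal s \<le> M_plus_orlicz A f x" using orlicz_le_of_less[OF f, of x s] by (meson not_less)
 moreover have "ennreal l < ennreal s" using s l by (simp add: ennreal_less_iff)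
 ultimately show "M_plus_orlicz A f x > ennreal l" by (rule less_le_trans[rotated])
qed

lemma open_M_gt: assumes "bcs f" "l \<ge> 0" shows "open {x. M_plus_orlicz A f x > ennreal l}"
proof -
 have "{x. M_plus_orlicz A f x > ennreal l} = (\<Union>s\<in>{l<..}. {x. \<not> orlicz_le A f x s})"
  using M_gt_iff[OF bcs_measurable[OF assms(1)] assms(2)] by auto
 then show ?thesis using open_not_orlicz_le[OF assms(1)] assms(2) by (auto intro!: open_UN)
qed

lemma bcs_restrict: "bcs f \<Longrightarrow> S \<in> sets borel \<Longrightarrow> bcs (\<lambda>y. indicator S y *\<^sub>R f y)"
 using bcs_mult_bounded[of f "\<lambda>y. of_real (indicator S y)" 1] by (simp add: scaleR_conv_of_real indicator_def)

lemma A_restrict: "s > 0 \<Longrightarrow> ennreal (A (norm (indicator S y *\<^sub>R f y) / s)) = ennreal (A (norm (f y) / s)) * indicator S y"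
 by (simp add: indicator_def A0)

text \<open>Intervals longer than \<open>h\<close> that start in \<open>[a, a + h]\<close> are contained in an interval of at most twice
  the length that starts at \<open>a\<close>, where \<open>f\<close> is controlled. Only the values of \<open>f\<close> in \<open>[a, a + 2 h]\<close> are
  left, and the weak type applies to these.\<close>
lemma M_local:
 assumes f: "bcs f" and s: "s > 0" and o: "orlicz_le A f a s" and l: "l \<ge> 2" and h: "h > 0"
 shows "emeasure lborel {x \<in> {a..a+h}. \<not> orlicz_le A f x (l * s)} \<le> ennreal (2 / l * h)"
proof -
 have fm [measurable]: "f \<in> borel_measurable borel" by (rule bcs_measurable[OF f])
 have ls: "l * s > 0" using l s by simp
 have [measurable]: "(\<lambda>y. A (norm (f y) / s)) \<in> borel_measurable borel"
  "(\<lambda>y. A (norm (f y) / (l * s))) \<in> borel_measurable borel"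
  using A_measurable[OF fm s] A_measurable[OF fm ls] by simp_all
 define f1 where "f1 y = indicator {a..a+2*h} y *\<^sub>R f y" for y
 have f1: "bcs f1" unfolding f1_def[abs_def] by (rule bcs_restrict[OF f]) simp
 have scale: "ennreal (A (norm u / (l * s))) \<le> ennreal (1 / l) * ennreal (A (norm u / s))" for u :: complex
  using A_div_scale[OF s, of l u] l A_nn[of "norm u / s"] s by (simp add: ennreal_mult[symmetric] ennreal_leI)
 have sub: "{x \<in> {a..a+h}. \<not> orlicz_le A f x (l * s)} \<subseteq> {x. \<not> orlicz_le A f1 x (l * s)}"
 proof
  fix x assume "x \<in> {x \<in> {a..a+h}. \<not> orlicz_le A f x (l * s)}"
  then have x: "a \<le> x" "x \<le> a + h" "\<not> orlicz_le A f x (l * s)" by auto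
  then obtain H where H: "H > 0" and gt: "(\<integral>\<^sup>+y. ennreal (A (norm (f y) / (l * s))) * indicator {x..x+H} y \<partial>lborel) > ennreal H"
   by (auto simp: orlicz_le_def not_le)
  have "H \<le> h"
  proof (rule ccontr)
   assume n: "\<not> H \<le> h"
   have "(\<integral>\<^sup>+y. ennreal (A (norm (f y) / (l * s))) * indicator {x..x+H} y \<partial>lborel)
     \<le> (\<integral>\<^sup>+y. ennreal (1 / l) * (ennreal (A (norm (f y) / s)) * indicator {a..a+2*H} y) \<partial>lborel)"
   proof (rule nn_integral_mono)
    fix y
    have "indicator {x..x+H} y \<le> (indicator {a..a+2*H} y :: ennreal)" using x n by (auto simp: indicator_def)
    then show "ennreal (A (norm (f y) / (l * s))) * indicator {x..x+H} y
      \<le> ennreal (1 / l) * (ennreal (A (norm (f y) / s)) * indicator {a..a+2*H} y)"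
     unfolding mult.assoc[symmetric] by (intro mult_mono scale) auto
   qed
   also have "\<dots> = ennreal (1 / l) * (\<integral>\<^sup>+y. ennreal (A (norm (f y) / s)) * indicator {a..a+2*H} y \<partial>lborel)"
    by (rule nn_integral_cmult) measurable
   also have "\<dots> \<le> ennreal (1 / l) * ennreal (2 * H)"
    using o H unfolding orlicz_le_def by (intro mult_left_mono) auto
   also have "\<dots> = ennreal (2 * H / l)" using l H by (simp add: ennreal_mult[symmetric])
   also have "\<dots> \<le> ennreal H" using l H by (intro ennreal_leI) (simp add: field_simps)
   finally show False using gt by simp
  qed
  then have "(\<integral>\<^sup>+y. ennreal (A (norm (f y) / (l * s))) * indicator {x..x+H} y \<partial>lborel)
    = (\<integral>\<^sup>+y. ennreal (A (norm (f1 y) / (l * s))) * indicator {x..x+H} y \<partial>lborel)"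
   using x by (intro nn_integral_cong) (auto simp: f1_def indicator_def)
  then show "x \<in> {x. \<not> orlicz_le A f1 x (l * s)}" using gt H by (auto simp: orlicz_le_def not_le)
 qed
 have "emeasure lborel {x \<in> {a..a+h}. \<not> orlicz_le A f x (l * s)} \<le> emeasure lborel {x. \<not> orlicz_le A f1 x (l * s)}"
  using sub open_not_orlicz_le[OF f1 ls] by (intro emeasure_mono) auto
 also have "\<dots> \<le> (\<integral>\<^sup>+y. ennreal (A (norm (f1 y) / (l * s))) \<partial>lborel)" by (rule not_orlicz_le_measure[OF f1 ls])
 also have "\<dots> \<le> (\<integral>\<^sup>+y. ennreal (1 / l) * (ennreal (A (norm (f y) / s)) * indicator {a..a+2*h} y) \<partial>lborel)"
  unfolding f1_def A_restrict[OF ls] mult.assoc[symmetric] by (intro nn_integral_mono mult_right_mono scale) auto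
 also have "\<dots> = ennreal (1 / l) * (\<integral>\<^sup>+y. ennreal (A (norm (f y) / s)) * indicator {a..a+2*h} y \<partial>lborel)"
  by (rule nn_integral_cmult) measurable
 also have "\<dots> \<le> ennreal (1 / l) * ennreal (2 * h)"
  using o h unfolding orlicz_le_def by (intro mult_left_mono) auto
 also have "\<dots> = ennreal (2 / l * h)" using l h by (simp add: ennreal_mult[symmetric])
 finally show ?thesis .
qed

text \<open>To the left of the support, moving the starting point of an interval to the right shortens the
  interval but keeps the integral.\<close>
lemma not_orlicz_le_mono_left:
 assumes supp: "\<And>y. y < -R \<Longrightarrow> f y = 0" and x: "x \<le> x'" "x' \<le> -R" and no: "\<not> orlicz_le A f x s" and s: "s > 0"
 shows "\<not> orlicz_le A f x' s"
proof -
 obtain H where H: "H > 0" and gt: "(\<integral>\<^sup>+y. ennreal (A (norm (f y) / s)) * indicator {x..x+H} y \<partial>lborel) > ennreal H"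
  using no by (auto simp: orlicz_le_def not_le)
 have "(\<integral>\<^sup>+y. ennreal (A (norm (f y) / s)) * indicator {x..x+H} y \<partial>lborel)
   = (\<integral>\<^sup>+y. ennreal (A (norm (f y) / s)) * indicator {x'..x+H} y \<partial>lborel)"
 proof (rule nn_integral_cong)
  fix y
  show "ennreal (A (norm (f y) / s)) * indicator {x..x+H} y = ennreal (A (norm (f y) / s)) * indicator {x'..x+H} y"
   using x supp[of y] A0 by (cases "y < x'") (auto simp: indicator_def)
 qed
 then have gt': "(\<integral>\<^sup>+y. ennreal (A (norm (f y) / s)) * indicator {x'..x+H} y \<partial>lborel) > ennreal H" using gt by simp
 have H': "x + H - x' > 0"
 proof (rule ccontr)
  assume "\<not> x + H - x' > 0"
  then have "(\<integral>\<^sup>+y. ennreal (A (norm (f y) / s)) * indicator {x'..x+H} y \<partial>lborel) \<le> (\<integral>\<^sup>+y. \<infinity> * indicator {x'} y \<partial>lborel)"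
   by (intro nn_integral_mono) (auto simp: indicator_def)
  also have "\<dots> = 0" by (simp add: nn_integral_cmult)
  finally show False using gt' by simp
 qed
 have "ennreal (x + H - x') \<le> ennreal H" using x by (intro ennreal_leI) simp
 also note gt'
 finally have "(\<integral>\<^sup>+y. ennreal (A (norm (f y) / s)) * indicator {x'..x'+(x + H - x')} y \<partial>lborel) > ennreal (x + H - x')" by simp
 then show ?thesis using H' unfolding orlicz_le_def by (meson leD)
qed

text \<open>Moving the starting point far to the left lengthens the interval, and the height decreases at most
  in proportion to the distance from the support, by convexity of \<open>A\<close>.\<close>
lemma not_orlicz_le_scale_left:
 assumes f: "f \<in> borel_measurable borel" and supp: "\<And>y. y < -R \<Longrightarrow> f y = 0" and x: "x \<le> x'" "x' \<le> -3*R" "R > 0"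
  and no: "\<not> orlicz_le A f x' s" and s: "s > 0"
 shows "\<not> orlicz_le A f x (s * (R - x') / (2 * (R - x)))"
proof -
 obtain H where H: "H > 0" and gt: "(\<integral>\<^sup>+y. ennreal (A (norm (f y) / s)) * indicator {x'..x'+H} y \<partial>lborel) > ennreal H"
  using no by (auto simp: orlicz_le_def not_le)
 have [measurable]: "(\<lambda>x. A (norm (f x) / s)) \<in> borel_measurable borel" using A_measurable[OF f s] by simp
 have HR: "x' + H \<ge> -R"
 proof (rule ccontr)
  assume "\<not> x' + H \<ge> -R"
  then have "ennreal (A (norm (f y) / s)) * indicator {x'..x'+H} y = 0" for y
   using supp[of y] A0 by (auto simp: indicator_def)
  then have "(\<lambda>y. ennreal (A (norm (f y) / s)) * indicator {x'..x'+H} y) = (\<lambda>y. 0)" by blast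
  then show False using gt by simp
 qed
 \<comment> \<open>\<open>1 / q\<close> bounds the ratio of the lengths of the two intervals.\<close>
 define q where "q = (R - x') / (2 * (R - x))"
 have q: "q > 0" "q \<le> 1" using x by (auto simp: q_def field_simps)
 define s' where "s' = s * q"
 have s': "s' > 0" "s = (1 / q) * s'" using s q by (auto simp: s'_def)
 have "ennreal (x' + H - x) \<le> ennreal ((1 / q) * H)"
 proof (rule ennreal_leI)
  have r: "R - x' > 0" using x by simp
  have "H \<ge> (R - x') / 2" using HR x by simp
  then have "1 \<le> 2 * H / (R - x')" using r by (simp add: field_simps)
  then have "x' - x \<le> (x' - x) * (2 * H / (R - x'))"
   using mult_left_mono[of 1 "2 * H / (R - x')" "x' - x"] x by simp
  moreover have "(1 / q) * H = 2 * H + (x' - x) * (2 * H / (R - x'))"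
   using r x by (simp add: q_def field_simps)
  ultimately show "x' + H - x \<le> (1 / q) * H" using H by linarith
 qed
 also have "\<dots> = ennreal (1 / q) * ennreal H" using q H by (intro ennreal_mult) auto
 also have "\<dots> < ennreal (1 / q) * (\<integral>\<^sup>+y. ennreal (A (norm (f y) / s)) * indicator {x'..x'+H} y \<partial>lborel)"
  using gt q by (intro ennreal_mult_strict_left_mono) auto
 also have "\<dots> = (\<integral>\<^sup>+y. ennreal (1 / q) * (ennreal (A (norm (f y) / s)) * indicator {x'..x'+H} y) \<partial>lborel)"
  by (rule nn_integral_cmult[symmetric]) measurable
 also have "\<dots> \<le> (\<integral>\<^sup>+y. ennreal (A (norm (f y) / s')) * indicator {x..x+(x' + H - x)} y \<partial>lborel)"
 proof (rule nn_integral_mono)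
  fix y
  have "A (norm (f y) / ((1 / q) * s')) \<le> (1 / (1 / q)) * A (norm (f y) / s')"
   using q s' by (intro A_div_scale) auto
  then have "A (norm (f y) / s) \<le> q * A (norm (f y) / s')" unfolding s'(2)[symmetric] by simp
  then have "(1 / q) * A (norm (f y) / s) \<le> A (norm (f y) / s')" using q by (simp add: pos_divide_le_eq mult.commute)
  then have "ennreal (1 / q) * ennreal (A (norm (f y) / s)) \<le> ennreal (A (norm (f y) / s'))"
   using q A_nn[of "norm (f y) / s"] s by (simp add: ennreal_mult[symmetric] ennreal_leI)
  moreover have "indicator {x'..x'+H} y \<le> (indicator {x..x+(x'+H-x)} y :: ennreal)" using x by (auto simp: indicator_def)
  ultimately show "ennreal (1 / q) * (ennreal (A (norm (f y) / s)) * indicator {x'..x'+H} y)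
    \<le> ennreal (A (norm (f y) / s')) * indicator {x..x+(x' + H - x)} y"
   unfolding mult.assoc[symmetric] by (intro mult_mono) auto
 qed
 finally have "\<not> orlicz_le A f x s'" using x H unfolding orlicz_le_def not_all not_imp
  by (intro exI[of _ "x' + H - x"]) auto
 then show ?thesis by (simp add: s'_def q_def)
qed

end

section \<open>Maximal truncations\<close>

text \<open>The condition \<open>H\<close> for the complementary function of \<open>A\<close>, after duality: the difference of
  the kernels is integrable against every function that is controlled at the left end of the interval
  in the Orlicz sense. The proof for Borel kernels is \<open>kernel_orlicz_bound\<close>.\<close>
locale orlicz_kernel = cz_kernel + young +
 assumes orlicz_hormander: "\<And>f s h \<xi> x z. bcs f \<Longrightarrow> s > 0 \<Longrightarrow> h > 0 \<Longrightarrow> orlicz_le A f \<xi> s \<Longrightarrow>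
   x \<in> {\<xi>..\<xi>+h} \<Longrightarrow> z \<in> {\<xi>..\<xi>+h} \<Longrightarrow>
   (\<integral>\<^sup>+y. ennreal (norm (k (y - x) - k (y - z)) * norm (f y)) * indicator {\<xi>+\<kappa>*h<..} y \<partial>lborel) \<le> ennreal (C0 * s)"
begin

lemma double_le_kappa: assumes "h > 0" shows "\<xi> + 2 * h \<le> \<xi> + \<kappa> * h"
 using mult_right_mono[OF kappa, of h] assms by simp

lemma Tr_shift: "Tr k e f x = (LBINT y. trunc k e (y - x) * f y)"
 unfolding Tr_def using lborel_integral_real_affine[of 1 "\<lambda>v. trunc k e v * f (x + v)" "-x"] by simp

text \<open>The truncations at \<open>x\<close> and \<open>z\<close> are chosen so that both integrals start at the same point \<open>Y\<close>; then
  their difference is an integral against the difference of the kernels.\<close>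
lemma Tr_compare:
 assumes f: "bcs f" and s: "s > 0" and h: "h > 0" and o: "orlicz_le A f \<xi> s"
  and x: "x \<in> {\<xi>..\<xi>+h}" and z: "z \<in> {\<xi>..\<xi>+h}" and Y: "Y \<ge> \<xi> + \<kappa> * h"
 shows "norm (Tr k (Y - x) f x - Tr k (Y - z) f z) \<le> C0 * s"
proof -
 have pos: "Y - x > 0" "Y - z > 0" using Y double_le_kappa[OF h, of \<xi>] h x z unfolding atLeastAtMost_iff by linarith+
 have [measurable]: "f \<in> borel_measurable borel" by (rule bcs_measurable[OF f])
 have int: "integrable lborel (\<lambda>y. trunc k (Y - u) (y - u) * f y)" if "Y - u > 0" for u
  by (rule integrable_bcs[OF bcs_mult_bounded[OF f, where B = "B2 / (Y - u)"]]) (auto intro: trunc_bounded that)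
 have "Tr k (Y - x) f x - Tr k (Y - z) f z
   = (LBINT y. trunc k (Y - x) (y - x) * f y - trunc k (Y - z) (y - z) * f y)"
  unfolding Tr_shift by (rule Bochner_Integration.integral_diff[OF int int, symmetric]) (use pos in auto)
 also have "\<dots> = (LBINT y. indicator {Y<..} y *\<^sub>R (k (y - x) - k (y - z)) * f y)"
  by (intro Bochner_Integration.integral_cong refl) (auto simp: trunc_def indicator_def algebra_simps)
 finally have eq: "Tr k (Y - x) f x - Tr k (Y - z) f z = (LBINT y. indicator {Y<..} y *\<^sub>R (k (y - x) - k (y - z)) * f y)" .
 have "ennreal (norm (Tr k (Y - x) f x - Tr k (Y - z) f z))
   \<le> (\<integral>\<^sup>+y. ennreal (norm (indicator {Y<..} y *\<^sub>R (k (y - x) - k (y - z)) * f y)) \<partial>lborel)"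
  unfolding eq
 proof (rule integral_norm_bound_ennreal)
  have "integrable lborel (\<lambda>y. trunc k (Y - x) (y - x) * f y - trunc k (Y - z) (y - z) * f y)"
   using int pos by (intro Bochner_Integration.integrable_diff) auto
  also have "(\<lambda>y. trunc k (Y - x) (y - x) * f y - trunc k (Y - z) (y - z) * f y)
    = (\<lambda>y. indicator {Y<..} y *\<^sub>R (k (y - x) - k (y - z)) * f y)"
   by (rule ext) (auto simp: trunc_def indicator_def algebra_simps)
  finally show "integrable lborel (\<lambda>y. indicator {Y<..} y *\<^sub>R (k (y - x) - k (y - z)) * f y)" .
 qed
 also have "\<dots> \<le> (\<integral>\<^sup>+y. ennreal (norm (k (y - x) - k (y - z)) * norm (f y)) * indicator {\<xi>+\<kappa>*h<..} y \<partial>lborel)"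
  using Y by (intro nn_integral_mono) (auto simp: indicator_def norm_mult)
 also have "\<dots> \<le> ennreal (C0 * s)" by (rule orlicz_hormander[OF f s h o x z])
 finally show ?thesis using C0 s by (subst (asm) ennreal_le_iff) auto
qed

text \<open>With control of the function at height \<open>\<gamma> t\<close>, both the passage between two points and the exceptional set of
  the local part cost only a quarter of \<open>t\<close> and half of the interval, respectively.\<close>
definition \<gamma> :: real where "\<gamma> = min (1 / (4 * (C0 + 1))) (1 / (16 * \<kappa> * weak_const))"

lemma \<gamma>: "\<gamma> > 0" "C0 * \<gamma> \<le> 1 / 4" "\<gamma> \<le> 1 / (16 * \<kappa> * weak_const)"
proof -
 show "\<gamma> > 0" using C0 kappa weak_const_pos by (simp add: \<gamma>_def)
 have "C0 * \<gamma> \<le> C0 * (1 / (4 * (C0 + 1)))" using C0 by (intro mult_left_mono) (auto simp: \<gamma>_def)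
 also have "\<dots> \<le> 1 / 4" using C0 by (simp add: field_simps)
 finally show "C0 * \<gamma> \<le> 1 / 4" .
qed (simp add: \<gamma>_def)

text \<open>Cotlar's inequality in terms of level sets. The truncation at \<open>x\<close> that starts at \<open>Y = x + e\<close> is
  compared with the one at a point \<open>z\<close> close to \<open>x\<close> that starts at the same \<open>Y\<close>. This one differs from
  the fine truncation at \<open>z\<close> by the contribution of \<open>g\<close> on \<open>[x, Y]\<close>, which is small for most \<open>z\<close> by
  the weak type. So at least half of an interval to the right of \<open>x\<close> lies in a level set of a single
  truncated operator.\<close>
lemma cotlar_point:
 assumes g: "bcs g" and t: "t > 0" and \<eta>: "\<eta> > 0" and e: "e \<ge> 2 * \<eta>"
  and big: "norm (Tr k e g x) > t" and o: "orlicz_le A g x (\<gamma> * t)"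
 shows "emeasure lborel ({z. norm (Tr k \<eta> g z) > t / 2} \<inter> {x..x + e / \<kappa>}) \<ge> ennreal (e / \<kappa> / 2)"
proof -
 have [measurable]: "g \<in> borel_measurable borel" by (rule bcs_measurable[OF g])
 have e0: "e > 0" using e \<eta> by simp
 define h where "h = e / \<kappa>"
 have h: "h > 0" "\<kappa> * h = e" using e0 kappa by (auto simp: h_def)
 have h2: "h \<le> e / 2" using h kappa mult_right_mono[OF kappa, of h] by simp
 define Y where "Y = x + e"
 have gt: "\<gamma> * t > 0" using \<gamma> t by simp
 define g1 where "g1 y = indicator {x..Y} y *\<^sub>R g y" for y
 have g1: "bcs g1" unfolding g1_def[abs_def] by (rule bcs_restrict[OF g]) simp
 have mT [measurable]: "Tr k \<eta> g \<in> borel_measurable borel" "Tr k \<eta> g1 \<in> borel_measurable borel"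
  using Tr_measurable[OF \<eta>] g g1 by auto
 define B where "B = {z. norm (Tr k \<eta> g1 z) > t / 4}"
 define S where "S = {z. norm (Tr k \<eta> g z) > t / 2} \<inter> {x..x + h}"
 have [measurable]: "B \<in> sets borel" "S \<in> sets borel" unfolding B_def S_def by measurable
 have cover: "{x..x+h} \<subseteq> S \<union> B"
 proof
  fix z assume z: "z \<in> {x..x+h}"
  show "z \<in> S \<union> B"
  proof (rule ccontr)
   assume n: "z \<notin> S \<union> B"
   then have n1: "norm (Tr k \<eta> g z) \<le> t / 2" and n2: "norm (Tr k \<eta> g1 z) \<le> t / 4"
    using z by (auto simp: S_def B_def)
   have "norm (Tr k (Y - x) g x - Tr k (Y - z) g z) \<le> C0 * (\<gamma> * t)"
    by (rule Tr_compare[OF g gt h(1) o]) (use z h in \<open>auto simp: Y_def\<close>)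
   also have "\<dots> \<le> t / 4" using mult_right_mono[OF \<gamma>(2), of t] t by simp
   finally have c: "norm (Tr k e g x - Tr k (Y - z) g z) \<le> t / 4" by (simp add: Y_def)
   have Yz: "Y - z \<ge> \<eta>" "Y - z > 0" using z h2 e \<eta> by (auto simp: Y_def)
   have "Tr k \<eta> g z - Tr k (Y - z) g z = (LBINT v. trunc k \<eta> v * g (z + v) - trunc k (Y - z) v * g (z + v))"
    unfolding Tr_def
    by (rule Bochner_Integration.integral_diff[OF integrable_bcs integrable_bcs, symmetric])
      (use Yz \<eta> g in \<open>auto intro: bcs_trunc_mult\<close>)
   also have "\<dots> = Tr k \<eta> g1 z"
    unfolding Tr_def
   proof (intro Bochner_Integration.integral_cong refl)
    fix v
    show "trunc k \<eta> v * g (z + v) - trunc k (Y - z) v * g (z + v) = trunc k \<eta> v * g1 (z + v)"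
     using z Yz \<eta> by (auto simp: trunc_def g1_def indicator_def)
   qed
   finally have "Tr k (Y - z) g z = Tr k \<eta> g z - Tr k \<eta> g1 z"
    by (metis add_diff_cancel_left' diff_add_cancel)
   then have "norm (Tr k e g x) \<le> norm (Tr k e g x - Tr k (Y - z) g z) + (norm (Tr k \<eta> g z) + norm (Tr k \<eta> g1 z))"
    by (metis add_left_mono diff_add_cancel norm_triangle_ineq norm_triangle_ineq4 order_trans)
   then show False using c n1 n2 big by linarith
  qed
 qed
 have mB: "emeasure lborel B \<le> ennreal (h / 2)"
 proof -
  have "ennreal (LBINT y. norm (g1 y)) = (\<integral>\<^sup>+y. ennreal (norm (g1 y)) \<partial>lborel)"
   using integrable_bcs[OF g1] by (intro nn_integral_eq_integral[symmetric]) auto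
  also have "\<dots> = (\<integral>\<^sup>+y. ennreal (norm (g y)) * indicator {x..x+e} y \<partial>lborel)"
   by (intro nn_integral_cong) (auto simp: g1_def Y_def indicator_def)
  also have "\<dots> \<le> ennreal (2 * e * (\<gamma> * t))"
   by (rule integral_le_of_orlicz_le[OF _ gt o e0]) measurable
  finally have G: "(LBINT y. norm (g1 y)) \<le> 2 * e * (\<gamma> * t)"
   using e0 gt by (subst (asm) ennreal_le_iff) auto
  have "ennreal (t / 4) * emeasure lborel B \<le> ennreal (weak_const * (LBINT y. norm (g1 y)))"
   unfolding B_def by (rule Tr_weak_type[OF \<eta> g1]) (use t in simp)
  also have "\<dots> \<le> ennreal (weak_const * (2 * e * (\<gamma> * t)))"
   using G weak_const_pos by (intro ennreal_leI mult_left_mono) auto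
  also have "\<dots> \<le> ennreal (t / 4 * (h / 2))"
  proof (rule ennreal_leI)
   have "weak_const * (2 * e * (\<gamma> * t)) = (2 * weak_const * e * t) * \<gamma>" by simp
   also have "\<dots> \<le> (2 * weak_const * e * t) * (1 / (16 * \<kappa> * weak_const))"
    using weak_const_pos e0 t \<gamma>(3) by (intro mult_left_mono) auto
   also have "\<dots> = t / 4 * (h / 2)" using weak_const_pos kappa by (simp add: h_def field_simps)
   finally show "weak_const * (2 * e * (\<gamma> * t)) \<le> t / 4 * (h / 2)" .
  qed
  also have "\<dots> = ennreal (t / 4) * ennreal (h / 2)" using t h by (intro ennreal_mult) auto
  finally show ?thesis using t by (subst (asm) ennreal_mult_le_mult_iff) auto
 qed
 have "ennreal h = emeasure lborel {x..x+h}" using h by simp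
 also have "\<dots> \<le> emeasure lborel (S \<union> B)" by (rule emeasure_mono[OF cover]) simp
 also have "\<dots> \<le> emeasure lborel S + emeasure lborel B" by (rule emeasure_subadditive) auto
 also have "\<dots> \<le> emeasure lborel S + ennreal (h / 2)" using mB by (rule add_left_mono)
 finally have "ennreal (h / 2) + ennreal (h / 2) \<le> emeasure lborel S + ennreal (h / 2)"
  using h by (simp flip: ennreal_plus)
 then have "ennreal (h / 2) \<le> emeasure lborel S" by (simp add: ennreal_add_left_cancel_le add.commute)
 then show ?thesis by (simp add: S_def h_def)
qed

lemma Tr_zero_right: assumes "\<And>y. y > R \<Longrightarrow> f y = 0" "x + e \<ge> R" "e > 0" shows "Tr k e f x = 0"
proof -
 have "trunc k e (y - x) * f y = 0" for y
  using assms(1)[of y] assms(2) by (cases "y > R") (auto simp: trunc_def indicator_def)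
 then have "(\<lambda>y. trunc k e (y - x) * f y) = (\<lambda>y. 0)" by blast
 then show ?thesis unfolding Tr_shift by simp
qed

lemma open_Tr_gt: "e > 0 \<Longrightarrow> bcs f \<Longrightarrow> open {x. norm (Tr k e f x) > t}"
 using continuous_Tr[of e f] by (intro open_Collect_less continuous_intros) auto

lemma open_Tmax_gt: "bcs f \<Longrightarrow> t \<ge> 0 \<Longrightarrow> open {x. Tmax k f x > ennreal t}"
proof -
 assume f: "bcs f" and t: "t \<ge> 0"
 have "{x. Tmax k f x > ennreal t} = (\<Union>e\<in>{0<..}. {x. norm (Tr k e f x) > t})"
  using t by (auto simp: Tmax_gt ennreal_less_iff)
 then show ?thesis using open_Tr_gt[OF _ f] by (auto intro!: open_UN)
qed

text \<open>By \<open>cotlar_point\<close>, the points where some truncation at distance at least \<open>2 \<eta>\<close> is large lie in the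
  rising set of the indicator of a level set of the truncation at \<open>\<eta>\<close>. The weak type of the latter is
  uniform in \<open>\<eta>\<close>, which tends to 0.\<close>
lemma cotlar_weak:
 assumes g: "bcs g" and t: "t > 0"
 shows "emeasure lborel {x \<in> {a..b}. Tmax k g x > ennreal t \<and> orlicz_le A g x (\<gamma> * t)} \<le> ennreal (6 * weak_const / t * (LBINT y. norm (g y)))"
proof -
 obtain C R where C: "C > 0" "R > 0" and [measurable]: "g \<in> borel_measurable borel" and "\<And>x. norm (g x) \<le> C"
  and gR: "\<And>x. \<bar>x\<bar> > R \<Longrightarrow> g x = 0"
  using g by (rule bcsE) blast
 have gt: "\<gamma> * t > 0" using \<gamma> t by simp
 define G where "G = (LBINT y. norm (g y))"
 have G0: "G \<ge> 0" by (simp add: G_def)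
 define E where "E n = {x \<in> {a..b}. (\<exists>e\<ge>2 * inverse (real (Suc n)). norm (Tr k e g x) > t) \<and> orlicz_le A g x (\<gamma> * t)}" for n
 have Em: "E n \<in> sets borel" for n
 proof -
  have "E n = {a..b} \<inter> ((\<Union>e\<in>{2 * inverse (real (Suc n))..}. {x. norm (Tr k e g x) > t}) \<inter> - {x. \<not> orlicz_le A g x (\<gamma> * t)})"
   by (auto simp: E_def)
  moreover have "open (\<Union>e\<in>{2 * inverse (real (Suc n))..}. {x. norm (Tr k e g x) > t})"
  proof (intro open_UN ballI open_Tr_gt g)
   fix e assume "e \<in> {2 * inverse (real (Suc n))..}"
   then show "0 < e" using less_le_trans[of 0 "2 * inverse (real (Suc n))" e] by (simp del: of_nat_Suc)
  qed
  moreover have "open {x. \<not> orlicz_le A g x (\<gamma> * t)}" by (rule open_not_orlicz_le[OF g gt])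
  ultimately show ?thesis by (auto intro!: sets.Int borel_comp)
 qed
 have E_le: "emeasure lborel (E n) \<le> ennreal (6 * weak_const / t * G)" for n
 proof -
  define \<eta> where "\<eta> = inverse (real (Suc n))"
  have \<eta>: "\<eta> > 0" by (simp add: \<eta>_def)
  \<comment> \<open>Restricting to a bounded set makes the indicator integrable; points with a nonzero truncation
   have \<open>x + e < R\<close>, so nothing is lost.\<close>
  define P where "P = \<bar>a\<bar> + \<bar>b\<bar> + R"
  define S where "S = {z. norm (Tr k \<eta> g z) > t / 2} \<inter> {-P..P}"
  have [measurable]: "Tr k \<eta> g \<in> borel_measurable borel" by (rule Tr_measurable[OF \<eta> g])
  have Sm [measurable]: "S \<in> sets borel" unfolding S_def by measurable
  have iS: "integrable lborel (\<lambda>x. indicator S x :: real)"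
  proof (rule integrable_real_indicator)
   have "emeasure lborel S \<le> emeasure lborel {-P..P}" by (rule emeasure_mono) (auto simp: S_def)
   then show "emeasure lborel S < \<infinity>" by (rule order_le_less_trans) (simp add: emeasure_lborel_Icc_eq)
  qed simp
  \<comment> \<open>The level set fills half of an interval; the height \<open>1 / 3\<close> leaves room for the strict inequality.\<close>
  have sub: "E n \<subseteq> rising_set (indicator S) (1 / 3)"
  proof
   fix x assume "x \<in> E n"
   then obtain e where x: "x \<in> {a..b}" and e: "e \<ge> 2 * \<eta>" "norm (Tr k e g x) > t" and o: "orlicz_le A g x (\<gamma> * t)"
    by (auto simp: E_def \<eta>_def)
   have e0: "e > 0" using e \<eta> by simp
   have "x + e < R"
   proof (rule ccontr)
    assume "\<not> x + e < R"
    then have "Tr k e g x = 0" using e0 by (intro Tr_zero_right[of R]) (auto intro: gR)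
    then show False using e(2) t by simp
   qed
   define h where "h = e / \<kappa>"
   have h: "h > 0" "h \<le> e" using e0 kappa by (auto simp: h_def field_simps)
   have "{x..x+h} \<subseteq> {-P..P}" using x h \<open>x + e < R\<close> C(2) by (auto simp: P_def)
   then have "S \<inter> {x..x+h} = {z. norm (Tr k \<eta> g z) > t / 2} \<inter> {x..x+h}" by (auto simp: S_def)
   then have "ennreal (h / 2) \<le> emeasure lborel (S \<inter> {x..x+h})"
    using cotlar_point[OF g t \<eta> e o] by (simp add: h_def)
   also have "\<dots> = ennreal (LBINT y:{x..x+h}. indicator S y)"
   proof -
    have "emeasure lborel (S \<inter> {x..x+h}) = (\<integral>\<^sup>+y. ennreal (indicator {x..x+h} y *\<^sub>R indicator S y) \<partial>lborel)"
    proof -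
     have "emeasure lborel (S \<inter> {x..x+h}) = (\<integral>\<^sup>+y. indicator (S \<inter> {x..x+h}) y \<partial>lborel)"
      by (rule nn_integral_indicator[symmetric]) simp
     also have "\<dots> = (\<integral>\<^sup>+y. ennreal (indicator {x..x+h} y *\<^sub>R indicator S y) \<partial>lborel)"
      by (intro nn_integral_cong) (auto simp: indicator_def)
     finally show ?thesis .
    qed
    also have "\<dots> = ennreal (LBINT y:{x..x+h}. indicator S y)"
     using integrable_set_integrable[OF iS, of "{x..x+h}"] unfolding set_lebesgue_integral_def set_integrable_def
     by (intro nn_integral_eq_integral) auto
    finally show ?thesis .
   qed
   finally have le: "ennreal (h / 2) \<le> ennreal (LBINT y:{x..x+h}. indicator S y)" .
   have nn: "0 \<le> (LBINT y:{x..x+h}. indicator S y :: real)"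
    unfolding set_lebesgue_integral_def by (intro Bochner_Integration.integral_nonneg) auto
   have "h / 2 \<le> (LBINT y:{x..x+h}. indicator S y)"
    using le nn by (simp only: ennreal_le_iff)
   then have "(1 / 3) * h < (LBINT y:{x..x+h}. indicator S y)" using h by linarith
   then show "x \<in> rising_set (indicator S) (1 / 3)" using h by (auto simp: rising_set_def)
  qed
  have rm: "ennreal (1 / 3) * emeasure lborel (rising_set (indicator S) (1 / 3)) \<le> (\<integral>\<^sup>+x. ennreal (indicator S x) \<partial>lborel)"
   by (rule rising_set_measure[OF iS, where R = P]) (auto simp: S_def indicator_def abs_if split: if_splits)
  have ro: "open (rising_set (indicator S) (1 / 3))"
   by (rule open_rising_set[OF iS, where R = P]) (auto simp: S_def indicator_def abs_if split: if_splits)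
  have "ennreal (t / 2) * (ennreal (1 / 3) * emeasure lborel (E n))
    \<le> ennreal (t / 2) * (ennreal (1 / 3) * emeasure lborel (rising_set (indicator S) (1 / 3)))"
   using sub ro by (intro mult_left_mono emeasure_mono) auto
  also have "\<dots> \<le> ennreal (t / 2) * emeasure lborel S"
   using rm by (intro mult_left_mono) (auto simp: ennreal_indicator)
  also have "\<dots> \<le> ennreal (t / 2) * emeasure lborel {z. norm (Tr k \<eta> g z) > t / 2}"
   by (intro mult_left_mono emeasure_mono) (auto simp: S_def)
  also have "\<dots> \<le> ennreal (weak_const * G)" unfolding G_def by (rule Tr_weak_type[OF \<eta> g]) (use t in simp)
  finally have "ennreal (6 / t) * (ennreal (t / 2) * (ennreal (1 / 3) * emeasure lborel (E n))) \<le> ennreal (6 / t) * ennreal (weak_const * G)"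
   by (rule mult_left_mono) simp
  moreover have "ennreal (6 / t) * (ennreal (t / 2) * ennreal (1 / 3)) = 1"
   using t by (simp add: ennreal_mult[symmetric])
  then have "ennreal (6 / t) * (ennreal (t / 2) * (ennreal (1 / 3) * emeasure lborel (E n))) = emeasure lborel (E n)"
   by (simp add: mult.assoc[symmetric])
  moreover have "ennreal (6 / t) * ennreal (weak_const * G) = ennreal (6 * weak_const / t * G)"
   using t weak_const_pos G0 by (subst ennreal_mult[symmetric]) auto
  ultimately show ?thesis by simp
 qed
 have un: "{x \<in> {a..b}. Tmax k g x > ennreal t \<and> orlicz_le A g x (\<gamma> * t)} = (\<Union>n. E n)"
 proof (rule set_eqI, rule iffI)
  fix x assume x: "x \<in> {x \<in> {a..b}. Tmax k g x > ennreal t \<and> orlicz_le A g x (\<gamma> * t)}"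
  then obtain e where e: "e > 0" "norm (Tr k e g x) > t" using t by (auto simp: Tmax_gt ennreal_less_iff)
  obtain n where "inverse (real (Suc n)) < e / 2" using reals_Archimedean[of "e/2"] e by auto
  then have "x \<in> E n" using x e by (auto simp: E_def intro!: exI[of _ e] simp del: of_nat_Suc)
  then show "x \<in> (\<Union>n. E n)" by blast
 next
  fix x assume "x \<in> (\<Union>n. E n)"
  then obtain n e where x: "x \<in> {a..b}" "orlicz_le A g x (\<gamma> * t)" and e: "e \<ge> 2 * inverse (real (Suc n))" "norm (Tr k e g x) > t"
   by (auto simp: E_def)
  have "e > 0" using e(1) less_le_trans[of 0 "2 * inverse (real (Suc n))" e] by (simp del: of_nat_Suc)
  then show "x \<in> {x \<in> {a..b}. Tmax k g x > ennreal t \<and> orlicz_le A g x (\<gamma> * t)}"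
   using x e t by (auto simp: Tmax_gt ennreal_less_iff)
 qed
 have "incseq E"
 proof (rule incseq_SucI)
  fix n
  have "inverse (real (Suc (Suc n))) \<le> inverse (real (Suc n))" by (rule le_imp_inverse_le) auto
  then have "e \<ge> 2 * inverse (real (Suc n)) \<Longrightarrow> e \<ge> 2 * inverse (real (Suc (Suc n)))" for e by linarith
  then show "E n \<subseteq> E (Suc n)" unfolding E_def by blast
 qed
 then have "emeasure lborel (\<Union>n. E n) = (SUP n. emeasure lborel (E n))"
  using Em by (intro SUP_emeasure_incseq[symmetric]) auto
 also have "\<dots> \<le> ennreal (6 * weak_const / t * G)" by (intro SUP_least E_le)
 finally show ?thesis unfolding un G_def .
qed

definition local_const :: real where "local_const = 12 * \<kappa> * weak_const + \<kappa> / \<gamma>"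

lemma local_const_pos: "local_const > 0" using kappa weak_const_pos \<gamma> by (simp add: local_const_def add_pos_pos)

text \<open>The maximal operator is compared with its value at the point \<open>z\<close>, which may be anywhere in the
  interval. Truncations at \<open>x\<close> and at \<open>z\<close> that start at a common point, not before \<open>\<xi> + \<kappa> h\<close>, differ by at
  most \<open>C0 s\<close>; the remaining part \<open>f1\<close> of \<open>f\<close> lies in \<open>[\<xi>, \<xi> + \<kappa> h]\<close> and is treated by
  \<open>cotlar_weak\<close>. In the applications \<open>z\<close> is the left or the right endpoint.\<close>
theorem Tmax_local:
 assumes f: "bcs f" and h: "h > 0" and z: "z \<in> {\<xi>..\<xi>+h}" and Tz: "Tmax k f z \<le> ennreal \<mu>" and \<mu>: "\<mu> \<ge> 0"
  and o: "orlicz_le A f \<xi> s" and s: "s > 0" and t: "t > 0"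
 shows "emeasure lborel {x \<in> {\<xi>..\<xi>+h}. Tmax k f x > ennreal (\<mu> + C0 * s + t)} \<le> ennreal (local_const * (s / t) * h)"
proof -
 have fm [measurable]: "f \<in> borel_measurable borel" by (rule bcs_measurable[OF f])
 have gt: "\<gamma> * t > 0" using \<gamma> t by simp
 define W where "W = \<xi> + \<kappa> * h"
 have W: "W > \<xi> + h" using double_le_kappa[OF h, of \<xi>] h by (simp add: W_def)
 define f1 where "f1 y = indicator {\<xi>..\<xi>+\<kappa>*h} y *\<^sub>R f y" for y
 have f1: "bcs f1" unfolding f1_def[abs_def] by (rule bcs_restrict[OF f]) simp
 have kh0: "\<kappa> * h > 0" using kappa h by simp
 have nn1: "local_const * (s / t) * h = 6 * weak_const / t * (2 * (\<kappa> * h) * s) + \<kappa> * h * (s / (\<gamma> * t))"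
  using t \<gamma> by (simp add: local_const_def field_simps)
 show ?thesis
 proof (cases "s \<le> \<gamma> * t")
  case False
  have "emeasure lborel {x \<in> {\<xi>..\<xi>+h}. Tmax k f x > ennreal (\<mu> + C0 * s + t)} \<le> emeasure lborel {\<xi>..\<xi>+h}"
   by (rule emeasure_mono) auto
  also have "\<dots> = ennreal h" using h by simp
  also have "\<dots> \<le> ennreal (local_const * (s / t) * h)"
  proof (rule ennreal_leI)
   have "h \<le> \<kappa> * h" using kappa h by simp
   also have "\<dots> = \<kappa> * h * 1" by simp
   also have "\<dots> \<le> \<kappa> * h * (s / (\<gamma> * t))" using False gt kh0 by (intro mult_left_mono) auto
   also have "\<dots> \<le> local_const * (s / t) * h"
   proof -
    have "0 \<le> 6 * weak_const / t * (2 * (\<kappa> * h) * s)"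
     using weak_const_pos t kappa h s by (intro mult_nonneg_nonneg divide_nonneg_pos) auto
    then show ?thesis unfolding nn1 by linarith
   qed
   finally show "h \<le> local_const * (s / t) * h" .
  qed
  finally show ?thesis .
 next
  case True
  have "{x \<in> {\<xi>..\<xi>+h}. Tmax k f x > ennreal (\<mu> + C0 * s + t)} \<subseteq>
    {x \<in> {\<xi>..\<xi>+h}. Tmax k f1 x > ennreal t \<and> orlicz_le A f1 x (\<gamma> * t)} \<union> {x. \<not> orlicz_le A f1 x (\<gamma> * t)}"
  proof
   fix x assume "x \<in> {x \<in> {\<xi>..\<xi>+h}. Tmax k f x > ennreal (\<mu> + C0 * s + t)}"
   then have x: "x \<in> {\<xi>..\<xi>+h}" and "Tmax k f x > ennreal (\<mu> + C0 * s + t)" by auto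
   then obtain e where e: "e > 0" and "ennreal (norm (Tr k e f x)) > ennreal (\<mu> + C0 * s + t)" by (auto simp: Tmax_gt)
   then have big: "norm (Tr k e f x) > \<mu> + C0 * s + t" using \<mu> C0 s t by (simp add: ennreal_less_iff del: ennreal_plus)
   \<comment> \<open>The common starting point; if \<open>x + e\<close> is already beyond \<open>W\<close>, the local part is not seen at all.\<close>
   define Y where "Y = max (x + e) W"
   have Yx: "Y - x > 0" "Y - z > 0" using e W z by (auto simp: Y_def)
   have "norm (Tr k (Y - x) f x - Tr k (Y - z) f z) \<le> C0 * s"
    by (rule Tr_compare[OF f s h o x z]) (simp add: Y_def W_def)
   moreover have "norm (Tr k (Y - z) f z) \<le> \<mu>"
    using order_trans[OF Tr_le_Tmax[OF Yx(2)] Tz] \<mu> by (simp add: ennreal_le_iff)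
   ultimately have far: "norm (Tr k (Y - x) f x) \<le> \<mu> + C0 * s"
    using norm_triangle_ineq2[of "Tr k (Y - x) f x" "Tr k (Y - z) f z"] by linarith
   have "Tr k e f x - Tr k (Y - x) f x = (LBINT v. trunc k e v * f (x + v) - trunc k (Y - x) v * f (x + v))"
    unfolding Tr_def
    by (rule Bochner_Integration.integral_diff[OF integrable_bcs integrable_bcs, symmetric])
      (use Yx e f in \<open>auto intro: bcs_trunc_mult\<close>)
   also have "\<dots> = Tr k e f1 x"
    unfolding Tr_def
   proof (intro Bochner_Integration.integral_cong refl)
    fix v
    show "trunc k e v * f (x + v) - trunc k (Y - x) v * f (x + v) = trunc k e v * f1 (x + v)"
     using x e by (auto simp: trunc_def f1_def indicator_def Y_def W_def)
   qed
   finally have "norm (Tr k e f x) \<le> norm (Tr k e f1 x) + norm (Tr k (Y - x) f x)"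
    by (metis diff_add_cancel norm_triangle_ineq)
   then have "norm (Tr k e f1 x) > t" using big far by linarith
   then have "Tmax k f1 x > ennreal t" using e t by (auto simp: Tmax_gt ennreal_less_iff)
   then show "x \<in> {x \<in> {\<xi>..\<xi>+h}. Tmax k f1 x > ennreal t \<and> orlicz_le A f1 x (\<gamma> * t)} \<union> {x. \<not> orlicz_le A f1 x (\<gamma> * t)}"
    using x by blast
  qed
  moreover have o1: "open {x. \<not> orlicz_le A f1 x (\<gamma> * t)}" by (rule open_not_orlicz_le[OF f1 gt])
  moreover have m1: "{x \<in> {\<xi>..\<xi>+h}. Tmax k f1 x > ennreal t \<and> orlicz_le A f1 x (\<gamma> * t)} \<in> sets borel"
  proof -
   have "{x \<in> {\<xi>..\<xi>+h}. Tmax k f1 x > ennreal t \<and> orlicz_le A f1 x (\<gamma> * t)}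
     = {\<xi>..\<xi>+h} \<inter> ({x. Tmax k f1 x > ennreal t} \<inter> - {x. \<not> orlicz_le A f1 x (\<gamma> * t)})" by auto
   then show ?thesis using o1 open_Tmax_gt[OF f1, of t] t by (auto intro!: sets.Int borel_comp)
  qed
  ultimately have "emeasure lborel {x \<in> {\<xi>..\<xi>+h}. Tmax k f x > ennreal (\<mu> + C0 * s + t)} \<le>
    emeasure lborel {x \<in> {\<xi>..\<xi>+h}. Tmax k f1 x > ennreal t \<and> orlicz_le A f1 x (\<gamma> * t)} + emeasure lborel {x. \<not> orlicz_le A f1 x (\<gamma> * t)}"
   by (intro order_trans[OF emeasure_mono emeasure_subadditive]) auto
  also have "\<dots> \<le> ennreal (6 * weak_const / t * (2 * (\<kappa> * h) * s)) + ennreal (\<kappa> * h * (s / (\<gamma> * t)))"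
  proof (rule add_mono)
   have "ennreal (LBINT y. norm (f1 y)) = (\<integral>\<^sup>+y. ennreal (norm (f1 y)) \<partial>lborel)"
    using integrable_bcs[OF f1] by (intro nn_integral_eq_integral[symmetric]) auto
   also have "\<dots> = (\<integral>\<^sup>+y. ennreal (norm (f y)) * indicator {\<xi>..\<xi>+\<kappa>*h} y \<partial>lborel)"
    by (intro nn_integral_cong) (auto simp: f1_def indicator_def)
   also have "\<dots> \<le> ennreal (2 * (\<kappa> * h) * s)" by (rule integral_le_of_orlicz_le[OF fm s o kh0])
   finally have "(LBINT y. norm (f1 y)) \<le> 2 * (\<kappa> * h) * s"
    using kh0 s by (subst (asm) ennreal_le_iff) auto
   then have "ennreal (6 * weak_const / t * (LBINT y. norm (f1 y))) \<le> ennreal (6 * weak_const / t * (2 * (\<kappa> * h) * s))"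
    using weak_const_pos t by (intro ennreal_leI mult_left_mono) auto
   then show "emeasure lborel {x \<in> {\<xi>..\<xi>+h}. Tmax k f1 x > ennreal t \<and> orlicz_le A f1 x (\<gamma> * t)} \<le> ennreal (6 * weak_const / t * (2 * (\<kappa> * h) * s))"
    using cotlar_weak[OF f1 t] by (rule order_trans[rotated])
   have [measurable]: "(\<lambda>y. A (norm (f y) / s)) \<in> borel_measurable borel" using A_measurable[OF fm s] by simp
   define l where "l = \<gamma> * t / s"
   have l: "l \<ge> 1" "\<gamma> * t = l * s" using True s by (auto simp: l_def)
   have "emeasure lborel {x. \<not> orlicz_le A f1 x (\<gamma> * t)} \<le> (\<integral>\<^sup>+y. ennreal (A (norm (f1 y) / (\<gamma> * t))) \<partial>lborel)"
    by (rule not_orlicz_le_measure[OF f1 gt])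
   also have "\<dots> \<le> (\<integral>\<^sup>+y. ennreal (1 / l) * (ennreal (A (norm (f y) / s)) * indicator {\<xi>..\<xi>+\<kappa>*h} y) \<partial>lborel)"
   proof (rule nn_integral_mono)
    fix y
    have "ennreal (A (norm (f y) / (l * s))) \<le> ennreal (1 / l) * ennreal (A (norm (f y) / s))"
     using A_div_scale[OF s l(1), of "f y"] l A_nn[of "norm (f y) / s"] s by (simp add: ennreal_mult[symmetric] ennreal_leI)
    then show "ennreal (A (norm (f1 y) / (\<gamma> * t))) \<le> ennreal (1 / l) * (ennreal (A (norm (f y) / s)) * indicator {\<xi>..\<xi>+\<kappa>*h} y)"
     unfolding f1_def A_restrict[OF gt] mult.assoc[symmetric] unfolding l(2) by (rule mult_right_mono) simp
   qed
   also have "\<dots> = ennreal (1 / l) * (\<integral>\<^sup>+y. ennreal (A (norm (f y) / s)) * indicator {\<xi>..\<xi>+\<kappa>*h} y \<partial>lborel)"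
    by (rule nn_integral_cmult) measurable
   also have "\<dots> \<le> ennreal (1 / l) * ennreal (\<kappa> * h)"
    using o kh0 unfolding orlicz_le_def by (intro mult_left_mono) auto
   also have "\<dots> = ennreal (\<kappa> * h * (s / (\<gamma> * t)))"
    using l(1) kh0 s gt by (subst ennreal_mult[symmetric]) (auto simp: l_def mult_ac)
   finally show "emeasure lborel {x. \<not> orlicz_le A f1 x (\<gamma> * t)} \<le> ennreal (\<kappa> * h * (s / (\<gamma> * t)))" .
  qed
  also have "\<dots> = ennreal (local_const * (s / t) * h)"
   unfolding nn1 using weak_const_pos t kappa h s \<gamma>(1)
   by (intro ennreal_plus[symmetric] mult_nonneg_nonneg divide_nonneg_pos mult_pos_pos) auto
  finally show ?thesis .
 qed
qed

text \<open>Seen from far to the left, the distances to the points of the support differ by a bounded factor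
  only, so the size of the kernel gives a multiple of the mean of the modulus of \<open>f\<close>.\<close>
lemma Tmax_far_left:
 assumes f: "bcs f" and R: "R > 0" "\<And>y. \<bar>y\<bar> > R \<Longrightarrow> f y = 0" and x: "x \<le> -3 * R" and s: "s > 0" and o: "orlicz_le A f x s"
 shows "Tmax k f x \<le> ennreal (4 * B2 * s)"
 unfolding Tmax_def
proof (rule SUP_least)
 fix e :: real assume "e \<in> {0<..}"
 then have e: "e > 0" by simp
 have fm [measurable]: "f \<in> borel_measurable borel" by (rule bcs_measurable[OF f])
 have H: "R - x > 0" using x R by simp
 have "ennreal (norm (Tr k e f x)) \<le> (\<integral>\<^sup>+y. ennreal (norm (trunc k e (y - x) * f y)) \<partial>lborel)"
  unfolding Tr_shift
  by (intro integral_norm_bound_ennreal integrable_bcs bcs_mult_bounded[OF f, where B = "B2 / e"])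
    (auto intro: trunc_bounded e)
 also have "\<dots> \<le> (\<integral>\<^sup>+y. ennreal (2 * B2 / (R - x)) * (ennreal (norm (f y)) * indicator {x..x+(R - x)} y) \<partial>lborel)"
 proof (rule nn_integral_mono)
  fix y
  show "ennreal (norm (trunc k e (y - x) * f y)) \<le> ennreal (2 * B2 / (R - x)) * (ennreal (norm (f y)) * indicator {x..x+(R - x)} y)"
  proof (cases "\<bar>y\<bar> > R")
   case False
   then have y: "-R \<le> y" "y \<le> R" by auto
   have "norm (k (y - x)) \<le> B2 / ((R - x) / 2)" using y x H by (intro k_size_le) auto
   then have "norm (trunc k e (y - x)) \<le> 2 * B2 / (R - x)"
    using B2_nonneg H by (auto simp: trunc_def indicator_def field_simps)
   then have "norm (trunc k e (y - x) * f y) \<le> 2 * B2 / (R - x) * norm (f y)"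
    unfolding norm_mult by (rule mult_right_mono) simp
   then show ?thesis using y x R B2_nonneg H by (auto simp: ennreal_mult[symmetric] intro!: ennreal_leI)
  qed (simp add: R)
 qed
 also have "\<dots> = ennreal (2 * B2 / (R - x)) * (\<integral>\<^sup>+y. ennreal (norm (f y)) * indicator {x..x+(R - x)} y \<partial>lborel)"
  by (rule nn_integral_cmult) measurable
 also have "\<dots> \<le> ennreal (2 * B2 / (R - x)) * ennreal (2 * (R - x) * s)"
  by (intro mult_left_mono integral_le_of_orlicz_le[OF fm s o H]) simp
 also have "\<dots> = ennreal (2 * B2 / (R - x) * (2 * (R - x) * s))"
  using B2_nonneg H s by (intro ennreal_mult[symmetric]) auto
 also have "2 * B2 / D * (2 * D * s) = 4 * B2 * s" if "D > 0" for D using that by simp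
 then have "2 * B2 / (R - x) * (2 * (R - x) * s) = 4 * B2 * s" using H by blast
 finally show "ennreal (norm (Tr k e f x)) \<le> ennreal (4 * B2 * s)" .
qed

end

section \<open>Level sets of the maximal singular integral\<close>

lemma ennpowr_mono: "x \<le> y \<Longrightarrow> p \<ge> 0 \<Longrightarrow> ennpowr x p \<le> ennpowr y p"
 unfolding ennpowr_def by (auto simp: top_unique intro!: ennreal_leI powr_mono2 enn2real_mono simp: less_top)

lemma ennpowr_ennreal: "a \<ge> 0 \<Longrightarrow> ennpowr (ennreal a) p = ennreal (a powr p)"
 by (simp add: ennpowr_def)

lemma ennpowr_ge:
 assumes "ennreal a \<le> ennreal c * m" "a \<ge> 0" "c > 0" "p > 0"
 shows "ennreal (a powr p) \<le> ennreal (c powr p) * ennpowr m p"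
proof (cases m)
 case (real m')
 then have "a \<le> c * m'" using assms by (simp add: ennreal_mult[symmetric])
 then have "a powr p \<le> (c * m') powr p" using assms by (intro powr_mono2) auto
 then show ?thesis using real assms by (simp add: ennpowr_ennreal ennreal_mult[symmetric] powr_mult ennreal_leI)
next
 case top
 then show ?thesis using assms by (simp add: ennpowr_def ennreal_mult_top)
qed

lemma ennpowr_measurable [measurable]:
 assumes [measurable]: "f \<in> borel_measurable M" shows "(\<lambda>x. ennpowr (f x) p) \<in> borel_measurable M"
 unfolding ennpowr_def by measurable

text \<open>A geometric series in the form in which finite sums with possibly infinite terms can be handled:
  the last term, with weight 3, is kept on the left-hand side of the induction.\<close>
lemma sum_contraction:
 fixes w d :: "nat \<Rightarrow> ennreal"
 assumes "\<And>j. w (Suc j) \<le> ennreal (3/4) * w j + d j"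
 shows "(\<Sum>j\<le>n. w j) \<le> 4 * (w 0 + (\<Sum>j<n. d j))"
proof -
 have "(\<Sum>j\<le>n. w j) + 3 * w n \<le> 4 * (w 0 + (\<Sum>j<n. d j))"
 proof (induction n)
  case 0
  have "w 0 + 3 * w 0 = (1 + 3) * w 0" by (simp only: distrib_right mult_1_left)
  then show ?case by simp
 next
  case (Suc n)
  have q: "4 * (ennreal (3/4) * w n) = 3 * w n"
  proof -
   have "(4::ennreal) * ennreal (3/4) = ennreal (4 * (3/4))" by (subst ennreal_mult) auto
   then show ?thesis by (simp add: mult.assoc[symmetric])
  qed
  have "(\<Sum>j\<le>Suc n. w j) + 3 * w (Suc n) = (\<Sum>j\<le>n. w j) + (1 + 3) * w (Suc n)"
   by (simp only: sum.atMost_Suc distrib_right mult_1_left add.assoc)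
  also have "\<dots> \<le> (\<Sum>j\<le>n. w j) + 4 * (ennreal (3/4) * w n + d n)"
   proof (rule add_left_mono)
   have "4 * w (Suc n) \<le> 4 * (ennreal (3/4) * w n + d n)" by (rule mult_left_mono[OF assms]) simp
   moreover have "(1 + 3 :: ennreal) = 4" by simp
   ultimately show "(1 + 3) * w (Suc n) \<le> 4 * (ennreal (3/4) * w n + d n)" by (simp only:)
  qed
  also have "\<dots> = ((\<Sum>j\<le>n. w j) + 3 * w n) + 4 * d n" by (simp only: distrib_left q add.assoc)
  also have "\<dots> \<le> 4 * (w 0 + (\<Sum>j<n. d j)) + 4 * d n" by (intro add_right_mono Suc)
  also have "\<dots> = 4 * (w 0 + (\<Sum>j<Suc n. d j))" by (simp add: distrib_left add.assoc)
  finally show ?case .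
 qed
 moreover have "(\<Sum>j\<le>n. w j) \<le> (\<Sum>j\<le>n. w j) + 3 * w n" by (rule add_increasing2) auto
 ultimately show ?thesis by (rule order_trans[rotated])
qed

text \<open>The sum is geometric and is dominated by its largest nonzero term, whose level is below \<open>m / g\<close>.\<close>
lemma geometric_levels:
 assumes L: "L > 1" and p: "p > 0" and c: "c > 0" and g: "g > 0"
 shows "(\<Sum>j<n. ennreal ((c * L ^ j) powr p) * indicator {m. m > ennreal (g * (c * L ^ j))} m)
   \<le> ennreal ((1 / g) powr p / (1 - L powr (-p))) * ennpowr m p"
proof (induction n)
 case (Suc n)
 define q where "q = L powr (-p)"
 have "L powr (-p) < L powr 0" using L p by (intro powr_less_mono) auto
 then have q: "0 < q" "q < 1" using L by (auto simp: q_def)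
 show ?case
 proof (cases "m > ennreal (g * (c * L ^ n))")
  case False
  then show ?thesis using Suc by simp
 next
  case True
  have geo: "(\<Sum>j<k. (c * L ^ j) powr p) \<le> (c * L ^ k) powr p * q / (1 - q)" for k
  proof (induction k)
   case (Suc k)
   have e: "(c * L ^ Suc k) powr p * q = (c * L ^ k) powr p"
   proof -
    have "(c * L ^ Suc k) powr p = (c * L ^ k) powr p * L powr p"
     using L c by (simp add: powr_mult mult_ac)
    moreover have "L powr p * q = 1" using L by (simp add: q_def flip: powr_add)
    ultimately show ?thesis by (simp add: mult.assoc)
   qed
   have "(\<Sum>j<Suc k. (c * L ^ j) powr p) \<le> (c * L ^ k) powr p * q / (1 - q) + (c * L ^ k) powr p" using Suc by simp
   also have "\<dots> = (c * L ^ k) powr p / (1 - q)" using q by (simp add: field_simps)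
   also have "\<dots> = (c * L ^ Suc k) powr p * q / (1 - q)" by (simp only: e)
   finally show ?case .
  qed (use q in simp)
  have e: "(c * L ^ Suc n) powr p * q = (c * L ^ n) powr p"
  proof -
   have "(c * L ^ Suc n) powr p = (c * L ^ n) powr p * L powr p"
    using L c by (simp add: powr_mult mult_ac)
   moreover have "L powr p * q = 1" using L by (simp add: q_def flip: powr_add)
   ultimately show ?thesis by (simp add: mult.assoc)
  qed
  have m: "ennreal ((c * L ^ n) powr p) \<le> ennreal ((1 / g) powr p) * ennpowr m p"
  proof (rule ennpowr_ge)
   have "ennreal (c * L ^ n) = ennreal (1 / g) * ennreal (g * (c * L ^ n))"
    using g c L by (subst ennreal_mult[symmetric]) auto
   also have "\<dots> \<le> ennreal (1 / g) * m" using True by (intro mult_left_mono) auto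
   finally show "ennreal (c * L ^ n) \<le> ennreal (1 / g) * m" .
  qed (use g c L p in auto)
  have "(\<Sum>j<Suc n. ennreal ((c * L ^ j) powr p) * indicator {m. m > ennreal (g * (c * L ^ j))} m)
    \<le> (\<Sum>j<Suc n. ennreal ((c * L ^ j) powr p))"
   by (intro sum_mono) (auto simp: indicator_def)
  also have "\<dots> = ennreal (\<Sum>j<Suc n. (c * L ^ j) powr p)" by (rule sum_ennreal) simp
  also have "\<dots> \<le> ennreal ((c * L ^ Suc n) powr p * q / (1 - q))" by (intro ennreal_leI geo)
  also have "\<dots> = ennreal (1 / (1 - q)) * ennreal ((c * L ^ n) powr p)"
   unfolding e using q by (subst ennreal_mult[symmetric]) auto
  also have "\<dots> \<le> ennreal (1 / (1 - q)) * (ennreal ((1 / g) powr p) * ennpowr m p)"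
   by (intro mult_left_mono m) simp
  also have "\<dots> = ennreal ((1 / g) powr p / (1 - L powr (-p))) * ennpowr m p"
   using q by (simp add: q_def mult.assoc[symmetric] ennreal_mult[symmetric])
  finally show ?thesis .
 qed
qed simp

locale coifman = orlicz_kernel + cplus +
 fixes p :: real
 assumes p: "0 < p" "p < r"
  and fin: "\<And>R. emeasure \<mu> {-R..R} < top"
begin

abbreviation M where "M f x \<equiv> M_plus_orlicz A f x"

text \<open>Large enough that, far to the left of the support, the maximal singular integral never exceeds \<open>l\<close>
  without \<open>M\<^sub>A\<^sup>+ f\<close> exceeding \<open>l / \<theta>1\<close>.\<close>
definition \<theta>1 :: real where "\<theta>1 = 4 * B2 + 1"

lemma \<theta>1: "\<theta>1 \<ge> 1" using B2_nonneg by (simp add: \<theta>1_def)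

text \<open>The second set provides control of \<open>f\<close> at the points outside \<open>\<Omega>\<close>. By the choice of \<open>\<theta>1\<close> it is all
  of \<open>\<Omega>\<close> far to the left, which makes \<open>\<Omega>\<close> bounded and accessible at low levels.\<close>
definition \<Omega> :: "(real \<Rightarrow> complex) \<Rightarrow> real \<Rightarrow> real set" where
 "\<Omega> f l = {x. Tmax k f x > ennreal l} \<union> {x. M f x > ennreal (l / \<theta>1)}"

lemma open_\<Omega>: "bcs f \<Longrightarrow> l > 0 \<Longrightarrow> open (\<Omega> f l)"
 unfolding \<Omega>_def using \<theta>1 by (intro open_Un open_Tmax_gt open_M_gt) auto

lemma level_measurable:
 fixes F :: "real \<Rightarrow> ennreal"
 assumes "\<And>l. l \<ge> 0 \<Longrightarrow> open {x. F x > ennreal l}" shows "F \<in> borel_measurable borel"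
proof (rule borel_measurableI_greater)
 fix y :: ennreal
 show "{x \<in> space borel. y < F x} \<in> sets borel"
 proof (cases y)
  case (real l)
  then show ?thesis using assms[of l] by simp
 qed simp
qed

lemma M_measurable: "bcs f \<Longrightarrow> M f \<in> borel_measurable borel"
 by (rule level_measurable, rule open_M_gt)

lemma Tmax_measurable: "bcs f \<Longrightarrow> Tmax k f \<in> borel_measurable borel"
 by (rule level_measurable, rule open_Tmax_gt)

lemma M_right:
 assumes f: "bcs f" and R: "\<And>y. \<bar>y\<bar> > R \<Longrightarrow> f y = 0" and x: "x > R"
 shows "M f x = 0" "Tmax k f x = 0"
proof -
 have "orlicz_le A f x s" if "s > 0" for s
  unfolding orlicz_le_def
 proof (intro allI impI)
  fix H :: real assume "H > 0"
  have "(\<lambda>y. ennreal (A (norm (f y) / s)) * indicator {x..x+H} y) = (\<lambda>y. 0)"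
   using R x A0 by (auto simp: indicator_def)
  then show "(\<integral>\<^sup>+y. ennreal (A (norm (f y) / s)) * indicator {x..x+H} y \<partial>lborel) \<le> ennreal H" by simp
 qed
 then have "M f x \<le> ennreal s" if "s > 0" for s using le_of_orlicz_le[OF bcs_measurable[OF f] that] that by blast
 then have "\<not> M f x > 0" by (metis ennreal_0 ennreal_eq_0_iff ennreal_le_epsilon add_0 linorder_not_le)
 then show "M f x = 0" by simp
 have "Tr k e f x = 0" if "e > 0" for e using that x R by (intro Tr_zero_right[of R]) auto
 then show "Tmax k f x = 0" by (simp add: Tmax_def)
qed

lemma T_le_M_left:
 assumes f: "bcs f" and R: "R > 0" "\<And>y. \<bar>y\<bar> > R \<Longrightarrow> f y = 0" and x: "x \<le> -3 * R" and l: "l > 0"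
  and T: "Tmax k f x > ennreal l"
 shows "M f x > ennreal (l / \<theta>1)"
proof (rule ccontr)
 assume n: "\<not> M f x > ennreal (l / \<theta>1)"
 define s where "s = l / (4 * B2 + 1 / 2)"
 have s: "s > 0" "s > l / \<theta>1" using l B2_nonneg by (auto simp: s_def \<theta>1_def intro!: divide_strict_left_mono)
 then have "orlicz_le A f x s" using n M_gt_iff[OF bcs_measurable[OF f], of "l / \<theta>1" x] l \<theta>1 by auto
 then have "Tmax k f x \<le> ennreal (4 * B2 * s)" using Tmax_far_left[OF f R x s(1)] by simp
 also have "\<dots> \<le> ennreal l"
 proof (rule ennreal_leI)
  have "4 * B2 * s \<le> (4 * B2 + 1 / 2) * s" using s by (intro mult_right_mono) auto
  also have "\<dots> = l" using B2_nonneg by (simp add: s_def)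
  finally show "4 * B2 * s \<le> l" .
 qed
 finally show False using T by simp
qed

lemma bounded_\<Omega>: assumes f: "bcs f" and l: "l > 0" shows "bounded (\<Omega> f l)"
proof -
 obtain C R where C: "C > 0" "R > 0" "\<And>x. norm (f x) \<le> C" and R: "\<And>x. \<bar>x\<bar> > R \<Longrightarrow> f x = 0"
  using f by (rule bcsE) blast
 have l': "l / \<theta>1 > 0" using l \<theta>1 by simp
 obtain R' where R': "integrable lborel (\<lambda>y. A (norm (f y) / (l / \<theta>1)))" "\<And>y. A (norm (f y) / (l / \<theta>1)) \<ge> 0"
  "\<And>y. \<bar>y\<bar> > R' \<Longrightarrow> A (norm (f y) / (l / \<theta>1)) = 0"
  "\<And>x. \<not> orlicz_le A f x (l / \<theta>1) \<longleftrightarrow> x \<in> rising_set (\<lambda>y. A (norm (f y) / (l / \<theta>1))) 1"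
  using orlicz_le_level[OF f l'] by blast
 have b: "bounded {x. \<not> orlicz_le A f x (l / \<theta>1)}"
  using bounded_rising_set[OF R'(1-3) zero_less_one] by (simp add: R'(4))
 have "\<Omega> f l \<subseteq> {-3 * R..R} \<union> {x. \<not> orlicz_le A f x (l / \<theta>1)}"
 proof
  fix x assume x: "x \<in> \<Omega> f l"
  show "x \<in> {-3 * R..R} \<union> {x. \<not> orlicz_le A f x (l / \<theta>1)}"
  proof (cases "x > R")
   case True
   then show ?thesis using x M_right[OF f R True] by (simp add: \<Omega>_def)
  next
   case False
   show ?thesis
   proof (cases "x \<ge> -3 * R")
    case xn: False
    then have "M f x > ennreal (l / \<theta>1)"
     using x T_le_M_left[OF f C(2) R, of x l] l by (auto simp: \<Omega>_def)
    then obtain s where "s > l / \<theta>1" "\<not> orlicz_le A f x s" using M_gt_iff[OF bcs_measurable[OF f], of "l / \<theta>1" x] l' by auto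
    then have "\<not> orlicz_le A f x (l / \<theta>1)" using orlicz_le_mono[of f x "l / \<theta>1" s] l' by auto
    then show ?thesis by simp
   qed (use False in simp)
  qed
 qed
 moreover have "bounded ({-3 * R..R} \<union> {x. \<not> orlicz_le A f x (l / \<theta>1)})"
  by (rule iffD2[OF bounded_Un]) (use b bounded_closed_interval in blast)
 ultimately show ?thesis by (rule bounded_subset[rotated])
qed

lemma \<Omega>_mono: assumes "0 < l" "l \<le> l'" shows "\<Omega> f l' \<subseteq> \<Omega> f l"
proof -
 have "ennreal l \<le> ennreal l'" "ennreal (l / \<theta>1) \<le> ennreal (l' / \<theta>1)"
  using assms \<theta>1 by (auto intro!: ennreal_leI divide_right_mono)
 then show ?thesis unfolding \<Omega>_def by (auto intro: le_less_trans)
qed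

definition fill_const :: real where "fill_const = 4 * local_const + 4"
definition min_ratio :: real where "min_ratio = max 4 (2 + 4 * C0)"

lemma orlicz_le_off:
 assumes "bcs f" "c \<notin> \<Omega> f l" "l > 0" "s > l / \<theta>1" shows "orlicz_le A f c s"
proof -
 have "\<not> M f c > ennreal (l / \<theta>1)" using assms by (simp add: \<Omega>_def)
 then show ?thesis using M_gt_iff[OF bcs_measurable[OF assms(1)], of "l / \<theta>1" c] assms \<theta>1 by auto
qed

text \<open>At a point \<open>c\<close> outside \<open>\<Omega> f l\<close> both operators are controlled at height \<open>l\<close>; local weak type estimates
  at height \<open>L l\<close> then gain a factor \<open>1 / L\<close>.\<close>
lemma \<Omega>_fill:
 assumes f: "bcs f" and l: "l > 0" and L: "L \<ge> min_ratio" and c: "c \<notin> \<Omega> f l" and h: "h > 0"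
 shows "emeasure lborel (\<Omega> f (L * l) \<inter> {c<..<c+h}) \<le> ennreal (fill_const / L * h)"
proof -
 have L4: "L \<ge> 4" "L / 2 \<ge> 1 + 2 * C0" using L by (auto simp: min_ratio_def)
 define s where "s = 2 * l / \<theta>1"
 have s: "s > 0" "s > l / \<theta>1" "s \<le> 2 * l" using l \<theta>1 by (auto simp: s_def field_simps)
 have o: "orlicz_le A f c s" by (rule orlicz_le_off[OF f c l s(2)])
 have Tc: "Tmax k f c \<le> ennreal l" using c by (simp add: \<Omega>_def not_less)
 define t where "t = L * l / 2"
 have t: "t > 0" using L4 l by (simp add: t_def)
 have Ll: "l + C0 * s + t \<le> L * l"
 proof -
  have "C0 * s \<le> C0 * (2 * l)" using s C0 by (intro mult_left_mono) auto
  moreover have "(1 + 2 * C0) * l \<le> L / 2 * l" using L4 l by (intro mult_right_mono) auto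
  ultimately show ?thesis by (simp add: t_def algebra_simps)
 qed
 define S1 where "S1 = {x \<in> {c..c+h}. Tmax k f x > ennreal (l + C0 * s + t)}"
 define S2 where "S2 = {x \<in> {c..c+h}. \<not> orlicz_le A f x (L / 2 * s)}"
 have sub: "\<Omega> f (L * l) \<inter> {c<..<c+h} \<subseteq> S1 \<union> S2"
 proof
  fix x assume x: "x \<in> \<Omega> f (L * l) \<inter> {c<..<c+h}"
  show "x \<in> S1 \<union> S2"
  proof (cases "Tmax k f x > ennreal (L * l)")
   case True
   have "ennreal (l + C0 * s + t) \<le> ennreal (L * l)" by (rule ennreal_leI[OF Ll])
   then show ?thesis using True x by (auto simp: S1_def intro: le_less_trans)
  next
   case False
   then have "M f x > ennreal (L * l / \<theta>1)" using x by (simp add: \<Omega>_def)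
   then obtain s' where "s' > L * l / \<theta>1" "\<not> orlicz_le A f x s'"
    using M_gt_iff[OF bcs_measurable[OF f], of "L * l / \<theta>1" x] L4 l \<theta>1 by auto
   moreover have "L / 2 * s = L * l / \<theta>1" by (simp add: s_def)
   moreover have "L / 2 * s > 0" using L4 s by simp
   ultimately have "\<not> orlicz_le A f x (L / 2 * s)" using orlicz_le_mono[of f x "L / 2 * s" s'] by auto
   then show ?thesis using x by (auto simp: S2_def)
  qed
 qed
 have S1m: "S1 \<in> sets borel"
 proof -
  have "S1 = {c..c+h} \<inter> {x. Tmax k f x > ennreal (l + C0 * s + t)}" by (auto simp: S1_def)
  moreover have "l + C0 * s + t \<ge> 0" using l C0 s(1) t by simp
  ultimately show ?thesis using borel_open[OF open_Tmax_gt[OF f]] by (simp add: sets.Int)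
 qed
 have S2m: "S2 \<in> sets borel"
 proof -
  have "S2 = {c..c+h} \<inter> {x. \<not> orlicz_le A f x (L / 2 * s)}" by (auto simp: S2_def)
  then show ?thesis using open_not_orlicz_le[OF f, of "L / 2 * s"] L4 s by auto
 qed
 have "emeasure lborel (\<Omega> f (L * l) \<inter> {c<..<c+h}) \<le> emeasure lborel (S1 \<union> S2)"
  using S1m S2m by (intro emeasure_mono[OF sub]) auto
 also have "\<dots> \<le> emeasure lborel S1 + emeasure lborel S2" using S1m S2m by (intro emeasure_subadditive) auto
 also have "\<dots> \<le> ennreal (local_const * (s / t) * h) + ennreal (2 / (L / 2) * h)"
  unfolding S1_def S2_def
  by (intro add_mono Tmax_local[OF f h _ Tc _ o s(1) t] M_local[OF f s(1) o _ h]) (use L4 h l in auto)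
 also have "\<dots> \<le> ennreal (local_const * (4 / L) * h) + ennreal (4 / L * h)"
 proof (intro add_mono ennreal_leI mult_right_mono mult_left_mono)
  show "s / t \<le> 4 / L" using s t L4 l by (simp add: t_def field_simps)
 qed (use local_const_pos h L4 in auto)
 also have "\<dots> = ennreal (fill_const / L * h)"
  using local_const_pos h L4 by (subst ennreal_plus[symmetric]) (auto simp: fill_const_def field_simps)
 finally show ?thesis .
qed

text \<open>In a component of \<open>\<Omega> f l\<close>, the maximal singular integral is at most \<open>l\<close> at the right endpoint, and \<open>f\<close>
  is controlled at height \<open>g l\<close> at every point of the exceptional set. So this set fills only a
  proportion of order \<open>g\<close> of the interval from any of its points to the right endpoint.\<close>
lemma good_lambda_T:
 assumes f: "bcs f" and l: "l > 0" and L: "L \<ge> min_ratio" and g: "0 < g" "g \<le> 1"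
 shows "emeasure \<mu> {x. Tmax k f x > ennreal (L * l) \<and> M f x \<le> ennreal (g * l)}
   \<le> ennreal (8 * Cw * (16 * local_const * g) powr \<epsilon>0) * (emeasure \<mu> (\<Omega> f l) + ennreal r * tail_mass (\<Omega> f l))"
proof -
 have L4: "L \<ge> 4" "L / 2 \<ge> 1 + 2 * C0" using L by (auto simp: min_ratio_def)
 define E where "E = {x. Tmax k f x > ennreal (L * l) \<and> M f x \<le> ennreal (g * l)}"
 have Em: "E \<in> sets borel"
 proof -
  have "E = {x. Tmax k f x > ennreal (L * l)} - {x. M f x > ennreal (g * l)}" by (auto simp: E_def not_less)
  then show ?thesis using open_Tmax_gt[OF f, of "L * l"] open_M_gt[OF f, of "g * l"] L4 l g by auto
 qed
 have ll: "l \<le> L * l" using L4 l by simp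
 have E\<Omega>: "E \<subseteq> \<Omega> f l"
  using ennreal_leI[OF ll] by (auto simp: E_def \<Omega>_def intro: le_less_trans)
 have "emeasure \<mu> E \<le> ennreal (8 * Cw * (4 * (4 * local_const * g)) powr \<epsilon>0) * (emeasure \<mu> (\<Omega> f l) + ennreal r * tail_mass (\<Omega> f l))"
 proof (rule good_lambda[OF open_\<Omega>[OF f l] bounded_\<Omega>[OF f l] Em E\<Omega>])
  show "0 \<le> 4 * local_const * g" using local_const_pos g by simp
  fix J \<xi> assume J: "J \<in> comp_ivls (\<Omega> f l)" and \<xi>: "\<xi> \<in> E" "\<xi> \<in> ivl J"
  define h where "h = snd J - \<xi>"
  have h: "h > 0" using \<xi> by (simp add: h_def ivl_def)
  have Tz: "Tmax k f (snd J) \<le> ennreal l" using J by (auto simp: comp_ivls_def \<Omega>_def not_less)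
  define s where "s = 2 * g * l"
  have s: "s > 0" "s > g * l" "s \<le> 2 * l" using g l by (auto simp: s_def)
  have "\<not> M f \<xi> > ennreal (g * l)" using \<xi> by (simp add: E_def not_less)
  then have o: "orlicz_le A f \<xi> s" using M_gt_iff[OF bcs_measurable[OF f], of "g * l" \<xi>] s g l by auto
  define t where "t = L * l / 2"
  have t: "t > 0" using L4 l by (simp add: t_def)
  have Ll: "l + C0 * s + t \<le> L * l"
  proof -
   have "C0 * s \<le> C0 * (2 * l)" using s C0 by (intro mult_left_mono) auto
   moreover have "(1 + 2 * C0) * l \<le> L / 2 * l" using L4 l by (intro mult_right_mono) auto
   ultimately show ?thesis by (simp add: t_def algebra_simps)
  qed
  have "emeasure lborel (E \<inter> {\<xi>..<snd J}) \<le> emeasure lborel {x \<in> {\<xi>..\<xi>+h}. Tmax k f x > ennreal (l + C0 * s + t)}"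
  proof (rule emeasure_mono)
   show "E \<inter> {\<xi>..<snd J} \<subseteq> {x \<in> {\<xi>..\<xi>+h}. Tmax k f x > ennreal (l + C0 * s + t)}"
    using ennreal_leI[OF Ll] by (auto simp: E_def h_def intro: le_less_trans)
   have "{x \<in> {\<xi>..\<xi>+h}. Tmax k f x > ennreal (l + C0 * s + t)} = {\<xi>..\<xi>+h} \<inter> {x. Tmax k f x > ennreal (l + C0 * s + t)}" by auto
   moreover have "l + C0 * s + t \<ge> 0" using l C0 s(1) t by simp
   ultimately show "{x \<in> {\<xi>..\<xi>+h}. Tmax k f x > ennreal (l + C0 * s + t)} \<in> sets lborel"
    using borel_open[OF open_Tmax_gt[OF f]] by (simp add: sets.Int)
  qed
  also have "\<dots> \<le> ennreal (local_const * (s / t) * h)"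
   by (rule Tmax_local[OF f h _ Tz _ o s(1) t]) (use h l in \<open>auto simp: h_def\<close>)
  also have "\<dots> \<le> ennreal (4 * local_const * g * h)"
  proof (intro ennreal_leI mult_right_mono)
   have "s / t \<le> 4 * g"
   proof -
    have "s / t = 4 * g / L" using l by (simp add: s_def t_def)
    also have "\<dots> \<le> 4 * g / 1" using L4 g by (intro divide_left_mono) auto
    finally show ?thesis by simp
   qed
   then have "local_const * (s / t) \<le> local_const * (4 * g)" using local_const_pos by (intro mult_left_mono) auto
   then show "local_const * (s / t) \<le> 4 * local_const * g" by simp
  qed (use h in simp)
  finally show "emeasure lborel (E \<inter> {\<xi>..<snd J}) \<le> ennreal (4 * local_const * g * (snd J - \<xi>))" by (simp add: h_def)
 qed
 moreover have "4 * (4 * local_const * g) = 16 * local_const * g" by simp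
 ultimately show ?thesis unfolding E_def by (simp only:)
qed

lemma scale_fraction: "c \<noteq> 0 \<Longrightarrow> D \<noteq> 0 \<Longrightarrow> l * (6 * E / D) = 12 * c * ((l / c) * E / (2 * D))" for c D l E :: real
 by (simp add: field_simps)

text \<open>The start of the summation over the levels, which takes the place of an a priori bound for the
  left-hand side of the main inequality. Let \<open>x'\<close> be nearly the leftmost point of \<open>\<Omega> f l\<close>. To the left
  of the support, \<open>M\<^sub>A\<^sup>+ f\<close> is of size at least \<open>l\<close> to the right of \<open>x'\<close> and decays to the left of \<open>x'\<close>
  no faster than the maximal function of the interval from \<open>x'\<close> to the support. As \<open>p < r\<close>, its
  \<open>p\<close>-th power thus dominates \<open>l powr p\<close> times the integrand of \<open>ivl_mass\<close>, up to a bounded set.\<close>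
lemma low_level:
 assumes f: "bcs f" and R: "R > 0" "\<And>y. \<bar>y\<bar> > R \<Longrightarrow> f y = 0" and l: "l > 0" and low: "M f (-4 * R) > ennreal (l / \<theta>1)"
 shows "ennreal (l powr p) * (emeasure \<mu> (\<Omega> f l) + tail_mass (\<Omega> f l))
   \<le> ennreal (1 + base_const) * (ennreal ((12 * \<theta>1) powr p) * (\<integral>\<^sup>+x. ennpowr (M f x) p \<partial>\<mu>)
     + ennreal (l powr p) * emeasure \<mu> {-(2 * R)..2 * R})"
proof -
 have fm: "f \<in> borel_measurable borel" by (rule bcs_measurable[OF f])
 have fl: "\<And>y. y < -R \<Longrightarrow> f y = 0" using R(2) by auto
 let ?O = "\<Omega> f l"
 have mem: "-4 * R \<in> ?O" using low by (simp add: \<Omega>_def)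
 have bb: "bdd_below ?O" using bounded_\<Omega>[OF f l] by (rule bounded_imp_bdd_below)
 define a0 where "a0 = Inf ?O"
 have a0: "a0 \<le> y" if "y \<in> ?O" for y unfolding a0_def using that bb by (rule cInf_lower)
 obtain y0 where y0: "y0 \<in> ?O" "y0 < a0 + R"
  using cInf_lessD[of ?O "a0 + R"] mem R(1) unfolding a0_def by auto
 define x' where "x' = min y0 (-4 * R)"
 have x': "x' \<in> ?O" "x' < a0 + R" "x' \<le> -4 * R" using y0 mem by (auto simp: x'_def min_def)
 have Mx': "M f x' > ennreal (l / \<theta>1)"
  using x'(1) T_le_M_left[OF f R, of x' l] x'(3) R(1) l by (auto simp: \<Omega>_def)
 then obtain s where s: "s > l / \<theta>1" "\<not> orlicz_le A f x' s"
  using M_gt_iff[OF fm, of "l / \<theta>1" x'] l \<theta>1 by auto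
 have l': "l / \<theta>1 > 0" using l \<theta>1 by simp
 then have s0: "s > 0" using s by simp
 \<comment> \<open>The interval contains \<open>\<Omega>\<close>, because \<open>a0 > x' - R\<close> and \<open>x' < 0\<close>.\<close>
 define \<alpha> \<beta> where "\<alpha> = 2 * x' - R" and "\<beta> = 2 * R"
 have ab: "\<alpha> < \<beta>" using x' R by (simp add: \<alpha>_def \<beta>_def)
 have O_sub: "?O \<subseteq> {\<alpha><..<\<beta>}"
 proof
  fix y assume y: "y \<in> ?O"
  have "y \<le> R"
  proof (rule ccontr)
   assume "\<not> y \<le> R"
   then have "R < y" by simp
   from M_right[OF f R(2) this] show False using y by (simp add: \<Omega>_def)
  qed
  then show "y \<in> {\<alpha><..<\<beta>}" using a0[OF y] x' R by (simp add: \<alpha>_def \<beta>_def)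
 qed
 define q where "q = \<alpha> - (\<beta> - \<alpha>)"
 have q: "q = 4 * x' - 4 * R" "\<beta> - q = 6 * R - 4 * x'" by (auto simp: q_def \<alpha>_def \<beta>_def)
 have pt: "ennreal (l powr p) * ennreal (ivl_max q \<beta> x powr r)
   \<le> ennreal ((12 * \<theta>1) powr p) * ennpowr (M f x) p + ennreal (l powr p) * indicator {-(2 * R)..2 * R} x" for x
 proof -
  have mI01: "0 \<le> ivl_max q \<beta> x" "ivl_max q \<beta> x \<le> 1" using ab q(2) x' R by (auto simp: ivl_max_def q divide_le_eq_1)
  consider "x \<ge> 2 * R" | "-R < x" "x < 2 * R" | "x' \<le> x" "x \<le> -R" | "x < x'" by linarith
  then show ?thesis
  proof cases
   case 1
   then have "ivl_max q \<beta> x = 0" using x' R by (auto simp: ivl_max_def q \<beta>_def)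
   then show ?thesis by simp
  next
   case 2
   have "ivl_max q \<beta> x powr r \<le> 1 powr r" using mI01 r by (intro powr_mono2) auto
   then have "ennreal (l powr p) * ennreal (ivl_max q \<beta> x powr r) \<le> ennreal (l powr p) * 1"
    by (intro mult_left_mono) auto
   then show ?thesis using 2 R by (simp add: add_increasing)
  next
   case 3
   have "\<not> orlicz_le A f x s" by (rule not_orlicz_le_mono_left[OF fl 3 s(2) s0])
   then have "M f x > ennreal (l / \<theta>1)" using s M_gt_iff[OF fm, of "l / \<theta>1" x] l' by auto
   then have "ennreal (12 * \<theta>1) * ennreal (l / \<theta>1) \<le> ennreal (12 * \<theta>1) * M f x" by (intro mult_left_mono) auto
   moreover have "ennreal l \<le> ennreal (12 * \<theta>1) * ennreal (l / \<theta>1)"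
    using \<theta>1 l by (subst ennreal_mult[symmetric]) (auto intro!: ennreal_leI)
   ultimately have "ennreal l \<le> ennreal (12 * \<theta>1) * M f x" by (rule order_trans[rotated])
   then have 4: "ennreal (l powr p) \<le> ennreal ((12 * \<theta>1) powr p) * ennpowr (M f x) p"
    using l \<theta>1 p by (intro ennpowr_ge) auto
   have "ivl_max q \<beta> x powr r \<le> 1 powr r" using mI01 r by (intro powr_mono2) auto
   then have "ennreal (l powr p) * ennreal (ivl_max q \<beta> x powr r) \<le> ennreal (l powr p) * 1"
    by (intro mult_left_mono) auto
   also have "\<dots> \<le> ennreal ((12 * \<theta>1) powr p) * ennpowr (M f x) p" using 4 by simp
   finally show ?thesis by (simp add: add_increasing2)
  next
   case 4
   have Rx: "R - x > 0" "R - x' > 0" using 4 x' R by auto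
   define s' where "s' = s * (R - x') / (2 * (R - x))"
   have s': "s' > 0" using s0 Rx by (simp add: s'_def)
   have "\<not> orlicz_le A f x s'" unfolding s'_def
    by (rule not_orlicz_le_scale_left[OF fm fl _ _ R(1) s(2) s0]) (use 4 x' R in auto)
   then have Ms: "ennreal s' \<le> M f x" using orlicz_le_of_less[OF fm, of x s'] by (meson not_less)
   have mle: "ivl_max q \<beta> x \<le> 6 * (R - x') / (R - x)"
   proof (cases "x \<le> q")
    case True
    have "ivl_max q \<beta> x = (6 * R - 4 * x') / (2 * R - x)" using True q by (simp add: ivl_max_def \<beta>_def)
    also have "\<dots> \<le> (6 * (R - x')) / (R - x)" using Rx x' R by (intro frac_le) auto
    finally show ?thesis .
   next
    case False
    have "ivl_max q \<beta> x \<le> 1" by (rule mI01)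
    also have "1 \<le> 6 * (R - x') / (R - x)" using False q Rx x' R by (simp add: pos_le_divide_eq)
    finally show ?thesis .
   qed
   have "l * ivl_max q \<beta> x \<le> l * (6 * (R - x') / (R - x))" using mle l by (intro mult_left_mono) auto
   also have "\<dots> = 12 * \<theta>1 * ((l / \<theta>1) * (R - x') / (2 * (R - x)))"
    using \<theta>1 by (intro scale_fraction) (use Rx in auto)
   also have "\<dots> \<le> 12 * \<theta>1 * s'"
    unfolding s'_def using \<theta>1 s Rx by (intro mult_left_mono divide_right_mono mult_right_mono) auto
   finally have "ennreal (l * ivl_max q \<beta> x) \<le> ennreal (12 * \<theta>1 * s')" by (rule ennreal_leI)
   also have "\<dots> = ennreal (12 * \<theta>1) * ennreal s'" using \<theta>1 s' by (intro ennreal_mult) auto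
   also have "\<dots> \<le> ennreal (12 * \<theta>1) * M f x" by (intro mult_left_mono Ms) simp
   finally have "ennreal ((l * ivl_max q \<beta> x) powr p) \<le> ennreal ((12 * \<theta>1) powr p) * ennpowr (M f x) p"
    using l mI01 \<theta>1 p by (intro ennpowr_ge) auto
   moreover have "ennreal (l powr p) * ennreal (ivl_max q \<beta> x powr r) \<le> ennreal ((l * ivl_max q \<beta> x) powr p)"
   proof -
    have "ivl_max q \<beta> x powr r \<le> ivl_max q \<beta> x powr p" using mI01 p by (intro powr_mono') auto
    then have "l powr p * ivl_max q \<beta> x powr r \<le> l powr p * ivl_max q \<beta> x powr p" by (intro mult_left_mono) auto
    also have "\<dots> = (l * ivl_max q \<beta> x) powr p" using l mI01 by (simp add: powr_mult)
    finally show ?thesis by (simp add: ennreal_mult[symmetric] ennreal_leI)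
   qed
   ultimately have "ennreal (l powr p) * ennreal (ivl_max q \<beta> x powr r) \<le> ennreal ((12 * \<theta>1) powr p) * ennpowr (M f x) p"
    by (rule order_trans[rotated])
   then show ?thesis by (simp add: add_increasing2)
  qed
 qed
 have [measurable]: "M f \<in> borel_measurable borel" by (rule M_measurable[OF f])
 have "ennreal (l powr p) * ivl_mass \<mu> r q \<beta> = (\<integral>\<^sup>+x. ennreal (l powr p) * ennreal (ivl_max q \<beta> x powr r) \<partial>\<mu>)"
  unfolding ivl_mass_def by (rule nn_integral_cmult[symmetric]) measurable
 also have "\<dots> \<le> (\<integral>\<^sup>+x. ennreal ((12 * \<theta>1) powr p) * ennpowr (M f x) p + ennreal (l powr p) * indicator {-(2 * R)..2 * R} x \<partial>\<mu>)"
  by (intro nn_integral_mono pt)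
 also have "\<dots> = ennreal ((12 * \<theta>1) powr p) * (\<integral>\<^sup>+x. ennpowr (M f x) p \<partial>\<mu>) + ennreal (l powr p) * emeasure \<mu> {-(2 * R)..2 * R}"
  by (subst nn_integral_add) (auto simp: nn_integral_cmult)
 finally have lV: "ennreal (l powr p) * ivl_mass \<mu> r q \<beta> \<le> ennreal ((12 * \<theta>1) powr p) * (\<integral>\<^sup>+x. ennpowr (M f x) p \<partial>\<mu>) + ennreal (l powr p) * emeasure \<mu> {-(2 * R)..2 * R}" .
 have base_const: "base_const \<ge> 0" using near_const_nonneg by (simp add: base_const_def decay_const_def)
 have "emeasure \<mu> ?O + tail_mass ?O \<le> ivl_mass \<mu> r q \<beta> + ennreal base_const * ivl_mass \<mu> r q \<beta>"
  unfolding q_def by (intro add_mono base_bound[OF open_\<Omega>[OF f l] O_sub ab])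
 also have "\<dots> = ennreal (1 + base_const) * ivl_mass \<mu> r q \<beta>" using base_const by (simp add: distrib_right)
 finally have "ennreal (l powr p) * (emeasure \<mu> ?O + tail_mass ?O) \<le> ennreal (l powr p) * (ennreal (1 + base_const) * ivl_mass \<mu> r q \<beta>)"
  by (rule mult_left_mono) simp
 also have "\<dots> = ennreal (1 + base_const) * (ennreal (l powr p) * ivl_mass \<mu> r q \<beta>)" by (simp only: mult.left_commute)
 also have "\<dots> \<le> ennreal (1 + base_const) * (ennreal ((12 * \<theta>1) powr p) * (\<integral>\<^sup>+x. ennpowr (M f x) p \<partial>\<mu>)
     + ennreal (l powr p) * emeasure \<mu> {-(2 * R)..2 * R})"
  by (rule mult_left_mono[OF lV]) simp
 finally show ?thesis .
qed

end

section \<open>Summation over the levels\<close>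

text \<open>Since \<open>y\<close> enters the bound of \<open>x'\<close> with a large factor \<open>T0\<close>, the sequence \<open>x\<close> is given the small weight
  \<open>\<alpha> = 1 / (2 T0)\<close>.\<close>
lemma step_combine:
 fixes x y x' y' d :: ennreal and \<sigma> r \<alpha> T0 :: real
 assumes nn: "\<sigma> \<ge> 0" "r \<ge> 0" "\<alpha> \<ge> 0" "T0 \<ge> 0" and c: "\<sigma> \<le> 1/4" "\<sigma> * r \<le> \<alpha> / 4" "\<alpha> * T0 = 1/2"
  and x: "x' \<le> ennreal (1/2) * x + ennreal T0 * y" and y: "y' \<le> ennreal \<sigma> * (y + ennreal r * x) + d"
 shows "y' + ennreal \<alpha> * x' \<le> ennreal (3/4) * (y + ennreal \<alpha> * x) + d"
proof -
 have "y' + ennreal \<alpha> * x' \<le> (ennreal \<sigma> * (y + ennreal r * x) + d) + ennreal \<alpha> * (ennreal (1/2) * x + ennreal T0 * y)"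
  by (rule add_mono[OF y mult_left_mono[OF x]]) simp
 also have "\<dots> = (ennreal \<sigma> + ennreal \<alpha> * ennreal T0) * y + (ennreal \<sigma> * ennreal r + ennreal \<alpha> * ennreal (1/2)) * x + d"
  by (simp only: distrib_left distrib_right ac_simps)
 also have "ennreal \<sigma> + ennreal \<alpha> * ennreal T0 = ennreal (\<sigma> + \<alpha> * T0)"
  using nn by (simp add: ennreal_mult)
 also have "ennreal \<sigma> * ennreal r + ennreal \<alpha> * ennreal (1/2) = ennreal (\<sigma> * r + \<alpha> * (1/2))"
  using nn by (subst ennreal_mult[symmetric], simp, simp, subst ennreal_mult[symmetric], simp, simp, subst ennreal_plus) auto
 also have "ennreal (\<sigma> + \<alpha> * T0) * y + ennreal (\<sigma> * r + \<alpha> * (1/2)) * x + d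
   \<le> ennreal (3/4) * y + ennreal (3/4 * \<alpha>) * x + d"
  using c by (intro add_right_mono add_mono mult_right_mono ennreal_leI) auto
 also have "ennreal (3/4) * y + ennreal (3/4 * \<alpha>) * x + d = ennreal (3/4) * (y + ennreal \<alpha> * x) + d"
  using nn by (subst ennreal_mult) (auto simp: distrib_left mult.assoc)
 finally show ?thesis .
qed

text \<open>One of the levels lies between \<open>v / L\<close> and \<open>v\<close>, for each \<open>v < T\<close>, as soon as the range of the
  levels is large enough.\<close>
lemma ennpowr_le_liminf_levels:
 assumes L: "L > 1" and p: "p > 0"
 shows "ennpowr T p \<le> ennreal (L powr p) *
  liminf (\<lambda>n. \<Sum>j\<le>2*n. ennreal ((1 / L ^ n * L ^ j) powr p) * indicator {m. m > ennreal (1 / L ^ n * L ^ j)} T)"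
  (is "_ \<le> _ * liminf ?G")
proof (rule ccontr)
 define Z where "Z = ennreal (L powr p) * liminf ?G"
 have key: "ennreal (v powr p) \<le> Z" if v: "v > 0" "ennreal v < T" for v
 proof -
  obtain N where N: "L ^ N > max v (1 / v)" using real_arch_pow[OF L] by blast
  have ev: "ennreal ((v / L) powr p) \<le> ?G n" if n: "n \<ge> N" for n
  proof -
   have Ln: "L ^ n > v" "L ^ n > 1 / v"
    using N less_le_trans[OF _ power_increasing[OF n, of L]] L by auto
   define j where "j = (GREATEST j. j \<le> 2 * n \<and> 1 / L ^ n * L ^ j < v)"
   have "0 \<le> 2 * n \<and> 1 / L ^ n * L ^ 0 < v" using Ln v L by (simp add: field_simps)
   then have j: "j \<le> 2 * n \<and> 1 / L ^ n * L ^ j < v" unfolding j_def by (rule GreatestI_nat[of _ 0 "2 * n"]) auto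
   have up: "v \<le> L * (1 / L ^ n * L ^ j)"
   proof (cases "j = 2 * n")
    case True
    have "v \<le> 1 / L ^ n * L ^ j" using Ln L by (simp add: True power_add mult_2)
    also have "\<dots> \<le> L * (1 / L ^ n * L ^ j)" using mult_right_mono[of 1 L "1 / L ^ n * L ^ j"] L by (simp only: mult_1_left) simp
    finally show ?thesis .
   next
    case False
    show ?thesis
    proof (rule ccontr)
     assume "\<not> ?thesis"
     then have "Suc j \<le> 2 * n \<and> 1 / L ^ n * L ^ Suc j < v" using False j by (auto simp: mult_ac)
     then have "Suc j \<le> j" unfolding j_def by (rule Greatest_le_nat) auto
     then show False by simp
    qed
   qed
   have "ennreal ((v / L) powr p) \<le> ennreal ((1 / L ^ n * L ^ j) powr p)"
    using up v L p by (intro ennreal_leI powr_mono2) (auto simp: divide_le_eq mult_ac)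
   also have "\<dots> = ennreal ((1 / L ^ n * L ^ j) powr p) * indicator {m. m > ennreal (1 / L ^ n * L ^ j)} T"
   proof -
    have "ennreal (1 / L ^ n * L ^ j) < T" using j v(2) by (meson ennreal_leI less_imp_le order_le_less_trans)
    then show ?thesis by simp
   qed
   also have "\<dots> \<le> ?G n"
    using j by (intro member_le_sum[of j "{..2*n}" "\<lambda>j. ennreal ((1 / L ^ n * L ^ j) powr p) * indicator {m. m > ennreal (1 / L ^ n * L ^ j)} T"]) auto
   finally show ?thesis .
  qed
  then have "ennreal ((v / L) powr p) \<le> liminf ?G"
   by (intro Liminf_bounded eventually_sequentiallyI[of N])
  then have "ennreal (L powr p) * ennreal ((v / L) powr p) \<le> Z" unfolding Z_def by (intro mult_left_mono) auto
  moreover have "ennreal (L powr p) * ennreal ((v / L) powr p) = ennreal (v powr p)"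
   using L v by (subst ennreal_mult[symmetric]) (auto simp flip: powr_mult)
  ultimately show ?thesis by simp
 qed
 assume "\<not> ?thesis"
 then have less: "Z < ennpowr T p" by (simp add: Z_def not_le)
 then obtain z where z: "Z = ennreal z" "z \<ge> 0" by (cases Z) auto
 have "ennreal (z powr (1 / p)) < T"
 proof (cases T)
  case (real \<tau>)
  then have "z < \<tau> powr p" using less z by (simp add: ennpowr_ennreal ennreal_less_iff)
  then have "z powr (1 / p) < (\<tau> powr p) powr (1 / p)" using z p by (intro powr_less_mono2) auto
  then show ?thesis using real p z by (simp add: powr_powr ennreal_less_iff)
 qed simp
 then obtain v where v: "ennreal (z powr (1 / p)) < ennreal v" "ennreal v < T" "v \<ge> 0"
  by (metis dense ennreal_cases top_greatest not_le)
 then have zv: "z powr (1 / p) < v" by (simp add: ennreal_less_iff)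
 then have v0: "v > 0" by (meson le_less_trans powr_ge_zero)
 have "(z powr (1 / p)) powr p < v powr p" using zv p by (intro powr_less_mono2) auto
 then have "z < v powr p" using p z by (simp add: powr_powr)
 moreover have "v powr p \<le> z" using key[OF v0 v(2)] z by simp
 ultimately show False by simp
qed

lemma ennreal_mult_add: "a \<ge> 0 \<Longrightarrow> b \<ge> 0 \<Longrightarrow> c \<ge> 0 \<Longrightarrow> ennreal a * ennreal b + ennreal a * ennreal c = ennreal (a * b + a * c)"
 by (simp add: ennreal_mult)

lemma ennreal_expand:
 assumes "u \<ge> 0" "v \<ge> 0" "a \<ge> 0" "b \<ge> 0" "m \<ge> 0"
 shows "ennreal u * (ennreal v * (ennreal a * I + ennreal b * ennreal m)) = ennreal (u * v * a) * I + ennreal (u * v * (b * m))"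
 using assms by (simp add: ennreal_mult distrib_left mult.assoc)

lemma ennreal_collect:
 assumes "u \<ge> 0" "a \<ge> 0" "c \<ge> 0" "b \<ge> 0"
 shows "ennreal u * ((ennreal a + ennreal c) * I + ennreal b) = ennreal (u * (a + c)) * I + ennreal (u * b)"
proof -
 have "ennreal a + ennreal c = ennreal (a + c)" using assms by simp
 moreover have "ennreal (u * (a + c)) = ennreal u * ennreal (a + c)" "ennreal (u * b) = ennreal u * ennreal b"
  using assms by (intro ennreal_mult add_nonneg_nonneg; simp)+
 ultimately show ?thesis by (simp only: distrib_left[of "ennreal u" "ennreal (a + c) * I"] mult.assoc)
qed

context coifman
begin

text \<open>The order of the choices matters. Since \<open>r > p\<close>, a large \<open>L\<close> makes \<open>L powr p * (fill_const / L) powr r\<close>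
  small; then \<open>t\<close> is chosen large depending on \<open>L\<close>, which fixes the weight \<open>\<alpha>\<close>, and finally \<open>g\<close> small.\<close>
lemma parameters:
 obtains L t g where "L \<ge> min_ratio" "t \<ge> decay_const" "0 < g" "g \<le> 1 / \<theta>1"
  "L powr p * (fill_const / L) powr r + L powr p * (near_const / t * r) \<le> 1/2"
  "L powr p * (8 * Cw * (16 * local_const * g) powr \<epsilon>0) \<le> 1/4"
  "L powr p * (8 * Cw * (16 * local_const * g) powr \<epsilon>0) * r \<le> 1 / (2 * (L powr p * (t + near_const / t))) / 4"
proof -
 have fill_const: "fill_const > 0" using local_const_pos by (simp add: fill_const_def)
 define L where "L = max min_ratio ((4 * fill_const powr r) powr (1 / (r - p)))"
 have L: "L \<ge> min_ratio" "L > 0" by (auto simp: L_def min_ratio_def)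
 have 1: "L powr p * (fill_const / L) powr r \<le> 1/4"
 proof -
  have "4 * fill_const powr r = ((4 * fill_const powr r) powr (1 / (r - p))) powr (r - p)"
   using p fill_const by (simp add: powr_powr)
  also have "\<dots> \<le> L powr (r - p)" using p by (intro powr_mono2) (auto simp: L_def)
  finally have "4 * fill_const powr r * L powr p \<le> L powr (r - p) * L powr p" by (rule mult_right_mono) simp
  also have "\<dots> = L powr r" by (simp flip: powr_add)
  finally have "4 * fill_const powr r * L powr p \<le> L powr r" .
  then show ?thesis using L fill_const by (simp add: powr_divide divide_le_eq mult_ac)
 qed
 define t where "t = max decay_const (4 * (L powr p * (near_const * r)))"
 have decay_const: "decay_const \<ge> 1" by (simp add: decay_const_def)
 have t: "t \<ge> decay_const" "t > 0" using decay_const by (auto simp: t_def)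
 have 2: "L powr p * (near_const / t * r) \<le> 1/4"
 proof -
  have "4 * (L powr p * (near_const * r)) \<le> t" by (simp add: t_def)
  then show ?thesis using t by (simp add: divide_le_eq mult_ac)
 qed
 define \<alpha> where "\<alpha> = 1 / (2 * (L powr p * (t + near_const / t)))"
 have \<alpha>: "\<alpha> > 0" unfolding \<alpha>_def using L t near_const_nonneg by (intro divide_pos_pos mult_pos_pos add_pos_nonneg) auto
 define \<delta> where "\<delta> = min (1/4) (\<alpha> / (4 * r)) / (L powr p * (8 * Cw))"
 have r0: "r > 0" using r by simp
 have \<delta>: "\<delta> > 0" using \<alpha> r0 L Cw by (simp add: \<delta>_def)
 define g where "g = min (1 / \<theta>1) (\<delta> powr (1 / \<epsilon>0) / (16 * local_const))"
 have g: "g > 0" "g \<le> 1 / \<theta>1" using \<theta>1 local_const_pos \<delta> by (auto simp: g_def)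
 have "16 * local_const * g \<le> 16 * local_const * (\<delta> powr (1 / \<epsilon>0) / (16 * local_const))" using local_const_pos by (intro mult_left_mono) (auto simp: g_def)
 also have "\<dots> = \<delta> powr (1 / \<epsilon>0)" using local_const_pos by simp
 finally have "(16 * local_const * g) powr \<epsilon>0 \<le> (\<delta> powr (1 / \<epsilon>0)) powr \<epsilon>0" using g local_const_pos e0 by (intro powr_mono2) auto
 also have "\<dots> = \<delta>" using e0 \<delta> by (simp add: powr_powr)
 finally have "L powr p * (8 * Cw * (16 * local_const * g) powr \<epsilon>0) \<le> L powr p * (8 * Cw * \<delta>)"
  using Cw by (intro mult_left_mono) auto
 also have "\<dots> = min (1/4) (\<alpha> / (4 * r))" using L Cw by (simp add: \<delta>_def)
 finally have 3: "L powr p * (8 * Cw * (16 * local_const * g) powr \<epsilon>0) \<le> min (1/4) (\<alpha> / (4 * r))" .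
 then have "L powr p * (8 * Cw * (16 * local_const * g) powr \<epsilon>0) * r \<le> \<alpha> / (4 * r) * r"
  using r0 by (intro mult_right_mono) auto
 also have "\<dots> = \<alpha> / 4" using r0 by simp
 finally have 4: "L powr p * (8 * Cw * (16 * local_const * g) powr \<epsilon>0) * r \<le> \<alpha> / 4" .
 show ?thesis
 proof (rule that[OF L(1) t(1) g])
  show "L powr p * (fill_const / L) powr r + L powr p * (near_const / t * r) \<le> 1/2" using 1 2 by linarith
  show "L powr p * (8 * Cw * (16 * local_const * g) powr \<epsilon>0) \<le> 1/4" using 3 by linarith
  show "L powr p * (8 * Cw * (16 * local_const * g) powr \<epsilon>0) * r \<le> 1 / (2 * (L powr p * (t + near_const / t))) / 4"
   using 4 unfolding \<alpha>_def .
 qed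
qed

text \<open>The two recursions, for the tail mass by \<open>\<Omega>_fill\<close> and for the measure by \<open>good_lambda_T\<close>, combined
  into a contraction of \<open>W\<close> up to the term with \<open>M\<^sub>A\<^sup>+ f\<close>.\<close>
lemma level_step:
 assumes f: "bcs f" and l: "l > 0" and L: "L \<ge> min_ratio" and t: "t \<ge> decay_const" and g: "0 < g" "g \<le> 1 / \<theta>1"
  and c1: "L powr p * (fill_const / L) powr r + L powr p * (near_const / t * r) \<le> 1/2"
  and c2: "L powr p * (8 * Cw * (16 * local_const * g) powr \<epsilon>0) \<le> 1/4"
  and c3: "L powr p * (8 * Cw * (16 * local_const * g) powr \<epsilon>0) * r \<le> \<alpha> / 4"
  and \<alpha>: "\<alpha> = 1 / (2 * (L powr p * (t + near_const / t)))"
 defines "W \<equiv> \<lambda>l. ennreal (l powr p) * emeasure \<mu> (\<Omega> f l) + ennreal \<alpha> * (ennreal (l powr p) * tail_mass (\<Omega> f l))"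
 shows "W (L * l) \<le> ennreal (3/4) * W l + ennreal ((L * l) powr p) * emeasure \<mu> {x. M f x > ennreal (g * l)}"
proof -
 have L4: "L \<ge> 4" using L by (simp add: min_ratio_def)
 have min_ratio: "L > 0" "L * l > 0" using L4 l by auto
 have t0: "t > 0" using t by (simp add: decay_const_def)
 have fill_const: "fill_const > 0" using local_const_pos by (simp add: fill_const_def)
 have ll: "l \<le> L * l" using L4 l by simp
 have sub: "\<Omega> f (L * l) \<subseteq> \<Omega> f l" by (rule \<Omega>_mono[OF l ll])
 have e: "(L * l) powr p = L powr p * l powr p" using min_ratio l by (simp add: powr_mult)
 define \<sigma> where "\<sigma> = 8 * Cw * (16 * local_const * g) powr \<epsilon>0"
 have \<sigma>: "\<sigma> \<ge> 0" using Cw by (simp add: \<sigma>_def)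
 let ?x = "ennreal (l powr p) * tail_mass (\<Omega> f l)" and ?y = "ennreal (l powr p) * emeasure \<mu> (\<Omega> f l)"
 have xs: "ennreal ((L * l) powr p) * tail_mass (\<Omega> f (L * l)) \<le> ennreal (1/2) * ?x + ennreal (L powr p * (t + near_const / t)) * ?y"
 proof -
  have "tail_mass (\<Omega> f (L * l)) \<le> ennreal ((fill_const / L) powr r) * tail_mass (\<Omega> f l)
    + (ennreal t * emeasure \<mu> (\<Omega> f l) + ennreal (near_const / t) * (emeasure \<mu> (\<Omega> f l) + ennreal r * tail_mass (\<Omega> f l)))"
   by (rule tail_mass_rec[OF open_\<Omega>[OF f min_ratio(2)] bounded_\<Omega>[OF f min_ratio(2)] open_\<Omega>[OF f l] bounded_\<Omega>[OF f l] sub _ t \<Omega>_fill[OF f l L]])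
    (use fill_const min_ratio in auto)
  then have "ennreal ((L * l) powr p) * tail_mass (\<Omega> f (L * l)) \<le> ennreal ((L * l) powr p) * (ennreal ((fill_const / L) powr r) * tail_mass (\<Omega> f l)
    + (ennreal t * emeasure \<mu> (\<Omega> f l) + ennreal (near_const / t) * (emeasure \<mu> (\<Omega> f l) + ennreal r * tail_mass (\<Omega> f l))))"
   by (rule mult_left_mono) simp
  also have "\<dots> = (ennreal (L powr p) * ennreal ((fill_const / L) powr r) + ennreal (L powr p) * (ennreal (near_const / t) * ennreal r)) * ?x
    + (ennreal (L powr p) * (ennreal t + ennreal (near_const / t))) * ?y"
   unfolding e ennreal_mult[OF powr_ge_zero powr_ge_zero] by (simp only: distrib_left distrib_right ac_simps)
  also have "ennreal (L powr p) * (ennreal t + ennreal (near_const / t)) = ennreal (L powr p * (t + near_const / t))"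
   using t0 near_const_nonneg by (subst ennreal_plus[symmetric]) (auto simp: ennreal_mult)
  also have "ennreal (L powr p) * ennreal ((fill_const / L) powr r) + ennreal (L powr p) * (ennreal (near_const / t) * ennreal r)
    = ennreal (L powr p * (fill_const / L) powr r + L powr p * (near_const / t * r))"
  proof -
   have "ennreal (near_const / t) * ennreal r = ennreal (near_const / t * r)" using t0 near_const_nonneg r by (intro ennreal_mult[symmetric]) auto
   moreover have "near_const / t * r \<ge> 0" using t0 near_const_nonneg r by simp
   ultimately show ?thesis by (simp only: ennreal_mult_add powr_ge_zero)
  qed
  also have "ennreal (L powr p * (fill_const / L) powr r + L powr p * (near_const / t * r)) * ?x + ennreal (L powr p * (t + near_const / t)) * ?y
    \<le> ennreal (1/2) * ?x + ennreal (L powr p * (t + near_const / t)) * ?y"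
   using c1 by (intro add_right_mono mult_right_mono ennreal_leI) auto
  finally show ?thesis .
 qed
 define D where "D = {x. M f x > ennreal (g * l)}"
 have gl: "g * l \<ge> 0" using g l by simp
 have Dm: "D \<in> sets \<mu>" unfolding D_def using borel_open[OF open_M_gt[OF f gl]] by simp
 have ys: "ennreal ((L * l) powr p) * emeasure \<mu> (\<Omega> f (L * l))
   \<le> ennreal (L powr p * \<sigma>) * (?y + ennreal r * ?x) + ennreal ((L * l) powr p) * emeasure \<mu> D"
 proof -
  define E where "E = {x. Tmax k f x > ennreal (L * l) \<and> M f x \<le> ennreal (g * l)}"
  have Em: "E \<in> sets \<mu>"
  proof -
   have "E = {x. Tmax k f x > ennreal (L * l)} - D" by (auto simp: E_def D_def not_less)
   moreover have "{x. Tmax k f x > ennreal (L * l)} \<in> sets \<mu>" using borel_open[OF open_Tmax_gt[OF f]] min_ratio by simp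
   ultimately show ?thesis using Dm by simp
  qed
  have "g * l \<le> L * l / \<theta>1"
  proof -
   have "g * l \<le> 1 / \<theta>1 * l" using g l by (intro mult_right_mono) auto
   also have "\<dots> \<le> L * l / \<theta>1" using ll \<theta>1 by (simp add: divide_right_mono)
   finally show ?thesis .
  qed
  then have "ennreal (g * l) \<le> ennreal (L * l / \<theta>1)" by (rule ennreal_leI)
  then have "\<Omega> f (L * l) \<subseteq> E \<union> D" unfolding \<Omega>_def E_def D_def by (auto simp: not_le intro: le_less_trans)
  then have "emeasure \<mu> (\<Omega> f (L * l)) \<le> emeasure \<mu> (E \<union> D)" using Em Dm by (intro emeasure_mono) auto
  also have "\<dots> \<le> emeasure \<mu> E + emeasure \<mu> D" using Em Dm by (rule emeasure_subadditive)
  also have "\<dots> \<le> ennreal \<sigma> * (emeasure \<mu> (\<Omega> f l) + ennreal r * tail_mass (\<Omega> f l)) + emeasure \<mu> D"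
  proof -
   have "1 / \<theta>1 \<le> 1" using \<theta>1 by simp
   then have "g \<le> 1" using g by linarith
   then show ?thesis using good_lambda_T[OF f l L g(1)] unfolding E_def \<sigma>_def by (intro add_right_mono)
  qed
  finally have "ennreal ((L * l) powr p) * emeasure \<mu> (\<Omega> f (L * l)) \<le> ennreal ((L * l) powr p) * (ennreal \<sigma> * (emeasure \<mu> (\<Omega> f l) + ennreal r * tail_mass (\<Omega> f l)) + emeasure \<mu> D)"
   by (rule mult_left_mono) simp
  also have "\<dots> = ennreal (L powr p) * ennreal \<sigma> * (?y + ennreal r * ?x) + ennreal ((L * l) powr p) * emeasure \<mu> D"
   unfolding e ennreal_mult[OF powr_ge_zero powr_ge_zero] by (simp only: distrib_left distrib_right ac_simps)
  also have "ennreal (L powr p) * ennreal \<sigma> = ennreal (L powr p * \<sigma>)" using \<sigma> by (simp add: ennreal_mult)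
  finally show ?thesis .
 qed
 have T0: "L powr p * (t + near_const / t) > 0" using min_ratio t0 near_const_nonneg by (intro mult_pos_pos add_pos_nonneg) auto
 show ?thesis unfolding W_def D_def[symmetric]
 proof (rule step_combine[OF _ _ _ _ _ _ _ xs ys])
  show "L powr p * \<sigma> \<le> 1/4" "L powr p * \<sigma> * r \<le> \<alpha> / 4" using c2 c3 by (simp_all add: \<sigma>_def)
  show "\<alpha> * (L powr p * (t + near_const / t)) = 1/2"
  proof -
   have "1 / (2 * P) * P = 1 / 2" if "P > 0" for P :: real using that by simp
   from this[OF T0] show ?thesis unfolding \<alpha> .
  qed
  show "\<alpha> \<ge> 0" unfolding \<alpha> using T0 by simp
 qed (use \<sigma> T0 r in auto)
qed

lemma Tmax_eq_0:
 assumes f: "bcs f" and R: "R > 0" "\<And>y. \<bar>y\<bar> > R \<Longrightarrow> f y = 0" and M0: "\<not> M f (-4 * R) > 0"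
 shows "Tmax k f x = 0"
proof -
 have fm [measurable]: "f \<in> borel_measurable borel" by (rule bcs_measurable[OF f])
 have o: "orlicz_le A f (-4 * R) s" if "s > 0" for s
  using M_gt_iff[OF fm, of 0 "-4 * R"] M0 that by auto
 have le: "(\<integral>\<^sup>+y. ennreal (norm (f y)) * indicator {-4 * R..-4 * R + 8 * R} y \<partial>lborel) \<le> ennreal (16 * R * s)" if "s > 0" for s
  using integral_le_of_orlicz_le[OF fm that o[OF that], of "8 * R"] R(1) by simp
 have "(\<integral>\<^sup>+y. ennreal (norm (f y)) * indicator {-4 * R..-4 * R + 8 * R} y \<partial>lborel) \<le> 0"
 proof (rule ennreal_le_epsilon)
  fix e :: real assume "e > 0"
  then show "(\<integral>\<^sup>+y. ennreal (norm (f y)) * indicator {-4 * R..-4 * R + 8 * R} y \<partial>lborel) \<le> 0 + ennreal e"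
   using le[of "e / (16 * R)"] R(1) by simp
 qed
 then have "AE y in lborel. ennreal (norm (f y)) * indicator {-4 * R..-4 * R + 8 * R} y = 0"
  by (subst (asm) le_zero_eq, subst (asm) nn_integral_0_iff_AE) auto
 then have f0: "AE y in lborel. f y = 0"
 proof (rule AE_mp, intro AE_I2 impI)
  fix y assume "ennreal (norm (f y)) * indicator {-4 * R..-4 * R + 8 * R} y = 0"
  then show "f y = 0" using R(2)[of y] R(1) by (cases "\<bar>y\<bar> > R") (auto simp: indicator_def split: if_splits)
 qed
 have "Tr k e f x = 0" for e
  unfolding Tr_shift
 proof (rule integral_eq_zero_AE)
  show "AE y in lborel. trunc k e (y - x) * f y = 0" using f0 by (auto elim: eventually_mono)
 qed
 then show ?thesis by (simp add: Tmax_def)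
qed

text \<open>The contraction is summed over the \<open>2 n + 1\<close> levels from \<open>1 / L ^ n\<close> to \<open>L ^ n\<close>. The lowest level is
  estimated by \<open>low_level\<close>, whose error term tends to 0 as \<open>n\<close> grows; Fatou's lemma then gives the
  integral of the maximal singular integral.\<close>
theorem coifman_bound:
 obtains C where "C > 0"
  "\<And>f. bcs f \<Longrightarrow> (\<integral>\<^sup>+x. ennpowr (Tmax k f x) p \<partial>\<mu>) \<le> ennreal C * (\<integral>\<^sup>+x. ennpowr (M f x) p \<partial>\<mu>)"
proof -
 obtain L t g where L: "L \<ge> min_ratio" and t: "t \<ge> decay_const" and g: "0 < g" "g \<le> 1 / \<theta>1"
  and c1: "L powr p * (fill_const / L) powr r + L powr p * (near_const / t * r) \<le> 1/2"
  and c2: "L powr p * (8 * Cw * (16 * local_const * g) powr \<epsilon>0) \<le> 1/4"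
  and c3: "L powr p * (8 * Cw * (16 * local_const * g) powr \<epsilon>0) * r \<le> 1 / (2 * (L powr p * (t + near_const / t))) / 4"
  using parameters by blast
 define \<alpha> where "\<alpha> = 1 / (2 * (L powr p * (t + near_const / t)))"
 note step = level_step[OF _ _ L t g c1 c2 c3[folded \<alpha>_def] \<alpha>_def]
 have L1: "L > 1" using L by (simp add: min_ratio_def)
 have t0: "t > 0" using t by (simp add: decay_const_def)
 have \<alpha>: "\<alpha> \<ge> 0" unfolding \<alpha>_def using L1 t0 near_const_nonneg by simp
 have base_const: "base_const \<ge> 0" using near_const_nonneg by (simp add: base_const_def decay_const_def)
 define Ca where "Ca = (1 + \<alpha>) * (1 + base_const) * (12 * \<theta>1) powr p"
 define Cb where "Cb = (1 + \<alpha>) * (1 + base_const)"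
 define Cc where "Cc = L powr p * ((1 / g) powr p / (1 - L powr (-p)))"
 have Cnn: "Ca \<ge> 0" "Cb \<ge> 0" using \<alpha> base_const by (auto simp: Ca_def Cb_def)
 have "L powr (-p) < L powr 0" using L1 p by (intro powr_less_mono) auto
 then have q1: "L powr (-p) < 1" using L1 by simp
 then have Ccnn: "Cc \<ge> 0" by (simp add: Cc_def)
 define C where "C = L powr p * (4 * (Ca + Cc)) + 1"
 have C: "C > 0" using Cnn Ccnn by (simp add: C_def add_nonneg_pos)
 have bound: "(\<integral>\<^sup>+x. ennpowr (Tmax k f x) p \<partial>\<mu>) \<le> ennreal C * (\<integral>\<^sup>+x. ennpowr (M f x) p \<partial>\<mu>)" if f: "bcs f" for f
 proof -
  obtain B R where R: "R > 0" "\<And>y. \<bar>y\<bar> > R \<Longrightarrow> f y = 0"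
   using f by (rule bcsE) blast
  define I where "I = (\<integral>\<^sup>+x. ennpowr (M f x) p \<partial>\<mu>)"
  have [measurable]: "M f \<in> borel_measurable borel" "Tmax k f \<in> borel_measurable borel"
   by (rule M_measurable[OF f], rule Tmax_measurable[OF f])
  show ?thesis
  proof (cases "M f (-4 * R) > 0")
   case False
   have "(\<lambda>x. ennpowr (Tmax k f x) p) = (\<lambda>x. 0)" using Tmax_eq_0[OF f R False] by (auto simp: ennpowr_def)
   then show ?thesis by simp
  next
   case True
   define W where "W l = ennreal (l powr p) * emeasure \<mu> (\<Omega> f l) + ennreal \<alpha> * (ennreal (l powr p) * tail_mass (\<Omega> f l))" for l
   define d where "d l = ennreal ((L * l) powr p) * emeasure \<mu> {x. M f x > ennreal (g * l)}" for l
   have Wstep: "W (L * l) \<le> ennreal (3/4) * W l + d l" if "l > 0" for l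
    using step[OF f that] unfolding W_def d_def .
   define G where "G n T = (\<Sum>j\<le>2*n. ennreal ((1 / L ^ n * L ^ j) powr p) * indicator {m. m > ennreal (1 / L ^ n * L ^ j)} T)" for n and T :: ennreal
   define m where "m = enn2real (emeasure \<mu> {-(2 * R)..2 * R})"
   have m: "emeasure \<mu> {-(2 * R)..2 * R} = ennreal m" "m \<ge> 0" using fin[of "2 * R"] by (auto simp: m_def)
   have Gint: "(\<integral>\<^sup>+x. G n (Tmax k f x) \<partial>\<mu>) \<le> ennreal (4 * (Ca + Cc)) * I + ennreal (4 * (Cb * ((1 / L ^ n) powr p * m)))"
    if n: "M f (-4 * R) > ennreal (1 / L ^ n / \<theta>1)" for n
   proof -
    define c where "c = 1 / L ^ n"
    have c: "c > 0" using L1 by (simp add: c_def)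
    have cj: "c * L ^ j > 0" for j using c L1 by simp
    have sd: "(\<Sum>j<2*n. d (c * L ^ j)) \<le> ennreal Cc * I"
    proof -
     have "(\<Sum>j<2*n. d (c * L ^ j)) = (\<Sum>j<2*n. \<integral>\<^sup>+x. ennreal (L powr p) * (ennreal ((c * L ^ j) powr p) * indicator {m. m > ennreal (g * (c * L ^ j))} (M f x)) \<partial>\<mu>)"
     proof (rule sum.cong[OF refl])
      fix j
      have "d (c * L ^ j) = ennreal (L powr p) * ennreal ((c * L ^ j) powr p) * emeasure \<mu> {x. M f x > ennreal (g * (c * L ^ j))}"
       unfolding d_def using L1 cj[of j] by (simp add: powr_mult ennreal_mult)
      also have "\<dots> = (\<integral>\<^sup>+x. (ennreal (L powr p) * ennreal ((c * L ^ j) powr p)) * indicator {x. M f x > ennreal (g * (c * L ^ j))} x \<partial>\<mu>)"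
       by (rule nn_integral_cmult_indicator[symmetric]) measurable
      also have "\<dots> = (\<integral>\<^sup>+x. ennreal (L powr p) * (ennreal ((c * L ^ j) powr p) * indicator {m. m > ennreal (g * (c * L ^ j))} (M f x)) \<partial>\<mu>)"
       by (intro nn_integral_cong) (simp add: mult.assoc indicator_def)
      finally show "d (c * L ^ j) = \<dots>" .
     qed
     also have "\<dots> = (\<integral>\<^sup>+x. (\<Sum>j<2*n. ennreal (L powr p) * (ennreal ((c * L ^ j) powr p) * indicator {m. m > ennreal (g * (c * L ^ j))} (M f x))) \<partial>\<mu>)"
      by (rule nn_integral_sum[symmetric]) measurable
     also have "\<dots> \<le> (\<integral>\<^sup>+x. ennreal Cc * ennpowr (M f x) p \<partial>\<mu>)"
     proof (rule nn_integral_mono)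
      fix x
      have "(\<Sum>j<2*n. ennreal (L powr p) * (ennreal ((c * L ^ j) powr p) * indicator {m. m > ennreal (g * (c * L ^ j))} (M f x)))
        = ennreal (L powr p) * (\<Sum>j<2*n. ennreal ((c * L ^ j) powr p) * indicator {m. m > ennreal (g * (c * L ^ j))} (M f x))"
       by (rule sum_distrib_left[symmetric])
      also have "\<dots> \<le> ennreal (L powr p) * (ennreal ((1 / g) powr p / (1 - L powr (-p))) * ennpowr (M f x) p)"
       by (intro mult_left_mono geometric_levels[OF L1 p(1) c g(1)]) simp
      also have "\<dots> = ennreal Cc * ennpowr (M f x) p"
       unfolding Cc_def using q1 by (subst ennreal_mult) (auto simp: mult.assoc)
      finally show "(\<Sum>j<2*n. ennreal (L powr p) * (ennreal ((c * L ^ j) powr p) * indicator {m. m > ennreal (g * (c * L ^ j))} (M f x))) \<le> ennreal Cc * ennpowr (M f x) p" .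
     qed
     also have "\<dots> = ennreal Cc * I" unfolding I_def by (rule nn_integral_cmult) measurable
     finally show ?thesis .
    qed
    have W0: "W c \<le> ennreal Ca * I + ennreal (Cb * (c powr p * m))"
    proof -
     have "W c \<le> ennreal (1 + \<alpha>) * (ennreal (c powr p) * (emeasure \<mu> (\<Omega> f c) + tail_mass (\<Omega> f c)))"
     proof -
      have "W c \<le> ennreal (1 + \<alpha>) * (ennreal (c powr p) * emeasure \<mu> (\<Omega> f c)) + ennreal (1 + \<alpha>) * (ennreal (c powr p) * tail_mass (\<Omega> f c))"
       unfolding W_def
      proof (rule add_mono)
       have "1 * (ennreal (c powr p) * emeasure \<mu> (\<Omega> f c)) \<le> ennreal (1 + \<alpha>) * (ennreal (c powr p) * emeasure \<mu> (\<Omega> f c))"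
        using \<alpha> by (intro mult_right_mono) auto
       then show "ennreal (c powr p) * emeasure \<mu> (\<Omega> f c) \<le> ennreal (1 + \<alpha>) * (ennreal (c powr p) * emeasure \<mu> (\<Omega> f c))" by simp
       show "ennreal \<alpha> * (ennreal (c powr p) * tail_mass (\<Omega> f c)) \<le> ennreal (1 + \<alpha>) * (ennreal (c powr p) * tail_mass (\<Omega> f c))"
        using \<alpha> by (intro mult_right_mono ennreal_leI) auto
      qed
      then show ?thesis by (simp only: distrib_left)
     qed
     also have "\<dots> \<le> ennreal (1 + \<alpha>) * (ennreal (1 + base_const) * (ennreal ((12 * \<theta>1) powr p) * I + ennreal (c powr p) * ennreal m))"
      using mult_left_mono[OF low_level[OF f R c n[folded c_def]] zero_le[of "ennreal (1 + \<alpha>)"]] unfolding I_def m(1) .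
     also have "\<dots> = ennreal Ca * I + ennreal (Cb * (c powr p * m))"
      unfolding Ca_def Cb_def using \<alpha> base_const m(2) by (intro ennreal_expand) auto
     finally show ?thesis .
    qed
    have "(\<integral>\<^sup>+x. G n (Tmax k f x) \<partial>\<mu>) = (\<Sum>j\<le>2*n. \<integral>\<^sup>+x. ennreal ((c * L ^ j) powr p) * indicator {m. m > ennreal (c * L ^ j)} (Tmax k f x) \<partial>\<mu>)"
     unfolding G_def c_def[symmetric] by (rule nn_integral_sum) measurable
    also have "\<dots> \<le> (\<Sum>j\<le>2*n. W (c * L ^ j))"
    proof (rule sum_mono)
     fix j
     have "(\<integral>\<^sup>+x. ennreal ((c * L ^ j) powr p) * indicator {m. m > ennreal (c * L ^ j)} (Tmax k f x) \<partial>\<mu>)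
       \<le> (\<integral>\<^sup>+x. ennreal ((c * L ^ j) powr p) * indicator (\<Omega> f (c * L ^ j)) x \<partial>\<mu>)"
      by (intro nn_integral_mono mult_left_mono) (auto simp: indicator_def \<Omega>_def)
     also have "\<dots> = ennreal ((c * L ^ j) powr p) * emeasure \<mu> (\<Omega> f (c * L ^ j))"
      using borel_open[OF open_\<Omega>[OF f cj]] by (intro nn_integral_cmult_indicator) simp
     also have "\<dots> \<le> W (c * L ^ j)" unfolding W_def by (rule add_increasing2) auto
     finally show "(\<integral>\<^sup>+x. ennreal ((c * L ^ j) powr p) * indicator {m. m > ennreal (c * L ^ j)} (Tmax k f x) \<partial>\<mu>) \<le> W (c * L ^ j)" .
    qed
    also have "\<dots> \<le> 4 * (W (c * L ^ 0) + (\<Sum>j<2*n. d (c * L ^ j)))"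
    proof (rule sum_contraction)
     fix j
     have "c * L ^ Suc j = L * (c * L ^ j)" by simp
     then show "W (c * L ^ Suc j) \<le> ennreal (3/4) * W (c * L ^ j) + d (c * L ^ j)" using Wstep[OF cj[of j]] by (simp only:)
    qed
    also have "\<dots> \<le> 4 * ((ennreal Ca * I + ennreal (Cb * (c powr p * m))) + ennreal Cc * I)"
     using W0 sd by (intro mult_left_mono add_mono) auto
    also have "\<dots> = ennreal 4 * ((ennreal Ca + ennreal Cc) * I + ennreal (Cb * (c powr p * m)))"
     by (simp add: distrib_right add_ac)
    also have "\<dots> = ennreal (4 * (Ca + Cc)) * I + ennreal (4 * (Cb * (c powr p * m)))"
     using Cnn Ccnn m(2) by (intro ennreal_collect) auto
    finally show ?thesis unfolding c_def .
   qed
   obtain n0 where n0: "M f (-4 * R) > ennreal (1 / L ^ n / \<theta>1)" if "n \<ge> n0" for n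
   proof -
    obtain z where z: "0 < ennreal z" "ennreal z < M f (-4 * R)"
     using dense[OF True] by (metis ennreal_cases top_greatest not_le)
    then have z0: "z > 0" by (simp add: ennreal_less_zero_iff)
    obtain n0 where n0: "L ^ n0 > 1 / z" using real_arch_pow[OF L1] by blast
    have "ennreal (1 / L ^ n / \<theta>1) < M f (-4 * R)" if n: "n \<ge> n0" for n
    proof -
     have "L ^ n0 \<le> L ^ n" using n L1 by (intro power_increasing) auto
     then have "1 / z < L ^ n" using n0 by linarith
     then have "1 / L ^ n \<le> z" using z0 L1 by (simp add: field_simps)
     moreover have "1 / L ^ n / \<theta>1 \<le> 1 / L ^ n / 1" using \<theta>1 L1 by (intro divide_left_mono) auto
     ultimately have "1 / L ^ n / \<theta>1 \<le> z" by simp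
     then show ?thesis using z(2) by (meson ennreal_leI le_less_trans)
    qed
    then show ?thesis using that by blast
   qed
   have lim: "(\<lambda>n. ennreal (4 * (Ca + Cc)) * I + ennreal (4 * (Cb * ((1 / L ^ n) powr p * m)))) \<longlonglongrightarrow> ennreal (4 * (Ca + Cc)) * I + 0"
   proof (rule tendsto_add[OF tendsto_const])
    have e: "(1 / L ^ n) powr p = (L powr (-p)) ^ n" for n
     using L1 by (simp add: powr_minus powr_divide power_one_over powr_power powr_realpow[symmetric] powr_powr inverse_eq_divide mult.commute)
    have "(\<lambda>n. 4 * (Cb * ((1 / L ^ n) powr p * m))) \<longlonglongrightarrow> 4 * (Cb * (0 * m))"
     unfolding e using q1 by (intro tendsto_intros LIMSEQ_realpow_zero) auto
    then have "(\<lambda>n. ennreal (4 * (Cb * ((1 / L ^ n) powr p * m)))) \<longlonglongrightarrow> ennreal (4 * (Cb * (0 * m)))"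
     by (rule tendsto_ennrealI)
    then show "(\<lambda>n. ennreal (4 * (Cb * ((1 / L ^ n) powr p * m)))) \<longlonglongrightarrow> 0" by simp
   qed
   have "(\<integral>\<^sup>+x. ennpowr (Tmax k f x) p \<partial>\<mu>) \<le> (\<integral>\<^sup>+x. ennreal (L powr p) * liminf (\<lambda>n. G n (Tmax k f x)) \<partial>\<mu>)"
    unfolding G_def by (intro nn_integral_mono ennpowr_le_liminf_levels[OF L1 p(1)])
   also have "\<dots> = ennreal (L powr p) * (\<integral>\<^sup>+x. liminf (\<lambda>n. G n (Tmax k f x)) \<partial>\<mu>)"
    unfolding G_def by (rule nn_integral_cmult) measurable
   also have "\<dots> \<le> ennreal (L powr p) * liminf (\<lambda>n. \<integral>\<^sup>+x. G n (Tmax k f x) \<partial>\<mu>)"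
    unfolding G_def by (intro mult_left_mono nn_integral_liminf) measurable
   also have "\<dots> \<le> ennreal (L powr p) * liminf (\<lambda>n. ennreal (4 * (Ca + Cc)) * I + ennreal (4 * (Cb * ((1 / L ^ n) powr p * m))))"
    by (intro mult_left_mono Liminf_mono eventually_sequentiallyI[of n0] Gint n0) auto
   also have "\<dots> = ennreal (L powr p) * (ennreal (4 * (Ca + Cc)) * I)"
    using lim_imp_Liminf[OF _ lim] by simp
   also have "\<dots> = ennreal (L powr p * (4 * (Ca + Cc))) * I"
    using Cnn Ccnn by (simp add: ennreal_mult mult.assoc)
   also have "\<dots> \<le> ennreal C * I" by (intro mult_right_mono ennreal_leI) (auto simp: C_def)
   finally show ?thesis unfolding I_def .
  qed
 qed
 show ?thesis by (rule that[OF C bound])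
qed

end

section \<open>Duality with the complementary Young function\<close>

lemma borel_measurable_lebesgue_AE:
 fixes f g :: "real \<Rightarrow> 'a::topological_space"
 assumes g: "g \<in> borel_measurable borel" and ae: "AE x in lborel. f x = g x"
 shows "f \<in> borel_measurable lebesgue"
proof (rule measurableI)
 fix S :: "'a set" assume S: "S \<in> sets borel"
 have "g -` S \<inter> space lebesgue \<in> sets lebesgue"
  using measurable_sets[OF g S] by simp
 moreover have "AE x in lebesgue. x \<in> g -` S \<inter> space lebesgue \<longleftrightarrow> x \<in> f -` S \<inter> space lebesgue"
  using ae by (intro AE_completion) (auto elim: eventually_mono)
 ultimately show "f -` S \<inter> space lebesgue \<in> sets lebesgue"
 proof -
  assume 1: "g -` S \<inter> space lebesgue \<in> sets lebesgue" and 2: "AE x in lebesgue. x \<in> g -` S \<inter> space lebesgue \<longleftrightarrow> x \<in> f -` S \<inter> space lebesgue"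
  show ?thesis by (rule completion.in_sets_AE[OF 2 1]) simp
 qed
qed simp

lemma integral_lebesgue_eq_lborel:
 fixes f g :: "real \<Rightarrow> complex"
 assumes g: "g \<in> borel_measurable borel" and ae: "AE x in lborel. f x = g x"
 shows "integral\<^sup>L lebesgue f = integral\<^sup>L lborel g"
proof -
 have "integral\<^sup>L lebesgue f = integral\<^sup>L lebesgue g"
  by (intro integral_cong_AE borel_measurable_lebesgue_AE[OF g ae] AE_completion[OF ae] measurable_completion) (use g in simp)
 also have "\<dots> = integral\<^sup>L lborel g" by (rule integral_completion) (use g in simp)
 finally show ?thesis .
qed

lemma AE_affine:
 fixes f g :: "real \<Rightarrow> 'a"
 assumes "AE x in lborel. f x = g x" and c: "c \<noteq> 0"
 shows "AE x in lborel. f (t + c * x) = g (t + c * x)"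
proof -
 obtain N where N: "{x \<in> space lborel. \<not> f x = g x} \<subseteq> N" "emeasure lborel N = 0" "N \<in> sets lborel"
  using assms(1) by (rule AE_E)
 have "AE x in lborel. x \<notin> N" using N by (intro AE_not_in) (auto simp: null_sets_def)
 then have "AE x in lborel. t + c * x \<notin> N"
  using N(3) by (intro AE_borel_affine[OF c, of "\<lambda>x. x \<notin> N"]) auto
 then show ?thesis by (rule eventually_mono) (use N(1) in auto)
qed

lemma orlicz_avg_cong_AE:
 fixes f g :: "real \<Rightarrow> 'a::real_normed_vector"
 assumes "AE x in lborel. f x = g x" shows "orlicz_avg D f E = orlicz_avg D g E"
proof -
 have "(\<integral>\<^sup>+x\<in>E. D (norm (f x) / l) \<partial>lebesgue) = (\<integral>\<^sup>+x\<in>E. D (norm (g x) / l) \<partial>lebesgue)" for l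
  using assms by (intro nn_integral_cong_AE AE_completion) (auto elim: eventually_mono)
 then show ?thesis unfolding orlicz_avg_def by simp
qed

lemma borel_version_complex:
 fixes f :: "real \<Rightarrow> complex"
 assumes f: "f \<in> borel_measurable lebesgue"
 obtains g where "g \<in> borel_measurable borel" "AE x in lborel. f x = g x"
proof -
 have re: "(\<lambda>x. Re (f x)) \<in> borel_measurable lebesgue" and im: "(\<lambda>x. Im (f x)) \<in> borel_measurable lebesgue"
  using f by measurable
 obtain a where a: "a \<in> borel_measurable lborel" "AE x in lborel. Re (f x) = a x"
  using completion_ex_borel_measurable_real[OF re] by blast
 obtain b where b: "b \<in> borel_measurable lborel" "AE x in lborel. Im (f x) = b x"
  using completion_ex_borel_measurable_real[OF im] by blast
 show ?thesis
 proof (rule that[of "\<lambda>x. Complex (a x) (b x)"])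
  have "(\<lambda>x. of_real (a x) + \<i> * of_real (b x)) \<in> borel_measurable borel" using a b by simp
  then show "(\<lambda>x. Complex (a x) (b x)) \<in> borel_measurable borel" by (simp add: complex_eq_iff Complex_eq)
  show "AE x in lborel. f x = Complex (a x) (b x)" using a(2) b(2) by eventually_elim (simp add: complex_eq_iff)
 qed
qed

text \<open>Local integrability only makes the restrictions to compact sets measurable.\<close>
lemma measurable_of_exhaustion:
 fixes f :: "real \<Rightarrow> 'a::real_normed_vector"
 assumes meas: "\<And>n::nat. (\<lambda>x. indicator (S n) x *\<^sub>R f x) \<in> borel_measurable lebesgue"
  and mem: "\<And>x. f x \<noteq> 0 \<Longrightarrow> \<forall>\<^sub>F n in sequentially. x \<in> S n"
 shows "f \<in> borel_measurable lebesgue"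
proof (rule borel_measurable_LIMSEQ_metric[OF meas])
 fix x
 show "(\<lambda>n. indicator (S n) x *\<^sub>R f x) \<longlonglongrightarrow> f x"
 proof (cases "f x = 0")
  case False
  show ?thesis by (rule tendsto_eventually) (use mem[OF False] in \<open>auto elim: eventually_mono\<close>)
 qed simp
qed

lemma complementary_young:
 assumes "t \<ge> 0" shows "ennreal (s * t) \<le> complementary A s + ennreal (A t)"
proof -
 have "ennreal (s * t) \<le> ennreal (s * t - A t) + ennreal (A t)"
  by (cases "A t \<ge> 0"; cases "s * t - A t \<ge> 0") (auto simp: ennreal_neg ennreal_leI simp flip: ennreal_plus intro: order_trans[OF ennreal_leI])
 also have "ennreal (s * t - A t) \<le> complementary A s"
  unfolding complementary_def using assms by (intro SUP_upper) simp
 finally show ?thesis by simp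
qed

text \<open>As a supremum of continuous functions, the complementary function is lower semicontinuous.\<close>
lemma complementary_measurable [measurable]: "complementary A \<in> borel_measurable borel"
proof (rule borel_measurableI_greater)
 fix y
 have "{s. y < complementary A s} = (\<Union>t\<in>{0..}. {s. y < ennreal (s * t - A t)})"
  unfolding complementary_def by (auto simp: less_SUP_iff)
 moreover have "open (\<Union>t\<in>{0..}. {s. y < ennreal (s * t - A t)})"
  by (intro open_UN ballI open_Collect_less continuous_on_ennreal continuous_intros)
 ultimately show "{s \<in> space borel. y < complementary A s} \<in> sets borel" by simp
qed

text \<open>Young's inequality is integrated for \<open>u\<close> divided by an admissible \<open>l\<close> in the Orlicz average; both
  integrals on the right are then at most \<open>2 \<rho>\<close>, the length of the ball.\<close>
lemma orlicz_holder:
 fixes u :: "real \<Rightarrow> complex"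
 assumes [measurable]: "u \<in> borel_measurable borel" "v \<in> borel_measurable borel" "Z \<in> sets borel"
  and A [measurable]: "(\<lambda>y. A (v y)) \<in> borel_measurable borel" and v: "\<And>y. v y \<ge> 0"
  and \<rho>: "\<rho> > 0" and Z: "Z \<subseteq> ball 0 \<rho>" and Q: "(\<integral>\<^sup>+y. ennreal (A (v y)) * indicator Z y \<partial>lborel) \<le> ennreal (2 * \<rho>)"
 shows "(\<integral>\<^sup>+y. ennreal (norm (u y) * v y) * indicator Z y \<partial>lborel)
  \<le> ennreal (4 * \<rho>) * orlicz_avg (complementary A) (\<lambda>y. if y \<in> Z then u y else 0) (ball 0 \<rho>)"
  (is "?I \<le> _ * ?O")
proof -
 have ball: "emeasure lebesgue (ball 0 \<rho> :: real set) = ennreal (2 * \<rho>)"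
  using \<rho> by (simp add: ball_eq_greaterThanLessThan)
 have "?I / ennreal (4 * \<rho>) \<le> ?O"
  unfolding orlicz_avg_def
 proof (rule Inf_greatest, safe)
  fix l :: real assume l: "l > 0"
   and le: "(\<integral>\<^sup>+x\<in>ball 0 \<rho>. complementary A (norm (if x \<in> Z then u x else 0) / l) \<partial>lebesgue) / emeasure lebesgue (ball 0 \<rho> :: real set) \<le> 1"
  have le': "(\<integral>\<^sup>+x. complementary A (norm (if x \<in> Z then u x else 0) / l) * indicator (ball 0 \<rho>) x \<partial>lborel) \<le> ennreal (2 * \<rho>)"
   using le \<rho> unfolding ball nn_integral_completion by (subst (asm) ennreal_div_le_1) auto
  have "?I \<le> (\<integral>\<^sup>+y. ennreal l * (complementary A (norm (if y \<in> Z then u y else 0) / l) * indicator (ball 0 \<rho>) y + ennreal (A (v y)) * indicator Z y) \<partial>lborel)"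
  proof (rule nn_integral_mono)
   fix y
   show "ennreal (norm (u y) * v y) * indicator Z y \<le> ennreal l * (complementary A (norm (if y \<in> Z then u y else 0) / l) * indicator (ball 0 \<rho>) y + ennreal (A (v y)) * indicator Z y)"
   proof (cases "y \<in> Z")
    case True
    have "ennreal (norm (u y) * v y) = ennreal l * ennreal (norm (u y) / l * v y)"
     using l v by (subst ennreal_mult[symmetric]) auto
    also have "\<dots> \<le> ennreal l * (complementary A (norm (u y) / l) + ennreal (A (v y)))"
     by (intro mult_left_mono complementary_young v) simp
    finally show ?thesis using True Z by (auto simp: indicator_def)
   qed simp
  qed
  also have "\<dots> = ennreal l * ((\<integral>\<^sup>+x. complementary A (norm (if x \<in> Z then u x else 0) / l) * indicator (ball 0 \<rho>) x \<partial>lborel) + (\<integral>\<^sup>+y. ennreal (A (v y)) * indicator Z y \<partial>lborel))"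
  proof -
   define F where "F y = complementary A (norm (if y \<in> Z then u y else 0) / l)" for y
   have [measurable]: "F \<in> borel_measurable borel"
    unfolding F_def by (rule measurable_compose[OF _ complementary_measurable]) measurable
   have 1: "(\<lambda>y. F y * indicator (ball 0 \<rho>) y) \<in> borel_measurable lborel" "(\<lambda>y. ennreal (A (v y)) * indicator Z y) \<in> borel_measurable lborel"
    using A borel_open[OF open_ball[of 0 \<rho>]] by (auto intro!: borel_measurable_times_ennreal borel_measurable_indicator)
   show ?thesis unfolding F_def[symmetric]
    by (rule trans[OF nn_integral_cmult[OF borel_measurable_add[OF 1]] arg_cong[where f = "(*) (ennreal l)", OF nn_integral_add[OF 1]]])
  qed
  also have "\<dots> \<le> ennreal l * (ennreal (2 * \<rho>) + ennreal (2 * \<rho>))"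
   by (intro mult_left_mono add_mono le' Q) simp
  also have "\<dots> = ennreal l * ennreal (4 * \<rho>)" using \<rho> by (simp flip: ennreal_plus)
  finally show "?I / ennreal (4 * \<rho>) \<le> ennreal l"
   using \<rho> by (simp add: divide_le_posI_ennreal mult.commute ennreal_zero_less_mult_iff)
 qed
 then have "?I / ennreal (4 * \<rho>) * ennreal (4 * \<rho>) \<le> ?O * ennreal (4 * \<rho>)" by (rule mult_right_mono) simp
 moreover have "?I / ennreal (4 * \<rho>) * ennreal (4 * \<rho>) = ?I" using \<rho> by (intro ennreal_div_mult) simp
 ultimately show ?thesis by (simp only: mult.commute)
qed

lemma exists_annulus:
 fixes R v :: real
 assumes R: "R > 0" and v: "v > 2 * R"
 obtains m where "2 ^ Suc m * R < v" "v \<le> 2 ^ (Suc m + 1) * R"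
proof -
 obtain N where "2 ^ N > v / R" using real_arch_pow[of 2 "v / R"] by auto
 then have N: "v \<le> 2 ^ N * R" using R by (simp add: field_simps)
 define j where "j = (LEAST j. v \<le> 2 ^ j * R)"
 have j: "v \<le> 2 ^ j * R" unfolding j_def using N by (rule LeastI)
 have j2: "j \<ge> 2"
 proof (rule ccontr)
  assume "\<not> j \<ge> 2"
  then have "(2::real) ^ j \<le> 2 ^ 1" by (intro power_increasing) auto
  then have "2 ^ j * R \<le> 2 * R" using R by simp
  then show False using j v by simp
 qed
 then obtain m where m: "j = Suc (Suc m)" by (metis Suc_le_D numeral_2_eq_2 Suc_le_mono)
 have "\<not> v \<le> 2 ^ Suc m * R" using not_less_Least[of "Suc m" "\<lambda>j. v \<le> 2 ^ j * R"] m unfolding j_def by simp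
 then show ?thesis using j m by (intro that[of m]) auto
qed

text \<open>The integral is split over the annuli of the condition \<open>H\<close> around \<open>z\<close>, of radii \<open>2 ^ Suc m * R\<close> with
  \<open>R = (c + 1) h\<close>. On each of them Young's inequality is used, the control of \<open>f\<close> at \<open>\<xi>\<close> being
  applied on an interval from \<open>\<xi>\<close> that contains the annulus.\<close>
lemma kernel_orlicz_bound:
 fixes k :: "real \<Rightarrow> complex"
 assumes Y: "young A" and k [measurable]: "k \<in> borel_measurable borel"
  and H: "\<And>x R. R > c * \<bar>x\<bar> \<Longrightarrow> (\<Sum>m. ennreal (2 ^ Suc m * R) * orlicz_avg (complementary A)
       (\<lambda>y. if 2 ^ Suc m * R < \<bar>y\<bar> \<and> \<bar>y\<bar> \<le> 2 ^ (Suc m + 1) * R then k (y - x) - k y else 0)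
       (ball 0 (2 ^ (Suc m + 1) * R))) \<le> ennreal C"
  and c: "c \<ge> 1" and C: "C \<ge> 0"
  and f [measurable]: "f \<in> borel_measurable borel" and s: "s > 0" and h: "h > 0" and o: "orlicz_le A f \<xi> s"
  and x: "x \<in> {\<xi>..\<xi>+h}" and z: "z \<in> {\<xi>..\<xi>+h}"
 shows "(\<integral>\<^sup>+y. ennreal (norm (k (y - x) - k (y - z)) * norm (f y)) * indicator {\<xi>+(2*c+3)*h<..} y \<partial>lborel) \<le> ennreal (8 * C * s)"
proof -
 interpret young A by (rule Y)
 \<comment> \<open>Beyond \<open>\<xi> + (2 c + 3) h\<close> the distance to \<open>z\<close> is more than \<open>2 R\<close>, where the annuli begin.\<close>
 define R where "R = (c + 1) * h"
 have R: "R > 0" using c h by (simp add: R_def)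
 have Rh: "h \<le> R" using mult_right_mono[of 1 "c + 1" h] c h by (simp add: R_def)
 define x0 where "x0 = x - z"
 have Rx0: "R > c * \<bar>x0\<bar>"
 proof -
  have "c * \<bar>x0\<bar> \<le> c * h" using x z c by (intro mult_left_mono) (auto simp: x0_def)
  also have "\<dots> < R" using h by (simp add: R_def distrib_right)
  finally show ?thesis .
 qed
 define u where "u v = k (v - x0) - k v" for v
 define Z where "Z m = {v :: real. 2 ^ Suc m * R < v \<and> v \<le> 2 ^ (Suc m + 1) * R}" for m
 define Z' where "Z' m = {v :: real. 2 ^ Suc m * R < \<bar>v\<bar> \<and> \<bar>v\<bar> \<le> 2 ^ (Suc m + 1) * R}" for m
 have [measurable]: "Z m \<in> sets borel" "Z' m \<in> sets borel" for m unfolding Z_def Z'_def by measurable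
 have um [measurable]: "u \<in> borel_measurable borel" unfolding u_def by measurable
 define fz where "fz v = f (z + v)" for v
 have [measurable]: "fz \<in> borel_measurable borel" unfolding fz_def by measurable
 have "(\<integral>\<^sup>+y. ennreal (norm (k (y - x) - k (y - z)) * norm (f y)) * indicator {\<xi>+(2*c+3)*h<..} y \<partial>lborel)
   = (\<integral>\<^sup>+v. ennreal (norm (u v) * norm (fz v)) * indicator {\<xi>+(2*c+3)*h<..} (z + v) \<partial>lborel)"
  by (subst nn_integral_real_affine[where c = 1 and t = z]) (simp_all add: u_def fz_def x0_def algebra_simps)
 also have "\<dots> \<le> (\<integral>\<^sup>+v. (\<Sum>m. ennreal (norm (u v) * norm (fz v)) * indicator (Z m) v) \<partial>lborel)"
 proof (rule nn_integral_mono)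
  fix v
  show "ennreal (norm (u v) * norm (fz v)) * indicator {\<xi>+(2*c+3)*h<..} (z + v) \<le> (\<Sum>m. ennreal (norm (u v) * norm (fz v)) * indicator (Z m) v)"
  proof (cases "z + v > \<xi> + (2*c+3)*h")
   case True
   have "v > 2 * R" using True z by (simp add: R_def algebra_simps)
   then obtain m where m: "2 ^ Suc m * R < v" "v \<le> 2 ^ (Suc m + 1) * R" by (rule exists_annulus[OF R])
   then have "v \<in> Z m" by (simp add: Z_def)
   then have "ennreal (norm (u v) * norm (fz v)) * indicator {\<xi>+(2*c+3)*h<..} (z + v) = ennreal (norm (u v) * norm (fz v)) * indicator (Z m) v"
    using True by (simp add: indicator_def)
   also have "\<dots> \<le> (\<Sum>m. ennreal (norm (u v) * norm (fz v)) * indicator (Z m) v)" by (rule ennreal_le_suminf)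
   finally show ?thesis .
  qed simp
 qed
 also have "\<dots> = (\<Sum>m. \<integral>\<^sup>+v. ennreal (norm (u v) * norm (fz v)) * indicator (Z m) v \<partial>lborel)"
  by (rule nn_integral_suminf) measurable
 also have "\<dots> \<le> (\<Sum>m. ennreal (8 * s) * (ennreal (2 ^ Suc m * R) * orlicz_avg (complementary A) (\<lambda>y. if y \<in> Z' m then u y else 0) (ball 0 (2 ^ (Suc m + 1) * R))))"
 proof (intro suminf_le summableI)
  fix m
  define \<rho> where "\<rho> = 2 ^ (Suc m + 1) * R"
  have \<rho>: "\<rho> > 0" "R \<le> \<rho>" using R by (auto simp: \<rho>_def intro: order_trans[OF _ mult_right_mono[of 1]])
  \<comment> \<open>The balls are open, so the two points at distance \<open>\<rho>\<close>, a null set, are removed.\<close>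
  let ?O = "orlicz_avg (complementary A) (\<lambda>y. if y \<in> Z' m - {\<rho>, -\<rho>} then u y else 0) (ball 0 \<rho>)"
  have Oe: "?O = orlicz_avg (complementary A) (\<lambda>y. if y \<in> Z' m then u y else 0) (ball 0 \<rho>)"
  proof (rule orlicz_avg_cong_AE)
   have "AE y in lborel. y \<noteq> \<rho>" "AE y in lborel. y \<noteq> -\<rho>" by (rule AE_lborel_singleton)+
   then show "AE y in lborel. (if y \<in> Z' m - {\<rho>, -\<rho>} then u y else 0) = (if y \<in> Z' m then u y else 0)"
    by eventually_elim auto
  qed
  have Am [measurable]: "(\<lambda>v. A (indicator {0<..} v * (norm (fz v) / s))) \<in> borel_measurable borel"
  proof -
   have "(\<lambda>v. A (indicator {0<..} v * (norm (fz v) / s))) = (\<lambda>v. A (norm (fz v * indicator {0<..} v) / s))" by (auto simp: indicator_def)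
   then show ?thesis using A_measurable[OF _ s, of "\<lambda>v. fz v * indicator {0<..} v" borel] by simp
  qed
  have "(\<integral>\<^sup>+v. ennreal (norm (u v) * (indicator {0<..} v * (norm (fz v) / s))) * indicator (Z' m - {\<rho>, -\<rho>}) v \<partial>lborel) \<le> ennreal (4 * \<rho>) * ?O"
  proof (rule orlicz_holder)
   show "Z' m - {\<rho>, - \<rho>} \<subseteq> ball 0 \<rho>"
   proof
    fix v assume v: "v \<in> Z' m - {\<rho>, - \<rho>}"
    then have "\<bar>v\<bar> \<le> \<rho>" by (simp add: Z'_def \<rho>_def)
    then show "v \<in> ball 0 \<rho>" using v by (auto simp: dist_real_def)
   qed
   have "(\<integral>\<^sup>+v. ennreal (A (indicator {0<..} v * (norm (fz v) / s))) * indicator (Z' m - {\<rho>, -\<rho>}) v \<partial>lborel)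
     \<le> (\<integral>\<^sup>+v. ennreal (A (norm (f (z + v)) / s)) * indicator {\<xi>..\<xi>+2*\<rho>} (z + v) \<partial>lborel)"
   proof (rule nn_integral_mono)
    fix v
    show "ennreal (A (indicator {0<..} v * (norm (fz v) / s))) * indicator (Z' m - {\<rho>, -\<rho>}) v \<le> ennreal (A (norm (f (z + v)) / s)) * indicator {\<xi>..\<xi>+2*\<rho>} (z + v)"
    proof (cases "v > 0 \<and> v \<in> Z' m")
     case True
     then have "v \<in> Z' m" by blast
     then have "\<bar>v\<bar> \<le> \<rho>" unfolding Z'_def \<rho>_def by blast
     then have "v \<le> \<rho>" by (rule abs_le_D1)
     then have "z + v \<in> {\<xi>..\<xi>+2*\<rho>}" using True z Rh \<rho>(2) unfolding atLeastAtMost_iff by linarith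
     then show ?thesis using True by (simp add: fz_def indicator_def)
    qed (auto simp: indicator_def A0)
   qed
   also have "\<dots> = (\<integral>\<^sup>+y. ennreal (A (norm (f y) / s)) * indicator {\<xi>..\<xi>+2*\<rho>} y \<partial>lborel)"
   proof -
    have [measurable]: "(\<lambda>y. A (norm (f y) / s)) \<in> borel_measurable borel" using A_measurable[OF f s] by simp
    show ?thesis by (subst (2) nn_integral_real_affine[where c = 1 and t = z]) simp_all
   qed
   also have "\<dots> \<le> ennreal (2 * \<rho>)" using o \<rho> by (auto simp: orlicz_le_def)
   finally show "(\<integral>\<^sup>+v. ennreal (A (indicator {0<..} v * (norm (fz v) / s))) * indicator (Z' m - {\<rho>, -\<rho>}) v \<partial>lborel) \<le> ennreal (2 * \<rho>)" .
   show "(\<lambda>v. A (indicator {0<..} v * (norm (fz v) / s))) \<in> borel_measurable borel" by (rule Am)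
  qed (use \<rho> s in \<open>auto intro!: mult_nonneg_nonneg\<close>)
  then have le: "(\<integral>\<^sup>+v. ennreal (norm (u v) * (indicator {0<..} v * (norm (fz v) / s))) * indicator (Z' m - {\<rho>, -\<rho>}) v \<partial>lborel)
    \<le> ennreal (4 * \<rho>) * orlicz_avg (complementary A) (\<lambda>y. if y \<in> Z' m then u y else 0) (ball 0 \<rho>)"
   unfolding Oe .
  have "(\<integral>\<^sup>+v. ennreal (norm (u v) * norm (fz v)) * indicator (Z m) v \<partial>lborel)
    \<le> (\<integral>\<^sup>+v. ennreal s * (ennreal (norm (u v) * (indicator {0<..} v * (norm (fz v) / s))) * indicator (Z' m - {\<rho>, -\<rho>}) v) \<partial>lborel)"
  proof (rule nn_integral_mono_AE)
   have "AE v in lborel. v \<noteq> \<rho>" by (rule AE_lborel_singleton)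
   then show "AE v in lborel. ennreal (norm (u v) * norm (fz v)) * indicator (Z m) v \<le> ennreal s * (ennreal (norm (u v) * (indicator {0<..} v * (norm (fz v) / s))) * indicator (Z' m - {\<rho>, -\<rho>}) v)"
   proof eventually_elim
    case (elim v)
    show ?case
    proof (cases "v \<in> Z m")
     case True
     have v0: "v > 0" using True R by (auto simp: Z_def intro: less_trans[rotated])
     have "v \<in> Z' m - {\<rho>, -\<rho>}" using True v0 elim \<rho>(1) by (auto simp: Z_def Z'_def)
     moreover have "ennreal (norm (u v) * norm (fz v)) = ennreal s * ennreal (norm (u v) * (norm (fz v) / s))"
      using s by (subst ennreal_mult[symmetric]) auto
     ultimately show ?thesis using v0 True by simp
    qed simp
   qed
  qed
  also have "\<dots> = ennreal s * (\<integral>\<^sup>+v. ennreal (norm (u v) * (indicator {0<..} v * (norm (fz v) / s))) * indicator (Z' m - {\<rho>, -\<rho>}) v \<partial>lborel)"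
   by (rule nn_integral_cmult) measurable
  also have "\<dots> \<le> ennreal s * (ennreal (4 * \<rho>) * orlicz_avg (complementary A) (\<lambda>y. if y \<in> Z' m then u y else 0) (ball 0 \<rho>))"
   by (intro mult_left_mono le) simp
  also have "\<dots> = ennreal (8 * s) * (ennreal (2 ^ Suc m * R) * orlicz_avg (complementary A) (\<lambda>y. if y \<in> Z' m then u y else 0) (ball 0 \<rho>))"
  proof -
   have "ennreal s * ennreal (4 * \<rho>) = ennreal (s * (4 * \<rho>))" using s \<rho> by (intro ennreal_mult[symmetric]) auto
   also have "s * (4 * \<rho>) = (8 * s) * (2 ^ Suc m * R)" by (simp add: \<rho>_def)
   also have "ennreal \<dots> = ennreal (8 * s) * ennreal (2 ^ Suc m * R)" using s R by (intro ennreal_mult) auto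
   finally show ?thesis by (simp only: mult.assoc[symmetric])
  qed
  finally show "(\<integral>\<^sup>+v. ennreal (norm (u v) * norm (fz v)) * indicator (Z m) v \<partial>lborel)
    \<le> ennreal (8 * s) * (ennreal (2 ^ Suc m * R) * orlicz_avg (complementary A) (\<lambda>y. if y \<in> Z' m then u y else 0) (ball 0 (2 ^ (Suc m + 1) * R)))"
   unfolding \<rho>_def .
 qed
 also have "\<dots> = ennreal (8 * s) * (\<Sum>m. ennreal (2 ^ Suc m * R) * orlicz_avg (complementary A) (\<lambda>y. if y \<in> Z' m then u y else 0) (ball 0 (2 ^ (Suc m + 1) * R)))"
  by (rule ennreal_suminf_cmult)
 also have "\<dots> \<le> ennreal (8 * s) * ennreal C"
  using H[OF Rx0] unfolding Z'_def u_def mem_Collect_eq by (intro mult_left_mono) auto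
 also have "\<dots> = ennreal (8 * C * s)" using s C by (simp add: ennreal_mult[symmetric] mult_ac)
 finally show ?thesis .
qed

section \<open>The weighted inequality\<close>

lemma Mplus_indicator_le:
 assumes ac: "a < c"
 shows "Mplus (indicator {a<..<c} :: real \<Rightarrow> real) x \<le> ennreal (ivl_max a c x)"
 unfolding Mplus_def
proof (rule SUP_least)
 fix h :: real assume "h \<in> {0<..}"
 then have h: "h > 0" by simp
 have e: "(\<integral>\<^sup>+y\<in>{x..x+h}. ennreal (norm (indicator {a<..<c} y :: real)) \<partial>lebesgue) = emeasure lborel ({a<..<c} \<inter> {x..x+h})"
 proof -
  have "(\<integral>\<^sup>+y\<in>{x..x+h}. ennreal (norm (indicator {a<..<c} y :: real)) \<partial>lebesgue) = (\<integral>\<^sup>+y. indicator ({a<..<c} \<inter> {x..x+h}) y \<partial>lborel)"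
   unfolding nn_integral_completion by (intro nn_integral_cong) (auto simp: indicator_def)
  then show ?thesis by simp
 qed
 have "emeasure lborel ({a<..<c} \<inter> {x..x+h}) \<le> ennreal (ivl_max a c x * h)"
 proof -
  consider "x \<ge> c" | "a < x" "x < c" | "x \<le> a" "x + h \<le> a" | "x \<le> a" "a < x + h" "x + h \<le> c" | "x \<le> a" "c < x + h" using ac by linarith
  then show ?thesis
  proof cases
   case 1
   then have "{a<..<c} \<inter> {x..x+h} = {}" by auto
   then show ?thesis by simp
  next
   case 2
   have "emeasure lborel ({a<..<c} \<inter> {x..x+h}) \<le> emeasure lborel {x..x+h}" by (intro emeasure_mono) auto
   then show ?thesis using 2 h by (simp add: ivl_max_def)
  next
   case 3
   then have "{a<..<c} \<inter> {x..x+h} = {}" by auto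
   then show ?thesis by simp
  next
   case 4
   have "emeasure lborel ({a<..<c} \<inter> {x..x+h}) \<le> emeasure lborel {a..x+h}" by (intro emeasure_mono) auto
   also have "\<dots> = ennreal (x + h - a)" using 4 by simp
   also have "\<dots> \<le> ennreal (ivl_max a c x * h)"
   proof (rule ennreal_leI)
    have "(x + h - a) * (c - x) \<le> (c - a) * h"
    proof -
     have "(c - a) * h - (x + h - a) * (c - x) = (a - x) * (c - x - h)" by (simp add: algebra_simps)
     also have "\<dots> \<ge> 0" using 4 by simp
     finally show ?thesis by simp
    qed
    then show "x + h - a \<le> ivl_max a c x * h" using 4 ac by (simp add: ivl_max_def pos_le_divide_eq)
   qed
   finally show ?thesis .
  next
   case 5
   have "emeasure lborel ({a<..<c} \<inter> {x..x+h}) \<le> emeasure lborel {a..c}" by (intro emeasure_mono) auto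
   also have "\<dots> = ennreal (c - a)" using ac by simp
   also have "\<dots> \<le> ennreal (ivl_max a c x * h)"
   proof (rule ennreal_leI)
    have "(c - a) * (c - x) \<le> (c - a) * h" using 5 ac by (intro mult_left_mono) auto
    then show "c - a \<le> ivl_max a c x * h" using 5 ac by (simp add: ivl_max_def pos_le_divide_eq)
   qed
   finally show ?thesis .
  qed
 qed
 then show "(\<integral>\<^sup>+y\<in>{x..x+h}. ennreal (norm (indicator {a<..<c} y :: real)) \<partial>lebesgue) / ennreal h \<le> ennreal (ivl_max a c x)"
  unfolding e using h ac by (subst divide_le_posI_ennreal) (auto simp: ennreal_mult[symmetric] ivl_max_def mult.commute)
qed

lemma ennpowr_cmult:
 assumes "c \<ge> 0" "q > 0" shows "ennpowr (ennreal c * x) q \<le> ennreal (c powr q) * ennpowr x q"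
proof (cases x)
 case (real x')
 then show ?thesis using assms by (simp add: ennreal_mult[symmetric] ennpowr_ennreal powr_mult)
next
 case top
 then show ?thesis using assms by (cases "c = 0") (auto simp: ennpowr_def ennreal_mult_top)
qed

lemma weight_borel_version:
 assumes w: "weight w"
 obtains w' where "w' \<in> borel_measurable borel" "\<And>x. w' x \<ge> 0" "AE x in lborel. w x = w' x"
  "\<And>R. (\<integral>\<^sup>+x\<in>{-R..R}. ennreal (w' x) \<partial>lborel) < top"
proof -
 have i: "w absolutely_integrable_on {-R..R}" for R using w by (simp add: weight_def)
 have wm: "w \<in> borel_measurable lebesgue"
 proof (rule measurable_of_exhaustion)
  fix n :: nat
  show "(\<lambda>x. indicator {-real n..real n} x *\<^sub>R w x) \<in> borel_measurable lebesgue"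
   using borel_measurable_integrable[OF i[unfolded set_integrable_def]] .
  fix x :: real
  obtain N where "\<bar>x\<bar> \<le> real N" using real_arch_simple by blast
  then show "\<forall>\<^sub>F n in sequentially. x \<in> {-real n..real n}" by (intro eventually_sequentiallyI[of N]) auto
 qed
 obtain w1 where w1: "w1 \<in> borel_measurable lborel" "AE x in lborel. w x = w1 x"
  using completion_ex_borel_measurable_real[OF wm] by blast
 have ae: "AE x in lborel. w x = max 0 (w1 x)" using w1(2)
 proof eventually_elim
  case (elim x)
  have "w x \<ge> 0" using w by (simp add: weight_def)
  then show ?case using elim by simp
 qed
 show ?thesis
 proof (rule that[of "\<lambda>x. max 0 (w1 x)"])
  fix R :: real
  have "(\<integral>\<^sup>+x\<in>{-R..R}. ennreal (max 0 (w1 x)) \<partial>lborel) = (\<integral>\<^sup>+x. ennreal (norm (indicator {-R..R} x *\<^sub>R w x)) \<partial>lborel)"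
  proof (rule nn_integral_cong_AE)
   show "AE x in lborel. ennreal (max 0 (w1 x)) * indicator {-R..R} x = ennreal (norm (indicator {-R..R} x *\<^sub>R w x))"
    using ae by eventually_elim (simp add: indicator_def)
  qed
  also have "\<dots> = (\<integral>\<^sup>+x. ennreal (norm (indicator {-R..R} x *\<^sub>R w x)) \<partial>lebesgue)" by (rule nn_integral_completion[symmetric])
  also have "\<dots> < top" using i[of R] unfolding set_integrable_def integrable_iff_bounded by simp
  finally show "(\<integral>\<^sup>+x\<in>{-R..R}. ennreal (max 0 (w1 x)) \<partial>lborel) < top" .
 qed (use w1 ae in auto)
qed

text \<open>The Borel version is cut back to the half-line and to the size bound, so that both hold everywhere
  and not only almost everywhere.\<close>
lemma kernel_borel_version:
 assumes K: "singular_kernel K" and os: "one_sided_kernel K"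
 obtains K' B2 where "K' \<in> borel_measurable borel" "\<And>x. x \<ge> 0 \<Longrightarrow> K' x = 0" "\<And>x. x < 0 \<Longrightarrow> norm (K' x) \<le> B2 / \<bar>x\<bar>"
  "AE x in lborel. K x = K' x"
proof -
 define decay_const where "decay_const x = (if x = 0 then 0 else K x)" for x
 define S where "S n = {-real (Suc n)..- 1 / real (Suc n)} \<union> {1 / real (Suc n)..real (Suc n)}" for n
 have "decay_const \<in> borel_measurable lebesgue"
 proof (rule measurable_of_exhaustion)
  fix n :: nat
  have S0: "0 \<notin> S n" by (auto simp: S_def divide_simps)
  have "compact (S n)" by (auto simp: S_def intro!: compact_Un)
  then have "K absolutely_integrable_on S n" using K S0 by (auto simp: singular_kernel_def)
  then have "(\<lambda>x. indicator (S n) x *\<^sub>R K x) \<in> borel_measurable lebesgue"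
   unfolding set_integrable_def by (rule borel_measurable_integrable)
  moreover have "(\<lambda>x. indicator (S n) x *\<^sub>R K x) = (\<lambda>x. indicator (S n) x *\<^sub>R decay_const x)"
   using S0 by (auto simp: decay_const_def indicator_def)
  ultimately show "(\<lambda>x. indicator (S n) x *\<^sub>R decay_const x) \<in> borel_measurable lebesgue" by simp
  fix x assume "decay_const x \<noteq> 0"
  then have x: "\<bar>x\<bar> > 0" by (auto simp: decay_const_def split: if_splits)
  obtain N where N: "max \<bar>x\<bar> (1 / \<bar>x\<bar>) \<le> real N" using real_arch_simple by blast
  show "\<forall>\<^sub>F n in sequentially. x \<in> S n"
  proof (rule eventually_sequentiallyI[of N])
   fix n assume "n \<ge> N"
   then have "\<bar>x\<bar> \<le> real (Suc n)" "1 / \<bar>x\<bar> \<le> real (Suc n)" using N by auto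
   moreover from this(2) have "1 / real (Suc n) \<le> \<bar>x\<bar>" using x by (simp add: field_simps)
   ultimately show "x \<in> S n" by (cases "x > 0") (auto simp: S_def)
  qed
 qed
 then obtain K1 where K1: "K1 \<in> borel_measurable borel" "AE x in lborel. decay_const x = K1 x"
  by (rule borel_version_complex)
 obtain B2 where B2: "\<And>x. x \<noteq> 0 \<Longrightarrow> norm (K x) \<le> B2 / \<bar>x\<bar>" using K unfolding singular_kernel_def by blast
 define K' where "K' x = (if x < 0 \<and> norm (K1 x) \<le> B2 / \<bar>x\<bar> then K1 x else 0)" for x
 have B20: "B2 \<ge> 0" using order_trans[OF norm_ge_zero B2[of 1]] by simp
 have "AE x in lborel. K x = K' x"
 proof -
  have "AE x in lborel. x \<noteq> (0::real)" by (rule AE_lborel_singleton)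
  then show ?thesis using K1(2)
  proof eventually_elim
   case (elim x)
   then show ?case using B2[of x] os by (auto simp: K'_def decay_const_def one_sided_kernel_def)
  qed
 qed
 moreover have "K' \<in> borel_measurable borel" using K1(1) unfolding K'_def by measurable
 moreover have "norm (K' x) \<le> B2 / \<bar>x\<bar>" for x
 proof -
  have "B2 / \<bar>x\<bar> \<ge> 0" using B20 by simp
  then show ?thesis unfolding K'_def by (auto simp only: norm_zero split: if_splits)
 qed
 moreover have "K' x = 0" if "x \<ge> 0" for x using that by (simp add: K'_def)
 ultimately show ?thesis by (intro that[of K' B2])
qed

lemma Linf_c_borel_version:
 assumes "f \<in> Linf_c" obtains f' where "bcs f'" "AE x in lborel. f x = f' x"
proof -
 have fm: "f \<in> borel_measurable lebesgue" and bd: "bounded (range f)"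
  using assms by (auto simp: Linf_c_def)
 obtain S where S: "compact S" "\<And>x. x \<notin> S \<Longrightarrow> f x = 0" using assms by (auto simp: Linf_c_def)
 obtain B where B: "\<And>x. norm (f x) \<le> B" using bd by (auto simp: bounded_iff)
 obtain R where R: "\<And>x. x \<in> S \<Longrightarrow> \<bar>x\<bar> \<le> R" using compact_imp_bounded[OF S(1)] by (auto simp: bounded_iff)
 obtain f1 where f1: "f1 \<in> borel_measurable borel" "AE x in lborel. f x = f1 x"
  using fm by (rule borel_version_complex)
 have B0: "B \<ge> 0" using order_trans[OF norm_ge_zero B[of 0]] .
 define f' where "f' x = (if \<bar>x\<bar> \<le> R \<and> norm (f1 x) \<le> B then f1 x else 0)" for x
 have "AE x in lborel. f x = f' x" using f1(2)
 proof eventually_elim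
  case (elim x)
  then show ?case using B[of x] S(2)[of x] R[of x] by (cases "x \<in> S") (auto simp: f'_def)
 qed
 moreover have "f' \<in> borel_measurable borel" using f1(1) unfolding f'_def by measurable
 then have "bcs f'" by (rule bcsI[of _ B R]) (use B0 in \<open>auto simp: f'_def\<close>)
 ultimately show ?thesis using that by blast
qed

lemma kernel_cancel:
 assumes K: "singular_kernel K" and K': "K' \<in> borel_measurable borel" "\<And>x. x \<ge> 0 \<Longrightarrow> K' x = 0" and ae: "AE x in lborel. K x = K' x"
 obtains B1 where "\<And>e N. 0 < e \<Longrightarrow> e < N \<Longrightarrow> norm (LBINT v:{e<..<N}. K' (-v)) \<le> B1"
proof -
 obtain B1 where B1: "\<And>e N. 0 < e \<Longrightarrow> e < N \<Longrightarrow> norm (LINT x:{x. e < \<bar>x\<bar> \<and> \<bar>x\<bar> < N}|lebesgue. K x) \<le> B1"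
  using K unfolding singular_kernel_def by blast
 have "norm (LBINT v:{e<..<N}. K' (-v)) \<le> B1" if e: "0 < e" "e < N" for e N
 proof -
  have "(LINT x:{x. e < \<bar>x\<bar> \<and> \<bar>x\<bar> < N}|lebesgue. K x) = (LBINT x. indicator {x. e < \<bar>x\<bar> \<and> \<bar>x\<bar> < N} x *\<^sub>R K' x)"
   unfolding set_lebesgue_integral_def
  proof (rule integral_lebesgue_eq_lborel)
   show "(\<lambda>x. indicator {x. e < \<bar>x\<bar> \<and> \<bar>x\<bar> < N} x *\<^sub>R K' x) \<in> borel_measurable borel" using K'(1) by measurable
   show "AE x in lborel. indicator {x. e < \<bar>x\<bar> \<and> \<bar>x\<bar> < N} x *\<^sub>R K x = indicator {x. e < \<bar>x\<bar> \<and> \<bar>x\<bar> < N} x *\<^sub>R K' x"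
    using ae by eventually_elim simp
  qed
  also have "\<dots> = (LBINT v. indicator {x. e < \<bar>x\<bar> \<and> \<bar>x\<bar> < N} (0 + (-1) * v) *\<^sub>R K' (0 + (-1) * v))"
   by (subst lborel_integral_real_affine[where c = "-1" and t = 0]) simp_all
  also have "\<dots> = (LBINT v:{e<..<N}. K' (-v))"
   unfolding set_lebesgue_integral_def
   by (intro Bochner_Integration.integral_cong refl) (use e K'(2) in \<open>auto simp: indicator_def\<close>)
  finally show ?thesis using B1[OF e] by simp
 qed
 then show ?thesis by (rule that)
qed

lemma T_plus_max_eq_Tmax:
 assumes K': "K' \<in> borel_measurable borel" "AE x in lborel. K x = K' x" and f': "f' \<in> borel_measurable borel" "AE x in lborel. f x = f' x"
 shows "T_plus_max K f x = Tmax (\<lambda>v. K' (-v)) f' x"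
proof -
 have "(LINT y:{x+e<..}|lebesgue. K (x - y) * f y) = Tr (\<lambda>v. K' (-v)) e f' x" for e
 proof -
  have "(LINT y:{x+e<..}|lebesgue. K (x - y) * f y) = (LBINT y. indicator {x+e<..} y *\<^sub>R (K' (x - y) * f' y))"
   unfolding set_lebesgue_integral_def
  proof (rule integral_lebesgue_eq_lborel)
   show "(\<lambda>y. indicator {x+e<..} y *\<^sub>R (K' (x - y) * f' y)) \<in> borel_measurable borel" using K'(1) f'(1) by measurable
   have "AE y in lborel. K (x + (-1) * y) = K' (x + (-1) * y)" by (rule AE_affine[OF K'(2)]) simp
   then show "AE y in lborel. indicator {x+e<..} y *\<^sub>R (K (x - y) * f y) = indicator {x+e<..} y *\<^sub>R (K' (x - y) * f' y)"
    using f'(2) by eventually_elim simp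
  qed
  also have "\<dots> = (LBINT v. indicator {x+e<..} (x + 1 * v) *\<^sub>R (K' (x - (x + 1 * v)) * f' (x + 1 * v)))"
   by (subst lborel_integral_real_affine[where c = 1 and t = x]) simp_all
  also have "\<dots> = Tr (\<lambda>v. K' (-v)) e f' x"
   unfolding Tr_def trunc_def by (intro Bochner_Integration.integral_cong refl) (simp add: indicator_def)
  finally show ?thesis .
 qed
 then show ?thesis by (simp add: T_plus_max_def Tmax_def)
qed

lemma hormander_transfer:
 assumes ae: "AE x in lborel. K x = K' x"
 shows "orlicz_avg D (\<lambda>y. if P y then K (x - y) - K (- y) else 0) E
  = orlicz_avg D (\<lambda>y. if P y then K' (- (y - x)) - K' (- y) else 0) E"
proof (rule orlicz_avg_cong_AE)
 have "AE y in lborel. K (x + (-1) * y) = K' (x + (-1) * y)" "AE y in lborel. K (0 + (-1) * y) = K' (0 + (-1) * y)"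
  by (rule AE_affine[OF ae], simp)+
 then show "AE y in lborel. (if P y then K (x - y) - K (- y) else 0) = (if P y then K' (- (y - x)) - K' (- y) else 0)"
  by eventually_elim simp
qed

text \<open>Passing to Borel versions of the kernel, the weight and the function changes neither of the two
  operators at any point, nor the integrals. The condition on the weight is used with the explicit
  bound for the maximal function of an interval.\<close>
theorem theorem7:
 fixes A :: "real \<Rightarrow> real" and K :: "real \<Rightarrow> complex" and w :: "real \<Rightarrow> real"
  and p \<epsilon> :: real
 assumes "young_function A"
  and "singular_kernel K"
  and "one_sided_kernel K"
  and "hormander_class (complementary A) K"
  and "0 < p" and "0 < \<epsilon>"
  and "weight w"
  and "C_plus (max p 1 + \<epsilon>) w"
 shows "\<exists>C>0. \<forall>f\<in>Linf_c.
      Lp_norm p w (T_plus_max K f) \<le> ennreal C * Lp_norm p w (M_plus_orlicz A f)"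
proof -
 obtain K' B2 where K': "K' \<in> borel_measurable borel" "\<And>x. x \<ge> 0 \<Longrightarrow> K' x = 0" "\<And>x. x < 0 \<Longrightarrow> norm (K' x) \<le> B2 / \<bar>x\<bar>"
  "AE x in lborel. K x = K' x"
  using kernel_borel_version[OF assms(2,3)] by blast
 define k where "k v = K' (-v)" for v
 have km: "k \<in> borel_measurable borel" using K'(1) unfolding k_def by measurable
 obtain B1 where B1: "\<And>e N. 0 < e \<Longrightarrow> e < N \<Longrightarrow> norm (LBINT v:{e<..<N}. k v) \<le> B1"
  unfolding k_def using kernel_cancel[OF assms(2) K'(1,2,4)] by blast
 obtain c C where c: "c \<ge> 1" and C: "C \<ge> 1" and H0: "\<And>x R. R > c * \<bar>x\<bar> \<Longrightarrow>
   (\<Sum>m. ennreal (2 ^ Suc m * R) * orlicz_avg (complementary A)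
       (\<lambda>y. if 2 ^ Suc m * R < \<bar>y\<bar> \<and> \<bar>y\<bar> \<le> 2 ^ (Suc m + 1) * R then K (x - y) - K (- y) else 0)
       (ball 0 (2 ^ (Suc m + 1) * R))) \<le> ennreal C"
  using assms(4) unfolding hormander_class_def by blast
 have H: "(\<Sum>m. ennreal (2 ^ Suc m * R) * orlicz_avg (complementary A)
       (\<lambda>y. if 2 ^ Suc m * R < \<bar>y\<bar> \<and> \<bar>y\<bar> \<le> 2 ^ (Suc m + 1) * R then k (y - x) - k y else 0)
       (ball 0 (2 ^ (Suc m + 1) * R))) \<le> ennreal C" if "R > c * \<bar>x\<bar>" for x R
  using H0[OF that] unfolding hormander_transfer[OF K'(4)] k_def .
 have Y: "young A" using assms(1) by (rule young.intro)
 note kob = kernel_orlicz_bound[OF Y km H c]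
 have orl1: "orlicz_le A (\<lambda>y. 1) \<xi> 1" for \<xi>
  using assms(1) by (auto simp: orlicz_le_def young_function_def nn_integral_cmult_indicator)
 obtain w' where w': "w' \<in> borel_measurable borel" "\<And>x. w' x \<ge> 0" "AE x in lborel. w x = w' x"
  "\<And>R. (\<integral>\<^sup>+x\<in>{-R..R}. ennreal (w' x) \<partial>lborel) < top"
  using weight_borel_version[OF assms(7)] by blast
 define \<mu> where "\<mu> = density lborel (\<lambda>x. ennreal (w' x))"
 have w'm [measurable]: "w' \<in> borel_measurable borel" by (rule w'(1))
 have weighted: "(\<integral>\<^sup>+x. F x * ennreal (w x) \<partial>lebesgue) = (\<integral>\<^sup>+x. F x \<partial>\<mu>)" if F: "F \<in> borel_measurable borel" for F
 proof -
  have "(\<integral>\<^sup>+x. F x * ennreal (w x) \<partial>lebesgue) = (\<integral>\<^sup>+x. ennreal (w' x) * F x \<partial>lborel)"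
   unfolding nn_integral_completion using w'(3) by (intro nn_integral_cong_AE) (auto elim!: eventually_mono simp: mult.commute)
  also have "\<dots> = (\<integral>\<^sup>+x. F x \<partial>\<mu>)" unfolding \<mu>_def using F by (subst nn_integral_density) auto
  finally show ?thesis .
 qed
 define r where "r = max p 1 + \<epsilon>"
 have r: "r > 1" "p < r" using assms(6) by (auto simp: r_def)
 obtain \<epsilon>0 Cw where e0: "\<epsilon>0 > 0" "Cw > 0" and cp: "\<And>a b c E. a < b \<Longrightarrow> b < c \<Longrightarrow> c - b < b - a \<Longrightarrow>
    E \<in> sets lebesgue \<Longrightarrow> E \<subseteq> {a<..<b} \<Longrightarrow>
    (\<integral>\<^sup>+x\<in>E. ennreal (w x) \<partial>lebesgue)
     \<le> ennreal (Cw * (measure lebesgue E / (c - b)) powr \<epsilon>0) *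
      (\<integral>\<^sup>+x. ennpowr (Mplus (indicator {a<..<c} :: real \<Rightarrow> real) x) r * ennreal (w x) \<partial>lebesgue)"
  using assms(8) unfolding C_plus_def r_def by meson
 interpret coifman k B1 B2 "2 * c + 3" "8 * C" A \<mu> r \<epsilon>0 Cw p
 proof unfold_locales
  show "k v = 0" if "v \<le> 0" for v using that K'(2) by (simp add: k_def)
  show "norm (k v) \<le> B2 / v" if "v > 0" for v using K'(3)[of "-v"] that by (simp add: k_def)
  show "(\<integral>\<^sup>+y. ennreal (norm (k (y - x) - k (y - z))) * indicator {\<xi>+(2*c+3)*h<..} y \<partial>lborel) \<le> ennreal (8 * C)"
   if "h > 0" "x \<in> {\<xi>..\<xi>+h}" "z \<in> {\<xi>..\<xi>+h}" for h \<xi> x z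
   using kob[OF _ _ _ zero_less_one that(1) orl1 that(2,3)] C by simp
  show "(\<integral>\<^sup>+y. ennreal (norm (k (y - x) - k (y - z)) * norm (f y)) * indicator {\<xi>+(2*c+3)*h<..} y \<partial>lborel) \<le> ennreal (8 * C * s)"
   if "bcs f" "s > 0" "h > 0" "orlicz_le A f \<xi> s" "x \<in> {\<xi>..\<xi>+h}" "z \<in> {\<xi>..\<xi>+h}" for f s h \<xi> x z
   using kob[OF _ _ bcs_measurable[OF that(1)] that(2-6)] C by simp
  show "emeasure \<mu> E \<le> ennreal (Cw * (measure lborel E / (d - b)) powr \<epsilon>0) * ivl_mass \<mu> r a d"
   if abd: "a < b" "b < d" "d - b < b - a" and E: "E \<in> sets borel" "E \<subseteq> {a<..<b}" for a b d E
  proof -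
   have "emeasure \<mu> E = (\<integral>\<^sup>+x\<in>E. ennreal (w x) \<partial>lebesgue)"
    using weighted[of "indicator E"] E(1) by (simp add: mult.commute \<mu>_def)
   also have "\<dots> \<le> ennreal (Cw * (measure lebesgue E / (d - b)) powr \<epsilon>0) *
      (\<integral>\<^sup>+x. ennpowr (Mplus (indicator {a<..<d} :: real \<Rightarrow> real) x) r * ennreal (w x) \<partial>lebesgue)"
    using E by (intro cp abd) auto
   also have "\<dots> \<le> ennreal (Cw * (measure lebesgue E / (d - b)) powr \<epsilon>0) * (\<integral>\<^sup>+x. ennreal (ivl_max a d x powr r) * ennreal (w x) \<partial>lebesgue)"
   proof (intro mult_left_mono nn_integral_mono mult_right_mono)
    fix x
    have ad: "a < d" using abd by simp
    have "ivl_max a d x \<ge> 0" using ad by (auto simp: ivl_max_def)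
    then show "ennpowr (Mplus (indicator {a<..<d} :: real \<Rightarrow> real) x) r \<le> ennreal (ivl_max a d x powr r)"
     using ennpowr_mono[OF Mplus_indicator_le[OF ad, of x], of r] r by (simp add: ennpowr_ennreal)
   qed auto
   also have "(\<integral>\<^sup>+x. ennreal (ivl_max a d x powr r) * ennreal (w x) \<partial>lebesgue) = ivl_mass \<mu> r a d"
    unfolding ivl_mass_def by (rule weighted) measurable
   finally show ?thesis using E(1) by simp
  qed
  show "emeasure \<mu> {-R..R} < top" for R
   using w'(4)[of R] unfolding \<mu>_def by (subst emeasure_density) auto
  show "sets \<mu> = sets borel" by (simp add: \<mu>_def)
 qed (use km B1 c C assms(1,5) r e0 in auto)
 obtain D where D: "D > 0" "\<And>f. bcs f \<Longrightarrow> (\<integral>\<^sup>+x. ennpowr (Tmax k f x) p \<partial>\<mu>) \<le> ennreal D * (\<integral>\<^sup>+x. ennpowr (M f x) p \<partial>\<mu>)"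
  using coifman_bound by blast
 show ?thesis
 proof (intro exI conjI ballI)
  show "D powr (1 / p) > 0" using D(1) by simp
  fix f assume "f \<in> Linf_c"
  then obtain f' where f': "bcs f'" "AE x in lborel. f x = f' x" by (rule Linf_c_borel_version)
  have T: "T_plus_max K f = Tmax k f'"
   using T_plus_max_eq_Tmax[OF K'(1,4) bcs_measurable[OF f'(1)] f'(2)] by (simp add: k_def[abs_def] fun_eq_iff)
  have Mf: "M_plus_orlicz A f = M_plus_orlicz A f'"
   unfolding M_plus_orlicz_def by (simp add: orlicz_avg_cong_AE[OF f'(2)] fun_eq_iff)
  have "Lp_norm p w (T_plus_max K f) = ennpowr (\<integral>\<^sup>+x. ennpowr (Tmax k f' x) p \<partial>\<mu>) (1 / p)"
   unfolding Lp_norm_def T by (subst weighted[OF ennpowr_measurable[OF Tmax_measurable[OF f'(1)]]]) (rule refl)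
  also have "\<dots> \<le> ennpowr (ennreal D * (\<integral>\<^sup>+x. ennpowr (M f' x) p \<partial>\<mu>)) (1 / p)"
   using assms(5) by (intro ennpowr_mono D(2)[OF f'(1)]) simp
  also have "\<dots> \<le> ennreal (D powr (1 / p)) * ennpowr (\<integral>\<^sup>+x. ennpowr (M f' x) p \<partial>\<mu>) (1 / p)"
   using assms(5) D(1) by (intro ennpowr_cmult) auto
  also have "ennpowr (\<integral>\<^sup>+x. ennpowr (M f' x) p \<partial>\<mu>) (1 / p) = Lp_norm p w (M_plus_orlicz A f)"
   unfolding Lp_norm_def Mf by (subst weighted[OF ennpowr_measurable[OF M_measurable[OF f'(1)]]]) (rule refl)
  finally show "Lp_norm p w (T_plus_max K f) \<le> ennreal (D powr (1 / p)) * Lp_norm p w (M_plus_orlicz A f)" .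
 qed
qed

end
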